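(* Let $\mathbb{K}\in\{\mathbb{R},\mathbb{C}\}$, let $\mathcal{H}$ be a graded and connected Hopf algebra over $\mathbb{K}$ and let $B$ be a commutative locally convex algebra over $\mathbb{K}$. (a) The Lie group $G(\mathcal{H},B)$ of $B$-valued characters of $\mathcal{H}$ is a Baker--Campbell--Hausdorff--Lie group which is exponential, i.e. its Lie group exponential map is a global $\mathbb{K}$-analytic diffeomorphism (from the Lie algebra onto the group). (b) If $B$ is sequentially complete, then $G(\mathcal{H},B)$ is a $C^0$-regular Lie group.
   Context: Algebras are unital associative $\mathbb{K}$-algebras. A locally convex space is a Hausdorff locally convex topological $\mathbb{K}$-vector space. A locally convex algebra is an algebra with a locally convex vector space topology for which multiplication $B\times B\to B$ is continuous. Graded connected Hopf algebra: a Hopf algebra $\mathcal{H}$ with a vector space decomposition $\mathcal{H}=\bigoplus_{n\in\mathbb{N}_0}\mathcal{H}_n$ such that $1_{\mathcal{H}}\in\mathcal{H}_0$, $\mathcal{H}_n\mathcal{H}_m\subseteq\mathcal{H}_{n+m}$, $\Delta(\mathcal{H}_n)\subseteq\bigoplus_{i+j=n}\mathcal{H}_i\otimes\mathcal{H}_j$, $\bigoplus_{n\ge1}\mathcal{H}_n\subseteq\ker\epsilon$, and $\dim\mathcal{H}_0=1$. Put $A:=\mathrm{Hom}_{\mathbb{K}}(\mathcal{H},B)$ with the topology of pointwise convergence and convolution $\phi\star\psi=m_B\circ(\phi\otimes\psi)\circ\Delta_{\mathcal{H}}$, unit $1_A=\epsilon_{\mathcal{H}}(\cdot)1_B$. $G(\mathcal{H},B)\subseteq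 A$ is the group (under $\star$) of unital algebra homomorphisms $\mathcal{H}\to B$. It carries the $\mathbb{K}$-analytic Lie group structure inherited as a $\mathbb{K}$-analytic submanifold of $A$ (locally, in suitable $\mathbb{K}$-analytic charts of the affine subspace $\{\phi\in A:\phi(1_{\mathcal{H}})=1_B\}$, it corresponds to a closed vector subspace); its topology is that of pointwise convergence, and its Lie algebra is $\mathfrak{g}(\mathcal{H},B)=\{\phi\in A:\phi(ab)=\epsilon_{\mathcal{H}}(a)\phi(b)+\epsilon_{\mathcal{H}}(b)\phi(a)\ \forall a,b\}$ with the commutator bracket of $\star$. Calculus (Keller's $C^r_c$-theory): $f:U\to F$, $U\subseteq E$ open, between locally convex spaces is $C^r$ if its iterated directional derivatives $d^{(k)}f:U\times E^k\to F$ ($k\le r$) exist and are continuous; smooth means $C^\infty$. $\mathbb{K}$-analytic means $C^\infty_{\mathbb{C}}$ if $\mathbb{K}=\mathbb{C}$, and extendable to a $C^\infty_{\mathbb{C}}$-map on an open neighbourhood in the complexification if $\mathbb{K}=\mathbb{R}$. Manifolds are Hausdorff and modelled on locally convex spaces. A Lie group exponential map of a Lie group $G$ with Lie algebra $\mathbf{L}(G)=T_{\mathbf 1}G$ is a smooth map $\exp:\mathbf{L}(G)\to G$ such that for each $x$ the curve $t\mapsto\exp(tx)$ is a one-parameter group with derivative $x$ at $0$. A BCH--Lie group is a $\mathbb{K}$-analytic Lie group with an exponential map which is a local $\mathbb{K}$-analytic diffeomorphism at $0$. $C^r$-regularity ($r\in\mathbb{N}_0\cup\{\infty\}$): with $\lambda_g(x)=gx$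 and $g.v:=T_{\mathbf 1}\lambda_g(v)$, a Lie group $G$ is $C^r$-regular if for each $C^r$-curve $\gamma:[0,1]\to\mathbf{L}(G)$ the initial value problem $\eta'(t)=\eta(t).\gamma(t)$, $\eta(0)=\mathbf 1$ has a (necessarily unique) $C^{r+1}$-solution $\mathrm{Evol}(\gamma):[0,1]\to G$, and $\mathrm{evol}:C^r([0,1],\mathbf{L}(G))\to G$, $\gamma\mapsto\mathrm{Evol}(\gamma)(1)$, is smooth (with the topology of uniform convergence of derivatives up to order $r$ on $C^r([0,1],\mathbf{L}(G))$). *)

theory Defs
  imports
    "HOL-Analysis.Analysis"
    "HOL-Library.Function_Algebras"
    "HOL-Algebra.Group"
begin

section \<open>The scalar field\<close>

text \<open>The two members of this class, up to isometric isomorphism of real normed algebras, are the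
  real and the complex numbers; the scalar field is real iff every scalar is \<open>of_real\<close> of a real.\<close>

class real_or_complex = real_normed_field +
  assumes real_or_complex:
    "(\<forall>z. \<exists>a. z = a *\<^sub>R 1) \<or>
     (\<exists>j. j * j = - 1 \<and> (\<forall>z. \<exists>a b. z = a *\<^sub>R 1 + b *\<^sub>R j))"

instance real :: real_or_complex
  by standard auto

instance complex :: real_or_complex
proof
  have "z = Re z *\<^sub>R 1 + Im z *\<^sub>R \<i>" for z
    by (simp add: complex_eq_iff)
  then have "\<exists>j::complex. j * j = - 1 \<and> (\<forall>z. \<exists>a b. z = a *\<^sub>R 1 + b *\<^sub>R j)"
    by (metis i_squared)
  then show "(\<forall>z::complex. \<exists>a. z = a *\<^sub>R 1) \<or>
     (\<exists>j::complex. j * j = - 1 \<and> (\<forall>z. \<exists>a b. z = a *\<^sub>R 1 + b *\<^sub>R j))" ..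
qed


section \<open>Locally convex spaces\<close>

text \<open>The carrier of a space is the \<open>topspace\<close> of its topology; addition is that of the
  ambient abelian group. This lets linear subspaces be spaces in their own right.\<close>

record ('k, 'v) tvs =
  vtop :: "'v topology"
  smul :: "'k \<Rightarrow> 'v \<Rightarrow> 'v"

abbreviation vcarrier :: "('k, 'v, 'z) tvs_scheme \<Rightarrow> 'v set" where
  "vcarrier E \<equiv> topspace (vtop E)"

locale locally_convex_space =
  fixes E :: "('k::real_normed_field, 'v::ab_group_add) tvs"
  assumes hausdorff: "Hausdorff_space (vtop E)"
    and zero_closed: "0 \<in> vcarrier E"
    and add_closed: "\<lbrakk>x \<in> vcarrier E; y \<in> vcarrier E\<rbrakk> \<Longrightarrow> x + y \<in> vcarrier E"
    and smul_closed: "x \<in> vcarrier E \<Longrightarrow> smul E a x \<in> vcarrier E"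
    and smul_add_right: "\<lbrakk>x \<in> vcarrier E; y \<in> vcarrier E\<rbrakk> \<Longrightarrow> smul E a (x + y) = smul E a x + smul E a y"
    and smul_add_left: "x \<in> vcarrier E \<Longrightarrow> smul E (a + b) x = smul E a x + smul E b x"
    and smul_smul: "x \<in> vcarrier E \<Longrightarrow> smul E a (smul E b x) = smul E (a * b) x"
    and smul_one: "x \<in> vcarrier E \<Longrightarrow> smul E 1 x = x"
    and continuous_add: "continuous_map (prod_topology (vtop E) (vtop E)) (vtop E) (\<lambda>(x, y). x + y)"
    and continuous_smul: "continuous_map (prod_topology euclidean (vtop E)) (vtop E) (\<lambda>(a, x). smul E a x)"
    and locally_convex: "\<lbrakk>openin (vtop E) U; 0 \<in> U\<rbrakk> \<Longrightarrow>
      \<exists>C. openin (vtop E) C \<and> 0 \<in> C \<and> C \<subseteq> U \<and>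
        (\<forall>x\<in>C. \<forall>y\<in>C. \<forall>t\<in>{0..1::real}. smul E (of_real (1 - t)) x + smul E (of_real t) y \<in> C)"

definition sequentially_complete :: "('k, 'v::ab_group_add) tvs \<Rightarrow> bool" where
  "sequentially_complete E \<longleftrightarrow>
    (\<forall>x::nat \<Rightarrow> 'v. range x \<subseteq> vcarrier E \<and>
        (\<forall>U. openin (vtop E) U \<and> 0 \<in> U \<longrightarrow> (\<exists>N. \<forall>m\<ge>N. \<forall>n\<ge>N. x m - x n \<in> U)) \<longrightarrow>
      (\<exists>l. limitin (vtop E) x l sequentially))"

definition subspace_tvs :: "('k, 'v) tvs \<Rightarrow> 'v set \<Rightarrow> ('k, 'v) tvs" where
  "subspace_tvs E F = \<lparr>vtop = subtopology (vtop E) F, smul = smul E\<rparr>"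

definition prod_tvs :: "('k, 'v) tvs \<Rightarrow> ('k, 'w) tvs \<Rightarrow> ('k, 'v \<times> 'w) tvs" where
  "prod_tvs E F = \<lparr>vtop = prod_topology (vtop E) (vtop F), smul = (\<lambda>a (x, y). (smul E a x, smul F a y))\<rparr>"

text \<open>The pair \<open>(x, y)\<close> stands for \<open>x + i y\<close>.\<close>

definition complexification ::
  "('k::real_normed_field, 'v::ab_group_add) tvs \<Rightarrow> (complex, 'v \<times> 'v) tvs" where
  "complexification E =
    \<lparr>vtop = prod_topology (vtop E) (vtop E),
     smul = (\<lambda>z (x, y). (smul E (of_real (Re z)) x - smul E (of_real (Im z)) y,
                         smul E (of_real (Re z)) y + smul E (of_real (Im z)) x))\<rparr>"


section \<open>Keller's differential calculus\<close>

definition has_dir_deriv ::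
  "('k::real_normed_field, 'v::ab_group_add) tvs \<Rightarrow> ('k, 'w::ab_group_add) tvs \<Rightarrow>
    ('v \<Rightarrow> 'w) \<Rightarrow> 'v \<Rightarrow> 'v \<Rightarrow> 'w \<Rightarrow> bool" where
  "has_dir_deriv E F f x y z \<longleftrightarrow>
    limitin (vtop F) (\<lambda>t. smul F (inverse t) (f (x + smul E t y) - f x)) z (at 0)"

definition dir_deriv ::
  "('k::real_normed_field, 'v::ab_group_add) tvs \<Rightarrow> ('k, 'w::ab_group_add) tvs \<Rightarrow>
    ('v \<Rightarrow> 'w) \<Rightarrow> 'v \<Rightarrow> 'v \<Rightarrow> 'w" where
  "dir_deriv E F f x y = (THE z. has_dir_deriv E F f x y z)"

text \<open>\<open>iter_deriv E F f k x y\<close> is \<open>d\<^sup>(\<^sup>k\<^sup>)f(x; y 0, \<dots>, y (k - 1))\<close>.\<close>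

primrec iter_deriv ::
  "('k::real_normed_field, 'v::ab_group_add) tvs \<Rightarrow> ('k, 'w::ab_group_add) tvs \<Rightarrow>
    ('v \<Rightarrow> 'w) \<Rightarrow> nat \<Rightarrow> 'v \<Rightarrow> (nat \<Rightarrow> 'v) \<Rightarrow> 'w" where
  "iter_deriv E F f 0 x y = f x"
| "iter_deriv E F f (Suc k) x y = dir_deriv E F (\<lambda>x'. iter_deriv E F f k x' y) x (y k)"

definition Cr_on ::
  "enat \<Rightarrow> ('k::real_normed_field, 'v::ab_group_add) tvs \<Rightarrow> ('k, 'w::ab_group_add) tvs \<Rightarrow>
    'v set \<Rightarrow> ('v \<Rightarrow> 'w) \<Rightarrow> bool" where
  "Cr_on r E F U f \<longleftrightarrow>
    openin (vtop E) U \<and> f \<in> U \<rightarrow> vcarrier F \<and>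
    (\<forall>k. enat (Suc k) \<le> r \<longrightarrow>
      (\<forall>x\<in>U. \<forall>y\<in>{..<Suc k} \<rightarrow>\<^sub>E vcarrier E.
        \<exists>z. has_dir_deriv E F (\<lambda>x'. iter_deriv E F f k x' y) x (y k) z)) \<and>
    (\<forall>k. enat k \<le> r \<longrightarrow>
      continuous_map
        (prod_topology (subtopology (vtop E) U) (product_topology (\<lambda>_. vtop E) {..<k}))
        (vtop F) (\<lambda>(x, y). iter_deriv E F f k x y))"

abbreviation smooth_on ::
  "('k::real_normed_field, 'v::ab_group_add) tvs \<Rightarrow> ('k, 'w::ab_group_add) tvs \<Rightarrow>
    'v set \<Rightarrow> ('v \<Rightarrow> 'w) \<Rightarrow> bool" where
  "smooth_on \<equiv> Cr_on \<infinity>"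

definition analytic_map_on ::
  "('k::real_or_complex, 'v::ab_group_add) tvs \<Rightarrow> ('k, 'w::ab_group_add) tvs \<Rightarrow>
    'v set \<Rightarrow> ('v \<Rightarrow> 'w) \<Rightarrow> bool" where
  "analytic_map_on E F U f \<longleftrightarrow>
    (if range (of_real :: real \<Rightarrow> 'k) = UNIV
     then openin (vtop E) U \<and> f \<in> U \<rightarrow> vcarrier F \<and>
       (\<exists>W g. smooth_on (complexification E) (complexification F) W g \<and>
         (\<forall>x\<in>U. (x, 0) \<in> W \<and> g (x, 0) = (f x, 0)))
     else smooth_on E F U f)"


section \<open>Curves in locally convex spaces\<close>

text \<open>Here \<open>I\<close> is a set of reals without isolated points, so that at the end points of an
  interval the derivative is one-sided.\<close>

definition has_curve_deriv ::
  "('k::real_normed_field, 'v::ab_group_add) tvs \<Rightarrow> real set \<Rightarrow> (real \<Rightarrow> 'v) \<Rightarrow> real \<Rightarrow> 'v \<Rightarrow> bool" where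
  "has_curve_deriv E I \<gamma> t v \<longleftrightarrow>
    limitin (vtop E) (\<lambda>s. smul E (of_real (inverse (s - t))) (\<gamma> s - \<gamma> t)) v (at t within I)"

primrec curve_deriv ::
  "('k::real_normed_field, 'v::ab_group_add) tvs \<Rightarrow> real set \<Rightarrow> nat \<Rightarrow> (real \<Rightarrow> 'v) \<Rightarrow> real \<Rightarrow> 'v" where
  "curve_deriv E I 0 \<gamma> = \<gamma>"
| "curve_deriv E I (Suc k) \<gamma> = (\<lambda>t. THE v. has_curve_deriv E I (curve_deriv E I k \<gamma>) t v)"

definition Cr_curve ::
  "('k::real_normed_field, 'v::ab_group_add) tvs \<Rightarrow> enat \<Rightarrow> real set \<Rightarrow> (real \<Rightarrow> 'v) \<Rightarrow> bool" where
  "Cr_curve E r I \<gamma> \<longleftrightarrow>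
    (\<forall>k. enat (Suc k) \<le> r \<longrightarrow> (\<forall>t\<in>I. \<exists>v. has_curve_deriv E I (curve_deriv E I k \<gamma>) t v)) \<and>
    (\<forall>k. enat k \<le> r \<longrightarrow> continuous_map (top_of_set I) (vtop E) (curve_deriv E I k \<gamma>))"

text \<open>Curves on \<open>[0,1]\<close> are represented by their extensions by zero, so that equality of curves
  is equality of functions and the ambient addition is pointwise.\<close>

definition Cr_curves ::
  "('k::real_normed_field, 'v::ab_group_add) tvs \<Rightarrow> enat \<Rightarrow> (real \<Rightarrow> 'v) set" where
  "Cr_curves E r = {\<gamma>. Cr_curve E r {0..1} \<gamma> \<and> (\<forall>t. t \<notin> {0..1} \<longrightarrow> \<gamma> t = 0)}"

definition Cr_curves_open ::
  "('k::real_normed_field, 'v::ab_group_add) tvs \<Rightarrow> enat \<Rightarrow> (real \<Rightarrow> 'v) set \<Rightarrow> bool" where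
  "Cr_curves_open E r W \<longleftrightarrow>
    W \<subseteq> Cr_curves E r \<and>
    (\<forall>\<gamma>\<in>W. \<exists>n V. enat n \<le> r \<and> openin (vtop E) V \<and> 0 \<in> V \<and>
      {\<delta> \<in> Cr_curves E r. \<forall>k\<le>n. \<forall>t\<in>{0..1}.
         curve_deriv E {0..1} k \<delta> t - curve_deriv E {0..1} k \<gamma> t \<in> V} \<subseteq> W)"

lemma istopology_Cr_curves_open: "istopology (Cr_curves_open E r)"
proof -
  have "Cr_curves_open E r (S \<inter> T)" if S: "Cr_curves_open E r S" and T: "Cr_curves_open E r T" for S T
    unfolding Cr_curves_open_def
  proof (intro conjI ballI)
    show "S \<inter> T \<subseteq> Cr_curves E r"
      using S by (auto simp: Cr_curves_open_def)
    fix \<gamma> assume \<gamma>: "\<gamma> \<in> S \<inter> T"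
    define B where "B = (\<lambda>n V. {\<delta> \<in> Cr_curves E r. \<forall>k\<le>(n::nat). \<forall>t\<in>{0..1}.
         curve_deriv E {0..1} k \<delta> t - curve_deriv E {0..1} k \<gamma> t \<in> V})"
    obtain n V where 1: "enat n \<le> r" "openin (vtop E) V" "0 \<in> V" "B n V \<subseteq> S"
      using S \<gamma> unfolding Cr_curves_open_def B_def by blast
    obtain m V' where 2: "enat m \<le> r" "openin (vtop E) V'" "0 \<in> V'" "B m V' \<subseteq> T"
      using T \<gamma> unfolding Cr_curves_open_def B_def by blast
    have "B (max n m) (V \<inter> V') \<subseteq> S \<inter> T"
      using 1(4) 2(4) by (force simp: B_def)
    moreover have "enat (max n m) \<le> r"
      using 1 2 by (simp add: max_def)
    moreover have "openin (vtop E) (V \<inter> V')" "0 \<in> V \<inter> V'"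
      using 1 2 by auto
    ultimately show "\<exists>n V. enat n \<le> r \<and> openin (vtop E) V \<and> 0 \<in> V \<and>
      {\<delta> \<in> Cr_curves E r. \<forall>k\<le>n. \<forall>t\<in>{0..1}.
         curve_deriv E {0..1} k \<delta> t - curve_deriv E {0..1} k \<gamma> t \<in> V} \<subseteq> S \<inter> T"
      unfolding B_def by blast
  qed
  moreover have "Cr_curves_open E r (\<Union>\<K>)" if "\<forall>K\<in>\<K>. Cr_curves_open E r K" for \<K>
    unfolding Cr_curves_open_def
  proof (intro conjI ballI)
    show "\<Union>\<K> \<subseteq> Cr_curves E r"
      using that by (auto simp: Cr_curves_open_def)
    fix \<gamma> assume "\<gamma> \<in> \<Union>\<K>"
    then obtain K where K: "K \<in> \<K>" "\<gamma> \<in> K" by blast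
    with that have "Cr_curves_open E r K" by blast
    with K(2) obtain n V where "enat n \<le> r" "openin (vtop E) V" "0 \<in> V"
      "{\<delta> \<in> Cr_curves E r. \<forall>k\<le>n. \<forall>t\<in>{0..1}.
         curve_deriv E {0..1} k \<delta> t - curve_deriv E {0..1} k \<gamma> t \<in> V} \<subseteq> K"
      unfolding Cr_curves_open_def by blast
    moreover have "K \<subseteq> \<Union>\<K>"
      using K(1) by blast
    ultimately show "\<exists>n V. enat n \<le> r \<and> openin (vtop E) V \<and> 0 \<in> V \<and>
      {\<delta> \<in> Cr_curves E r. \<forall>k\<le>n. \<forall>t\<in>{0..1}.
         curve_deriv E {0..1} k \<delta> t - curve_deriv E {0..1} k \<gamma> t \<in> V} \<subseteq> \<Union>\<K>"
      by (meson order_trans)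
  qed
  ultimately show ?thesis
    by (simp add: istopology_def)
qed

definition Cr_curve_space ::
  "('k::real_normed_field, 'v::ab_group_add) tvs \<Rightarrow> enat \<Rightarrow> ('k, real \<Rightarrow> 'v) tvs" where
  "Cr_curve_space E r = \<lparr>vtop = topology (Cr_curves_open E r), smul = (\<lambda>a \<gamma> t. smul E a (\<gamma> t))\<rparr>"


section \<open>Manifolds modelled on locally convex spaces\<close>

text \<open>A chart is a pair of its domain and its coordinate map. The values of the coordinate
  map outside the domain are irrelevant. All charts take values in the same model space.\<close>

record ('k, 'e, 'm) manifold =
  model :: "('k, 'e) tvs"
  mtop :: "'m topology"
  atlas :: "('m set \<times> ('m \<Rightarrow> 'e)) set"

definition topological_chart :: "('k, 'e, 'm) manifold \<Rightarrow> 'm set \<times> ('m \<Rightarrow> 'e) \<Rightarrow> bool" where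
  "topological_chart M c \<longleftrightarrow>
    openin (mtop M) (fst c) \<and> openin (vtop (model M)) (snd c ` fst c) \<and>
    homeomorphic_map (subtopology (mtop M) (fst c)) (subtopology (vtop (model M)) (snd c ` fst c)) (snd c)"

definition transition :: "'m set \<times> ('m \<Rightarrow> 'e) \<Rightarrow> 'm set \<times> ('m \<Rightarrow> 'e) \<Rightarrow> 'e \<Rightarrow> 'e" where
  "transition c d = (\<lambda>x. snd d (inv_into (fst c) (snd c) x))"

definition analytic_transition ::
  "('k::real_or_complex, 'e::ab_group_add) tvs \<Rightarrow> 'm set \<times> ('m \<Rightarrow> 'e) \<Rightarrow> 'm set \<times> ('m \<Rightarrow> 'e) \<Rightarrow> bool" where
  "analytic_transition E c d \<longleftrightarrow> analytic_map_on E E (snd c ` (fst c \<inter> fst d)) (transition c d)"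

definition analytic_manifold :: "('k::real_or_complex, 'e::ab_group_add, 'm) manifold \<Rightarrow> bool" where
  "analytic_manifold M \<longleftrightarrow>
    locally_convex_space (model M) \<and> Hausdorff_space (mtop M) \<and>
    (\<forall>c\<in>atlas M. topological_chart M c) \<and>
    (\<Union>c\<in>atlas M. fst c) = topspace (mtop M) \<and>
    (\<forall>c\<in>atlas M. \<forall>d\<in>atlas M. analytic_transition (model M) c d)"

definition maximal_atlas ::
  "('k::real_or_complex, 'e::ab_group_add, 'm) manifold \<Rightarrow> ('m set \<times> ('m \<Rightarrow> 'e)) set" where
  "maximal_atlas M =
    {c. topological_chart M c \<and>
        (\<forall>d\<in>atlas M. analytic_transition (model M) c d \<and> analytic_transition (model M) d c)}"

text \<open>The subset \<open>S\<close> with the charts obtained by restricting all analytic charts of \<open>M\<close> that take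
  \<open>S\<close> to the vector subspace \<open>F\<close> of the model space. The set \<open>S\<close> is a submanifold modelled on the
  closed subspace \<open>F\<close> iff the domains of these charts cover it.\<close>

definition submanifold ::
  "('k::real_or_complex, 'e::ab_group_add, 'm) manifold \<Rightarrow> 'e set \<Rightarrow> 'm set \<Rightarrow> ('k, 'e, 'm) manifold" where
  "submanifold M F S =
    \<lparr>model = subspace_tvs (model M) F,
     mtop = subtopology (mtop M) S,
     atlas = {(U \<inter> S, restrict \<phi> (U \<inter> S)) | U \<phi>. (U, \<phi>) \<in> maximal_atlas M \<and> \<phi> ` (U \<inter> S) = \<phi> ` U \<inter> F}\<rparr>"

definition tvs_manifold :: "('k, 'e) tvs \<Rightarrow> ('k, 'e, 'e) manifold" where
  "tvs_manifold E = \<lparr>model = E, mtop = vtop E, atlas = {(vcarrier E, \<lambda>x. x)}\<rparr>"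

definition prod_manifold ::
  "('k, 'e, 'm) manifold \<Rightarrow> ('k, 'f, 'n) manifold \<Rightarrow> ('k, 'e \<times> 'f, 'm \<times> 'n) manifold" where
  "prod_manifold M N =
    \<lparr>model = prod_tvs (model M) (model N),
     mtop = prod_topology (mtop M) (mtop N),
     atlas = {(fst c \<times> fst d, map_prod (snd c) (snd d)) | c d. c \<in> atlas M \<and> d \<in> atlas N}\<rparr>"

text \<open>\<open>P\<close> is one of the local notions \<open>smooth_on\<close>, \<open>analytic_map_on\<close>.\<close>

definition manifold_map_on ::
  "(('k, 'e) tvs \<Rightarrow> ('k, 'f) tvs \<Rightarrow> 'e set \<Rightarrow> ('e \<Rightarrow> 'f) \<Rightarrow> bool) \<Rightarrow>
    ('k, 'e, 'm) manifold \<Rightarrow> ('k, 'f, 'n) manifold \<Rightarrow> 'm set \<Rightarrow> ('m \<Rightarrow> 'n) \<Rightarrow> bool" where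
  "manifold_map_on P M N U f \<longleftrightarrow>
    openin (mtop M) U \<and> continuous_map (subtopology (mtop M) U) (mtop N) f \<and>
    (\<forall>c\<in>atlas M. \<forall>d\<in>atlas N.
      P (model M) (model N) (snd c ` {p \<in> U \<inter> fst c. f p \<in> fst d})
        (\<lambda>x. snd d (f (inv_into (fst c) (snd c) x))))"

abbreviation smooth_manifold_map ::
  "('k::real_or_complex, 'e::ab_group_add, 'm) manifold \<Rightarrow> ('k, 'f::ab_group_add, 'n) manifold \<Rightarrow>
    ('m \<Rightarrow> 'n) \<Rightarrow> bool" where
  "smooth_manifold_map M N \<equiv> manifold_map_on smooth_on M N (topspace (mtop M))"

abbreviation analytic_manifold_map ::
  "('k::real_or_complex, 'e::ab_group_add, 'm) manifold \<Rightarrow> ('k, 'f::ab_group_add, 'n) manifold \<Rightarrow>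
    ('m \<Rightarrow> 'n) \<Rightarrow> bool" where
  "analytic_manifold_map M N \<equiv> manifold_map_on analytic_map_on M N (topspace (mtop M))"

definition analytic_diffeo_on ::
  "('k::real_or_complex, 'e::ab_group_add, 'm) manifold \<Rightarrow> ('k, 'f::ab_group_add, 'n) manifold \<Rightarrow>
    'm set \<Rightarrow> 'n set \<Rightarrow> ('m \<Rightarrow> 'n) \<Rightarrow> bool" where
  "analytic_diffeo_on M N U V f \<longleftrightarrow>
    bij_betw f U V \<and> manifold_map_on analytic_map_on M N U f \<and>
    manifold_map_on analytic_map_on N M V (inv_into U f)"


section \<open>Tangent spaces\<close>

definition charts_at :: "('k, 'e, 'm) manifold \<Rightarrow> 'm \<Rightarrow> ('m set \<times> ('m \<Rightarrow> 'e)) set" where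
  "charts_at M p = {c \<in> atlas M. p \<in> fst c}"

text \<open>A tangent vector at \<open>p\<close> is the family of its representatives in the charts around \<open>p\<close>
  (zero at all other indices), any two of which are related by the derivative of the
  chart change. Each evaluation at a chart around \<open>p\<close> identifies the tangent space with the model
  space, also topologically.\<close>

definition tangent_space ::
  "('k::real_or_complex, 'e::ab_group_add, 'm) manifold \<Rightarrow> 'm \<Rightarrow> ('m set \<times> ('m \<Rightarrow> 'e) \<Rightarrow> 'e) set" where
  "tangent_space M p =
    {v. (\<forall>c\<in>charts_at M p. v c \<in> vcarrier (model M)) \<and> (\<forall>c. c \<notin> charts_at M p \<longrightarrow> v c = 0) \<and>
        (\<forall>c\<in>charts_at M p. \<forall>d\<in>charts_at M p.
          v d = dir_deriv (model M) (model M) (transition c d) (snd c p) (v c))}"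

definition tangent_tvs ::
  "('k::real_or_complex, 'e::ab_group_add, 'm) manifold \<Rightarrow> 'm \<Rightarrow> ('k, 'm set \<times> ('m \<Rightarrow> 'e) \<Rightarrow> 'e) tvs" where
  "tangent_tvs M p =
    \<lparr>vtop = subtopology (product_topology (\<lambda>_. vtop (model M)) UNIV) (tangent_space M p),
     smul = (\<lambda>a v c. smul (model M) a (v c))\<rparr>"

text \<open>The value of the tangent map does not depend on the chart around \<open>p\<close> that is selected.\<close>

definition tangent_map ::
  "('k::real_or_complex, 'e::ab_group_add, 'm) manifold \<Rightarrow> ('k, 'f::ab_group_add, 'n) manifold \<Rightarrow>
    ('m \<Rightarrow> 'n) \<Rightarrow> 'm \<Rightarrow> ('m set \<times> ('m \<Rightarrow> 'e) \<Rightarrow> 'e) \<Rightarrow> ('n set \<times> ('n \<Rightarrow> 'f) \<Rightarrow> 'f)" where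
  "tangent_map M N f p v = (\<lambda>d.
    if d \<in> charts_at N (f p) then
      (let c = SOME c. c \<in> charts_at M p
       in dir_deriv (model M) (model N) (\<lambda>x. snd d (f (inv_into (fst c) (snd c) x))) (snd c p) (v c))
    else 0)"

definition has_velocity ::
  "('k::real_or_complex, 'e::ab_group_add, 'm) manifold \<Rightarrow> real set \<Rightarrow> (real \<Rightarrow> 'm) \<Rightarrow> real \<Rightarrow>
    ('m set \<times> ('m \<Rightarrow> 'e) \<Rightarrow> 'e) \<Rightarrow> bool" where
  "has_velocity M I \<eta> t v \<longleftrightarrow>
    v \<in> tangent_space M (\<eta> t) \<and>
    (\<forall>c\<in>charts_at M (\<eta> t). has_curve_deriv (model M) I (\<lambda>s. snd c (\<eta> s)) t (v c))"

definition Cr_manifold_curve ::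
  "('k::real_or_complex, 'e::ab_group_add, 'm) manifold \<Rightarrow> enat \<Rightarrow> real set \<Rightarrow> (real \<Rightarrow> 'm) \<Rightarrow> bool" where
  "Cr_manifold_curve M r I \<eta> \<longleftrightarrow>
    continuous_map (top_of_set I) (mtop M) \<eta> \<and>
    (\<forall>c\<in>atlas M. Cr_curve (model M) r {t \<in> I. \<eta> t \<in> fst c} (\<lambda>t. snd c (\<eta> t)))"


section \<open>Lie groups\<close>

text \<open>A Lie group is a pair of a manifold and a group structure on the same carrier.\<close>

definition analytic_lie_group :: "('k::real_or_complex, 'e::ab_group_add, 'm) manifold \<Rightarrow> 'm monoid \<Rightarrow> bool" where
  "analytic_lie_group M G \<longleftrightarrow>
    analytic_manifold M \<and> group G \<and> carrier G = topspace (mtop M) \<and>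
    analytic_manifold_map (prod_manifold M M) M (\<lambda>(x, y). x \<otimes>\<^bsub>G\<^esub> y) \<and>
    analytic_manifold_map M M (\<lambda>x. inv\<^bsub>G\<^esub> x)"

definition lie_algebra ::
  "('k::real_or_complex, 'e::ab_group_add, 'm) manifold \<Rightarrow> 'm monoid \<Rightarrow> ('k, 'm set \<times> ('m \<Rightarrow> 'e) \<Rightarrow> 'e) tvs" where
  "lie_algebra M G = tangent_tvs M \<one>\<^bsub>G\<^esub>"

definition lie_group_exponential ::
  "('k::real_or_complex, 'e::ab_group_add, 'm) manifold \<Rightarrow> 'm monoid \<Rightarrow>
    (('m set \<times> ('m \<Rightarrow> 'e) \<Rightarrow> 'e) \<Rightarrow> 'm) \<Rightarrow> bool" where
  "lie_group_exponential M G ex \<longleftrightarrow>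
    smooth_manifold_map (tvs_manifold (lie_algebra M G)) M ex \<and>
    (\<forall>x \<in> vcarrier (lie_algebra M G).
      (\<forall>s t::real. ex (smul (lie_algebra M G) (of_real (s + t)) x) =
         ex (smul (lie_algebra M G) (of_real s) x) \<otimes>\<^bsub>G\<^esub> ex (smul (lie_algebra M G) (of_real t) x)) \<and>
      has_velocity M UNIV (\<lambda>t. ex (smul (lie_algebra M G) (of_real t) x)) 0 x)"

definition BCH_lie_group :: "('k::real_or_complex, 'e::ab_group_add, 'm) manifold \<Rightarrow> 'm monoid \<Rightarrow> bool" where
  "BCH_lie_group M G \<longleftrightarrow>
    analytic_lie_group M G \<and>
    (\<exists>ex. lie_group_exponential M G ex \<and>
      (\<exists>U V. 0 \<in> U \<and> analytic_diffeo_on (tvs_manifold (lie_algebra M G)) M U V ex))"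

definition exponential_lie_group :: "('k::real_or_complex, 'e::ab_group_add, 'm) manifold \<Rightarrow> 'm monoid \<Rightarrow> bool" where
  "exponential_lie_group M G \<longleftrightarrow>
    analytic_lie_group M G \<and>
    (\<exists>ex. lie_group_exponential M G ex \<and>
      analytic_diffeo_on (tvs_manifold (lie_algebra M G)) M (vcarrier (lie_algebra M G)) (carrier G) ex)"

text \<open>\<open>\<eta>\<close> solves \<open>\<eta>'(t) = \<eta>(t).\<gamma>(t)\<close>, \<open>\<eta>(0) = 1\<close> on \<open>[0,1]\<close>.\<close>

definition solves_evolution ::
  "('k::real_or_complex, 'e::ab_group_add, 'm) manifold \<Rightarrow> 'm monoid \<Rightarrow>
    (real \<Rightarrow> 'm set \<times> ('m \<Rightarrow> 'e) \<Rightarrow> 'e) \<Rightarrow> (real \<Rightarrow> 'm) \<Rightarrow> bool" where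
  "solves_evolution M G \<gamma> \<eta> \<longleftrightarrow>
    \<eta> 0 = \<one>\<^bsub>G\<^esub> \<and>
    (\<forall>t\<in>{0..1}. has_velocity M {0..1} \<eta> t
       (tangent_map M M (\<lambda>x. \<eta> t \<otimes>\<^bsub>G\<^esub> x) \<one>\<^bsub>G\<^esub> (\<gamma> t)))"

definition Cr_regular ::
  "enat \<Rightarrow> ('k::real_or_complex, 'e::ab_group_add, 'm) manifold \<Rightarrow> 'm monoid \<Rightarrow> bool" where
  "Cr_regular r M G \<longleftrightarrow>
    analytic_lie_group M G \<and>
    (\<exists>Evol.
      (\<forall>\<gamma> \<in> Cr_curves (lie_algebra M G) r.
        Cr_manifold_curve M (r + 1) {0..1} (Evol \<gamma>) \<and> solves_evolution M G \<gamma> (Evol \<gamma>)) \<and>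
      smooth_manifold_map (tvs_manifold (Cr_curve_space (lie_algebra M G) r)) M (\<lambda>\<gamma>. Evol \<gamma> 1))"


section \<open>Tensor products\<close>

definition bilinear_map ::
  "('k::field \<Rightarrow> 'v::ab_group_add \<Rightarrow> 'v) \<Rightarrow> ('k \<Rightarrow> 'x::ab_group_add \<Rightarrow> 'x) \<Rightarrow> ('v \<Rightarrow> 'v \<Rightarrow> 'x) \<Rightarrow> bool" where
  "bilinear_map sV sX f \<longleftrightarrow>
    (\<forall>x. Vector_Spaces.linear sV sX (f x)) \<and> (\<forall>y. Vector_Spaces.linear sV sX (\<lambda>x. f x y))"

definition trilinear_form ::
  "('k::field \<Rightarrow> 'v::ab_group_add \<Rightarrow> 'v) \<Rightarrow> ('v \<Rightarrow> 'v \<Rightarrow> 'v \<Rightarrow> 'k) \<Rightarrow> bool" where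
  "trilinear_form sV f \<longleftrightarrow>
    (\<forall>x. bilinear_map sV (*) (f x)) \<and> (\<forall>y z. Vector_Spaces.linear sV (*) (\<lambda>x. f x y z))"

text \<open>Over a field, \<open>V \<otimes> V\<close> embeds into the dual of the space of bilinear forms, \<open>x \<otimes> y\<close> being
  evaluation at \<open>(x, y)\<close>; likewise for triple tensor products and trilinear forms. The tensor
  product is realised as the image of this embedding; addition is pointwise, and the universal
  property is \<open>sum_list_tensor_eq\<close> and \<open>tensor_lift_sum_list\<close> below.\<close>

definition tensor ::
  "('k::field \<Rightarrow> 'v::ab_group_add \<Rightarrow> 'v) \<Rightarrow> 'v \<Rightarrow> 'v \<Rightarrow> (('v \<Rightarrow> 'v \<Rightarrow> 'k) \<Rightarrow> 'k)" where
  "tensor sV x y = (\<lambda>\<beta>. if bilinear_map sV (*) \<beta> then \<beta> x y else 0)"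

definition tensor3 ::
  "('k::field \<Rightarrow> 'v::ab_group_add \<Rightarrow> 'v) \<Rightarrow> 'v \<Rightarrow> 'v \<Rightarrow> 'v \<Rightarrow> (('v \<Rightarrow> 'v \<Rightarrow> 'v \<Rightarrow> 'k) \<Rightarrow> 'k)" where
  "tensor3 sV x y z = (\<lambda>\<tau>. if trilinear_form sV \<tau> then \<tau> x y z else 0)"

text \<open>The span of the pure tensors \<open>x \<otimes> y\<close> with \<open>(x, y) \<in> R\<close>, if \<open>R\<close> is closed under scaling of
  the first component.\<close>

definition tensor_sums ::
  "('k::field \<Rightarrow> 'v::ab_group_add \<Rightarrow> 'v) \<Rightarrow> ('v \<times> 'v) set \<Rightarrow> (('v \<Rightarrow> 'v \<Rightarrow> 'k) \<Rightarrow> 'k) set" where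
  "tensor_sums sV R = {\<Sum>(x, y)\<leftarrow>xs. tensor sV x y | xs. set xs \<subseteq> R}"

text \<open>The linear map \<open>V \<otimes> V \<rightarrow> X\<close> induced by a bilinear map \<open>f\<close>: if \<open>u\<close> is the sum of the
  \<open>x\<^sub>i \<otimes> y\<^sub>i\<close>, then its value at \<open>u\<close> is the sum of the \<open>f x\<^sub>i y\<^sub>i\<close>.\<close>

definition tensor_lift ::
  "('k::field \<Rightarrow> 'v::ab_group_add \<Rightarrow> 'v) \<Rightarrow> ('v \<Rightarrow> 'v \<Rightarrow> 'x::ab_group_add) \<Rightarrow>
    (('v \<Rightarrow> 'v \<Rightarrow> 'k) \<Rightarrow> 'k) \<Rightarrow> 'x" where
  "tensor_lift sV f u =
    (let xs = SOME xs. u = (\<Sum>(x, y)\<leftarrow>xs. tensor sV x y) in \<Sum>(x, y)\<leftarrow>xs. f x y)"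

lemma sum_list_tensor_eq:
  assumes f: "bilinear_map sV sX f"
    and eq: "(\<Sum>(x, y)\<leftarrow>xs. tensor sV x y) = (\<Sum>(x, y)\<leftarrow>ys. tensor sV x y)"
  shows "(\<Sum>(x, y)\<leftarrow>xs. f x y) = (\<Sum>(x, y)\<leftarrow>ys. f x y)"
proof (rule ccontr)
  define a where "a = (\<Sum>(x, y)\<leftarrow>xs. f x y) - (\<Sum>(x, y)\<leftarrow>ys. f x y)"
  assume "\<not> ?thesis"
  then have a: "a \<noteq> 0" by (simp add: a_def)
  have sX: "vector_space sX"
    using f by (auto simp: bilinear_map_def Vector_Spaces.linear_def)
  have K: "vector_space ((*) :: 'a \<Rightarrow> 'a \<Rightarrow> 'a)"
    by unfold_locales (simp_all add: algebra_simps)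
  interpret p: vector_space_pair sX "(*) :: 'a \<Rightarrow> 'a \<Rightarrow> 'a"
    by (rule vector_space_pair.intro[OF sX K])
  have "p.vs1.independent {a}"
    using a by simp
  then obtain l where l: "Vector_Spaces.linear sX (*) l" and la: "l a = 1"
    using p.linear_independent_extend[of "{a}" "\<lambda>_. 1"] by auto
  have bil: "bilinear_map sV (*) (\<lambda>x y. l (f x y))"
    unfolding bilinear_map_def
  proof (intro conjI allI)
    fix z
    have "Vector_Spaces.linear sV sX (f z)" "Vector_Spaces.linear sV sX (\<lambda>x. f x z)"
      using f by (simp_all add: bilinear_map_def)
    from this[THEN Vector_Spaces.linear_compose, OF l]
    show "Vector_Spaces.linear sV (*) (\<lambda>y. l (f z y))" "Vector_Spaces.linear sV (*) (\<lambda>x. l (f x z))"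
      by (simp_all only: o_def)
  qed
  have *: "l (\<Sum>(x, y)\<leftarrow>zs. f x y) = (\<Sum>(x, y)\<leftarrow>zs. tensor sV x y) (\<lambda>x y. l (f x y))" for zs
    by (induction zs) (auto simp: p.linear_0[OF l] p.linear_add[OF l] tensor_def bil)
  have "l a = 0"
    unfolding a_def p.linear_diff[OF l] * eq by simp
  with la show False by simp
qed

lemma tensor_lift_sum_list:
  assumes "bilinear_map sV sX f"
  shows "tensor_lift sV f (\<Sum>(x, y)\<leftarrow>xs. tensor sV x y) = (\<Sum>(x, y)\<leftarrow>xs. f x y)"
  unfolding tensor_lift_def Let_def
  by (rule someI2[where a = xs]) (rule refl, rule sum_list_tensor_eq[OF assms], erule sym)


section \<open>Graded connected Hopf algebras\<close>

locale hopf_algebra = vector_space scaleH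
  for scaleH :: "'k::field \<Rightarrow> 'h::ring_1 \<Rightarrow> 'h" +
  fixes \<Delta> :: "'h \<Rightarrow> (('h \<Rightarrow> 'h \<Rightarrow> 'k) \<Rightarrow> 'k)"
    and \<epsilon> :: "'h \<Rightarrow> 'k"
    and antipode :: "'h \<Rightarrow> 'h"
  assumes scale_mult_left: "scaleH c x * y = scaleH c (x * y)"
    and scale_mult_right: "x * scaleH c y = scaleH c (x * y)"
    and comult_in: "\<Delta> x \<in> tensor_sums scaleH UNIV"
    and comult_add: "\<Delta> (x + y) = \<Delta> x + \<Delta> y"
    and comult_scale: "\<Delta> (scaleH c x) = (\<lambda>\<beta>. c * \<Delta> x \<beta>)"
    and counit_linear: "Vector_Spaces.linear scaleH (*) \<epsilon>"
    and coassoc: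
      "tensor_lift scaleH (\<lambda>a b. tensor_lift scaleH (\<lambda>a1 a2. tensor3 scaleH a1 a2 b) (\<Delta> a)) (\<Delta> x) =
       tensor_lift scaleH (\<lambda>a b. tensor_lift scaleH (\<lambda>b1 b2. tensor3 scaleH a b1 b2) (\<Delta> b)) (\<Delta> x)"
    and counit_left: "tensor_lift scaleH (\<lambda>a b. scaleH (\<epsilon> a) b) (\<Delta> x) = x"
    and counit_right: "tensor_lift scaleH (\<lambda>a b. scaleH (\<epsilon> b) a) (\<Delta> x) = x"
    and comult_one: "\<Delta> 1 = tensor scaleH 1 1"
    and comult_mult:
      "\<Delta> (x * y) =
       tensor_lift scaleH (\<lambda>a b. tensor_lift scaleH (\<lambda>c d. tensor scaleH (a * c) (b * d)) (\<Delta> y)) (\<Delta> x)"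
    and counit_one: "\<epsilon> 1 = 1"
    and counit_mult: "\<epsilon> (x * y) = \<epsilon> x * \<epsilon> y"
    and antipode_linear: "Vector_Spaces.linear scaleH scaleH antipode"
    and antipode_left: "tensor_lift scaleH (\<lambda>a b. antipode a * b) (\<Delta> x) = scaleH (\<epsilon> x) 1"
    and antipode_right: "tensor_lift scaleH (\<lambda>a b. a * antipode b) (\<Delta> x) = scaleH (\<epsilon> x) 1"

locale graded_connected_hopf_algebra = hopf_algebra scaleH \<Delta> \<epsilon> antipode
  for scaleH :: "'k::field \<Rightarrow> 'h::ring_1 \<Rightarrow> 'h"
    and \<Delta> :: "'h \<Rightarrow> (('h \<Rightarrow> 'h \<Rightarrow> 'k) \<Rightarrow> 'k)"
    and \<epsilon> :: "'h \<Rightarrow> 'k"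
    and antipode :: "'h \<Rightarrow> 'h" +
  fixes grade :: "nat \<Rightarrow> 'h set"
  assumes grade_subspace: "module.subspace scaleH (grade n)"
    and grade_direct_sum:
      "\<exists>!c. (\<forall>n. c n \<in> grade n) \<and> finite {n. c n \<noteq> 0} \<and> x = (\<Sum>n | c n \<noteq> 0. c n)"
    and grade_one: "1 \<in> grade 0"
    and grade_mult: "\<lbrakk>x \<in> grade n; y \<in> grade m\<rbrakk> \<Longrightarrow> x * y \<in> grade (n + m)"
    and grade_comult: "x \<in> grade n \<Longrightarrow> \<Delta> x \<in> tensor_sums scaleH (\<Union>(i, j) \<in> {(i, j). i + j = n}. grade i \<times> grade j)"
    and grade_counit: "\<lbrakk>1 \<le> n; x \<in> grade n\<rbrakk> \<Longrightarrow> \<epsilon> x = 0"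
    and grade_connected: "vector_space.dim scaleH (grade 0) = 1"


section \<open>Character groups\<close>

text \<open>The sort \<open>{comm_ring, comm_monoid_mult}\<close> is that of unital commutative rings in which,
  unlike in \<open>comm_ring_1\<close>, \<open>0 = 1\<close> is not excluded.\<close>

locale commutative_locally_convex_algebra =
  fixes B :: "('k::real_normed_field, 'b::{comm_ring, comm_monoid_mult}) tvs"
  assumes lcs: "locally_convex_space B"
    and carrier_UNIV: "vcarrier B = UNIV"
    and smul_mult: "smul B c x * y = smul B c (x * y)"
    and continuous_mult: "continuous_map (prod_topology (vtop B) (vtop B)) (vtop B) (\<lambda>(x, y). x * y)"

definition hom_tvs ::
  "('k::field \<Rightarrow> 'h::ab_group_add \<Rightarrow> 'h) \<Rightarrow> ('k, 'b::ab_group_add) tvs \<Rightarrow> ('k, 'h \<Rightarrow> 'b) tvs" where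
  "hom_tvs scaleH B =
    \<lparr>vtop = subtopology (product_topology (\<lambda>_. vtop B) UNIV) {\<phi>. Vector_Spaces.linear scaleH (smul B) \<phi>},
     smul = (\<lambda>c \<phi> h. smul B c (\<phi> h))\<rparr>"

definition convolution ::
  "('k::field \<Rightarrow> 'h::ring_1 \<Rightarrow> 'h) \<Rightarrow> ('h \<Rightarrow> (('h \<Rightarrow> 'h \<Rightarrow> 'k) \<Rightarrow> 'k)) \<Rightarrow>
    ('h \<Rightarrow> 'b::{comm_ring, comm_monoid_mult}) \<Rightarrow> ('h \<Rightarrow> 'b) \<Rightarrow> ('h \<Rightarrow> 'b)" where
  "convolution scaleH \<Delta> \<phi> \<psi> = (\<lambda>h. tensor_lift scaleH (\<lambda>a b. \<phi> a * \<psi> b) (\<Delta> h))"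

definition convolution_unit ::
  "('h \<Rightarrow> 'k) \<Rightarrow> ('k, 'b::{comm_ring, comm_monoid_mult}) tvs \<Rightarrow> 'h \<Rightarrow> 'b" where
  "convolution_unit \<epsilon> B = (\<lambda>h. smul B (\<epsilon> h) 1)"

definition characters ::
  "('k::field \<Rightarrow> 'h::ring_1 \<Rightarrow> 'h) \<Rightarrow> ('k, 'b::{comm_ring, comm_monoid_mult}) tvs \<Rightarrow> ('h \<Rightarrow> 'b) set" where
  "characters scaleH B =
    {\<phi>. Vector_Spaces.linear scaleH (smul B) \<phi> \<and> \<phi> 1 = 1 \<and> (\<forall>a b. \<phi> (a * b) = \<phi> a * \<phi> b)}"

definition character_group ::
  "('k::field \<Rightarrow> 'h::ring_1 \<Rightarrow> 'h) \<Rightarrow> ('h \<Rightarrow> (('h \<Rightarrow> 'h \<Rightarrow> 'k) \<Rightarrow> 'k)) \<Rightarrow> ('h \<Rightarrow> 'k) \<Rightarrow>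
    ('k, 'b::{comm_ring, comm_monoid_mult}) tvs \<Rightarrow> ('h \<Rightarrow> 'b) monoid" where
  "character_group scaleH \<Delta> \<epsilon> B =
    \<lparr>carrier = characters scaleH B, mult = convolution scaleH \<Delta>, one = convolution_unit \<epsilon> B\<rparr>"

definition infinitesimal_characters ::
  "('k::field \<Rightarrow> 'h::ring_1 \<Rightarrow> 'h) \<Rightarrow> ('h \<Rightarrow> 'k) \<Rightarrow>
    ('k, 'b::{comm_ring, comm_monoid_mult}) tvs \<Rightarrow> ('h \<Rightarrow> 'b) set" where
  "infinitesimal_characters scaleH \<epsilon> B =
    {\<phi>. Vector_Spaces.linear scaleH (smul B) \<phi> \<and>
        (\<forall>a b. \<phi> (a * b) = smul B (\<epsilon> a) (\<phi> b) + smul B (\<epsilon> b) (\<phi> a))}"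

text \<open>The affine subspace of all linear \<open>\<phi>\<close> with \<open>\<phi> 1 = 1\<close>, a manifold with one global chart.\<close>

definition affine_hom_manifold ::
  "('k::field \<Rightarrow> 'h::ring_1 \<Rightarrow> 'h) \<Rightarrow> ('h \<Rightarrow> 'k) \<Rightarrow>
    ('k, 'b::{comm_ring, comm_monoid_mult}) tvs \<Rightarrow> ('k, 'h \<Rightarrow> 'b, 'h \<Rightarrow> 'b) manifold" where
  "affine_hom_manifold scaleH \<epsilon> B =
    (let A = hom_tvs scaleH B in
      \<lparr>model = subspace_tvs A {\<phi>. \<phi> 1 = 0},
       mtop = subtopology (vtop A) {\<phi>. \<phi> 1 = 1},
       atlas = {({\<phi> \<in> vcarrier A. \<phi> 1 = 1}, \<lambda>\<phi>. \<phi> - convolution_unit \<epsilon> B)}\<rparr>)"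

definition character_manifold ::
  "('k::real_or_complex \<Rightarrow> 'h::ring_1 \<Rightarrow> 'h) \<Rightarrow> ('h \<Rightarrow> 'k) \<Rightarrow>
    ('k, 'b::{comm_ring, comm_monoid_mult}) tvs \<Rightarrow> ('k, 'h \<Rightarrow> 'b, 'h \<Rightarrow> 'b) manifold" where
  "character_manifold scaleH \<epsilon> B =
    submanifold (affine_hom_manifold scaleH \<epsilon> B) (infinitesimal_characters scaleH \<epsilon> B) (characters scaleH B)"

end

theory Submission
  imports Defs "HOL-Computational_Algebra.Formal_Power_Series"
begin

text \<open>For linear \<open>\<phi>\<close> with \<open>\<phi>(1) = 0\<close> the convolution powers \<open>\<phi>\<^sup>n\<close> vanish in degrees below \<open>n\<close>, so at every
  element of the Hopf algebra a power series in \<open>\<phi>\<close> is a finite sum; it is therefore analytic in \<open>\<phi>\<close> for the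
  topology of pointwise convergence. The exponential series and the logarithm series are mutually inverse and
  interchange infinitesimal characters and characters. Hence the logarithm is a global chart of the character
  group, in which the group operations are analytic and the exponential map is the identity.

  A curve \<open>\<gamma>\<close> of infinitesimal characters has the evolution \<open>\<eta> = \<Sum>\<^sub>n Y\<^sub>n\<close> given by the Dyson iterates
  \<open>Y\<^sub>0 = \<epsilon>\<close>, \<open>Y\<^sub>n\<^sub>+\<^sub>1(t) = \<integral>\<^sub>0\<^sup>t Y\<^sub>n \<star> \<gamma>\<close>. The integrals exist by sequential completeness, and the sum is again
  finite at every element. Multiplicativity of \<open>\<eta>\<close> follows by induction on the degree, and \<open>\<gamma> \<mapsto> \<eta>(1)\<close> is smooth
  because each of its values is composed of finitely many continuous linear and bilinear maps.\<close>

section \<open>Vector arithmetic, limits and neighbourhoods of 0, and a mean value theorem\<close>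

section \<open>Locally convex spaces\<close>

text \<open>Part (a) assumes no completeness of B, so nothing may be integrated there: mean value
  estimates come from bisection, and derivatives stay in a space of maps because that space is
  closed under pointwise limits. The charts of the character group are restrictions of all analytic
  charts of the affine space that straighten it. Hence the logarithm has to be compatible with each
  of them, and the chart changes must be analytic on open sets of infinitesimal characters, not just
  of the ambient space. Over the reals this asks for an extension to the complexification of the
  subspace, with values in it; a continuous linear projection onto the infinitesimal characters
  provides the values. A closed subspace of a locally convex space may fail to have such a
  projection, but here precomposition with an algebraic projection of the Hopf algebra is one, as
  the topology only sees values at single elements. Sequential completeness enters through the
  integrals alone; the evolution depends smoothly on the whole curve because integration is
  continuous and linear for uniform convergence.\<close>

abbreviation lcs :: "('k::real_normed_field, 'v::ab_group_add) tvs \<Rightarrow> bool" where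
  "lcs \<equiv> locally_convex_space"

text \<open>Multiplying a filter with a principal filter encodes uniformity in a parameter, so that
  an estimate uniform over a segment becomes an ordinary limit.\<close>

lemma eventually_prod_principal:
  "eventually P (F \<times>\<^sub>F principal A) \<longleftrightarrow> eventually (\<lambda>t. \<forall>s\<in>A. P (t, s)) F"
  unfolding eventually_prod_filter eventually_principal
  by (auto elim: eventually_mono intro!: exI[of _ "\<lambda>s. s \<in> A"])

lemma limitin_compose_filterlim:
  assumes "limitin X f l F" "filterlim g F G"
  shows "limitin X (\<lambda>t. f (g t)) l G"
  using assms by (auto simp: limitin_def filterlim_iff)

lemma limitin_in_openin:
  assumes "limitin X f l F" "openin X U" "l \<in> U"
  shows "eventually (\<lambda>t. f t \<in> U) F"
  using assms by (auto simp: limitin_def)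

lemma limitin_pairI:
  assumes "limitin X f a F" "limitin Y g b F"
  shows "limitin (prod_topology X Y) (\<lambda>t. (f t, g t)) (a, b) F"
  using assms by (simp add: limitin_pairwise o_def)

context locally_convex_space
begin

lemma smul_zero_left: "x \<in> vcarrier E \<Longrightarrow> smul E 0 x = 0"
  using smul_add_left[of x 0 0] by simp

lemma smul_zero_right: "smul E a 0 = 0"
  using smul_add_right[of 0 0 a] zero_closed by simp

lemma smul_minus_one: assumes "x \<in> vcarrier E" shows "smul E (- 1) x = - x"
proof -
  have "smul E (- 1) x + smul E 1 x = 0"
    using assms smul_add_left[of x "- 1" 1] by (simp add: smul_zero_left)
  then show ?thesis
    using assms by (simp add: smul_one eq_neg_iff_add_eq_0)
qed

lemma uminus_closed: "x \<in> vcarrier E \<Longrightarrow> - x \<in> vcarrier E"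
  using smul_closed[of x "- 1"] by (simp add: smul_minus_one)

lemma diff_closed: "\<lbrakk>x \<in> vcarrier E; y \<in> vcarrier E\<rbrakk> \<Longrightarrow> x - y \<in> vcarrier E"
  using add_closed[of x "- y"] uminus_closed[of y] by simp

lemma smul_minus_left: "x \<in> vcarrier E \<Longrightarrow> smul E (- a) x = - smul E a x"
  using smul_smul[of x "- 1" a] by (simp add: smul_minus_one smul_closed)

lemma smul_minus_right: "x \<in> vcarrier E \<Longrightarrow> smul E a (- x) = - smul E a x"
  using smul_smul[of x a "- 1"] smul_minus_one[of x] smul_minus_left[of x a] by simp

lemma smul_diff_right:
  "\<lbrakk>x \<in> vcarrier E; y \<in> vcarrier E\<rbrakk> \<Longrightarrow> smul E a (x - y) = smul E a x - smul E a y"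
  using smul_add_right[of x "- y" a] by (simp add: uminus_closed smul_minus_right)

lemma smul_diff_left: "x \<in> vcarrier E \<Longrightarrow> smul E (a - b) x = smul E a x - smul E b x"
  using smul_add_left[of x a "- b"] by (simp add: smul_minus_left)

lemma smul_inverse_cancel: "\<lbrakk>x \<in> vcarrier E; a \<noteq> 0\<rbrakk> \<Longrightarrow> smul E (inverse a) (smul E a x) = x"
  by (simp add: smul_smul smul_one)

lemma smul_cancel_inverse: "\<lbrakk>x \<in> vcarrier E; a \<noteq> 0\<rbrakk> \<Longrightarrow> smul E a (smul E (inverse a) x) = x"
  by (simp add: smul_smul smul_one)

lemma sum_list_closed: "(\<And>x. x \<in> set xs \<Longrightarrow> f x \<in> vcarrier E) \<Longrightarrow> (\<Sum>x\<leftarrow>xs. f x) \<in> vcarrier E"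
  by (induction xs) (auto intro: add_closed zero_closed)

lemma sum_closed: "(\<And>x. x \<in> A \<Longrightarrow> f x \<in> vcarrier E) \<Longrightarrow> (\<Sum>x\<in>A. f x) \<in> vcarrier E"
  by (induction A rule: infinite_finite_induct) (auto intro: add_closed zero_closed)

lemma smul_sum_right:
  "(\<And>x. x \<in> A \<Longrightarrow> f x \<in> vcarrier E) \<Longrightarrow> smul E a (\<Sum>x\<in>A. f x) = (\<Sum>x\<in>A. smul E a (f x))"
  by (induction A rule: infinite_finite_induct) (auto simp: smul_zero_right smul_add_right sum_closed)

lemma smul_sum_list_right:
  "(\<And>x. x \<in> set xs \<Longrightarrow> f x \<in> vcarrier E) \<Longrightarrow> smul E a (\<Sum>x\<leftarrow>xs. f x) = (\<Sum>x\<leftarrow>xs. smul E a (f x))"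
  by (induction xs) (auto simp: smul_zero_right smul_add_right sum_list_closed)

lemma limitin_add:
  assumes "limitin (vtop E) f a F" "limitin (vtop E) g b F"
  shows "limitin (vtop E) (\<lambda>t. f t + g t) (a + b) F"
  using continuous_map_limit[OF continuous_add limitin_pairI[OF assms]] by (simp add: o_def)

lemma limitin_smul:
  assumes "(c \<longlongrightarrow> a) F" "limitin (vtop E) f x F"
  shows "limitin (vtop E) (\<lambda>t. smul E (c t) (f t)) (smul E a x) F"
proof -
  have "limitin euclidean c a F" using assms(1) by simp
  from continuous_map_limit[OF continuous_smul limitin_pairI[OF this assms(2)]]
  show ?thesis by (simp add: o_def)
qed

lemma limitin_smul_const:
  "limitin (vtop E) f x F \<Longrightarrow> limitin (vtop E) (\<lambda>t. smul E a (f t)) (smul E a x) F"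
  by (rule limitin_smul) auto

lemma limitin_carrier: "limitin (vtop E) f x F \<Longrightarrow> eventually (\<lambda>t. f t \<in> vcarrier E) F"
  by (auto simp: limitin_def)

lemma limitin_uminus:
  assumes "limitin (vtop E) f a F"
  shows "limitin (vtop E) (\<lambda>t. - f t) (- a) F"
proof -
  have "limitin (vtop E) (\<lambda>t. smul E (- 1) (f t)) (- a) F"
    using limitin_smul_const[OF assms, of "- 1"] limitin_topspace[OF assms] by (simp add: smul_minus_one)
  then show ?thesis
    by (rule limitin_transform_eventually[rotated])
       (use limitin_carrier[OF assms] in \<open>auto elim: eventually_mono simp: smul_minus_one\<close>)
qed

lemma limitin_diff:
  assumes "limitin (vtop E) f a F" "limitin (vtop E) g b F"
  shows "limitin (vtop E) (\<lambda>t. f t - g t) (a - b) F"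
  using limitin_add[OF assms(1) limitin_uminus[OF assms(2)]] by simp

lemma limitin_sum_list:
  assumes "\<And>x. x \<in> set xs \<Longrightarrow> limitin (vtop E) (f x) (l x) F"
  shows "limitin (vtop E) (\<lambda>t. \<Sum>x\<leftarrow>xs. f x t) (\<Sum>x\<leftarrow>xs. l x) F"
  using assms by (induction xs) (auto intro!: limitin_add simp: zero_closed)

lemma limitin_sum:
  assumes "\<And>x. x \<in> A \<Longrightarrow> limitin (vtop E) (f x) (l x) F"
  shows "limitin (vtop E) (\<lambda>t. \<Sum>x\<in>A. f x t) (\<Sum>x\<in>A. l x) F"
  using assms by (induction A rule: infinite_finite_induct) (auto intro!: limitin_add simp: zero_closed)

lemma limitin_unique:
  "\<lbrakk>limitin (vtop E) f a F; limitin (vtop E) f b F; F \<noteq> bot\<rbrakk> \<Longrightarrow> a = b"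
  using limitin_Hausdorff_unique hausdorff by metis

lemma continuous_map_add':
  assumes "continuous_map X (vtop E) f" "continuous_map X (vtop E) g"
  shows "continuous_map X (vtop E) (\<lambda>x. f x + g x)"
  using continuous_map_compose[OF continuous_map_pairedI[OF assms] continuous_add] by (simp add: o_def)

lemma continuous_map_smul':
  assumes "continuous_map X euclidean c" "continuous_map X (vtop E) g"
  shows "continuous_map X (vtop E) (\<lambda>x. smul E (c x) (g x))"
  using continuous_map_compose[OF continuous_map_pairedI[OF assms] continuous_smul] by (simp add: o_def)

lemma continuous_map_smul_const:
  "continuous_map X (vtop E) g \<Longrightarrow> continuous_map X (vtop E) (\<lambda>x. smul E a (g x))"
  by (rule continuous_map_smul') auto

lemma continuous_map_uminus':
  assumes "continuous_map X (vtop E) g"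
  shows "continuous_map X (vtop E) (\<lambda>x. - g x)"
proof -
  have "g x \<in> vcarrier E" if "x \<in> topspace X" for x
    using assms that by (auto simp: continuous_map_def)
  then show ?thesis
    by (intro continuous_map_eq[OF continuous_map_smul_const[OF assms, of "- 1"]]) (simp add: smul_minus_one)
qed

lemma continuous_map_diff':
  assumes "continuous_map X (vtop E) f" "continuous_map X (vtop E) g"
  shows "continuous_map X (vtop E) (\<lambda>x. f x - g x)"
  using continuous_map_add'[OF assms(1) continuous_map_uminus'[OF assms(2)]] by simp

lemma continuous_map_sum_list':
  assumes "\<And>i. i \<in> set xs \<Longrightarrow> continuous_map X (vtop E) (f i)"
  shows "continuous_map X (vtop E) (\<lambda>x. \<Sum>i\<leftarrow>xs. f i x)"
  using assms by (induction xs) (auto intro!: continuous_map_add' simp: zero_closed)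

lemma openin_translate:
  assumes "openin (vtop E) V" "a \<in> vcarrier E"
  shows "openin (vtop E) {x \<in> vcarrier E. x - a \<in> V}"
  by (rule openin_continuous_map_preimage[OF _ assms(1)]) (auto intro!: continuous_map_diff' simp: assms)

text \<open>Translations are homeomorphisms, so neighbourhoods of 0 test convergence at every point;
  the later estimates are carried out in this form.\<close>

lemma limitin_nbhd_zero:
  "limitin (vtop E) f a F \<longleftrightarrow> a \<in> vcarrier E \<and>
    (\<forall>V. openin (vtop E) V \<and> 0 \<in> V \<longrightarrow> eventually (\<lambda>t. f t \<in> vcarrier E \<and> f t - a \<in> V) F)"
proof (intro iffI conjI allI impI)
  assume "limitin (vtop E) f a F"
  then show "a \<in> vcarrier E" by (rule limitin_topspace)
next
  fix V assume *: "limitin (vtop E) f a F" "openin (vtop E) V \<and> 0 \<in> V"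
  then have "a \<in> vcarrier E" by (simp add: limitin_def)
  with * show "eventually (\<lambda>t. f t \<in> vcarrier E \<and> f t - a \<in> V) F"
    using limitin_in_openin[OF *(1) openin_translate[of V a]] by auto
next
  assume *: "a \<in> vcarrier E \<and>
    (\<forall>V. openin (vtop E) V \<and> 0 \<in> V \<longrightarrow> eventually (\<lambda>t. f t \<in> vcarrier E \<and> f t - a \<in> V) F)"
  show "limitin (vtop E) f a F"
    unfolding limitin_def
  proof (intro conjI allI impI)
    show "a \<in> vcarrier E" using * by simp
    fix U assume U: "openin (vtop E) U \<and> a \<in> U"
    have "openin (vtop E) {x \<in> vcarrier E. x - (- a) \<in> U}"
      using U * by (intro openin_translate uminus_closed) auto
    then have "eventually (\<lambda>t. f t \<in> vcarrier E \<and> f t - a \<in> {x \<in> vcarrier E. x - (- a) \<in> U}) F"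
      using U zero_closed * by (auto simp: U)
    then show "eventually (\<lambda>t. f t \<in> U) F"
      by (rule eventually_mono) auto
  qed
qed

definition convex_in :: "'v set \<Rightarrow> bool" where
  "convex_in C \<longleftrightarrow> (\<forall>x\<in>C. \<forall>y\<in>C. \<forall>t\<in>{0..1::real}. smul E (of_real (1 - t)) x + smul E (of_real t) y \<in> C)"

lemma convex_inD:
  assumes "convex_in C" "x \<in> C" "y \<in> C" "0 \<le> a" "0 \<le> b" "a + b = (1::real)"
  shows "smul E (of_real a) x + smul E (of_real b) y \<in> C"
proof -
  have "a = 1 - b" "b \<in> {0..1}" using assms by auto
  then show ?thesis using assms(1-3) unfolding convex_in_def by blast
qed

lemma convex_nbhd:
  assumes "openin (vtop E) U" "0 \<in> U"
  obtains C where "openin (vtop E) C" "0 \<in> C" "C \<subseteq> U" "convex_in C"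
  using locally_convex[OF assms] unfolding convex_in_def by blast

text \<open>The stand-in for halving epsilon: continuity of addition at \<open>(0, 0)\<close> gives
  a convex neighbourhood C with C + C inside U.\<close>

lemma half_nbhd:
  assumes "openin (vtop E) U" "0 \<in> U"
  obtains C where "openin (vtop E) C" "0 \<in> C" "C \<subseteq> U" "convex_in C"
    "\<And>x y. \<lbrakk>x \<in> C; y \<in> C\<rbrakk> \<Longrightarrow> x + y \<in> U"
proof -
  let ?W = "{p \<in> topspace (prod_topology (vtop E) (vtop E)). (\<lambda>(x, y). x + y) p \<in> U}"
  have "openin (prod_topology (vtop E) (vtop E)) ?W"
    by (rule openin_continuous_map_preimage[OF continuous_add assms(1)])
  moreover have "(0, 0) \<in> ?W"
    using assms zero_closed by auto
  ultimately obtain V1 V2 where V: "openin (vtop E) V1" "openin (vtop E) V2" "0 \<in> V1" "0 \<in> V2" "V1 \<times> V2 \<subseteq> ?W"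
    unfolding openin_prod_topology_alt by meson
  have "openin (vtop E) (U \<inter> V1 \<inter> V2)" "0 \<in> U \<inter> V1 \<inter> V2"
    using V assms by auto
  from convex_nbhd[OF this] obtain C where C: "openin (vtop E) C" "0 \<in> C" "C \<subseteq> U \<inter> V1 \<inter> V2" "convex_in C" .
  have "C \<subseteq> U" using C(3) by blast
  moreover have "x + y \<in> U" if "x \<in> C" "y \<in> C" for x y
  proof -
    have "(x, y) \<in> V1 \<times> V2" using C(3) that by blast
    then have "(x, y) \<in> ?W" using V(5) by (rule subsetD[rotated])
    then show ?thesis by simp
  qed
  ultimately show ?thesis
    using that[OF C(1,2) _ C(4)] by blast
qed

text \<open>A mean value theorem by bisection: it replaces the usual appeal to the Hahn-Banach theorem.\<close>

lemma mean_value: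
  assumes N: "openin (vtop E) N" "0 \<in> N"
  obtains V where "openin (vtop E) V" "0 \<in> V"
    "\<And>\<gamma> \<gamma>' a b p. \<lbrakk>a < b; p \<in> vcarrier E; \<And>t. t \<in> {a..b} \<Longrightarrow> \<gamma> t \<in> vcarrier E;
       \<And>t. t \<in> {a..b} \<Longrightarrow> has_curve_deriv E {a..b} \<gamma> t (\<gamma>' t);
       \<And>t. t \<in> {a..b} \<Longrightarrow> \<gamma>' t - p \<in> V\<rbrakk> \<Longrightarrow>
     smul E (of_real (inverse (b - a))) (\<gamma> b - \<gamma> a) - p \<in> N"
proof -
  obtain D where D: "openin (vtop E) D" "0 \<in> D" "D \<subseteq> N" "convex_in D"
    by (rule convex_nbhd[OF N])
  \<comment> \<open>V is fixed before any curve is considered, so one neighbourhood serves all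
    curves, intervals and p. One copy of V bounds the error of the difference quotient at a point,
    the other the distance of the derivative from p; the sum stays in the convex D.\<close>
  obtain V where V: "openin (vtop E) V" "0 \<in> V" "V \<subseteq> D" "convex_in V"
    "\<And>x y. \<lbrakk>x \<in> V; y \<in> V\<rbrakk> \<Longrightarrow> x + y \<in> D"
    by (rule half_nbhd[OF D(1,2)]) blast
  have Vc: "x \<in> vcarrier E" if "x \<in> V" for x using V(1) that openin_subset by blast
  have Dc: "x \<in> vcarrier E" if "x \<in> D" for x using D(1) that openin_subset by blast
  have "smul E (of_real (inverse (b - a))) (\<gamma> b - \<gamma> a) - p \<in> N"
    if ab: "a < b" and p: "p \<in> vcarrier E" and \<gamma>: "\<And>t. t \<in> {a..b} \<Longrightarrow> \<gamma> t \<in> vcarrier E"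
      and d: "\<And>t. t \<in> {a..b} \<Longrightarrow> has_curve_deriv E {a..b} \<gamma> t (\<gamma>' t)"
      and \<gamma>V: "\<And>t. t \<in> {a..b} \<Longrightarrow> \<gamma>' t - p \<in> V"
    for \<gamma> \<gamma>' a b p
  proof -
    \<comment> \<open>The quotient is multiplied out, so that the assertion makes sense for s = t as
      well; the guards confine it to subintervals of the given interval.\<close>
    define P where "P = (\<lambda>s t. a \<le> s \<longrightarrow> t \<le> b \<longrightarrow>
      (\<exists>w\<in>D. \<gamma> t - \<gamma> s = smul E (of_real (t - s)) (p + w)))"
    \<comment> \<open>Concatenating two intervals averages the errors w1 and w2 with the lengths as
      weights, and D is convex.\<close>
    have comb: "\<exists>w\<in>D. smul E (of_real \<beta>) (p + w2) + smul E (of_real \<alpha>) (p + w1) =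
        smul E (of_real (\<alpha> + \<beta>)) (p + w)"
      if "0 \<le> \<alpha>" "0 \<le> \<beta>" "w1 \<in> D" "w2 \<in> D" for \<alpha> \<beta> w1 w2
    proof (cases "\<alpha> + \<beta> = 0")
      case True
      then have "\<alpha> = 0" "\<beta> = 0" using that by auto
      then show ?thesis using that p by (auto simp: smul_zero_left add_closed Dc)
    next
      case False
      define w where "w = smul E (of_real (\<alpha> / (\<alpha> + \<beta>))) w1 + smul E (of_real (\<beta> / (\<alpha> + \<beta>))) w2"
      have "w \<in> D" unfolding w_def
        by (rule convex_inD[OF D(4)]) (use that False in \<open>auto simp flip: add_divide_distrib\<close>)
      have "smul E (of_real (\<alpha> + \<beta>)) w = smul E (of_real \<alpha>) w1 + smul E (of_real \<beta>) w2"
      proof -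
        have "(of_real (\<alpha> + \<beta>) :: 'k) * of_real (\<alpha> / (\<alpha> + \<beta>)) = of_real \<alpha>"
          "(of_real (\<alpha> + \<beta>) :: 'k) * of_real (\<beta> / (\<alpha> + \<beta>)) = of_real \<beta>"
          using False by (simp_all del: of_real_add add: of_real_eq_0_iff)
        then show ?thesis
          unfolding w_def smul_add_right[OF smul_closed[OF Dc[OF that(3)]] smul_closed[OF Dc[OF that(4)]]]
            smul_smul[OF Dc[OF that(3)]] smul_smul[OF Dc[OF that(4)]] by simp
      qed
      then have "smul E (of_real \<beta>) (p + w2) + smul E (of_real \<alpha>) (p + w1) =
          smul E (of_real (\<alpha> + \<beta>)) (p + w)"
        using that p \<open>w \<in> D\<close> by (simp add: smul_add_right smul_add_left Dc)
      with \<open>w \<in> D\<close> show ?thesis by blast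
    qed
    \<comment> \<open>Bisection reduces the claim to concatenation of intervals and to short
      intervals around each point x.\<close>
    have "P a b"
      using less_imp_le[OF ab]
    proof (induction rule: Bolzano)
      case (trans r s t)
      show ?case
        unfolding P_def
      proof (intro impI)
        assume "a \<le> r" "t \<le> b"
        with trans obtain w1 w2 where w: "w1 \<in> D" "w2 \<in> D"
          "\<gamma> s - \<gamma> r = smul E (of_real (s - r)) (p + w1)" "\<gamma> t - \<gamma> s = smul E (of_real (t - s)) (p + w2)"
          unfolding P_def by (meson order_trans)
        have "\<gamma> t - \<gamma> r = (\<gamma> t - \<gamma> s) + (\<gamma> s - \<gamma> r)" by simp
        also have "\<dots> = smul E (of_real (t - s)) (p + w2) + smul E (of_real (s - r)) (p + w1)"
          by (simp only: w)
        finally show "\<exists>w\<in>D. \<gamma> t - \<gamma> r = smul E (of_real (t - r)) (p + w)"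
          using comb[of "s - r" "t - s" w1 w2] trans w by auto
      qed
    next
      case (local x)
      then have x: "x \<in> {a..b}" by simp
      have lim: "limitin (vtop E) (\<lambda>s. smul E (of_real (inverse (s - x))) (\<gamma> s - \<gamma> x)) (\<gamma>' x) (at x within {a..b})"
        using d[OF x] unfolding has_curve_deriv_def .
      then have "eventually (\<lambda>s. smul E (of_real (inverse (s - x))) (\<gamma> s - \<gamma> x) - \<gamma>' x \<in> V) (at x within {a..b})"
        unfolding limitin_nbhd_zero using V(1,2) by (auto elim: eventually_mono)
      then obtain e where e: "e > 0" "\<And>s. \<lbrakk>s \<in> {a..b}; s \<noteq> x; dist s x < e\<rbrakk> \<Longrightarrow>
          smul E (of_real (inverse (s - x))) (\<gamma> s - \<gamma> x) - \<gamma>' x \<in> V"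
        unfolding eventually_at by auto
      have \<gamma>'c: "\<gamma>' x \<in> vcarrier E" by (rule limitin_topspace[OF lim])
      have key: "\<exists>w\<in>D. \<gamma> s - \<gamma> x = smul E (of_real (s - x)) (p + w)" if s: "s \<in> {a..b}" "dist s x < e" for s
      proof (cases "s = x")
        case True
        then have "\<gamma> s - \<gamma> x = smul E (of_real (s - x)) (p + 0)"
          using p by (simp add: smul_zero_left)
        with D(2) show ?thesis by blast
      next
        case False
        define v where "v = smul E (of_real (inverse (s - x))) (\<gamma> s - \<gamma> x) - \<gamma>' x"
        have "v \<in> V" unfolding v_def by (rule e(2)) (use s False in auto)
        then have "v + (\<gamma>' x - p) \<in> D" using V(5) \<gamma>V[OF x] by blast
        moreover have "smul E (of_real (inverse (s - x))) (\<gamma> s - \<gamma> x) = p + (v + (\<gamma>' x - p))"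
          by (simp add: v_def)
        then have "smul E (of_real (s - x)) (smul E (of_real (inverse (s - x))) (\<gamma> s - \<gamma> x)) =
            smul E (of_real (s - x)) (p + (v + (\<gamma>' x - p)))"
          by simp
        then have "\<gamma> s - \<gamma> x = smul E (of_real (s - x)) (p + (v + (\<gamma>' x - p)))"
          using False \<gamma>[OF x] \<gamma>[OF s(1)]
          by (simp add: smul_smul smul_one diff_closed flip: of_real_mult of_real_diff del: of_real_mult of_real_diff)
        ultimately show ?thesis by blast
      qed
      show ?case
      proof (intro exI[of _ e] conjI allI impI)
        fix s t assume st: "s \<le> x \<and> x \<le> t \<and> t - s < e"
        show "P s t"
          unfolding P_def
        proof (intro impI)
          assume "a \<le> s" "t \<le> b"
          with st x have "s \<in> {a..b}" "t \<in> {a..b}" "dist s x < e" "dist t x < e"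
            by (auto simp: dist_real_def)
          then obtain w1 w2 where w: "w1 \<in> D" "w2 \<in> D"
            "\<gamma> s - \<gamma> x = smul E (of_real (s - x)) (p + w1)" "\<gamma> t - \<gamma> x = smul E (of_real (t - x)) (p + w2)"
            using key by meson
          have "\<gamma> t - \<gamma> s = (\<gamma> t - \<gamma> x) - (\<gamma> s - \<gamma> x)" by simp
          also have "\<dots> = smul E (of_real (t - x)) (p + w2) - smul E (- of_real (x - s)) (p + w1)"
            by (simp only: w of_real_minus[symmetric]) simp
          also have "\<dots> = smul E (of_real (t - x)) (p + w2) + smul E (of_real (x - s)) (p + w1)"
            using w(1) p by (simp only: smul_minus_left add_closed Dc) simp
          finally show "\<exists>w\<in>D. \<gamma> t - \<gamma> s = smul E (of_real (t - s)) (p + w)"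
            using comb[of "x - s" "t - x" w1 w2] st w by auto
        qed
      qed (use e in auto)
    qed
    then obtain w where w: "w \<in> D" "\<gamma> b - \<gamma> a = smul E (of_real (b - a)) (p + w)"
      unfolding P_def by auto
    then have "smul E (of_real (inverse (b - a))) (\<gamma> b - \<gamma> a) = p + w"
      using ab p by (simp add: smul_smul smul_one add_closed Dc flip: of_real_mult of_real_diff del: of_real_mult of_real_diff)
    then show ?thesis using w(1) D(3) by auto
  qed
  then show thesis by (rule that[OF V(1,2)])
qed

end

section \<open>Iterated directional derivatives: coinduction, strict differentiability, the chain
  rule of all orders\<close>

section \<open>Smooth maps\<close>

abbreviation jet_domain :: "('k, 'v) tvs \<Rightarrow> 'v set \<Rightarrow> nat \<Rightarrow> ('v \<times> (nat \<Rightarrow> 'v)) topology" where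
  "jet_domain E U k \<equiv> prod_topology (subtopology (vtop E) U) (product_topology (\<lambda>_. vtop E) {..<k})"

lemma limitin_line:
  assumes "lcs E" "x \<in> vcarrier E" "y \<in> vcarrier E"
  shows "limitin (vtop E) (\<lambda>t. x + smul E t y) x (at 0)"
proof -
  interpret locally_convex_space E by fact
  have "limitin (vtop E) (\<lambda>t. x + smul E t y) (x + smul E 0 y) (at 0)"
    using assms by (intro limitin_add limitin_smul tendsto_ident_at) auto
  then show ?thesis using assms by (simp add: smul_zero_left)
qed

lemma has_dir_deriv_unique:
  assumes "lcs F" "has_dir_deriv E F f x y z" "has_dir_deriv E F f x y z'"
  shows "z = z'"
  using locally_convex_space.limitin_unique[OF assms(1)] assms(2,3)
  unfolding has_dir_deriv_def by fastforce

lemma dir_deriv_eqI: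
  "\<lbrakk>lcs F; has_dir_deriv E F f x y z\<rbrakk> \<Longrightarrow> dir_deriv E F f x y = z"
  unfolding dir_deriv_def by (blast intro: has_dir_deriv_unique)

lemma has_dir_deriv_cong:
  assumes "lcs E" "openin (vtop E) U" "x \<in> U" "y \<in> vcarrier E" "\<And>x'. x' \<in> U \<Longrightarrow> f x' = g x'"
  shows "has_dir_deriv E F f x y z \<longleftrightarrow> has_dir_deriv E F g x y z"
proof -
  have "x \<in> vcarrier E" using assms(2,3) openin_subset by blast
  then have ev: "eventually (\<lambda>t. x + smul E t y \<in> U) (at 0)"
    using limitin_in_openin[OF limitin_line[OF assms(1) _ assms(4)] assms(2,3)] by simp
  show ?thesis
    unfolding has_dir_deriv_def
    by (rule iffI; erule limitin_transform_eventually[rotated])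
       (use ev assms(3,5) in \<open>auto elim: eventually_mono\<close>)
qed

lemma iter_deriv_cong:
  "(\<And>i. i < k \<Longrightarrow> y i = y' i) \<Longrightarrow> iter_deriv E F f k x y = iter_deriv E F f k x y'"
proof (induction k arbitrary: x)
  case (Suc k)
  then have "(\<lambda>x'. iter_deriv E F f k x' y) = (\<lambda>x'. iter_deriv E F f k x' y')" "y k = y' k"
    by auto
  then show ?case by simp
qed simp

lemma iter_deriv_local:
  assumes "lcs E" "openin (vtop E) U" "\<And>x'. x' \<in> U \<Longrightarrow> f x' = g x'"
  shows "\<lbrakk>x \<in> U; \<And>i. i < k \<Longrightarrow> y i \<in> vcarrier E\<rbrakk> \<Longrightarrow> iter_deriv E F f k x y = iter_deriv E F g k x y"
proof (induction k arbitrary: x)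
  case (Suc k)
  have "has_dir_deriv E F (\<lambda>x'. iter_deriv E F f k x' y) x (y k) z \<longleftrightarrow>
      has_dir_deriv E F (\<lambda>x'. iter_deriv E F g k x' y) x (y k) z" for z
    using Suc by (intro has_dir_deriv_cong[OF assms(1,2)]) auto
  then show ?case by (simp add: dir_deriv_def)
qed (simp add: assms)

lemma topspace_derivD:
  assumes "p \<in> topspace (prod_topology (subtopology X U) (product_topology (\<lambda>_. Y) {..<k::nat}))"
  shows "fst p \<in> U" "\<forall>i<k. snd p i \<in> topspace Y"
proof -
  have "fst p \<in> topspace X \<inter> U" "snd p \<in> {..<k} \<rightarrow>\<^sub>E topspace Y"
    using assms by (simp_all add: mem_Times_iff)
  then show "fst p \<in> U" "\<forall>i<k. snd p i \<in> topspace Y" by (simp_all add: PiE_iff)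
qed

text \<open>\<open>iter_deriv\<close> is a nested definite description and awkward to compute. It
  suffices to exhibit a property Q k of candidates for the k-th derivative that forces continuity
  and is preserved by differentiation in the direction \<open>y k\<close>; uniqueness of limits then
  identifies \<open>iter_deriv\<close> with a candidate at every order.\<close>

lemma smooth_coinduct:
  assumes E: "lcs E" and F: "lcs F"
    and U: "openin (vtop E) U" and f: "f \<in> U \<rightarrow> vcarrier F"
    and Q0: "Q 0 (\<lambda>x y. f x)"
    and cont: "\<And>k h. Q k h \<Longrightarrow> continuous_map
        (jet_domain E U k) (vtop F) (\<lambda>(x, y). h x y)"
    and step: "\<And>k h. Q k h \<Longrightarrow> \<exists>h'. Q (Suc k) h' \<and> (\<forall>x\<in>U. \<forall>y. (\<forall>i<Suc k. y i \<in> vcarrier E) \<longrightarrow>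
        has_dir_deriv E F (\<lambda>x'. h x' y) x (y k) (h' x y))"
  shows "smooth_on E F U f"
proof -
  have ex: "\<exists>h. Q k h \<and> (\<forall>x\<in>U. \<forall>y. (\<forall>i<k. y i \<in> vcarrier E) \<longrightarrow> iter_deriv E F f k x y = h x y)" for k
  proof (induction k)
    case 0
    then show ?case using Q0 by auto
  next
    case (Suc k)
    then obtain h where h: "Q k h" "\<And>x y. \<lbrakk>x \<in> U; \<forall>i<k. y i \<in> vcarrier E\<rbrakk> \<Longrightarrow> iter_deriv E F f k x y = h x y"
      by blast
    from step[OF h(1)] obtain h' where h': "Q (Suc k) h'"
      "\<And>x y. \<lbrakk>x \<in> U; \<forall>i<Suc k. y i \<in> vcarrier E\<rbrakk> \<Longrightarrow> has_dir_deriv E F (\<lambda>x'. h x' y) x (y k) (h' x y)"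
      by blast
    have "iter_deriv E F f (Suc k) x y = h' x y" if "x \<in> U" "\<forall>i<Suc k. y i \<in> vcarrier E" for x y
    proof -
      have "has_dir_deriv E F (\<lambda>x'. iter_deriv E F f k x' y) x (y k) (h' x y)"
        by (subst has_dir_deriv_cong[OF E U that(1), where g = "\<lambda>x'. h x' y"]) (use that h h' in auto)
      then show ?thesis by (simp add: dir_deriv_eqI[OF F])
    qed
    with h'(1) show ?case by blast
  qed
  have deriv: "\<exists>z. has_dir_deriv E F (\<lambda>x'. iter_deriv E F f k x' y) x (y k) z"
    if x: "x \<in> U" and y: "y \<in> {..<Suc k} \<rightarrow>\<^sub>E vcarrier E" for k x y
  proof -
    have yc: "y i \<in> vcarrier E" if "i < Suc k" for i
      using y that by auto
    obtain h where h: "Q k h" "\<And>x y. \<lbrakk>x \<in> U; \<forall>i<k. y i \<in> vcarrier E\<rbrakk> \<Longrightarrow> iter_deriv E F f k x y = h x y"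
      using ex by blast
    from step[OF h(1)] obtain h' where
      h': "\<And>x y. \<lbrakk>x \<in> U; \<forall>i<Suc k. y i \<in> vcarrier E\<rbrakk> \<Longrightarrow> has_dir_deriv E F (\<lambda>x'. h x' y) x (y k) (h' x y)"
      by blast
    have "has_dir_deriv E F (\<lambda>x'. iter_deriv E F f k x' y) x (y k) (h' x y)"
      by (subst has_dir_deriv_cong[OF E U x, where g = "\<lambda>x'. h x' y"]) (use x yc h h' in auto)
    then show ?thesis by blast
  qed
  have "continuous_map (jet_domain E U k)
        (vtop F) (\<lambda>(x, y). iter_deriv E F f k x y)" for k
  proof -
    obtain h where h: "Q k h" "\<And>x y. \<lbrakk>x \<in> U; \<forall>i<k. y i \<in> vcarrier E\<rbrakk> \<Longrightarrow> iter_deriv E F f k x y = h x y"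
      using ex by blast
    show ?thesis
      unfolding case_prod_beta
      by (rule continuous_map_eq[OF cont[OF h(1), unfolded case_prod_beta]])
        (rule h(2)[OF topspace_derivD, symmetric])
  qed
  with deriv U f show ?thesis
    unfolding Cr_on_def by simp
qed

lemma smooth_on_openin: "smooth_on E F U f \<Longrightarrow> openin (vtop E) U"
  by (simp add: Cr_on_def)

lemma smooth_on_carrier: "\<lbrakk>smooth_on E F U f; x \<in> U\<rbrakk> \<Longrightarrow> f x \<in> vcarrier F"
  by (auto simp: Cr_on_def)

lemma smooth_on_domain: "\<lbrakk>smooth_on E F U f; x \<in> U\<rbrakk> \<Longrightarrow> x \<in> vcarrier E"
  by (rule subsetD[OF openin_subset[OF smooth_on_openin]])

lemma smooth_on_deriv:
  assumes "lcs F" "smooth_on E F U f" "x \<in> U" "\<And>i. i < Suc k \<Longrightarrow> y i \<in> vcarrier E"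
  shows "has_dir_deriv E F (\<lambda>x'. iter_deriv E F f k x' y) x (y k) (iter_deriv E F f (Suc k) x y)"
proof -
  \<comment> \<open>\<open>Cr_on\<close> quantifies over extensional families of directions;
    restricting y is harmless because the derivative of order k reads only the entries below
    k.\<close>
  let ?y = "restrict y {..<Suc k}"
  have y: "?y \<in> {..<Suc k} \<rightarrow>\<^sub>E vcarrier E" using assms(4) by auto
  have "\<exists>z. has_dir_deriv E F (\<lambda>x'. iter_deriv E F f k x' ?y) x (?y k) z"
    by (rule assms(2)[unfolded Cr_on_def, THEN conjunct2, THEN conjunct2, THEN conjunct1, rule_format, OF _ assms(3) y]) simp
  then obtain z where "has_dir_deriv E F (\<lambda>x'. iter_deriv E F f k x' ?y) x (y k) z"
    by auto
  moreover have "(\<lambda>x'. iter_deriv E F f k x' ?y) = (\<lambda>x'. iter_deriv E F f k x' y)"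
    by (intro ext iter_deriv_cong) simp
  ultimately have d: "has_dir_deriv E F (\<lambda>x'. iter_deriv E F f k x' y) x (y k) z" by simp
  then show ?thesis using dir_deriv_eqI[OF assms(1) d] by simp
qed

text \<open>Joint continuity restated along an arbitrary filter, with directions that need not be
  extensional; the product filter in the proof of strict differentiability requires this
  generality.\<close>

lemma smooth_on_limit:
  assumes f: "smooth_on E F U f" and X: "limitin (vtop E) X x Fl" and x: "x \<in> U"
    and z: "\<And>i. i < k \<Longrightarrow> limitin (vtop E) (\<lambda>t. z t i) (l i) Fl"
  shows "limitin (vtop F) (\<lambda>t. iter_deriv E F f k (X t) (z t)) (iter_deriv E F f k x l) Fl"
proof -
  have "continuous_map (jet_domain E U k)
        (vtop F) (\<lambda>(x, y). iter_deriv E F f k x y)"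
    using f unfolding Cr_on_def by simp
  moreover have "limitin (subtopology (vtop E) U) X x Fl"
    using X x limitin_in_openin[OF X smooth_on_openin[OF f] x] by (simp add: limitin_subtopology)
  moreover have "eventually (\<lambda>t. \<forall>i\<in>{..<k}. z t i \<in> vcarrier E) Fl"
    using z by (subst eventually_ball_finite_distrib) (auto simp: limitin_def)
  then have "limitin (product_topology (\<lambda>_. vtop E) {..<k}) (\<lambda>t. restrict (z t) {..<k}) (restrict l {..<k}) Fl"
    using z by (simp add: limitin_componentwise PiE_iff Pi_iff)
  ultimately have "limitin (vtop F) ((\<lambda>(x, y). iter_deriv E F f k x y) \<circ> (\<lambda>t. (X t, restrict (z t) {..<k})))
      (iter_deriv E F f k x (restrict l {..<k})) Fl"
    using continuous_map_limit limitin_pairI by fastforce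
  moreover have "iter_deriv E F f k x' (restrict y {..<k}) = iter_deriv E F f k x' y" for x' y
    by (rule iter_deriv_cong) simp
  ultimately show ?thesis by (simp add: o_def)
qed

lemma iter_deriv_carrier:
  assumes f: "smooth_on E F U f" and "x \<in> U" "\<And>i. i < k \<Longrightarrow> y i \<in> vcarrier E"
  shows "iter_deriv E F f k x y \<in> vcarrier F"
  by (rule limitin_topspace[OF smooth_on_limit[OF f, of "\<lambda>_. x" x sequentially k "\<lambda>_. y" y]])
     (use assms smooth_on_domain[OF f] in auto)

lemma smooth_on_continuous_map:
  assumes "smooth_on E F U f" "continuous_map X (vtop E) u" "u \<in> topspace X \<rightarrow> U"
    and "\<And>i. i < k \<Longrightarrow> continuous_map X (vtop E) (\<lambda>p. v p i)"
  shows "continuous_map X (vtop F) (\<lambda>p. iter_deriv E F f k (u p) (v p))"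
  unfolding continuous_map_atin
proof
  fix p assume p: "p \<in> topspace X"
  show "limitin (vtop F) (\<lambda>p. iter_deriv E F f k (u p) (v p)) (iter_deriv E F f k (u p) (v p)) (atin X p)"
    by (rule smooth_on_limit[OF assms(1)])
       (use assms p in \<open>auto simp: continuous_map_atin\<close>)
qed

lemma smooth_on_continuous:
  "smooth_on E F U f \<Longrightarrow> continuous_map (subtopology (vtop E) U) (vtop F) f"
  using smooth_on_continuous_map[where k = 0 and u = "\<lambda>x. x" and X = "subtopology (vtop E) U", of E F U f]
  by (simp add: continuous_map_from_subtopology)

text \<open>Off U the two functions may differ, but directional derivatives at points of the open
  set U see only values in U, so the derivatives of f are candidates for those of g.\<close>

lemma smooth_on_cong:
  assumes E: "lcs E" and F: "lcs F"
    and f: "smooth_on E F U f" and eq: "\<And>x. x \<in> U \<Longrightarrow> f x = g x"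
  shows "smooth_on E F U g"
proof (rule smooth_coinduct[where Q = "\<lambda>k h. \<forall>x\<in>U. \<forall>y. (\<forall>i<k. y i \<in> vcarrier E) \<longrightarrow> h x y = iter_deriv E F f k x y"])
  note U = smooth_on_openin[OF f]
  show "openin (vtop E) U" by (rule U)
  show "g \<in> U \<rightarrow> vcarrier F" using smooth_on_carrier[OF f] eq by auto
  show "\<forall>x\<in>U. \<forall>y. (\<forall>i<0. y i \<in> vcarrier E) \<longrightarrow> g x = iter_deriv E F f 0 x y" using eq by simp
  fix k h assume h: "\<forall>x\<in>U. \<forall>y. (\<forall>i<k. y i \<in> vcarrier E) \<longrightarrow> h x y = iter_deriv E F f k x y"
  have "continuous_map (jet_domain E U k)
        (vtop F) (\<lambda>(x, y). iter_deriv E F f k x y)"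
    using f unfolding Cr_on_def by simp
  then show "continuous_map (jet_domain E U k)
        (vtop F) (\<lambda>(x, y). h x y)"
    unfolding case_prod_beta
    by (rule continuous_map_eq) (rule h[rule_format, OF topspace_derivD(1) topspace_derivD(2)[rule_format], symmetric])
  have "has_dir_deriv E F (\<lambda>x'. h x' y) x (y k) (iter_deriv E F f (Suc k) x y)"
    if "x \<in> U" "\<forall>i<Suc k. y i \<in> vcarrier E" for x y
    by (subst has_dir_deriv_cong[OF E U that(1), where g = "\<lambda>x'. iter_deriv E F f k x' y"])
       (use that h smooth_on_deriv[OF F f] in auto)
  then show "\<exists>h'. (\<forall>x\<in>U. \<forall>y. (\<forall>i<Suc k. y i \<in> vcarrier E) \<longrightarrow> h' x y = iter_deriv E F f (Suc k) x y) \<and>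
      (\<forall>x\<in>U. \<forall>y. (\<forall>i<Suc k. y i \<in> vcarrier E) \<longrightarrow> has_dir_deriv E F (\<lambda>x'. h x' y) x (y k) (h' x y))"
    by (intro exI[of _ "\<lambda>x y. iter_deriv E F f (Suc k) x y"]) auto
qed (rule E F)+

lemma smooth_on_subset:
  assumes F: "lcs F" and f: "smooth_on E F U f" and V: "openin (vtop E) V" "V \<subseteq> U"
  shows "smooth_on E F V f"
proof -
  have "continuous_map (prod_topology (subtopology (vtop E) V) (product_topology (\<lambda>_. vtop E) {..<k}))
        (vtop F) (\<lambda>(x, y). iter_deriv E F f k x y)" for k
    unfolding case_prod_beta
    by (rule smooth_on_continuous_map[OF f])
       (use V in \<open>auto intro!: continuous_map_into_fulltopology[OF continuous_map_fst]
          continuous_map_compose[OF continuous_map_snd, unfolded o_def]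
          continuous_map_product_projection\<close>)
  then show ?thesis
    using f V unfolding Cr_on_def by auto
qed

text \<open>Strict differentiability: base point, old directions, new direction w and step \<tau>
  may all vary. The difference quotient is taken over a segment that shrinks to x, and on it the
  next derivative is uniformly close to its limit p, so the mean value theorem applies.
  Multilinearity of the derivatives and all chain rules rest on this lemma.\<close>

lemma smooth_on_strict:
  assumes E: "lcs E" and F: "lcs F" and f: "smooth_on E F U f"
    and X: "limitin (vtop E) X x Fl" and x: "x \<in> U"
    and z: "\<And>i. i < k \<Longrightarrow> limitin (vtop E) (\<lambda>t. z t i) (l i) Fl"
    and w: "limitin (vtop E) w y Fl"
    and \<tau>: "(\<tau> \<longlongrightarrow> 0) Fl" "eventually (\<lambda>t. \<tau> t \<noteq> 0) Fl"
  shows "limitin (vtop F)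
    (\<lambda>t. smul F (inverse (\<tau> t)) (iter_deriv E F f k (X t + smul E (\<tau> t) (w t)) (z t) - iter_deriv E F f k (X t) (z t)))
    (iter_deriv E F f (Suc k) x (l(k := y))) Fl"
proof -
  interpret E: locally_convex_space E by fact
  interpret F: locally_convex_space F by fact
  let ?D = "iter_deriv E F f"
  define p where "p = ?D (Suc k) x (l(k := y))"
  have xc: "x \<in> vcarrier E" using smooth_on_domain[OF f x] .
  note U = smooth_on_openin[OF f]
  \<comment> \<open>The factor \<open>{0..1}\<close> is the parameter of the segment; convergence
    along G is convergence uniform on the segment.\<close>
  define G where "G = Fl \<times>\<^sub>F principal {0..1::real}"
  have to_G: "limitin Y (\<lambda>ts. u (fst ts)) a G" if "limitin Y u a Fl" for Y :: "'z topology" and u a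
    unfolding G_def by (rule limitin_compose_filterlim[OF that filterlim_fst])
  have sc: "((\<lambda>ts. of_real (snd ts) * \<tau> (fst ts)) \<longlongrightarrow> 0) G"
  proof (rule Lim_null_comparison)
    show "eventually (\<lambda>ts. norm (of_real (snd ts) * \<tau> (fst ts)) \<le> norm (\<tau> (fst ts))) G"
      unfolding G_def eventually_prod_principal
      by (auto simp: norm_mult mult_left_le_one_le)
    have "((\<lambda>ts. \<tau> (fst ts)) \<longlongrightarrow> 0) G"
      unfolding G_def by (rule filterlim_compose[OF \<tau>(1) filterlim_fst])
    then show "((\<lambda>ts. norm (\<tau> (fst ts))) \<longlongrightarrow> 0) G"
      by (rule tendsto_norm_zero)
  qed
  have pt: "limitin (vtop E) (\<lambda>ts. X (fst ts) + smul E (of_real (snd ts) * \<tau> (fst ts)) (w (fst ts))) x G"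
    using E.limitin_add[OF to_G[OF X] E.limitin_smul[OF sc to_G[OF w]]] limitin_topspace[OF w]
    by (simp add: E.smul_zero_left)
  have dl: "limitin (vtop F) (\<lambda>ts. ?D (Suc k) (X (fst ts) + smul E (of_real (snd ts) * \<tau> (fst ts)) (w (fst ts)))
      ((z (fst ts))(k := w (fst ts)))) p G"
    unfolding p_def
  proof (rule smooth_on_limit[OF f pt x])
    fix i assume "i < Suc k"
    then show "limitin (vtop E) (\<lambda>t. ((z (fst t))(k := w (fst t))) i) ((l(k := y)) i) G"
      using to_G[OF w] to_G[OF z, of i] by (auto simp: less_Suc_eq)
  qed
  have pc: "p \<in> vcarrier F" by (rule limitin_topspace[OF dl])
  have evU: "eventually (\<lambda>t. \<forall>s\<in>{0..1}. X t + smul E (of_real s * \<tau> t) (w t) \<in> U) Fl"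
    using limitin_in_openin[OF pt U x] unfolding G_def eventually_prod_principal by simp
  have evz: "eventually (\<lambda>t. \<forall>i<k. z t i \<in> vcarrier E) Fl"
  proof -
    have "eventually (\<lambda>t. \<forall>i\<in>{..<k}. z t i \<in> vcarrier E) Fl"
      using E.limitin_carrier[OF z] by (subst eventually_ball_finite_distrib) auto
    then show ?thesis by (rule eventually_mono) auto
  qed
  show ?thesis
    unfolding F.limitin_nbhd_zero p_def[symmetric]
  proof (intro conjI allI impI)
    show "p \<in> vcarrier F" by (rule pc)
    fix N assume N: "openin (vtop F) N \<and> 0 \<in> N"
    obtain V where V: "openin (vtop F) V" "0 \<in> V"
      "\<And>\<gamma> \<gamma>' a b p. \<lbrakk>a < b; p \<in> vcarrier F; \<And>t. t \<in> {a..b} \<Longrightarrow> \<gamma> t \<in> vcarrier F;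
       \<And>t. t \<in> {a..b} \<Longrightarrow> has_curve_deriv F {a..b} \<gamma> t (\<gamma>' t);
       \<And>t. t \<in> {a..b} \<Longrightarrow> \<gamma>' t - p \<in> V\<rbrakk> \<Longrightarrow>
     smul F (of_real (inverse (b - a))) (\<gamma> b - \<gamma> a) - p \<in> N"
      by (rule F.mean_value[of N]) (use N in auto)
    have evd: "eventually (\<lambda>t. \<forall>s\<in>{0..1}. ?D (Suc k) (X t + smul E (of_real s * \<tau> t) (w t)) ((z t)(k := w t)) - p \<in> V) Fl"
      using dl V(1,2) unfolding F.limitin_nbhd_zero G_def eventually_prod_principal
      by (auto elim!: eventually_mono)
    show "eventually (\<lambda>t. smul F (inverse (\<tau> t)) (?D k (X t + smul E (\<tau> t) (w t)) (z t) - ?D k (X t) (z t)) \<in> vcarrier F \<and>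
        smul F (inverse (\<tau> t)) (?D k (X t + smul E (\<tau> t) (w t)) (z t) - ?D k (X t) (z t)) - p \<in> N) Fl"
      using evU evz evd \<tau>(2) E.limitin_carrier[OF w] E.limitin_carrier[OF X]
    proof eventually_elim
      case (elim t)
      \<comment> \<open>The segment and the scaled values along it. Dividing by the step makes the
        velocity of \<gamma> exactly the next derivative in the direction
        \<open>w t\<close>.\<close>
      define \<xi> where "\<xi> s = X t + smul E (of_real s * \<tau> t) (w t)" for s :: real
      define \<gamma> where "\<gamma> s = smul F (inverse (\<tau> t)) (?D k (\<xi> s) (z t))" for s
      have Dc: "?D k (\<xi> s) (z t) \<in> vcarrier F" if "s \<in> {0..1}" for s
        using elim that by (intro iter_deriv_carrier[OF f]) (auto simp: \<xi>_def)
      have "has_curve_deriv F {0..1} \<gamma> s (?D (Suc k) (\<xi> s) ((z t)(k := w t)))" if s: "s \<in> {0..1}" for s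
      proof -
        have "has_dir_deriv E F (\<lambda>x'. ?D k x' ((z t)(k := w t))) (\<xi> s) (((z t)(k := w t)) k) (?D (Suc k) (\<xi> s) ((z t)(k := w t)))"
          by (rule smooth_on_deriv[OF F f]) (use elim s in \<open>auto simp: \<xi>_def\<close>)
        moreover have "?D k x' ((z t)(k := w t)) = ?D k x' (z t)" for x'
          by (rule iter_deriv_cong) auto
        ultimately have *: "limitin (vtop F) (\<lambda>\<sigma>. smul F (inverse \<sigma>) (?D k (\<xi> s + smul E \<sigma> (w t)) (z t) - ?D k (\<xi> s) (z t)))
            (?D (Suc k) (\<xi> s) ((z t)(k := w t))) (at 0)"
          by (simp add: has_dir_deriv_def)
        have "filterlim (\<lambda>r. of_real (r - s) * \<tau> t) (at 0) (at s within {0..1})"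
          unfolding filterlim_at
        proof
          show "eventually (\<lambda>r. of_real (r - s) * \<tau> t \<in> UNIV \<and> of_real (r - s) * \<tau> t \<noteq> 0) (at s within {0..1})"
            using elim by (simp add: eventually_at_filter)
          have "((\<lambda>r. of_real (r - s) * \<tau> t) \<longlongrightarrow> of_real (s - s) * \<tau> t) (at s within {0..1})"
            by (intro tendsto_intros)
          then show "((\<lambda>r. of_real (r - s) * \<tau> t) \<longlongrightarrow> 0) (at s within {0..1})" by simp
        qed
        note lim = limitin_compose_filterlim[OF * this]
        show ?thesis
          unfolding has_curve_deriv_def
        proof (rule limitin_transform_eventually[OF _ lim])
          show "eventually (\<lambda>r. smul F (inverse (of_real (r - s) * \<tau> t))
             (?D k (\<xi> s + smul E (of_real (r - s) * \<tau> t) (w t)) (z t) - ?D k (\<xi> s) (z t)) =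
               smul F (of_real (inverse (r - s))) (\<gamma> r - \<gamma> s)) (at s within {0..1})"
            unfolding eventually_at_filter
          proof (intro always_eventually allI impI)
            fix r assume r: "r \<noteq> s" "r \<in> {0..1}"
            have "\<xi> s + smul E (of_real (r - s) * \<tau> t) (w t) = \<xi> r"
              unfolding \<xi>_def using elim
              by (simp add: add.assoc flip: E.smul_add_left distrib_right)
            moreover have "\<gamma> r - \<gamma> s = smul F (inverse (\<tau> t)) (?D k (\<xi> r) (z t) - ?D k (\<xi> s) (z t))"
              unfolding \<gamma>_def using Dc[OF r(2)] Dc[OF s] by (simp add: F.smul_diff_right)
            ultimately show "smul F (inverse (of_real (r - s) * \<tau> t))
                 (?D k (\<xi> s + smul E (of_real (r - s) * \<tau> t) (w t)) (z t) - ?D k (\<xi> s) (z t)) =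
               smul F (of_real (inverse (r - s))) (\<gamma> r - \<gamma> s)"
              using F.smul_smul[OF F.diff_closed[OF Dc[OF r(2)] Dc[OF s]]]
              by (simp add: mult.commute)
          qed
        qed
      qed
      then have "smul F (of_real (inverse (1 - 0))) (\<gamma> 1 - \<gamma> 0) - p \<in> N"
        by (rule V(3)[OF zero_less_one pc, rotated])
          (use Dc elim in \<open>auto simp: \<gamma>_def \<xi>_def F.smul_closed simp del: iter_deriv.simps\<close>)
      moreover have "\<gamma> 1 - \<gamma> 0 = smul F (inverse (\<tau> t)) (?D k (X t + smul E (\<tau> t) (w t)) (z t) - ?D k (X t) (z t))"
        unfolding \<gamma>_def using Dc[of 0] Dc[of 1] elim by (simp add: F.smul_diff_right \<xi>_def E.smul_zero_left)
      moreover have "\<gamma> 1 - \<gamma> 0 \<in> vcarrier F"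
        using Dc[of 0] Dc[of 1] by (auto simp: \<gamma>_def intro!: F.diff_closed F.smul_closed)
      ultimately show ?case by (simp add: F.smul_one)
    qed
  qed
qed

text \<open>Additivity and homogeneity are combined in one identity so that one induction covers
  both. For the newest direction, moving by t (c a + b) means moving by t b and then by t c a from
  the shifted base point, and strictness allows the base point to move; for older directions the
  identity is differentiated once more.\<close>

lemma iter_deriv_affine:
  assumes E: "lcs E" and F: "lcs F" and f: "smooth_on E F U f"
    and a: "a \<in> vcarrier E" and b: "b \<in> vcarrier E"
  shows "\<lbrakk>i < k; x \<in> U; \<And>j. j < k \<Longrightarrow> l j \<in> vcarrier E\<rbrakk> \<Longrightarrow> iter_deriv E F f k x (l(i := smul E c a + b)) =
    smul F c (iter_deriv E F f k x (l(i := a))) + iter_deriv E F f k x (l(i := b))"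
proof (induction k arbitrary: x)
  case (Suc k)
  interpret E: locally_convex_space E by fact
  interpret F: locally_convex_space F by fact
  let ?D = "iter_deriv E F f"
  note U = smooth_on_openin[OF f]
  note lc = Suc.prems(3)
  have xc: "x \<in> vcarrier E" by (rule smooth_on_domain[OF f Suc.prems(2)])
  have ca: "smul E c a \<in> vcarrier E" using a by (rule E.smul_closed)
  have cab: "smul E c a + b \<in> vcarrier E" using ca b by (rule E.add_closed)
  have ev: "eventually (\<lambda>t. x + smul E t y \<in> U) (at 0)" if "y \<in> vcarrier E" for y
    by (rule limitin_in_openin[OF limitin_line[OF E xc that] U Suc.prems(2)])
  show ?case
  proof (cases "i = k")
    case True
    show ?thesis
    \<comment> \<open>With c = 0 the inner step t c would vanish, which strict differentiability
      excludes.\<close>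
    proof (cases "c = 0")
      case c: True
      have "?D (Suc k) x (l(k := a)) \<in> vcarrier F"
        using lc a Suc.prems(2) by (intro iter_deriv_carrier[OF f]) auto
      then show ?thesis
        unfolding c True E.smul_zero_left[OF a] by (simp only: F.smul_zero_left add_0)
    next
      case c: False
      have l1: "limitin (vtop F) (\<lambda>t. smul F (inverse (t * d)) (?D k (x + smul E t y + smul E (t * d) z) l - ?D k (x + smul E t y) l))
          (?D (Suc k) x (l(k := z))) (at 0)" if "y \<in> vcarrier E" "z \<in> vcarrier E" "d \<noteq> 0" for y z d
        using that lc Suc.prems(2) xc
        by (intro smooth_on_strict[OF E F f limitin_line[OF E], where w = "\<lambda>_. z" and z = "\<lambda>_. l" and \<tau> = "\<lambda>t. t * d"])
           (auto intro!: tendsto_eq_intros simp: eventually_at_filter)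
      have "limitin (vtop F) (\<lambda>t. smul F (inverse t) (?D k (x + smul E t (smul E c a + b)) l - ?D k x l))
          (?D (Suc k) x (l(k := smul E c a + b))) (at 0)"
        using l1[OF E.zero_closed cab one_neq_zero] by (simp add: E.smul_zero_right)
      \<comment> \<open>One summand has base point x + t b and step t c, the other base point x and
        step t; together they telescope to the quotient in the direction c a + b.\<close>
      moreover have "limitin (vtop F) (\<lambda>t. smul F (inverse t) (?D k (x + smul E t (smul E c a + b)) l - ?D k x l))
          (smul F c (?D (Suc k) x (l(k := a))) + ?D (Suc k) x (l(k := b))) (at 0)"
      proof (rule limitin_transform_eventually[OF _ F.limitin_add[OF F.limitin_smul_const[OF l1[OF b a c]] l1[OF E.zero_closed b one_neq_zero]]])
        show "eventually (\<lambda>t. smul F c (smul F (inverse (t * c)) (?D k (x + smul E t b + smul E (t * c) a) l - ?D k (x + smul E t b) l)) +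
            smul F (inverse (t * 1)) (?D k (x + smul E t 0 + smul E (t * 1) b) l - ?D k (x + smul E t 0) l) =
            smul F (inverse t) (?D k (x + smul E t (smul E c a + b)) l - ?D k x l)) (at 0)"
          using ev[OF b] ev[OF cab]
        proof eventually_elim
          case (elim t)
          have D: "?D k x l \<in> vcarrier F" "?D k (x + smul E t b) l \<in> vcarrier F" "?D k (x + smul E t (smul E c a + b)) l \<in> vcarrier F"
            using elim lc Suc.prems(2) by (auto intro!: iter_deriv_carrier[OF f])
          have x': "x + smul E t b + smul E (t * c) a = x + smul E t (smul E c a + b)"
            using a b ca by (simp add: E.smul_add_right E.smul_smul algebra_simps)
          have "c * inverse (t * c) = inverse t" using c by (simp add: field_simps)
          then show ?case
            unfolding x' F.smul_smul[OF F.diff_closed[OF D(3,2)]]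
            using D by (simp add: E.smul_zero_right F.smul_diff_right del: inverse_mult_distrib)
        qed
      qed
      ultimately show ?thesis
        unfolding True by (rule F.limitin_unique) simp
    qed
  next
    case False
    then have i: "i < k" using Suc.prems by simp
    have d: "has_dir_deriv E F (\<lambda>x'. ?D k x' (l(i := y))) x (l k) (?D (Suc k) x (l(i := y)))" if "y \<in> vcarrier E" for y
      using smooth_on_deriv[OF F f Suc.prems(2), where y = "l(i := y)" and k = k] i lc that by auto
    have "has_dir_deriv E F (\<lambda>x'. smul F c (?D k x' (l(i := a))) + ?D k x' (l(i := b))) x (l k)
        (smul F c (?D (Suc k) x (l(i := a))) + ?D (Suc k) x (l(i := b)))"
      unfolding has_dir_deriv_def
    proof (rule limitin_transform_eventually[OF _ F.limitin_add[OF F.limitin_smul_const[OF d[OF a, unfolded has_dir_deriv_def]] d[OF b, unfolded has_dir_deriv_def]]])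
      have "l k \<in> vcarrier E" using lc by simp
      from ev[OF this] show "eventually (\<lambda>t. smul F c (smul F (inverse t) (?D k (x + smul E t (l k)) (l(i := a)) - ?D k x (l(i := a)))) +
         smul F (inverse t) (?D k (x + smul E t (l k)) (l(i := b)) - ?D k x (l(i := b))) =
         smul F (inverse t) (smul F c (?D k (x + smul E t (l k)) (l(i := a))) + ?D k (x + smul E t (l k)) (l(i := b)) -
           (smul F c (?D k x (l(i := a))) + ?D k x (l(i := b))))) (at 0)"
      proof eventually_elim
        case (elim t)
        have D: "?D k x' (l(i := y)) \<in> vcarrier F" if "x' \<in> U" "y \<in> vcarrier E" for x' y
          using lc that by (intro iter_deriv_carrier[OF f]) auto
        show ?case
          using D[OF elim a] D[OF elim b] D[OF Suc.prems(2) a] D[OF Suc.prems(2) b]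
          by (simp add: F.smul_diff_right F.smul_add_right F.smul_smul F.smul_closed F.add_closed F.diff_closed mult.commute)
      qed
    qed
    moreover have "has_dir_deriv E F (\<lambda>x'. smul F c (?D k x' (l(i := a))) + ?D k x' (l(i := b))) x (l k) (?D (Suc k) x (l(i := smul E c a + b)))"
    proof (subst has_dir_deriv_cong[OF E U Suc.prems(2), where g = "\<lambda>x'. ?D k x' (l(i := smul E c a + b))"])
      show "smul F c (?D k x' (l(i := a))) + ?D k x' (l(i := b)) = ?D k x' (l(i := smul E c a + b))" if "x' \<in> U" for x'
        by (rule Suc.IH[OF i that, symmetric]) (use lc in auto)
    qed (use lc d[OF cab] in auto)
    ultimately show ?thesis
      by (rule has_dir_deriv_unique[OF F, rotated])
  qed
qed simp

lemma iter_deriv_additive: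
  assumes E: "lcs E" and F: "lcs F" and f: "smooth_on E F U f"
    and a: "a \<in> vcarrier E" and b: "b \<in> vcarrier E" and i: "i < k" and x: "x \<in> U" and l: "\<And>j. j < k \<Longrightarrow> l j \<in> vcarrier E"
  shows "iter_deriv E F f k x (l(i := a + b)) = iter_deriv E F f k x (l(i := a)) + iter_deriv E F f k x (l(i := b))"
proof -
  have "iter_deriv E F f k x (l(i := a)) \<in> vcarrier F" by (rule iter_deriv_carrier[OF f x]) (use a l in auto)
  then show ?thesis
    using iter_deriv_affine[where l = l and c = 1, OF E F f a b i x l] locally_convex_space.smul_one[OF E a] locally_convex_space.smul_one[OF F] by simp
qed

lemma iter_deriv_homogeneous:
  assumes E: "lcs E" and F: "lcs F" and f: "smooth_on E F U f"
    and a: "a \<in> vcarrier E" and i: "i < k" and x: "x \<in> U" and l: "\<And>j. j < k \<Longrightarrow> l j \<in> vcarrier E"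
  shows "iter_deriv E F f k x (l(i := smul E c a)) = smul F c (iter_deriv E F f k x (l(i := a)))"
proof -
  note z = locally_convex_space.zero_closed[OF E]
  have "iter_deriv E F f k x (l(i := 0)) = 0" using iter_deriv_additive[where l = l, OF E F f z z i x l] by simp
  then show ?thesis using iter_deriv_affine[where l = l and c = c, OF E F f a z i x l] by simp
qed

lemma iter_deriv_diff:
  assumes E: "lcs E" and F: "lcs F" and f: "smooth_on E F U f"
    and a: "a \<in> vcarrier E" and b: "b \<in> vcarrier E"
    and "i < k" "x \<in> U" "\<And>j. j < k \<Longrightarrow> l j \<in> vcarrier E"
  shows "iter_deriv E F f k x (l(i := a - b)) = iter_deriv E F f k x (l(i := a)) - iter_deriv E F f k x (l(i := b))"
  using iter_deriv_additive[OF E F f locally_convex_space.diff_closed[OF E a b] b assms(6,7), of l] assms(8)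
  by (simp add: algebra_simps)

text \<open>The total derivative of a higher derivative of g whose base point and directions all
  move; it is the inductive step of the higher chain rule. The base point is moved first, by
  strictness; then the directions are exchanged one at a time and the differences telescope by
  multilinearity.\<close>

lemma iter_deriv_total:
  assumes F: "lcs F" and G: "lcs G" and g: "smooth_on F G V g"
    and p: "limitin (vtop F) p q Fl" "q \<in> V"
    and z: "\<And>i. i < m \<Longrightarrow> limitin (vtop F) (\<lambda>t. z t i) (l i) Fl"
    and \<tau>: "(\<tau> \<longlongrightarrow> 0) Fl" "eventually (\<lambda>t. \<tau> t \<noteq> 0) Fl"
    and w: "limitin (vtop F) (\<lambda>t. smul F (inverse (\<tau> t)) (p t - q)) w Fl"
    and u: "\<And>i. i < m \<Longrightarrow> limitin (vtop F) (\<lambda>t. smul F (inverse (\<tau> t)) (z t i - l i)) (u i) Fl"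
  shows "limitin (vtop G) (\<lambda>t. smul G (inverse (\<tau> t)) (iter_deriv F G g m (p t) (z t) - iter_deriv F G g m q l))
    (iter_deriv F G g (Suc m) q (l(m := w)) + (\<Sum>i<m. iter_deriv F G g m q (l(i := u i)))) Fl"
proof -
  interpret F: locally_convex_space F by fact
  interpret G: locally_convex_space G by fact
  let ?D = "iter_deriv F G g"
  \<comment> \<open>The hybrid family of directions: the first i entries have already moved, the
    others are still at their limits.\<close>
  define h where "h i t = (\<lambda>j. if j < i then z t j else l j)" for i :: nat and t
  have qc: "q \<in> vcarrier F" by (rule smooth_on_domain[OF g p(2)])
  have lc: "l i \<in> vcarrier F" if "i < m" for i by (rule limitin_topspace[OF z[OF that]])
  have hlim: "limitin (vtop F) (\<lambda>t. h i t j) (l j) Fl" if "j < m" for i j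
    using z[OF that] lc[OF that] by (cases "j < i") (simp_all add: h_def)
  let ?w = "\<lambda>t. smul F (inverse (\<tau> t)) (p t - q)"
  have "limitin (vtop G) (\<lambda>t. smul G (inverse (\<tau> t)) (?D m (q + smul F (\<tau> t) (?w t)) (z t) - ?D m q (z t)))
      (?D (Suc m) q (l(m := w))) Fl"
    by (rule smooth_on_strict[OF F G g _ p(2) z w \<tau>]) (use qc in auto)
  moreover have "limitin (vtop G) (\<lambda>t. ?D m q ((h i t)(i := smul F (inverse (\<tau> t)) (z t i - l i))))
      (?D m q (l(i := u i))) Fl" if "i < m" for i
    by (rule smooth_on_limit[OF g]) (use qc p(2) hlim u that in auto)
  ultimately have "limitin (vtop G) (\<lambda>t. smul G (inverse (\<tau> t)) (?D m (q + smul F (\<tau> t) (?w t)) (z t) - ?D m q (z t)) +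
      (\<Sum>i<m. ?D m q ((h i t)(i := smul F (inverse (\<tau> t)) (z t i - l i)))))
      (?D (Suc m) q (l(m := w)) + (\<Sum>i<m. ?D m q (l(i := u i)))) Fl"
    by (intro G.limitin_add G.limitin_sum) auto
  then show ?thesis
  proof (rule limitin_transform_eventually[rotated])
    have "eventually (\<lambda>t. \<forall>i\<in>{..<m}. z t i \<in> vcarrier F) Fl"
      using F.limitin_carrier[OF z] by (subst eventually_ball_finite_distrib) auto
    then show "eventually (\<lambda>t. smul G (inverse (\<tau> t)) (?D m (q + smul F (\<tau> t) (?w t)) (z t) - ?D m q (z t)) +
        (\<Sum>i<m. ?D m q ((h i t)(i := smul F (inverse (\<tau> t)) (z t i - l i)))) =
        smul G (inverse (\<tau> t)) (?D m (p t) (z t) - ?D m q l)) Fl"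
      using F.limitin_carrier[OF p(1)] limitin_in_openin[OF p(1) smooth_on_openin[OF g] p(2)] \<tau>(2)
    proof eventually_elim
      case (elim t)
      have hc: "h i t j \<in> vcarrier F" if "j < m" for i j
        using elim that lc by (auto simp: h_def)
      have Dh: "?D m q (h i t) \<in> vcarrier G" for i
        by (rule iter_deriv_carrier[OF g p(2) hc])
      have Dz: "?D m (p t) (z t) \<in> vcarrier G" "?D m q (z t) \<in> vcarrier G"
        using elim p(2) by (auto intro!: iter_deriv_carrier[OF g])
      have pq: "q + smul F (\<tau> t) (?w t) = p t"
        using elim qc by (simp add: F.smul_smul F.diff_closed F.smul_one)
      have 1: "?D m q ((h i t)(i := smul F (inverse (\<tau> t)) (z t i - l i))) =
          smul G (inverse (\<tau> t)) (?D m q (h (Suc i) t) - ?D m q (h i t))" if i: "i < m" for i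
      proof -
        have "?D m q ((h i t)(i := smul F (inverse (\<tau> t)) (z t i - l i))) =
            smul G (inverse (\<tau> t)) (?D m q ((h i t)(i := z t i - l i)))"
          by (rule iter_deriv_homogeneous[OF F G g _ i p(2) hc]) (use elim i lc in \<open>auto intro: F.diff_closed\<close>)
        also have "?D m q ((h i t)(i := z t i - l i)) = ?D m q ((h i t)(i := z t i)) - ?D m q ((h i t)(i := l i))"
          by (rule iter_deriv_diff[OF F G g _ _ i p(2) hc]) (use elim i lc in auto)
        also have "(h i t)(i := z t i) = h (Suc i) t"
          by (auto simp: h_def fun_eq_iff)
        also have "(h i t)(i := l i) = h i t"
          by (auto simp: h_def fun_eq_iff)
        finally show ?thesis .
      qed
      have "(\<Sum>i<m. ?D m q ((h i t)(i := smul F (inverse (\<tau> t)) (z t i - l i)))) =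
          smul G (inverse (\<tau> t)) (\<Sum>i<m. ?D m q (h (Suc i) t) - ?D m q (h i t))"
        using 1 Dh by (subst G.smul_sum_right) (auto intro: G.diff_closed)
      also have "(\<Sum>i<m. ?D m q (h (Suc i) t) - ?D m q (h i t)) = ?D m q (h m t) - ?D m q (h 0 t)"
        by (rule sum_lessThan_telescope)
      also have "?D m q (h m t) = ?D m q (z t)"
        by (rule iter_deriv_cong) (simp add: h_def)
      also have "h 0 t = l" by (simp add: h_def)
      finally have 2: "(\<Sum>i<m. ?D m q ((h i t)(i := smul F (inverse (\<tau> t)) (z t i - l i)))) =
          smul G (inverse (\<tau> t)) (?D m q (z t) - ?D m q l)" .
      have "?D m q l \<in> vcarrier G" using lc by (rule iter_deriv_carrier[OF g p(2)])
      then show ?case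
        unfolding pq 2 using Dz by (simp add: G.smul_diff_right)
    qed
  qed
qed

text \<open>The \<open>k\<close>-th derivative of \<open>g \<circ> f\<close> is a sum of terms indexed by lists \<open>T\<close> of blocks of indices:
  differentiating a term either creates a new block \<open>[k]\<close> or appends \<open>k\<close> to one of the blocks.\<close>

theorem smooth_on_compose:
  assumes E: "lcs E" and F: "lcs F" and G: "lcs G"
    and f: "smooth_on E F U f" and g: "smooth_on F G V g" and UV: "f ` U \<subseteq> V"
  shows "smooth_on E G U (\<lambda>x. g (f x))"
proof -
  interpret F: locally_convex_space F by fact
  interpret G: locally_convex_space G by fact
  let ?f = "iter_deriv E F f" and ?g = "iter_deriv F G g"
  \<comment> \<open>A block I stands for the derivative of f in the directions \<open>y i\<close>
    for i in I, and a list T for the derivative of g at f x in the directions given by its blocks;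
    the empty list is g (f x) and the empty block is f x.\<close>
  define v where "v I x y = ?f (length I) x (\<lambda>j. y (I ! j))" for I x and y :: "nat \<Rightarrow> _"
  define val where "val T x y = ?g (length T) (f x) (\<lambda>i. v (T ! i) x y)" for T x and y :: "nat \<Rightarrow> _"
  \<comment> \<open>At order k only the directions of index below k may occur, since the jets of
    order k record no others.\<close>
  define small where "small k T \<longleftrightarrow> (\<forall>I\<in>set T. \<forall>i\<in>set I. i < k)" for k :: nat and T
  define next_terms where "next_terms k T = (T @ [[k]]) # map (\<lambda>i. T[i := T ! i @ [k]]) [0..<length T]" for k :: nat and T
  define Q where "Q k h \<longleftrightarrow> (\<exists>Ts. (\<forall>T\<in>set Ts. small k T) \<and> h = (\<lambda>x y. \<Sum>T\<leftarrow>Ts. val T x y))" for k h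
  have fV: "f x \<in> V" if "x \<in> U" for x using UV that by auto
  have small_nth: "T ! i ! j < k" if "small k T" "i < length T" "j < length (T ! i)" for k T i j
    using that unfolding small_def by (meson nth_mem)
  have small_next: "small (Suc k) T'" if T: "small k T" and T': "T' \<in> set (next_terms k T)" for k T T'
  proof -
    have s: "small (Suc k) T" using T unfolding small_def by (meson less_SucI)
    consider "T' = T @ [[k]]" | i where "i < length T" "T' = T[i := T ! i @ [k]]"
      using T' unfolding next_terms_def by auto
    then show ?thesis
    proof cases
      case 1
      then show ?thesis using s by (auto simp: small_def)
    next
      case 2
      have "set T' \<subseteq> insert (T ! i @ [k]) (set T)"
        unfolding 2 by (rule set_update_subset_insert)
      moreover have "\<forall>j\<in>set (T ! i @ [k]). j < Suc k"
        using s 2(1) unfolding small_def by (auto dest: nth_mem)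
      ultimately show ?thesis using s unfolding small_def by blast
    qed
  qed
  have v_lim: "has_dir_deriv E F (\<lambda>x'. v I x' y) x (y k) (v (I @ [k]) x y)"
    if "x \<in> U" "\<forall>i<Suc k. y i \<in> vcarrier E" "\<forall>i\<in>set I. i < k" for I x y k
  proof -
    let ?y = "\<lambda>j. if j < length I then y (I ! j) else y k"
    have yI: "y (I ! j) \<in> vcarrier E" if "j < length I" for j
    proof -
      have "I ! j < k" using that \<open>\<forall>i\<in>set I. i < k\<close> nth_mem by blast
      then show ?thesis using \<open>\<forall>i<Suc k. y i \<in> vcarrier E\<close> by simp
    qed
    have "has_dir_deriv E F (\<lambda>x'. ?f (length I) x' ?y) x (?y (length I)) (?f (Suc (length I)) x ?y)"
      using that yI by (intro smooth_on_deriv[OF F f]) auto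
    moreover have "?f (length I) x' ?y = v I x' y" for x'
      unfolding v_def by (rule iter_deriv_cong) simp
    moreover have "?f (Suc (length I)) x ?y = v (I @ [k]) x y"
      unfolding v_def length_append_singleton by (rule iter_deriv_cong) (auto simp: nth_append less_Suc_eq)
    ultimately show ?thesis by simp
  qed
  have v_cont: "continuous_map (jet_domain E U k) (vtop F)
      (\<lambda>p. v I (fst p) (snd p))" if "\<forall>i\<in>set I. i < k" for I k
    unfolding v_def
  proof (rule smooth_on_continuous_map[OF f])
    fix j assume "j < length I"
    then have "I ! j \<in> {..<k}" using that by auto
    then have "continuous_map (product_topology (\<lambda>_. vtop E) {..<k}) (vtop E) (\<lambda>y. y (I ! j))"
      by (rule continuous_map_product_projection)
    from continuous_map_compose[OF continuous_map_snd this]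
    show "continuous_map (jet_domain E U k) (vtop E) (\<lambda>p. snd p (I ! j))"
      by (simp add: o_def)
  next
    show "continuous_map (jet_domain E U k) (vtop E) fst"
      by (rule continuous_map_into_fulltopology[OF continuous_map_fst])
    show "fst \<in> topspace (jet_domain E U k) \<rightarrow> U"
      by (intro funcsetI) (rule topspace_derivD)
  qed
  have f_eq: "v [] x y = f x" for x y by (simp add: v_def)
  have val_cont: "continuous_map (jet_domain E U k) (vtop G)
      (\<lambda>p. val T (fst p) (snd p))" if "small k T" for T k
    unfolding val_def
  proof (rule smooth_on_continuous_map[OF g])
    show "continuous_map (jet_domain E U k) (vtop F) (\<lambda>p. f (fst p))"
      using v_cont[of "[]" k] by (simp add: f_eq)
    show "(\<lambda>p. f (fst p)) \<in> topspace (jet_domain E U k) \<rightarrow> V"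
      by (intro funcsetI fV) (rule topspace_derivD)
    show "continuous_map (jet_domain E U k) (vtop F)
        (\<lambda>p. v (T ! i) (fst p) (snd p))" if "i < length T" for i
      by (rule v_cont) (use that \<open>small k T\<close> in \<open>auto simp: small_def\<close>)
  qed
  have val_deriv: "has_dir_deriv E G (\<lambda>x'. val T x' y) x (y k) (\<Sum>T'\<leftarrow>next_terms k T. val T' x y)"
    if x: "x \<in> U" and y: "\<forall>i<Suc k. y i \<in> vcarrier E" and T: "small k T" for T x y k
  proof -
    have sm: "\<forall>j\<in>set (T ! i). j < k" if "i < length T" for i
      using T that unfolding small_def by auto
    have yI: "y (I ! j) \<in> vcarrier E" if "\<forall>i\<in>set I. i < k" "j < length I" for I j
    proof -
      have "I ! j < k" using that nth_mem by blast
      then show ?thesis using y by simp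
    qed
    have cont: "limitin (vtop F) (\<lambda>t. v I (x + smul E t (y k)) y) (v I x y) (at 0)" if "\<forall>i\<in>set I. i < k" for I
      unfolding v_def
      by (rule smooth_on_limit[OF f limitin_line[OF E]])
         (use x yI[OF that] smooth_on_domain[OF f x] y in auto)
    have d: "limitin (vtop F) (\<lambda>t. smul F (inverse t) (v I (x + smul E t (y k)) y - v I x y)) (v (I @ [k]) x y) (at 0)"
      if "\<forall>i\<in>set I. i < k" for I
      using v_lim[OF x y that] by (simp add: has_dir_deriv_def)
    have "limitin (vtop G) (\<lambda>t. smul G (inverse t) (val T (x + smul E t (y k)) y - val T x y))
       (?g (Suc (length T)) (f x) ((\<lambda>i. v (T ! i) x y)(length T := v [k] x y)) +
        (\<Sum>i<length T. ?g (length T) (f x) ((\<lambda>i. v (T ! i) x y)(i := v (T ! i @ [k]) x y)))) (at 0)"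
      unfolding val_def
      by (rule iter_deriv_total[OF F G g])
         (use cont[of "[]"] d[of "[]"] cont[OF sm] d[OF sm] fV[OF x] in
           \<open>auto simp: f_eq eventually_at_filter intro: tendsto_ident_at\<close>)
    moreover have "?g (Suc (length T)) (f x) ((\<lambda>i. v (T ! i) x y)(length T := v [k] x y)) = val (T @ [[k]]) x y"
      unfolding val_def length_append_singleton by (rule iter_deriv_cong) (auto simp: nth_append less_Suc_eq)
    moreover have "?g (length T) (f x) ((\<lambda>i. v (T ! i) x y)(i := v (T ! i @ [k]) x y)) = val (T[i := T ! i @ [k]]) x y"
      if "i < length T" for i
      unfolding val_def length_list_update by (rule iter_deriv_cong) (use that in auto)
    ultimately show ?thesis
      unfolding has_dir_deriv_def next_terms_def
      by (simp add: interv_sum_list_conv_sum_set_nat atLeast0LessThan o_def)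
  qed
  show ?thesis
  proof (rule smooth_coinduct[OF E G, where Q = Q])
    show "openin (vtop E) U" by (rule smooth_on_openin[OF f])
    show "(\<lambda>x. g (f x)) \<in> U \<rightarrow> vcarrier G"
      using fV smooth_on_carrier[OF g] by auto
    show "Q 0 (\<lambda>x y. g (f x))"
      unfolding Q_def by (rule exI[of _ "[[]]"]) (simp add: small_def val_def)
  next
    fix k h assume "Q k h"
    then obtain Ts where Ts: "\<forall>T\<in>set Ts. small k T" "h = (\<lambda>x y. \<Sum>T\<leftarrow>Ts. val T x y)"
      unfolding Q_def by blast
    show "continuous_map (jet_domain E U k) (vtop G) (\<lambda>(x, y). h x y)"
      unfolding Ts(2) case_prod_beta by (rule G.continuous_map_sum_list') (use val_cont Ts(1) in blast)
    define h' where "h' = (\<lambda>x y. \<Sum>T\<leftarrow>concat (map (next_terms k) Ts). val T x y)"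
    have "Q (Suc k) h'"
      unfolding Q_def
    proof (intro exI conjI)
      show "h' = (\<lambda>x y. \<Sum>T\<leftarrow>concat (map (next_terms k) Ts). val T x y)" by (rule h'_def)
      show "\<forall>T\<in>set (concat (map (next_terms k) Ts)). small (Suc k) T"
      proof
        fix T' assume "T' \<in> set (concat (map (next_terms k) Ts))"
        then obtain T where "T \<in> set Ts" "T' \<in> set (next_terms k T)" by auto
        then show "small (Suc k) T'" using Ts(1) by (intro small_next[of k T]) auto
      qed
    qed
    moreover have "has_dir_deriv E G (\<lambda>x'. h x' y) x (y k) (h' x y)"
      if x: "x \<in> U" and y: "\<forall>i<Suc k. y i \<in> vcarrier E" for x y
    proof -
      have "limitin (vtop G) (\<lambda>t. \<Sum>T\<leftarrow>Ts. smul G (inverse t) (val T (x + smul E t (y k)) y - val T x y))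
          (\<Sum>T\<leftarrow>Ts. \<Sum>T'\<leftarrow>next_terms k T. val T' x y) (at 0)"
        using val_deriv[OF x y] Ts(1) unfolding has_dir_deriv_def by (intro G.limitin_sum_list) auto
      moreover have "(\<Sum>T\<leftarrow>Ts. \<Sum>T'\<leftarrow>next_terms k T. val T' x y) = h' x y"
        unfolding h'_def by (induction Ts) auto
      moreover have "eventually (\<lambda>t. (\<Sum>T\<leftarrow>Ts. smul G (inverse t) (val T (x + smul E t (y k)) y - val T x y)) =
          smul G (inverse t) (h (x + smul E t (y k)) y - h x y)) (at 0)"
      proof -
        have "eventually (\<lambda>t. x + smul E t (y k) \<in> U) (at 0)"
          by (rule limitin_in_openin[OF limitin_line[OF E] smooth_on_openin[OF f] x])
             (simp_all add: y smooth_on_domain[OF f x])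
        then show ?thesis
        proof eventually_elim
          case (elim t)
          have c: "val T x' y \<in> vcarrier G" if "T \<in> set Ts" "x' \<in> U" for T x'
          proof -
            have "small k T" using that Ts by auto
            then show ?thesis
              unfolding val_def v_def using y fV[OF that(2)] that(2)
              by (intro iter_deriv_carrier[OF g] iter_deriv_carrier[OF f]) (auto dest: small_nth)
          qed
          have "h (x + smul E t (y k)) y - h x y = (\<Sum>T\<leftarrow>Ts. val T (x + smul E t (y k)) y - val T x y)"
            unfolding Ts(2) by (simp add: sum_list_subtractf)
          then show ?case
            using c x elim by (simp add: G.smul_sum_list_right G.diff_closed)
        qed
      qed
      ultimately show ?thesis
        unfolding has_dir_deriv_def by (simp only: limitin_transform_eventually)
    qed
    ultimately show "\<exists>h'. Q (Suc k) h' \<and> (\<forall>x\<in>U. \<forall>y. (\<forall>i<Suc k. y i \<in> vcarrier E) \<longrightarrow>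
        has_dir_deriv E G (\<lambda>x'. h x' y) x (y k) (h' x y))"
      by blast
  qed
qed

section \<open>Products, complexifications and spaces of functions; smoothness of linear, bilinear
  and componentwise maps\<close>

section \<open>Products, function spaces and linear maps\<close>

lemma continuous_map_fst_comp: "continuous_map X (prod_topology Y Z) f \<Longrightarrow> continuous_map X Y (\<lambda>x. fst (f x))"
  using continuous_map_compose[OF _ continuous_map_fst] by (simp add: o_def)

lemma continuous_map_snd_comp: "continuous_map X (prod_topology Y Z) f \<Longrightarrow> continuous_map X Z (\<lambda>x. snd (f x))"
  using continuous_map_compose[OF _ continuous_map_snd] by (simp add: o_def)

lemma continuous_map_id': "continuous_map X X (\<lambda>x. x)"
  using continuous_map_id by (simp add: id_def)

lemmas continuous_map_projs =
  continuous_map_fst_comp continuous_map_snd_comp continuous_map_id' continuous_map_fst continuous_map_snd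

lemma vtop_prod_tvs [simp]: "vtop (prod_tvs E F) = prod_topology (vtop E) (vtop F)"
  and smul_prod_tvs [simp]: "smul (prod_tvs E F) a p = (smul E a (fst p), smul F a (snd p))"
  by (simp_all add: prod_tvs_def case_prod_beta)

lemma vtop_complexification [simp]: "vtop (complexification E) = prod_topology (vtop E) (vtop E)"
  and smul_complexification [simp]: "smul (complexification E) z p =
    (smul E (of_real (Re z)) (fst p) - smul E (of_real (Im z)) (snd p),
     smul E (of_real (Re z)) (snd p) + smul E (of_real (Im z)) (fst p))"
  by (simp_all add: complexification_def case_prod_beta)

lemma lcs_prod:
  assumes E: "lcs E" and F: "lcs F"
  shows "lcs (prod_tvs E F)"
proof -
  interpret E: locally_convex_space E by fact
  interpret F: locally_convex_space F by fact
  show ?thesis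
  proof
    show "Hausdorff_space (vtop (prod_tvs E F))"
      by (simp add: Hausdorff_space_prod_topology E.hausdorff F.hausdorff)
    show "continuous_map (prod_topology (vtop (prod_tvs E F)) (vtop (prod_tvs E F))) (vtop (prod_tvs E F)) (\<lambda>(x, y). x + y)"
      unfolding vtop_prod_tvs continuous_map_pairwise o_def case_prod_unfold fst_add snd_add
      by (intro conjI E.continuous_map_add' F.continuous_map_add' continuous_map_projs)
        (rule continuous_map_projs)+
    show "continuous_map (prod_topology euclidean (vtop (prod_tvs E F))) (vtop (prod_tvs E F)) (\<lambda>(a, x). smul (prod_tvs E F) a x)"
      unfolding vtop_prod_tvs continuous_map_pairwise o_def case_prod_unfold smul_prod_tvs fst_conv snd_conv
      by (intro conjI E.continuous_map_smul' F.continuous_map_smul' continuous_map_projs)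
        (rule continuous_map_projs)+
    fix U assume U: "openin (vtop (prod_tvs E F)) U" "0 \<in> U"
    then obtain V W where VW: "openin (vtop E) V" "openin (vtop F) W" "0 \<in> V" "0 \<in> W" "V \<times> W \<subseteq> U"
      unfolding vtop_prod_tvs openin_prod_topology_alt zero_prod_def by meson
    obtain C where C: "openin (vtop E) C" "0 \<in> C" "C \<subseteq> V" "E.convex_in C"
      by (rule E.convex_nbhd[OF VW(1,3)])
    obtain D where D: "openin (vtop F) D" "0 \<in> D" "D \<subseteq> W" "F.convex_in D"
      by (rule F.convex_nbhd[OF VW(2,4)])
    show "\<exists>C. openin (vtop (prod_tvs E F)) C \<and> 0 \<in> C \<and> C \<subseteq> U \<and>
        (\<forall>x\<in>C. \<forall>y\<in>C. \<forall>t\<in>{0..1::real}. smul (prod_tvs E F) (of_real (1 - t)) x + smul (prod_tvs E F) (of_real t) y \<in> C)"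
    proof (intro exI[of _ "C \<times> D"] conjI)
      show "C \<times> D \<subseteq> U" using C(3) D(3) VW(5) by blast
      show "\<forall>x\<in>C \<times> D. \<forall>y\<in>C \<times> D. \<forall>t\<in>{0..1::real}.
          smul (prod_tvs E F) (of_real (1 - t)) x + smul (prod_tvs E F) (of_real t) y \<in> C \<times> D"
        using C(4) D(4) unfolding E.convex_in_def F.convex_in_def by (simp add: mem_Times_iff)
    qed (use C D in \<open>simp_all add: openin_prod_Times_iff zero_prod_def\<close>)
  qed (auto simp: E.zero_closed F.zero_closed zero_prod_def E.add_closed F.add_closed E.smul_closed F.smul_closed
      E.smul_add_right F.smul_add_right E.smul_add_left F.smul_add_left E.smul_smul F.smul_smul E.smul_one F.smul_one)
qed

text \<open>Topology and addition are those of \<open>prod_tvs E E\<close>, and convexity involves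
  real scalars alone, which act componentwise; what remains is the complex scalar action.\<close>

lemma lcs_complexification:
  assumes E: "lcs E"
  shows "lcs (complexification E)"
proof -
  interpret E: locally_convex_space E by fact
  interpret EE: locally_convex_space "prod_tvs E E" by (rule lcs_prod[OF E E])
  show ?thesis
  proof
    show "Hausdorff_space (vtop (complexification E))"
      using EE.hausdorff by simp
    show "continuous_map (prod_topology (vtop (complexification E)) (vtop (complexification E))) (vtop (complexification E)) (\<lambda>(x, y). x + y)"
      using EE.continuous_add by simp
    have "continuous_map euclidean euclidean (\<lambda>z. of_real (Re z) :: 'a)"
      "continuous_map euclidean euclidean (\<lambda>z. of_real (Im z) :: 'a)"
      by (simp_all add: continuous_on_of_real continuous_on_Re continuous_on_Im continuous_on_id)
    from this[THEN continuous_map_compose[OF continuous_map_fst]]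
    have re_im: "continuous_map (prod_topology euclidean Y) euclidean (\<lambda>x. of_real (Re (fst x)) :: 'a)"
      "continuous_map (prod_topology euclidean Y) euclidean (\<lambda>x. of_real (Im (fst x)) :: 'a)" for Y :: "'y topology"
      by (simp_all add: o_def)
    show "continuous_map (prod_topology euclidean (vtop (complexification E))) (vtop (complexification E))
        (\<lambda>(a, x). smul (complexification E) a x)"
      unfolding vtop_complexification continuous_map_pairwise o_def case_prod_unfold smul_complexification fst_conv snd_conv
      by (intro conjI E.continuous_map_add' E.continuous_map_diff' E.continuous_map_smul' continuous_map_projs)
        (rule re_im continuous_map_projs)+
    fix U assume U: "openin (vtop (complexification E)) U" "0 \<in> U"
    then obtain C where C: "openin (vtop (prod_tvs E E)) C" "0 \<in> C" "C \<subseteq> U" "EE.convex_in C"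
      using EE.convex_nbhd[of U] by auto
    have Cc: "fst x \<in> vcarrier E" "snd x \<in> vcarrier E" if "x \<in> C" for x
      using openin_subset[OF C(1)] that by auto
    show "\<exists>C. openin (vtop (complexification E)) C \<and> 0 \<in> C \<and> C \<subseteq> U \<and>
        (\<forall>x\<in>C. \<forall>y\<in>C. \<forall>t\<in>{0..1::real}. smul (complexification E) (of_real (1 - t)) x + smul (complexification E) (of_real t) y \<in> C)"
    proof (intro exI[of _ C] conjI ballI)
      fix x y and t :: real assume "x \<in> C" "y \<in> C" "t \<in> {0..1}"
      then show "smul (complexification E) (of_real (1 - t)) x + smul (complexification E) (of_real t) y \<in> C"
        using C(4) Cc unfolding EE.convex_in_def by (simp add: E.smul_zero_left)
    qed (use C in auto)
  qed (auto simp: E.zero_closed zero_prod_def E.add_closed E.smul_closed E.diff_closed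
      E.smul_add_right E.smul_diff_right E.smul_add_left E.smul_diff_left E.smul_smul E.smul_one E.smul_zero_left algebra_simps)
qed

text \<open>Pointwise convergence on a set S of functions. The Hom space, its subspaces and the
  tangent spaces, whose elements are families over charts, are instances, so their local convexity
  is proved once.\<close>

definition fun_tvs :: "('k, 'v) tvs \<Rightarrow> ('i \<Rightarrow> 'v) set \<Rightarrow> ('k, 'i \<Rightarrow> 'v) tvs" where
  "fun_tvs E S = \<lparr>vtop = subtopology (product_topology (\<lambda>_. vtop E) UNIV) S, smul = (\<lambda>a f i. smul E a (f i))\<rparr>"

lemma vtop_fun_tvs: "vtop (fun_tvs E S) = subtopology (product_topology (\<lambda>_. vtop E) UNIV) S"
  and smul_fun_tvs [simp]: "smul (fun_tvs E S) a f = (\<lambda>i. smul E a (f i))"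
  by (simp_all add: fun_tvs_def)

definition fun_subspace :: "('k::real_normed_field, 'v::ab_group_add) tvs \<Rightarrow> ('i \<Rightarrow> 'v) set \<Rightarrow> bool" where
  "fun_subspace E S \<longleftrightarrow> 0 \<in> S \<and> (\<forall>f\<in>S. \<forall>g\<in>S. f + g \<in> S) \<and> (\<forall>a. \<forall>f\<in>S. (\<lambda>i. smul E a (f i)) \<in> S) \<and>
    (\<forall>f\<in>S. \<forall>i. f i \<in> vcarrier E)"

lemma vcarrier_fun_tvs: "fun_subspace E S \<Longrightarrow> vcarrier (fun_tvs E S) = S"
  by (auto simp: vtop_fun_tvs fun_subspace_def)

lemma limitin_fun_tvs:
  assumes "fun_subspace E S"
  shows "limitin (vtop (fun_tvs E S)) f l Fl \<longleftrightarrow>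
    l \<in> S \<and> eventually (\<lambda>t. f t \<in> S) Fl \<and> (\<forall>i. limitin (vtop E) (\<lambda>t. f t i) (l i) Fl)"
proof -
  have "eventually (\<lambda>t. f t \<in> topspace (product_topology (\<lambda>_. vtop E) UNIV)) Fl" if "eventually (\<lambda>t. f t \<in> S) Fl"
    using that assms by (auto elim!: eventually_mono simp: fun_subspace_def)
  then show ?thesis
    by (auto simp: vtop_fun_tvs limitin_subtopology limitin_componentwise)
qed

lemma continuous_map_fun_tvs:
  "continuous_map X (vtop (fun_tvs E S)) f \<longleftrightarrow>
    f \<in> topspace X \<rightarrow> S \<and> (\<forall>i. continuous_map X (vtop E) (\<lambda>x. f x i))"
  by (auto simp: vtop_fun_tvs continuous_map_in_subtopology continuous_map_componentwise_UNIV)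

lemma continuous_map_fun_tvs_apply: "continuous_map (vtop (fun_tvs E S)) (vtop E) (\<lambda>f. f i)"
  unfolding vtop_fun_tvs
  by (rule continuous_map_from_subtopology[OF continuous_map_product_projection]) simp

lemma lcs_fun:
  assumes E: "lcs E" and S: "fun_subspace E S"
  shows "lcs (fun_tvs E S)"
proof -
  interpret E: locally_convex_space E by fact
  note carrier = vcarrier_fun_tvs[OF S]
  have Sc: "f i \<in> vcarrier E" if "f \<in> S" for f i using S that by (simp add: fun_subspace_def)
  have comp: "continuous_map X (vtop E) (\<lambda>x. f x i)" if "continuous_map X (vtop (fun_tvs E S)) f" for X :: "'x topology" and f i
    using that by (simp add: continuous_map_fun_tvs)
  show ?thesis
  proof
    show "Hausdorff_space (vtop (fun_tvs E S))"
      unfolding vtop_fun_tvs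
      by (intro Hausdorff_space_subtopology) (simp add: Hausdorff_space_product_topology E.hausdorff)
    have "continuous_map (prod_topology (vtop (fun_tvs E S)) (vtop (fun_tvs E S))) (vtop (fun_tvs E S)) (\<lambda>p i. fst p i + snd p i)"
      unfolding continuous_map_fun_tvs[of _ E S]
    proof (intro conjI allI)
      have "(\<lambda>i. f i + g i) \<in> S" if "f \<in> S" "g \<in> S" for f g
        using S that by (auto simp: fun_subspace_def plus_fun_def)
      then show "(\<lambda>p i. fst p i + snd p i) \<in> topspace (prod_topology (vtop (fun_tvs E S)) (vtop (fun_tvs E S))) \<rightarrow> S"
        by (auto simp: carrier)
    qed (intro E.continuous_map_add' comp continuous_map_fst continuous_map_snd)
    then show "continuous_map (prod_topology (vtop (fun_tvs E S)) (vtop (fun_tvs E S))) (vtop (fun_tvs E S)) (\<lambda>(x, y). x + y)"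
      by (simp add: case_prod_unfold plus_fun_def)
    have "continuous_map (prod_topology euclidean (vtop (fun_tvs E S))) (vtop (fun_tvs E S)) (\<lambda>p i. smul E (fst p) (snd p i))"
      unfolding continuous_map_fun_tvs[of _ E S]
    proof (intro conjI allI)
      show "(\<lambda>x i. smul E (fst x) (snd x i)) \<in> topspace (prod_topology euclidean (vtop (fun_tvs E S))) \<rightarrow> S"
        using S by (auto simp: carrier fun_subspace_def)
    qed (intro E.continuous_map_smul' comp continuous_map_fst continuous_map_snd)
    then show "continuous_map (prod_topology euclidean (vtop (fun_tvs E S))) (vtop (fun_tvs E S)) (\<lambda>(a, x). smul (fun_tvs E S) a x)"
      by (simp add: case_prod_unfold)
    fix U assume U: "openin (vtop (fun_tvs E S)) U" "0 \<in> U"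
    then obtain T where T: "openin (product_topology (\<lambda>_. vtop E) UNIV) T" "U = T \<inter> S"
      unfolding vtop_fun_tvs openin_subtopology by blast
    then have "0 \<in> T" using U by blast
    from product_topology_open_contains_basis[OF T(1) this]
    obtain X where X: "0 \<in> (\<Pi>\<^sub>E i\<in>UNIV. X i)" "\<And>i. openin (vtop E) (X i)" "finite {i. X i \<noteq> vcarrier E}"
      "(\<Pi>\<^sub>E i\<in>UNIV. X i) \<subseteq> T" by blast
    have "\<exists>C. openin (vtop E) C \<and> 0 \<in> C \<and> C \<subseteq> X i \<and> E.convex_in C" for i
    proof -
      have "0 \<in> X i" using PiE_mem[OF X(1), of i] by simp
      from E.convex_nbhd[OF X(2) this] show ?thesis by metis
    qed
    then obtain C where C: "\<And>i. openin (vtop E) (C i)" "\<And>i. 0 \<in> C i" "\<And>i. C i \<subseteq> X i" "\<And>i. E.convex_in (C i)"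
      by metis
    \<comment> \<open>Coordinates on which the given neighbourhood imposes nothing stay
      unrestricted; the product of the C i could restrict infinitely many coordinates and then fail
      to be open.\<close>
    define D where "D i = (if X i = vcarrier E then vcarrier E else C i)" for i
    have D: "openin (vtop E) (D i)" "0 \<in> D i" "D i \<subseteq> X i" "E.convex_in (D i)" for i
      using C by (auto simp: D_def E.zero_closed E.convex_in_def E.add_closed E.smul_closed)
    have "openin (product_topology (\<lambda>_. vtop E) UNIV) (\<Pi>\<^sub>E i\<in>UNIV. D i)"
    proof (rule product_topology_basis)
      show "finite {i. D i \<noteq> vcarrier E}"
        by (rule finite_subset[OF _ X(3)]) (auto simp: D_def)
    qed (rule D)
    then have op: "openin (vtop (fun_tvs E S)) ((\<Pi>\<^sub>E i\<in>UNIV. D i) \<inter> S)"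
      unfolding vtop_fun_tvs openin_subtopology by blast
    show "\<exists>C. openin (vtop (fun_tvs E S)) C \<and> 0 \<in> C \<and> C \<subseteq> U \<and>
        (\<forall>x\<in>C. \<forall>y\<in>C. \<forall>t\<in>{0..1::real}. smul (fun_tvs E S) (of_real (1 - t)) x + smul (fun_tvs E S) (of_real t) y \<in> C)"
    proof (intro exI[of _ "(\<Pi>\<^sub>E i\<in>UNIV. D i) \<inter> S"] conjI op ballI)
      show "0 \<in> (\<Pi>\<^sub>E i\<in>UNIV. D i) \<inter> S" using D(2) S by (simp add: PiE_UNIV_domain fun_subspace_def)
      show "(\<Pi>\<^sub>E i\<in>UNIV. D i) \<inter> S \<subseteq> U"
        unfolding T(2) using X(4) D(3) by (force simp: PiE_UNIV_domain)
      fix x y and t :: real assume *: "x \<in> (\<Pi>\<^sub>E i\<in>UNIV. D i) \<inter> S" "y \<in> (\<Pi>\<^sub>E i\<in>UNIV. D i) \<inter> S" "t \<in> {0..1}"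
      have "smul E (of_real (1 - t)) (x i) + smul E (of_real t) (y i) \<in> D i" for i
      proof -
        have "x i \<in> D i" "y i \<in> D i" using * by (auto simp: PiE_UNIV_domain)
        then show ?thesis using D(4)[of i] *(3) unfolding E.convex_in_def by blast
      qed
      moreover have "(\<lambda>i. smul E (of_real (1 - t)) (x i)) + (\<lambda>i. smul E (of_real t) (y i)) \<in> S"
        using S * by (simp add: fun_subspace_def)
      ultimately show "smul (fun_tvs E S) (of_real (1 - t)) x + smul (fun_tvs E S) (of_real t) y \<in> (\<Pi>\<^sub>E i\<in>UNIV. D i) \<inter> S"
        by (simp add: PiE_UNIV_domain)
    qed
  qed (use S in \<open>auto simp: carrier Sc fun_subspace_def fun_eq_iff E.smul_add_right E.smul_add_left E.smul_smul E.smul_one\<close>)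
qed

definition continuous_linear ::
  "('k::real_normed_field, 'v::ab_group_add) tvs \<Rightarrow> ('k, 'w::ab_group_add) tvs \<Rightarrow> ('v \<Rightarrow> 'w) \<Rightarrow> bool" where
  "continuous_linear E F L \<longleftrightarrow> continuous_map (vtop E) (vtop F) L \<and>
    (\<forall>x\<in>vcarrier E. \<forall>y\<in>vcarrier E. L (x + y) = L x + L y) \<and>
    (\<forall>a. \<forall>x\<in>vcarrier E. L (smul E a x) = smul F a (L x))"

lemma continuous_linear_carrier: "\<lbrakk>continuous_linear E F L; x \<in> vcarrier E\<rbrakk> \<Longrightarrow> L x \<in> vcarrier F"
  by (auto simp: continuous_linear_def continuous_map_def)

lemma continuous_linear_zero:
  assumes "lcs E" "continuous_linear E F L" shows "L 0 = 0"
proof -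
  have "L (0 + 0) = L 0 + L 0"
    using assms locally_convex_space.zero_closed unfolding continuous_linear_def by blast
  then show ?thesis by simp
qed

lemma continuous_linear_diff:
  assumes "lcs E" "continuous_linear E F L" "x \<in> vcarrier E" "y \<in> vcarrier E"
  shows "L (x - y) = L x - L y"
proof -
  have "x - y \<in> vcarrier E" using assms(1,3,4) by (rule locally_convex_space.diff_closed)
  then have "L (x - y + y) = L (x - y) + L y" using assms unfolding continuous_linear_def by blast
  then show ?thesis by simp
qed

lemma continuous_linear_compose:
  assumes "continuous_linear E F L" "continuous_linear F G M"
  shows "continuous_linear E G (\<lambda>x. M (L x))"
proof -
  have "continuous_map (vtop E) (vtop G) (\<lambda>x. M (L x))"
    using assms continuous_map_compose[of "vtop E" "vtop F" L "vtop G" M] by (simp add: continuous_linear_def o_def)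
  then show ?thesis
    using assms continuous_linear_carrier[OF assms(1)] by (simp add: continuous_linear_def)
qed

lemma continuous_linear_id: "continuous_linear E E (\<lambda>x. x)"
  by (simp add: continuous_linear_def continuous_map_id')

lemma continuous_linear_fst: "continuous_linear (prod_tvs E F) E fst"
  and continuous_linear_snd: "continuous_linear (prod_tvs E F) F snd"
  by (simp_all add: continuous_linear_def continuous_map_fst continuous_map_snd)

lemma continuous_linear_add:
  assumes "lcs F" shows "continuous_linear (prod_tvs F F) F (\<lambda>p. fst p + snd p)"
proof -
  interpret locally_convex_space F by fact
  show ?thesis
    using continuous_add by (auto simp: continuous_linear_def case_prod_unfold smul_add_right)
qed

lemma continuous_linear_smul:
  assumes "lcs F" shows "continuous_linear F F (smul F c)"
proof -
  interpret locally_convex_space F by fact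
  show ?thesis
    by (auto simp: continuous_linear_def smul_add_right smul_smul mult.commute
        intro!: continuous_map_smul_const continuous_map_id')
qed

lemma continuous_linear_fun_apply:
  "continuous_linear (fun_tvs E S) E (\<lambda>f. f i)"
  by (simp add: continuous_linear_def continuous_map_fun_tvs_apply)

lemma smooth_on_linear:
  fixes E :: "('k::real_normed_field, 'v::ab_group_add) tvs" and F :: "('k, 'w::ab_group_add) tvs"
  assumes E: "lcs E" and F: "lcs F"
    and L: "continuous_linear E F L" and U: "openin (vtop E) U"
  shows "smooth_on E F U L"
proof -
  interpret E: locally_convex_space E by fact
  interpret F: locally_convex_space F by fact
  note c = continuous_linear_carrier[OF L]
  have Uc: "x \<in> vcarrier E" if "x \<in> U" for x using openin_subset[OF U] that by blast
  have cont: "continuous_map X (vtop F) (\<lambda>x. L (f x))" if "continuous_map X (vtop E) f" for X :: "'x topology" and f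
    using continuous_map_compose[OF that, of "vtop F" L] L by (simp add: continuous_linear_def o_def)
  show ?thesis
  proof (rule smooth_coinduct[OF E F U, where Q = "\<lambda>k h. h = (\<lambda>(x::'v) (y::nat \<Rightarrow> 'v). if k = 0 then L x else if k = 1 then L (y 0) else 0)"])
    show "L \<in> U \<rightarrow> vcarrier F" using c Uc by auto
    fix k h assume h: "h = (\<lambda>(x::'v) (y::nat \<Rightarrow> 'v). if k = (0::nat) then L x else if k = 1 then L (y (0::nat)) else 0)"
    show "continuous_map (jet_domain E U k) (vtop F) (\<lambda>(x, y). h x y)"
    proof -
      consider "k = 0" | "k = 1" | "k \<noteq> 0" "k \<noteq> 1" by blast
      then show ?thesis
      proof cases
        case 1
        then show ?thesis
          by (auto simp: h case_prod_unfold intro!: cont continuous_map_into_fulltopology[OF continuous_map_fst])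
      next
        case 2
        have "continuous_map (product_topology (\<lambda>_. vtop E) {..<k}) (vtop E) (\<lambda>y. y 0)"
          by (rule continuous_map_product_projection) (simp add: 2)
        from continuous_map_compose[OF continuous_map_snd this] show ?thesis
          by (auto simp: 2 h case_prod_unfold o_def intro!: cont)
      next
        case 3
        then show ?thesis by (simp add: h F.zero_closed case_prod_unfold)
      qed
    qed
    have "has_dir_deriv E F (\<lambda>x'. h x' y) x (y k) (if k = 0 then L (y 0) else 0)"
      if x: "x \<in> U" and y: "\<forall>i<Suc k. y i \<in> vcarrier E" for x y
    proof -
      have "limitin (vtop F) (\<lambda>t. if k = 0 then L (y 0) else 0) (if k = 0 then L (y 0) else 0) (at (0::'k))"
        using y c F.zero_closed by (auto simp: less_Suc_eq)
      then show ?thesis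
        unfolding has_dir_deriv_def
      proof (rule limitin_transform_eventually[rotated])
        have "L (x + smul E t (y 0)) - L x = smul F t (L (y 0))" if "k = 0" for t
          using L x y Uc that by (simp add: continuous_linear_def E.smul_closed)
        then show "eventually (\<lambda>t. (if k = 0 then L (y 0) else 0) =
            smul F (inverse t) (h (x + smul E t (y k)) y - h x y)) (at 0)"
          using y by (auto simp: eventually_at_filter h F.smul_inverse_cancel c F.smul_zero_right)
      qed
    qed
    then show "\<exists>h'. h' = (\<lambda>(x::'v) (y::nat \<Rightarrow> 'v). if Suc k = 0 then L x else if Suc k = 1 then L (y 0) else 0) \<and>
        (\<forall>x\<in>U. \<forall>y. (\<forall>i<Suc k. y i \<in> vcarrier E) \<longrightarrow> has_dir_deriv E F (\<lambda>x'. h x' y) x (y k) (h' x y))"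
      by simp
  qed simp
qed

lemma smooth_on_const:
  fixes E :: "('k::real_normed_field, 'v::ab_group_add) tvs" and F :: "('k, 'w::ab_group_add) tvs"
  assumes E: "lcs E" and F: "lcs F"
    and U: "openin (vtop E) U" and c: "c \<in> vcarrier F"
  shows "smooth_on E F U (\<lambda>_. c)"
proof -
  interpret F: locally_convex_space F by fact
  show ?thesis
  proof (rule smooth_coinduct[OF E F U, where Q = "\<lambda>k h. h = (\<lambda>(x::'v) (y::nat \<Rightarrow> 'v). if k = 0 then c else 0)"])
    fix k h assume h: "h = (\<lambda>(x::'v) (y::nat \<Rightarrow> 'v). if k = (0::nat) then c else 0)"
    show "continuous_map (jet_domain E U k) (vtop F) (\<lambda>(x, y). h x y)"
      using c F.zero_closed by (simp add: h case_prod_unfold)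
    show "\<exists>h'. h' = (\<lambda>(x::'v) (y::nat \<Rightarrow> 'v). if Suc k = 0 then c else 0) \<and>
        (\<forall>x\<in>U. \<forall>y. (\<forall>i<Suc k. y i \<in> vcarrier E) \<longrightarrow> has_dir_deriv E F (\<lambda>x'. h x' y) x (y k) (h' x y))"
      by (simp add: h has_dir_deriv_def F.smul_zero_right F.zero_closed)
  qed (use c in auto)
qed

lemma smooth_on_pair:
  assumes E: "lcs E" and F: "lcs F" and G: "lcs G"
    and f: "smooth_on E F U f" and g: "smooth_on E G U g"
  shows "smooth_on E (prod_tvs F G) U (\<lambda>x. (f x, g x))"
proof -
  interpret F: locally_convex_space F by fact
  interpret G: locally_convex_space G by fact
  show ?thesis
  proof (rule smooth_coinduct[OF E lcs_prod[OF F G] smooth_on_openin[OF f],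
        where Q = "\<lambda>k h. h = (\<lambda>x y. (iter_deriv E F f k x y, iter_deriv E G g k x y))"])
    show "(\<lambda>x. (f x, g x)) \<in> U \<rightarrow> vcarrier (prod_tvs F G)"
      using smooth_on_carrier[OF f] smooth_on_carrier[OF g] by auto
    fix k h assume h: "h = (\<lambda>x y. (iter_deriv E F f k x y, iter_deriv E G g k x y))"
    show "continuous_map (jet_domain E U k)
        (vtop (prod_tvs F G)) (\<lambda>(x, y). h x y)"
      using f g unfolding Cr_on_def vtop_prod_tvs h by (simp add: case_prod_unfold continuous_map_pairedI)
    have "has_dir_deriv E (prod_tvs F G) (\<lambda>x'. h x' y) x (y k) (iter_deriv E F f (Suc k) x y, iter_deriv E G g (Suc k) x y)"
      if "x \<in> U" "\<forall>i<Suc k. y i \<in> vcarrier E" for x y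
      using smooth_on_deriv[OF F.locally_convex_space_axioms f that(1), of k y]
        smooth_on_deriv[OF G.locally_convex_space_axioms g that(1), of k y] that(2)
      by (simp add: has_dir_deriv_def h limitin_pairwise o_def del: iter_deriv.simps)
    then show "\<exists>h'. h' = (\<lambda>x y. (iter_deriv E F f (Suc k) x y, iter_deriv E G g (Suc k) x y)) \<and>
        (\<forall>x\<in>U. \<forall>y. (\<forall>i<Suc k. y i \<in> vcarrier E) \<longrightarrow> has_dir_deriv E (prod_tvs F G) (\<lambda>x'. h x' y) x (y k) (h' x y))"
      by blast
  qed simp
qed

lemma smooth_on_add:
  assumes E: "lcs E" and F: "lcs F"
    and f: "smooth_on E F U f" and g: "smooth_on E F U g"
  shows "smooth_on E F U (\<lambda>x. f x + g x)"
proof -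
  have FF: "lcs (prod_tvs F F)" by (rule lcs_prod[OF F F])
  have "smooth_on E F U (\<lambda>x. fst (f x, g x) + snd (f x, g x))"
    by (rule smooth_on_compose[OF E FF F smooth_on_pair[OF E F F f g]
          smooth_on_linear[OF FF F continuous_linear_add[OF F] openin_topspace]])
       (use smooth_on_carrier[OF f] smooth_on_carrier[OF g] in auto)
  then show ?thesis by simp
qed

lemma smooth_on_compose_linear:
  assumes E: "lcs E" and F: "lcs F" and G: "lcs G"
    and f: "smooth_on E F U f" and L: "continuous_linear F G L"
  shows "smooth_on E G U (\<lambda>x. L (f x))"
  by (rule smooth_on_compose[OF E F G f smooth_on_linear[OF F G L openin_topspace]])
     (use smooth_on_carrier[OF f] in auto)

lemma smooth_on_smul:
  assumes "lcs E" "lcs F" "smooth_on E F U f"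
  shows "smooth_on E F U (\<lambda>x. smul F c (f x))"
  by (rule smooth_on_compose_linear[OF assms(1,2,2,3) continuous_linear_smul[OF assms(2)]])

lemma smooth_on_sum_list:
  assumes E: "lcs E" and F: "lcs F" and U: "openin (vtop E) U"
  shows "(\<And>i. i \<in> set xs \<Longrightarrow> smooth_on E F U (f i)) \<Longrightarrow> smooth_on E F U (\<lambda>x. \<Sum>i\<leftarrow>xs. f i x)"
  by (induction xs) (auto intro!: smooth_on_add[OF E F] smooth_on_const[OF E F U] locally_convex_space.zero_closed[OF F])

lemma smooth_on_sum:
  assumes E: "lcs E" and F: "lcs F" and U: "openin (vtop E) U"
  shows "(\<And>i. i \<in> A \<Longrightarrow> smooth_on E F U (f i)) \<Longrightarrow> smooth_on E F U (\<lambda>x. \<Sum>i\<in>A. f i x)"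
  by (induction A rule: infinite_finite_induct)
     (auto intro!: smooth_on_add[OF E F] smooth_on_const[OF E F U] locally_convex_space.zero_closed[OF F])

definition continuous_bilinear ::
  "('k::real_normed_field, 'u::ab_group_add) tvs \<Rightarrow> ('k, 'v::ab_group_add) tvs \<Rightarrow> ('k, 'w::ab_group_add) tvs \<Rightarrow>
    ('u \<Rightarrow> 'v \<Rightarrow> 'w) \<Rightarrow> bool" where
  "continuous_bilinear E F G b \<longleftrightarrow>
    continuous_map (prod_topology (vtop E) (vtop F)) (vtop G) (\<lambda>p. b (fst p) (snd p)) \<and>
    (\<forall>x\<in>vcarrier E. \<forall>x'\<in>vcarrier E. \<forall>y\<in>vcarrier F. b (x + x') y = b x y + b x' y) \<and>
    (\<forall>x\<in>vcarrier E. \<forall>y\<in>vcarrier F. \<forall>y'\<in>vcarrier F. b x (y + y') = b x y + b x y') \<and>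
    (\<forall>a. \<forall>x\<in>vcarrier E. \<forall>y\<in>vcarrier F. b (smul E a x) y = smul G a (b x y)) \<and>
    (\<forall>a. \<forall>x\<in>vcarrier E. \<forall>y\<in>vcarrier F. b x (smul F a y) = smul G a (b x y))"

lemma continuous_bilinearD:
  assumes "continuous_bilinear E F G b"
  shows "continuous_map (prod_topology (vtop E) (vtop F)) (vtop G) (\<lambda>p. b (fst p) (snd p))"
    and "\<lbrakk>x \<in> vcarrier E; y \<in> vcarrier F\<rbrakk> \<Longrightarrow> b x y \<in> vcarrier G"
    and "\<lbrakk>x \<in> vcarrier E; x' \<in> vcarrier E; y \<in> vcarrier F\<rbrakk> \<Longrightarrow> b (x + x') y = b x y + b x' y"
    and "\<lbrakk>x \<in> vcarrier E; y \<in> vcarrier F; y' \<in> vcarrier F\<rbrakk> \<Longrightarrow> b x (y + y') = b x y + b x y'"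
    and "\<lbrakk>x \<in> vcarrier E; y \<in> vcarrier F\<rbrakk> \<Longrightarrow> b (smul E a x) y = smul G a (b x y)"
    and "\<lbrakk>x \<in> vcarrier E; y \<in> vcarrier F\<rbrakk> \<Longrightarrow> b x (smul F a y) = smul G a (b x y)"
proof -
  show c: "continuous_map (prod_topology (vtop E) (vtop F)) (vtop G) (\<lambda>p. b (fst p) (snd p))"
    using assms by (simp add: continuous_bilinear_def)
  show "b x y \<in> vcarrier G" if "x \<in> vcarrier E" "y \<in> vcarrier F"
    using funcset_mem[OF continuous_map_funspace[OF c], of "(x, y)"] that by simp
qed (use assms in \<open>simp_all add: continuous_bilinear_def\<close>)

lemma smooth_on_bilinear:
  assumes E: "lcs E" and F: "lcs F" and G: "lcs G"
    and b: "continuous_bilinear E F G b" and U: "openin (vtop (prod_tvs E F)) U"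
  shows "smooth_on (prod_tvs E F) G U (\<lambda>p. b (fst p) (snd p))"
proof -
  interpret E: locally_convex_space E by fact
  interpret F: locally_convex_space F by fact
  interpret G: locally_convex_space G by fact
  note bD = continuous_bilinearD[OF b]
  have Uc: "fst x \<in> vcarrier E" "snd x \<in> vcarrier F" if "x \<in> U" for x
    using openin_subset[OF U] that by auto
  have cont: "continuous_map X (vtop G) (\<lambda>x. b (f x) (g x))"
    if "continuous_map X (vtop E) f" "continuous_map X (vtop F) g" for X :: "'x topology" and f g
    using continuous_map_compose[OF continuous_map_pairedI[OF that] bD(1)] by (simp add: o_def)
  have limb: "limitin (vtop G) (\<lambda>t. b (f t) (g t)) (b x y) Fl"
    if "limitin (vtop E) f x Fl" "limitin (vtop F) g y Fl" for f g x y and Fl :: "'a filter"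
    using continuous_map_limit[OF bD(1) limitin_pairI[OF that]] by (simp add: o_def)
  define D where "D k x y = (if k = 0 then b (fst x) (snd x)
      else if k = 1 then b (fst x) (snd (y 0)) + b (fst (y 0)) (snd x)
      else if k = 2 then b (fst (y 1)) (snd (y 0)) + b (fst (y 0)) (snd (y 1)) else 0)"
    for k :: nat and x and y :: "nat \<Rightarrow> _"
  show ?thesis
  proof (rule smooth_coinduct[OF lcs_prod[OF E F] G U, where Q = "\<lambda>k h. h = D k"])
    show "(\<lambda>p. b (fst p) (snd p)) \<in> U \<rightarrow> vcarrier G" using Uc bD(2) by auto
    show "(\<lambda>x y. b (fst x) (snd x)) = D 0" by (simp add: D_def fun_eq_iff)
    fix k h assume h: "h = D k"
    have cx: "continuous_map (prod_topology (subtopology (prod_topology (vtop E) (vtop F)) U) Y) (vtop E) (\<lambda>p. fst (fst p))"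
      "continuous_map (prod_topology (subtopology (prod_topology (vtop E) (vtop F)) U) Y) (vtop F) (\<lambda>p. snd (fst p))"
      for Y :: "'y topology"
      by (rule continuous_map_fst_comp[OF continuous_map_into_fulltopology[OF continuous_map_fst]]
          continuous_map_snd_comp[OF continuous_map_into_fulltopology[OF continuous_map_fst]])+
    have cy: "continuous_map (prod_topology X (product_topology (\<lambda>_. prod_topology (vtop E) (vtop F)) {..<k})) (vtop E) (\<lambda>p. fst (snd p i))"
      "continuous_map (prod_topology X (product_topology (\<lambda>_. prod_topology (vtop E) (vtop F)) {..<k})) (vtop F) (\<lambda>p. snd (snd p i))"
      if "i < k" for i k and X :: "'y topology"
      using continuous_map_fst_comp[OF continuous_map_compose[OF continuous_map_snd continuous_map_product_projection, of i "{..<k}"]]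
        continuous_map_snd_comp[OF continuous_map_compose[OF continuous_map_snd continuous_map_product_projection, of i "{..<k}"]] that
      by (simp_all add: o_def)
    consider "k = 0" | "k = 1" | "k = 2" | "k > 2" by linarith
    then show "continuous_map (prod_topology (subtopology (vtop (prod_tvs E F)) U) (product_topology (\<lambda>_. vtop (prod_tvs E F)) {..<k}))
        (vtop G) (\<lambda>(x, y). h x y)"
      by cases (auto simp: h D_def case_prod_unfold G.zero_closed intro!: cont G.continuous_map_add' cx cy)
    have "has_dir_deriv (prod_tvs E F) G (\<lambda>x'. h x' y) x (y k) (D (Suc k) x y)"
      if x: "x \<in> U" and y: "\<forall>i<Suc k. y i \<in> vcarrier (prod_tvs E F)" for x y
    proof -
      note xc = Uc[OF x]
      have yc: "fst (y i) \<in> vcarrier E" "snd (y i) \<in> vcarrier F" if "i < Suc k" for i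
        using y that by (auto simp: mem_Times_iff)
      \<comment> \<open>The difference quotient with t cancelled. Only at order 0 does it depend on
        t: the first derivative of a bilinear map is additive in the base point and the higher ones
        are constant in it.\<close>
      define R where "R t = (if k = 0 then b (fst x) (snd (y 0)) + b (fst (y 0)) (snd x + smul F t (snd (y 0))) else D (Suc k) x y)" for t
      have "limitin (vtop G) R (D (Suc k) x y) (at 0)"
      proof (cases "k = 0")
        case True
        show ?thesis
          unfolding R_def[abs_def] D_def using True xc yc
          by (auto intro!: G.limitin_add limb limitin_line[OF F] bD(2))
      next
        case False
        have "D (Suc k) x y \<in> vcarrier G"
          using False yc by (auto simp: D_def intro!: G.add_closed bD(2) G.zero_closed)
        then show ?thesis using False by (simp add: R_def[abs_def])
      qed
      then show ?thesis
        unfolding has_dir_deriv_def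
      proof (rule limitin_transform_eventually[rotated])
        have "R t = smul G (inverse t) (h (x + smul (prod_tvs E F) t (y k)) y - h x y)" if t: "t \<noteq> 0" for t
        proof -
          consider "k = 0" | "k = 1" | "k > 1" by linarith
          then have "h (x + smul (prod_tvs E F) t (y k)) y - h x y = smul G t (R t)"
            using xc yc
            by cases (auto simp: h R_def D_def bD E.smul_closed F.smul_closed E.add_closed F.add_closed
                G.smul_add_right G.smul_closed G.add_closed G.smul_zero_right algebra_simps)
          moreover have "R t \<in> vcarrier G"
            using xc yc by (auto simp: R_def D_def intro!: G.add_closed bD(2) F.add_closed F.smul_closed G.zero_closed)
          ultimately show ?thesis using t by (simp add: G.smul_inverse_cancel)
        qed
        then show "eventually (\<lambda>t. R t = smul G (inverse t) (h (x + smul (prod_tvs E F) t (y k)) y - h x y)) (at 0)"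
          by (simp add: eventually_at_filter)
      qed
    qed
    then show "\<exists>h'. h' = D (Suc k) \<and>
        (\<forall>x\<in>U. \<forall>y. (\<forall>i<Suc k. y i \<in> vcarrier (prod_tvs E F)) \<longrightarrow> has_dir_deriv (prod_tvs E F) G (\<lambda>x'. h x' y) x (y k) (h' x y))"
      by blast
  qed
qed

lemma smooth_on_bilinear_compose:
  assumes X: "lcs X" and E: "lcs E" and F: "lcs F" and G: "lcs G"
    and b: "continuous_bilinear E F G b" and f: "smooth_on X E U f" and g: "smooth_on X F U g"
  shows "smooth_on X G U (\<lambda>x. b (f x) (g x))"
proof -
  have EF: "lcs (prod_tvs E F)" by (rule lcs_prod[OF E F])
  have "smooth_on X G U (\<lambda>x. b (fst (f x, g x)) (snd (f x, g x)))"
    by (rule smooth_on_compose[OF X EF G smooth_on_pair[OF X E F f g] smooth_on_bilinear[OF E F G b openin_topspace]])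
       (use smooth_on_carrier[OF f] smooth_on_carrier[OF g] in auto)
  then show ?thesis by simp
qed

text \<open>Difference quotients of f stay in S, and S is closed under pointwise limits, so the
  componentwise derivatives again lie in S; closedness takes the place of completeness.\<close>

lemma smooth_on_fun:
  assumes E: "lcs E" and F: "lcs F"
    and S: "fun_subspace F S" and cl: "closedin (product_topology (\<lambda>_. vtop F) UNIV) S"
    and U: "openin (vtop E) U" and f: "f \<in> U \<rightarrow> S" and sm: "\<And>i. smooth_on E F U (\<lambda>x. f x i)"
  shows "smooth_on E (fun_tvs F S) U f"
proof -
  interpret F: locally_convex_space F by fact
  interpret FS: locally_convex_space "fun_tvs F S" by (rule lcs_fun[OF F S])
  let ?D = "\<lambda>k x y i. iter_deriv E F (\<lambda>x. f x i) k x y"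
  note carrier = vcarrier_fun_tvs[OF S]
  show ?thesis
  proof (rule smooth_coinduct[OF E lcs_fun[OF F S] U,
        where Q = "\<lambda>k h. h = ?D k \<and> (\<forall>x\<in>U. \<forall>y. (\<forall>i<k. y i \<in> vcarrier E) \<longrightarrow> h x y \<in> S)"])
    show "f \<in> U \<rightarrow> vcarrier (fun_tvs F S)" using f carrier by simp
    show "(\<lambda>x y. f x) = ?D 0 \<and> (\<forall>x\<in>U. \<forall>y. (\<forall>i<0. y i \<in> vcarrier E) \<longrightarrow> f x \<in> S)" using f by auto
    fix k h assume h: "h = ?D k \<and> (\<forall>x\<in>U. \<forall>y. (\<forall>i<k. y i \<in> vcarrier E) \<longrightarrow> h x y \<in> S)"
    then have hS: "h x y \<in> S" if "x \<in> U" "\<forall>i<k. y i \<in> vcarrier E" for x y using that by blast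
    show "continuous_map (jet_domain E U k)
        (vtop (fun_tvs F S)) (\<lambda>(x, y). h x y)"
      unfolding continuous_map_fun_tvs case_prod_unfold
    proof (intro conjI allI funcsetI)
      show "h (fst p) (snd p) \<in> S" if "p \<in> topspace (jet_domain E U k)" for p
        using topspace_derivD[OF that] by (rule hS)
      show "continuous_map (jet_domain E U k)
        (vtop F) (\<lambda>p. h (fst p) (snd p) i)" for i
        using sm[of i] h by (simp add: Cr_on_def case_prod_unfold)
    qed
    have main: "?D (Suc k) x y \<in> S \<and> has_dir_deriv E (fun_tvs F S) (\<lambda>x'. h x' y) x (y k) (?D (Suc k) x y)"
      if x: "x \<in> U" and y: "\<forall>i<Suc k. y i \<in> vcarrier E" for x y
    proof -
      have comp: "limitin (vtop F) (\<lambda>t. smul F (inverse t) (h (x + smul E t (y k)) y i - h x y i)) (?D (Suc k) x y i) (at 0)" for i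
        using smooth_on_deriv[OF F sm[of i] x, of k y] y h by (simp add: has_dir_deriv_def del: iter_deriv.simps)
      have "x \<in> vcarrier E" using x openin_subset[OF U] by blast
      then have "eventually (\<lambda>t. x + smul E t (y k) \<in> U) (at 0)"
        using y by (intro limitin_in_openin[OF limitin_line[OF E] U x]) auto
      then have ev: "eventually (\<lambda>t. smul (fun_tvs F S) (inverse t) (h (x + smul E t (y k)) y - h x y) \<in> S) (at 0)"
      proof eventually_elim
        case (elim t)
        have "h (x + smul E t (y k)) y \<in> vcarrier (fun_tvs F S)" "h x y \<in> vcarrier (fun_tvs F S)"
          unfolding carrier using hS elim x y by auto
        from FS.smul_closed[OF FS.diff_closed[OF this]] show ?case unfolding carrier .
      qed
      have "limitin (product_topology (\<lambda>_. vtop F) UNIV)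
          (\<lambda>t. smul (fun_tvs F S) (inverse t) (h (x + smul E t (y k)) y - h x y)) (?D (Suc k) x y) (at 0)"
        using comp ev S by (auto simp: limitin_componentwise fun_subspace_def elim!: eventually_mono simp del: iter_deriv.simps)
      from limitin_closedin[OF this cl ev] have "?D (Suc k) x y \<in> S" by simp
      then show ?thesis
        using comp ev by (simp add: has_dir_deriv_def limitin_fun_tvs[OF S] del: iter_deriv.simps)
    qed
    show "\<exists>h'. (h' = ?D (Suc k) \<and> (\<forall>x\<in>U. \<forall>y. (\<forall>i<Suc k. y i \<in> vcarrier E) \<longrightarrow> h' x y \<in> S)) \<and>
        (\<forall>x\<in>U. \<forall>y. (\<forall>i<Suc k. y i \<in> vcarrier E) \<longrightarrow> has_dir_deriv E (fun_tvs F S) (\<lambda>x'. h x' y) x (y k) (h' x y))"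
      by (rule exI[of _ "?D (Suc k)"]) (use main in blast)
  qed
qed

section \<open>First derivatives of composites; analytic maps over either scalar field\<close>

section \<open>Chain rule and analytic maps\<close>

lemma dir_deriv_iter_deriv: "dir_deriv E F f x y = iter_deriv E F f (Suc 0) x (\<lambda>_. y)"
  by simp

lemma smooth_on_has_dir_deriv:
  assumes "lcs F" "smooth_on E F U f" "x \<in> U" "y \<in> vcarrier E"
  shows "has_dir_deriv E F f x y (dir_deriv E F f x y)"
  using smooth_on_deriv[OF assms(1-3), of 0 "\<lambda>_. y"] assms(4) by simp

lemma dir_deriv_carrier:
  assumes "smooth_on E F U f" "x \<in> U" "y \<in> vcarrier E"
  shows "dir_deriv E F f x y \<in> vcarrier F"
  using iter_deriv_carrier[OF assms(1,2), of "Suc 0" "\<lambda>_. y"] assms(3) by simp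

text \<open>The difference quotient of f is itself taken as the varying direction in the strict
  derivative of g, so a single directional derivative of f is enough.\<close>

lemma has_dir_deriv_compose:
  assumes E: "lcs E" and F: "lcs F" and G: "lcs G"
    and f: "has_dir_deriv E F f x y z" "openin (vtop E) U" "x \<in> U" "y \<in> vcarrier E" "f \<in> U \<rightarrow> vcarrier F"
    and g: "smooth_on F G V g" "f x \<in> V"
  shows "has_dir_deriv E G (\<lambda>x. g (f x)) x y (dir_deriv F G g (f x) z)"
proof -
  interpret F: locally_convex_space F by fact
  have xc: "x \<in> vcarrier E" using openin_subset[OF f(2)] f(3) by blast
  have fc: "f x \<in> vcarrier F" using f by auto
  have "limitin (vtop G) (\<lambda>t. smul G (inverse t) (iter_deriv F G g 0 (f x + smul F t (smul F (inverse t) (f (x + smul E t y) - f x))) (\<lambda>_. 0) -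
      iter_deriv F G g 0 (f x) (\<lambda>_. 0)))
      (iter_deriv F G g (Suc 0) (f x) ((\<lambda>_. 0)(0 := z))) (at 0)"
    by (rule smooth_on_strict[OF F G g(1) _ g(2), where \<tau> = "\<lambda>t. t"])
       (use f(1) fc in \<open>auto simp: has_dir_deriv_def eventually_at_filter intro: tendsto_ident_at\<close>)
  then have "limitin (vtop G) (\<lambda>t. smul G (inverse t) (g (f x + smul F t (smul F (inverse t) (f (x + smul E t y) - f x))) - g (f x)))
      (dir_deriv F G g (f x) z) (at 0)"
    by simp
  then show ?thesis
    unfolding has_dir_deriv_def
  proof (rule limitin_transform_eventually[rotated])
    have "eventually (\<lambda>t. x + smul E t y \<in> U) (at 0)"
      by (rule limitin_in_openin[OF limitin_line[OF E xc f(4)] f(2,3)])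
    moreover have "eventually (\<lambda>t::'a. t \<noteq> 0) (at 0)" by (simp add: eventually_at_filter)
    ultimately show "eventually (\<lambda>t. smul G (inverse t) (g (f x + smul F t (smul F (inverse t) (f (x + smul E t y) - f x))) - g (f x)) =
        smul G (inverse t) (g (f (x + smul E t y)) - g (f x))) (at 0)"
    proof eventually_elim
      case (elim t)
      have "f (x + smul E t y) - f x \<in> vcarrier F"
        using elim f(5) fc by (intro F.diff_closed) auto
      then show ?case using elim by (simp add: F.smul_cancel_inverse)
    qed
  qed
qed

lemma dir_deriv_compose:
  assumes E: "lcs E" and F: "lcs F" and G: "lcs G"
    and f: "smooth_on E F U f" and g: "smooth_on F G V g" and x: "x \<in> U" "f x \<in> V" and y: "y \<in> vcarrier E"
  shows "dir_deriv E G (\<lambda>x. g (f x)) x y = dir_deriv F G g (f x) (dir_deriv E F f x y)"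
  by (intro dir_deriv_eqI[OF G] has_dir_deriv_compose[OF E F G smooth_on_has_dir_deriv[OF F f x(1) y]
        smooth_on_openin[OF f] x(1) y _ g x(2)])
     (use smooth_on_carrier[OF f] in auto)

lemma dir_deriv_cong:
  assumes "lcs E" "openin (vtop E) U" "x \<in> U" "y \<in> vcarrier E" "\<And>x'. x' \<in> U \<Longrightarrow> f x' = g x'"
  shows "dir_deriv E F f x y = dir_deriv E F g x y"
  using iter_deriv_local[OF assms(1,2,5,3), where k = "Suc 0" and y = "\<lambda>_. y"] assms(4) by simp

lemma dir_deriv_linear:
  assumes E: "lcs E" and F: "lcs F" and L: "continuous_linear E F L"
    and x: "x \<in> vcarrier E" and y: "y \<in> vcarrier E"
  shows "dir_deriv E F L x y = L y"
proof (rule dir_deriv_eqI[OF F])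
  interpret E: locally_convex_space E by fact
  interpret F: locally_convex_space F by fact
  note c = continuous_linear_carrier[OF L]
  show "has_dir_deriv E F L x y (L y)"
    unfolding has_dir_deriv_def
  proof (rule limitin_eventually)
    have "L (x + smul E t y) - L x = smul F t (L y)" for t
      using L x y by (simp add: continuous_linear_def E.smul_closed)
    then show "eventually (\<lambda>t. smul F (inverse t) (L (x + smul E t y) - L x) = L y) (at 0)"
      using c y by (auto simp: eventually_at_filter F.smul_inverse_cancel)
  qed (use c y in simp)
qed

lemma continuous_linear_dir_deriv:
  assumes E: "lcs E" and F: "lcs F" and f: "smooth_on E F U f" and x: "x \<in> U"
  shows "continuous_linear E F (dir_deriv E F f x)"
  unfolding continuous_linear_def
proof (intro conjI ballI allI)
  have "continuous_map (vtop E) (vtop F) (\<lambda>y. iter_deriv E F f (Suc 0) x (\<lambda>_. y))"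
    by (rule smooth_on_continuous_map[OF f]) (use x smooth_on_domain[OF f x] in \<open>auto simp: continuous_map_id'\<close>)
  then show "continuous_map (vtop E) (vtop F) (dir_deriv E F f x)" by simp
  show "dir_deriv E F f x (y + z) = dir_deriv E F f x y + dir_deriv E F f x z" if "y \<in> vcarrier E" "z \<in> vcarrier E" for y z
    using iter_deriv_additive[OF E F f that, of 0 "Suc 0" x "\<lambda>_. y"] x that by simp
  show "dir_deriv E F f x (smul E a y) = smul F a (dir_deriv E F f x y)" if "y \<in> vcarrier E" for a y
    using iter_deriv_homogeneous[OF E F f that, of 0 "Suc 0" x "\<lambda>_. y"] x that by simp
qed

lemma has_curve_deriv_unique:
  assumes "lcs E" "at t within I \<noteq> bot" "has_curve_deriv E I \<gamma> t v" "has_curve_deriv E I \<gamma> t w"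
  shows "v = w"
  using locally_convex_space.limitin_unique[OF assms(1)] assms(2-4) unfolding has_curve_deriv_def by metis

text \<open>As for directional derivatives, with the real step s - t pushed into the scalar field;
  since I may contain end points, one-sided derivatives are covered.\<close>

lemma has_curve_deriv_compose:
  assumes E: "lcs E" and F: "lcs F"
    and f: "smooth_on E F U f" and \<gamma>: "has_curve_deriv E I \<gamma> t v" "\<And>s. s \<in> I \<Longrightarrow> \<gamma> s \<in> vcarrier E" "t \<in> I" "\<gamma> t \<in> U"
  shows "has_curve_deriv F I (\<lambda>s. f (\<gamma> s)) t (dir_deriv E F f (\<gamma> t) v)"
proof -
  interpret E: locally_convex_space E by fact
  let ?q = "\<lambda>s. smul E (of_real (inverse (s - t))) (\<gamma> s - \<gamma> t)"
  have "((\<lambda>s. of_real (s - t) :: 'a) \<longlongrightarrow> of_real (t - t)) (at t within I)"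
    by (intro tendsto_intros)
  then have \<tau>: "((\<lambda>s. of_real (s - t) :: 'a) \<longlongrightarrow> 0) (at t within I)"
    by simp
  have "limitin (vtop F) (\<lambda>s. smul F (inverse (of_real (s - t))) (iter_deriv E F f 0 (\<gamma> t + smul E (of_real (s - t)) (?q s)) (\<lambda>_. 0) -
      iter_deriv E F f 0 (\<gamma> t) (\<lambda>_. 0)))
      (iter_deriv E F f (Suc 0) (\<gamma> t) ((\<lambda>_. 0)(0 := v))) (at t within I)"
    by (rule smooth_on_strict[OF E F f _ \<gamma>(4)])
       (use \<gamma> \<tau> in \<open>auto simp: has_curve_deriv_def eventually_at_filter\<close>)
  then have "limitin (vtop F) (\<lambda>s. smul F (inverse (of_real (s - t))) (f (\<gamma> t + smul E (of_real (s - t)) (?q s)) - f (\<gamma> t)))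
      (dir_deriv E F f (\<gamma> t) v) (at t within I)"
    by simp
  then show ?thesis
    unfolding has_curve_deriv_def
  proof (rule limitin_transform_eventually[rotated])
    show "eventually (\<lambda>s. smul F (inverse (of_real (s - t))) (f (\<gamma> t + smul E (of_real (s - t)) (?q s)) - f (\<gamma> t)) =
        smul F (of_real (inverse (s - t))) (f (\<gamma> s) - f (\<gamma> t))) (at t within I)"
      unfolding eventually_at_filter
    proof (intro always_eventually allI impI)
      fix s assume s: "s \<noteq> t" "s \<in> I"
      have "(of_real (s - t) :: 'a) \<noteq> 0" using s by (simp only: of_real_eq_0_iff)
      then have "smul E (of_real (s - t)) (?q s) = \<gamma> s - \<gamma> t"
        unfolding of_real_inverse using \<gamma> s by (intro E.smul_cancel_inverse E.diff_closed) auto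
      then show "smul F (inverse (of_real (s - t))) (f (\<gamma> t + smul E (of_real (s - t)) (?q s)) - f (\<gamma> t)) =
        smul F (of_real (inverse (s - t))) (f (\<gamma> s) - f (\<gamma> t))"
        unfolding of_real_inverse by simp
    qed
  qed
qed

lemma continuous_linear_complexification:
  assumes E: "lcs E" and L: "continuous_linear E F L"
  shows "continuous_linear (complexification E) (complexification F) (\<lambda>p. (L (fst p), L (snd p)))"
proof -
  interpret E: locally_convex_space E by fact
  have c: "continuous_map X (vtop F) (\<lambda>x. L (f x))" if "continuous_map X (vtop E) f" for X :: "'x topology" and f
    using continuous_map_compose[OF that, of "vtop F" L] L by (simp add: continuous_linear_def o_def)
  show ?thesis
    unfolding continuous_linear_def
  proof (intro conjI ballI allI)
    show "continuous_map (vtop (complexification E)) (vtop (complexification F)) (\<lambda>p. (L (fst p), L (snd p)))"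
      by (simp add: continuous_map_pairedI c continuous_map_fst continuous_map_snd)
  qed (use L in \<open>auto simp: continuous_linear_def continuous_linear_diff[OF E L] E.smul_closed\<close>)
qed

text \<open>Identifies pairs of points of two complexifications with points of the complexification
  of the product; the same formula serves in both directions.\<close>

definition swap_parts :: "('a \<times> 'b) \<times> ('c \<times> 'd) \<Rightarrow> ('a \<times> 'c) \<times> ('b \<times> 'd)" where
  "swap_parts p = ((fst (fst p), fst (snd p)), (snd (fst p), snd (snd p)))"

lemma swap_parts_simp [simp]: "swap_parts ((a, b), (c, d)) = ((a, c), (b, d))"
  by (simp add: swap_parts_def)

lemma continuous_linear_swap_parts:
  "continuous_linear (prod_tvs (complexification F) (complexification G)) (complexification (prod_tvs F G)) swap_parts"
  "continuous_linear (complexification (prod_tvs F G)) (prod_tvs (complexification F) (complexification G)) swap_parts"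
proof -
  have "continuous_map (prod_topology (prod_topology S T) (prod_topology S' T'))
      (prod_topology (prod_topology S S') (prod_topology T T')) swap_parts" for S T S' T'
    unfolding swap_parts_def[abs_def]
    by (intro continuous_map_pairedI continuous_map_fst_comp[OF continuous_map_fst] continuous_map_fst_comp[OF continuous_map_snd]
        continuous_map_snd_comp[OF continuous_map_fst] continuous_map_snd_comp[OF continuous_map_snd])
  then show "continuous_linear (prod_tvs (complexification F) (complexification G)) (complexification (prod_tvs F G)) swap_parts"
    "continuous_linear (complexification (prod_tvs F G)) (prod_tvs (complexification F) (complexification G)) swap_parts"
    by (auto simp: continuous_linear_def)
qed

lemma continuous_bilinear_complexification:
  assumes E: "lcs E" and F: "lcs F" and G: "lcs G"
    and b: "continuous_bilinear E F G b"
  shows "continuous_bilinear (complexification E) (complexification F) (complexification G)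
    (\<lambda>x y. (b (fst x) (fst y) - b (snd x) (snd y), b (fst x) (snd y) + b (snd x) (fst y)))"
proof -
  interpret E: locally_convex_space E by fact
  interpret F: locally_convex_space F by fact
  interpret G: locally_convex_space G by fact
  note bD = continuous_bilinearD[OF b]
  have bdl: "b (x - x') y = b x y - b x' y" if "x \<in> vcarrier E" "x' \<in> vcarrier E" "y \<in> vcarrier F" for x x' y
    using bD(3)[of "x - x'" x' y] that by (simp add: E.diff_closed)
  have bdr: "b x (y - y') = b x y - b x y'" if "x \<in> vcarrier E" "y \<in> vcarrier F" "y' \<in> vcarrier F" for x y y'
    using bD(4)[of x "y - y'" y'] that by (simp add: F.diff_closed)
  have c: "continuous_map X (vtop G) (\<lambda>x. b (f x) (g x))"
    if "continuous_map X (vtop E) f" "continuous_map X (vtop F) g" for X :: "'x topology" and f g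
    using continuous_map_compose[OF continuous_map_pairedI[OF that] bD(1)] by (simp add: o_def)
  show ?thesis
    unfolding continuous_bilinear_def
  proof (intro conjI ballI allI)
    show "continuous_map (prod_topology (vtop (complexification E)) (vtop (complexification F))) (vtop (complexification G))
       (\<lambda>p. (b (fst (fst p)) (fst (snd p)) - b (snd (fst p)) (snd (snd p)),
             b (fst (fst p)) (snd (snd p)) + b (snd (fst p)) (fst (snd p))))"
      unfolding vtop_complexification
      by (intro continuous_map_pairedI G.continuous_map_add' G.continuous_map_diff' c
          continuous_map_fst_comp[OF continuous_map_fst] continuous_map_fst_comp[OF continuous_map_snd]
          continuous_map_snd_comp[OF continuous_map_fst] continuous_map_snd_comp[OF continuous_map_snd])
  qed (auto simp: bD bdl bdr E.smul_closed F.smul_closed G.smul_add_right G.smul_diff_right algebra_simps)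
qed

lemma analytic_map_on_openin: "analytic_map_on E F U f \<Longrightarrow> openin (vtop E) U"
  by (auto simp: analytic_map_on_def Cr_on_def split: if_splits)

lemma analytic_map_on_funcset: "analytic_map_on E F U f \<Longrightarrow> f \<in> U \<rightarrow> vcarrier F"
  by (auto simp: analytic_map_on_def Cr_on_def split: if_splits)

text \<open>The scalar type is abstract and the meaning of analyticity depends on whether
  \<open>of_real\<close> is onto; the closure properties below split on this, and this rule and the
  next handle the real case.\<close>

lemma analytic_map_onI_real:
  fixes E :: "('k::real_or_complex, 'v::ab_group_add) tvs"
  assumes "range (of_real :: real \<Rightarrow> 'k) = UNIV" "openin (vtop E) U" "f \<in> U \<rightarrow> vcarrier F"
    "smooth_on (complexification E) (complexification F) W g" "\<And>x. x \<in> U \<Longrightarrow> (x, 0) \<in> W \<and> g (x, 0) = (f x, 0)"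
  shows "analytic_map_on E F U f"
  unfolding analytic_map_on_def if_P[OF assms(1)] by (intro conjI exI[of _ W] exI[of _ g]) (use assms in auto)

lemma analytic_map_onD_real:
  fixes E :: "('k::real_or_complex, 'v::ab_group_add) tvs"
  assumes "range (of_real :: real \<Rightarrow> 'k) = UNIV" "analytic_map_on E F U f"
  obtains W g where "smooth_on (complexification E) (complexification F) W g"
    "\<And>x. x \<in> U \<Longrightarrow> (x, 0) \<in> W" "\<And>x. x \<in> U \<Longrightarrow> g (x, 0) = (f x, 0)"
  using assms(2) unfolding analytic_map_on_def if_P[OF assms(1)] by meson

lemma analytic_map_on_complex:
  fixes E :: "('k::real_or_complex, 'v::ab_group_add) tvs"
  assumes "range (of_real :: real \<Rightarrow> 'k) \<noteq> UNIV"
  shows "analytic_map_on E F U f \<longleftrightarrow> smooth_on E F U f"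
  unfolding analytic_map_on_def using assms by simp

lemma analytic_map_on_compose:
  fixes E :: "('k::real_or_complex, 'v::ab_group_add) tvs"
  assumes E: "lcs E" and F: "lcs F" and G: "lcs G"
    and f: "analytic_map_on E F U f" and g: "analytic_map_on F G V g" and UV: "f ` U \<subseteq> V"
  shows "analytic_map_on E G U (\<lambda>x. g (f x))"
proof (cases "range (of_real :: real \<Rightarrow> 'k) = UNIV")
  case True
  let ?E = "complexification E" and ?F = "complexification F" and ?G = "complexification G"
  obtain W f' where f': "smooth_on ?E ?F W f'" "\<And>x. x \<in> U \<Longrightarrow> (x, 0) \<in> W" "\<And>x. x \<in> U \<Longrightarrow> f' (x, 0) = (f x, 0)"
    using analytic_map_onD_real[OF True f] by metis
  obtain W' g' where g': "smooth_on ?F ?G W' g'" "\<And>x. x \<in> V \<Longrightarrow> (x, 0) \<in> W'" "\<And>x. x \<in> V \<Longrightarrow> g' (x, 0) = (g x, 0)"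
    using analytic_map_onD_real[OF True g] by metis
  \<comment> \<open>The extension of g lives on W' only, so the extension of f is restricted to the
    preimage of W', which is open and contains the points \<open>(x, 0)\<close> with x in U.\<close>
  define X where "X = {w \<in> topspace (subtopology (vtop ?E) W). f' w \<in> W'}"
  have "openin (subtopology (vtop ?E) W) X"
    unfolding X_def by (rule openin_continuous_map_preimage[OF smooth_on_continuous[OF f'(1)] smooth_on_openin[OF g'(1)]])
  then have X: "openin (vtop ?E) X"
    using openin_trans_full smooth_on_openin[OF f'(1)] by blast
  have XW: "X \<subseteq> W" by (auto simp: X_def)
  note EC = lcs_complexification[OF E] and FC = lcs_complexification[OF F]
    and GC = lcs_complexification[OF G]
  show ?thesis
  proof (rule analytic_map_onI_real[OF True])
    show "smooth_on ?E ?G X (\<lambda>w. g' (f' w))"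
      by (rule smooth_on_compose[OF EC FC GC smooth_on_subset[OF FC f'(1) X XW] g'(1)]) (auto simp: X_def)
    show "(x, 0) \<in> X \<and> g' (f' (x, 0)) = (g (f x), 0)" if "x \<in> U" for x
    proof -
      have "f x \<in> V" using UV that by auto
      moreover have "(x, 0) \<in> topspace (vtop ?E)" using smooth_on_domain[OF f'(1) f'(2)[OF that]] .
      ultimately show ?thesis using f'(2,3)[OF that] g'(2,3) by (simp add: X_def)
    qed
    show "openin (vtop E) U" by (rule analytic_map_on_openin[OF f])
    show "(\<lambda>x. g (f x)) \<in> U \<rightarrow> vcarrier G"
      using analytic_map_on_funcset[OF g] UV by auto
  qed
next
  case False
  then show ?thesis
    using smooth_on_compose[OF E F G _ _ UV] f g by (simp add: analytic_map_on_complex)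
qed

lemma analytic_map_on_subset:
  fixes E :: "('k::real_or_complex, 'v::ab_group_add) tvs"
  assumes F: "lcs F" and f: "analytic_map_on E F U f" and V: "openin (vtop E) V" "V \<subseteq> U"
  shows "analytic_map_on E F V f"
proof (cases "range (of_real :: real \<Rightarrow> 'k) = UNIV")
  case True
  obtain W f' where f': "smooth_on (complexification E) (complexification F) W f'"
    "\<And>x. x \<in> U \<Longrightarrow> (x, 0) \<in> W" "\<And>x. x \<in> U \<Longrightarrow> f' (x, 0) = (f x, 0)"
    using analytic_map_onD_real[OF True f] by metis
  show ?thesis
    by (rule analytic_map_onI_real[OF True V(1) _ f'(1)]) (use analytic_map_on_funcset[OF f] V(2) f' in auto)
next
  case False
  then show ?thesis using smooth_on_subset[OF F _ V] f by (simp add: analytic_map_on_complex)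
qed

lemma analytic_map_on_cong:
  fixes E :: "('k::real_or_complex, 'v::ab_group_add) tvs"
  assumes E: "lcs E" and F: "lcs F"
    and f: "analytic_map_on E F U f" and eq: "\<And>x. x \<in> U \<Longrightarrow> f x = g x"
  shows "analytic_map_on E F U g"
proof (cases "range (of_real :: real \<Rightarrow> 'k) = UNIV")
  case True
  obtain W f' where f': "smooth_on (complexification E) (complexification F) W f'"
    "\<And>x. x \<in> U \<Longrightarrow> (x, 0) \<in> W" "\<And>x. x \<in> U \<Longrightarrow> f' (x, 0) = (f x, 0)"
    using analytic_map_onD_real[OF True f] by metis
  show ?thesis
    by (rule analytic_map_onI_real[OF True analytic_map_on_openin[OF f] _ f'(1)])
       (use analytic_map_on_funcset[OF f] f' in \<open>auto simp flip: eq\<close>)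
next
  case False
  then show ?thesis using smooth_on_cong[OF E F] f eq by (simp add: analytic_map_on_complex)
qed

lemma analytic_map_on_linear:
  fixes E :: "('k::real_or_complex, 'v::ab_group_add) tvs"
  assumes E: "lcs E" and F: "lcs F"
    and L: "continuous_linear E F L" and U: "openin (vtop E) U"
  shows "analytic_map_on E F U L"
proof (cases "range (of_real :: real \<Rightarrow> 'k) = UNIV")
  case True
  show ?thesis
  proof (rule analytic_map_onI_real[OF True U])
    show "smooth_on (complexification E) (complexification F) (vcarrier (complexification E)) (\<lambda>p. (L (fst p), L (snd p)))"
      by (intro smooth_on_linear lcs_complexification E F continuous_linear_complexification[OF E L] openin_topspace)
  qed (use openin_subset[OF U] continuous_linear_carrier[OF L] locally_convex_space.zero_closed[OF E]
      continuous_linear_zero[OF E L] in auto)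
next
  case False
  then show ?thesis using smooth_on_linear[OF E F L U] by (simp add: analytic_map_on_complex)
qed

lemma analytic_map_on_pair:
  fixes E :: "('k::real_or_complex, 'v::ab_group_add) tvs"
  assumes E: "lcs E" and F: "lcs F" and G: "lcs G"
    and f: "analytic_map_on E F U f" and g: "analytic_map_on E G U g"
  shows "analytic_map_on E (prod_tvs F G) U (\<lambda>x. (f x, g x))"
proof (cases "range (of_real :: real \<Rightarrow> 'k) = UNIV")
  case True
  let ?E = "complexification E" and ?F = "complexification F" and ?G = "complexification G"
  obtain W f' where f': "smooth_on ?E ?F W f'" "\<And>x. x \<in> U \<Longrightarrow> (x, 0) \<in> W" "\<And>x. x \<in> U \<Longrightarrow> f' (x, 0) = (f x, 0)"
    using analytic_map_onD_real[OF True f] by metis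
  obtain W' g' where g': "smooth_on ?E ?G W' g'" "\<And>x. x \<in> U \<Longrightarrow> (x, 0) \<in> W'" "\<And>x. x \<in> U \<Longrightarrow> g' (x, 0) = (g x, 0)"
    using analytic_map_onD_real[OF True g] by metis
  note EC = lcs_complexification[OF E] and FC = lcs_complexification[OF F]
    and GC = lcs_complexification[OF G]
  have op: "openin (vtop ?E) (W \<inter> W')"
    by (intro openin_Int smooth_on_openin[OF f'(1)] smooth_on_openin[OF g'(1)])
  have sm: "smooth_on ?E (complexification (prod_tvs F G)) (W \<inter> W') (\<lambda>w. swap_parts (f' w, g' w))"
    by (rule smooth_on_compose_linear[OF EC lcs_prod[OF FC GC] lcs_complexification[OF lcs_prod[OF F G]]
        smooth_on_pair[OF EC FC GC] continuous_linear_swap_parts(1)])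
       (auto intro: smooth_on_subset[OF FC f'(1) op] smooth_on_subset[OF GC g'(1) op])
  show ?thesis
    by (rule analytic_map_onI_real[OF True analytic_map_on_openin[OF f] _ sm])
       (use f'(2,3) g'(2,3) analytic_map_on_funcset[OF f] analytic_map_on_funcset[OF g] in \<open>auto simp: zero_prod_def\<close>)
next
  case False
  then show ?thesis using smooth_on_pair[OF E F G] f g by (simp add: analytic_map_on_complex)
qed

lemma analytic_map_on_bilinear:
  fixes E :: "('k::real_or_complex, 'v::ab_group_add) tvs"
  assumes E: "lcs E" and F: "lcs F" and G: "lcs G"
    and b: "continuous_bilinear E F G b" and U: "openin (vtop (prod_tvs E F)) U"
  shows "analytic_map_on (prod_tvs E F) G U (\<lambda>p. b (fst p) (snd p))"
proof (cases "range (of_real :: real \<Rightarrow> 'k) = UNIV")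
  case True
  interpret E: locally_convex_space E by fact
  interpret F: locally_convex_space F by fact
  let ?E = "complexification E" and ?F = "complexification F" and ?G = "complexification G" and ?P = "complexification (prod_tvs E F)"
  note EC = lcs_complexification[OF E] and FC = lcs_complexification[OF F]
    and GC = lcs_complexification[OF G]
  note bC = continuous_bilinear_complexification[OF E F G b]
  have PC: "lcs ?P" by (intro lcs_complexification lcs_prod E F)
  let ?b = "\<lambda>x y. (b (fst x) (fst y) - b (snd x) (snd y), b (fst x) (snd y) + b (snd x) (fst y))"
  have sm: "smooth_on ?P ?G (vcarrier ?P) (\<lambda>p. ?b (fst (swap_parts p)) (snd (swap_parts p)))"
    by (rule smooth_on_compose[OF PC lcs_prod[OF EC FC] GC
          smooth_on_linear[OF PC lcs_prod[OF EC FC] continuous_linear_swap_parts(2) openin_topspace]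
          smooth_on_bilinear[OF EC FC GC bC openin_topspace]]) auto
  show ?thesis
  proof (rule analytic_map_onI_real[OF True U _ sm])
    have b0: "b x 0 = 0" if "x \<in> vcarrier E" for x
      using continuous_bilinearD(4)[OF b that F.zero_closed F.zero_closed] by simp
    have b0': "b 0 y = 0" if "y \<in> vcarrier F" for y
      using continuous_bilinearD(3)[OF b E.zero_closed E.zero_closed that] by simp
    show "(x, 0) \<in> vcarrier ?P \<and> ?b (fst (swap_parts (x, 0))) (snd (swap_parts (x, 0))) = (b (fst x) (snd x), 0)" if "x \<in> U" for x
      using that openin_subset[OF U] by (auto simp: swap_parts_def b0 b0' E.zero_closed F.zero_closed zero_prod_def)
  qed (use openin_subset[OF U] continuous_bilinearD(2)[OF b] in auto)
next
  case False
  then show ?thesis using smooth_on_bilinear[OF E F G b U] by (simp add: analytic_map_on_complex)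
qed

lemma analytic_map_on_compose_linear:
  assumes E: "lcs E" and F: "lcs F" and G: "lcs G"
    and f: "analytic_map_on E F U f" and L: "continuous_linear F G L"
  shows "analytic_map_on E G U (\<lambda>x. L (f x))"
  by (rule analytic_map_on_compose[OF E F G f analytic_map_on_linear[OF F G L openin_topspace]])
     (use analytic_map_on_funcset[OF f] in auto)

text \<open>Over the reals, the first components of the derivatives of the complex extension at
  \<open>(x, 0)\<close> in the directions \<open>(y i, 0)\<close> are derivatives of f, since a real
  step is a special complex step.\<close>

lemma analytic_map_on_imp_smooth:
  fixes E :: "('k::real_or_complex, 'v::ab_group_add) tvs" and F :: "('k, 'w::ab_group_add) tvs"
  assumes E: "lcs E" and F: "lcs F" and f: "analytic_map_on E F U f"
  shows "smooth_on E F U f"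
proof (cases "range (of_real :: real \<Rightarrow> 'k) = UNIV")
  case True
  interpret E: locally_convex_space E by fact
  interpret F: locally_convex_space F by fact
  let ?E = "complexification E" and ?F = "complexification F"
  note EC = lcs_complexification[OF E] and FC = lcs_complexification[OF F]
  interpret FC: locally_convex_space ?F by (rule FC)
  obtain W g where g: "smooth_on ?E ?F W g" "\<And>x. x \<in> U \<Longrightarrow> (x, 0) \<in> W" "\<And>x. x \<in> U \<Longrightarrow> g (x, 0) = (f x, 0)"
    using analytic_map_onD_real[OF True f] by metis
  note U = analytic_map_on_openin[OF f]
  \<comment> \<open>All that is known of the scalars is that \<open>of_real\<close> is onto;
    \<open>re\<close> reads a scalar as a real number and carries punctured neighbourhoods of 0 to
    those of the complex 0.\<close>
  define re where "re = inv_into UNIV (of_real :: real \<Rightarrow> 'k)"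
  have re: "of_real (re t) = t" for t
    unfolding re_def by (rule f_inv_into_f) (use True in simp)
  have re_norm: "norm (complex_of_real (re t)) = norm t" for t
    using re[of t] norm_of_real[of "re t", where 'a = 'k] by simp
  have fl: "filterlim (\<lambda>t. complex_of_real (re t)) (at 0) (at 0)"
    unfolding filterlim_at
  proof
    have "((\<lambda>t. norm (complex_of_real (re t))) \<longlongrightarrow> 0) (at 0)"
      unfolding re_norm by (rule tendsto_norm_zero) (rule tendsto_ident_at)
    then show "((\<lambda>t. complex_of_real (re t)) \<longlongrightarrow> 0) (at 0)" by (rule tendsto_norm_zero_cancel)
    have "complex_of_real (re t) \<noteq> 0" if "t \<noteq> 0" for t
      using re_norm[of t] that by auto
    then show "eventually (\<lambda>t. complex_of_real (re t) \<in> UNIV \<and> complex_of_real (re t) \<noteq> 0) (at 0)"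
      by (simp add: eventually_at_filter)
  qed
  define D where "D k x y = fst (iter_deriv ?E ?F g k (x, 0) (\<lambda>i. (y i, 0)))" for k x and y :: "nat \<Rightarrow> 'v"
  \<comment> \<open>Outside U nothing relates f to its extension; f0 agrees with f on U and makes
    the candidate of order 0 an identity of functions.\<close>
  define f0 where "f0 x = fst (g (x, 0))" for x
  have "smooth_on E F U f0"
  proof (rule smooth_coinduct[OF E F U, where Q = "\<lambda>k h. h = D k"])
    show "f0 \<in> U \<rightarrow> vcarrier F"
      using g analytic_map_on_funcset[OF f] by (auto simp: f0_def)
    show "(\<lambda>x y. f0 x) = D 0" by (simp add: D_def f0_def fun_eq_iff)
    fix k h assume h: "h = D k"
    have "continuous_map (jet_domain E U k) (vtop ?F)
        (\<lambda>p. iter_deriv ?E ?F g k (fst p, 0) (\<lambda>i. (snd p i, 0)))"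
    proof (rule smooth_on_continuous_map[OF g(1)])
      show "continuous_map (jet_domain E U k) (vtop ?E) (\<lambda>p. (fst p, 0))"
        by (simp add: continuous_map_pairedI E.zero_closed continuous_map_into_fulltopology[OF continuous_map_fst])
      show "(\<lambda>p. (fst p, 0)) \<in> topspace (jet_domain E U k) \<rightarrow> W"
        by (intro funcsetI g(2)) (rule topspace_derivD)
      show "continuous_map (jet_domain E U k) (vtop ?E) (\<lambda>p. (snd p i, 0))"
        if "i < k" for i
      proof -
        have "continuous_map (product_topology (\<lambda>_. vtop E) {..<k}) (vtop E) (\<lambda>y. y i)"
          by (rule continuous_map_product_projection) (simp add: that)
        from continuous_map_compose[OF continuous_map_snd this]
        have "continuous_map (jet_domain E U k) (vtop E) (\<lambda>p. snd p i)"
          by (simp add: o_def)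
        then show ?thesis by (simp add: continuous_map_pairedI E.zero_closed)
      qed
    qed
    then show "continuous_map (jet_domain E U k) (vtop F) (\<lambda>(x, y). h x y)"
      unfolding h D_def case_prod_unfold vtop_complexification by (rule continuous_map_fst_comp)
    have "has_dir_deriv E F (\<lambda>x'. h x' y) x (y k) (D (Suc k) x y)"
      if x: "x \<in> U" and y: "\<forall>i<Suc k. y i \<in> vcarrier E" for x y
    proof -
      let ?y = "\<lambda>i. (y i, 0::'v)"
      have "has_dir_deriv ?E ?F (\<lambda>x'. iter_deriv ?E ?F g k x' ?y) (x, 0) (?y k) (iter_deriv ?E ?F g (Suc k) (x, 0) ?y)"
        by (rule smooth_on_deriv[OF FC g(1) g(2)[OF x]]) (use y E.zero_closed in auto)
      from limitin_compose_filterlim[OF this[unfolded has_dir_deriv_def] fl]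
      have "limitin (vtop F) (\<lambda>t. fst (smul ?F (inverse (complex_of_real (re t)))
          (iter_deriv ?E ?F g k ((x, 0) + smul ?E (complex_of_real (re t)) (?y k)) ?y - iter_deriv ?E ?F g k (x, 0) ?y)))
          (D (Suc k) x y) (at 0)"
        unfolding vtop_complexification limitin_pairwise o_def D_def by simp
      then show ?thesis
        unfolding has_dir_deriv_def
      proof (rule limitin_transform_eventually[rotated])
        have xc: "x \<in> vcarrier E" using x openin_subset[OF U] by blast
        have "eventually (\<lambda>t. x + smul E t (y k) \<in> U) (at 0)"
          by (rule limitin_in_openin[OF limitin_line[OF E xc] U x]) (use y in simp)
        then show "eventually (\<lambda>t. fst (smul ?F (inverse (complex_of_real (re t)))
          (iter_deriv ?E ?F g k ((x, 0) + smul ?E (complex_of_real (re t)) (?y k)) ?y - iter_deriv ?E ?F g k (x, 0) ?y)) =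
            smul F (inverse t) (h (x + smul E t (y k)) y - h x y)) (at 0)"
        proof eventually_elim
          case (elim t)
          have "(x, 0) + smul ?E (complex_of_real (re t)) (?y k) = (x + smul E t (y k), 0)"
            using y by (simp add: re E.smul_zero_right E.smul_zero_left)
          moreover have "iter_deriv ?E ?F g k (x + smul E t (y k), 0) ?y - iter_deriv ?E ?F g k (x, 0) ?y \<in> vcarrier ?F"
            by (intro FC.diff_closed iter_deriv_carrier[OF g(1)] g(2) elim x) (use y E.zero_closed in auto)
          moreover have "of_real (inverse (re t)) = inverse t" by (simp add: re)
          ultimately show ?case
            unfolding h D_def of_real_inverse[symmetric] smul_complexification
            by (auto simp: F.smul_zero_left mem_Times_iff simp flip: fst_diff simp del: of_real_inverse)
        qed
      qed
    qed
    then show "\<exists>h'. h' = D (Suc k) \<and>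
        (\<forall>x\<in>U. \<forall>y. (\<forall>i<Suc k. y i \<in> vcarrier E) \<longrightarrow> has_dir_deriv E F (\<lambda>x'. h x' y) x (y k) (h' x y))"
      by blast
  qed
  then show ?thesis by (rule smooth_on_cong[OF E F]) (simp add: f0_def g)
next
  case False
  then show ?thesis using f by (simp add: analytic_map_on_complex)
qed

section \<open>Sweedler sums, the filtration by degree, and power series under convolution\<close>

section \<open>The convolution algebra\<close>

text \<open>Tensors are functions on spaces of forms; this is their scalar multiplication, with
  respect to which \<open>tensor\<close> and \<open>tensor3\<close> are multilinear.\<close>

definition fun_scale :: "'k::field \<Rightarrow> ('t \<Rightarrow> 'k) \<Rightarrow> 't \<Rightarrow> 'k" where
  "fun_scale c F = (\<lambda>\<tau>. c * F \<tau>)"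

lemma vector_space_fun_scale: "vector_space fun_scale"
  by unfold_locales (simp_all add: fun_scale_def fun_eq_iff algebra_simps)

lemma linear_iff_vector_space:
  assumes "vector_space s" "vector_space s'"
  shows "Vector_Spaces.linear s s' f \<longleftrightarrow> (\<forall>x y. f (x + y) = f x + f y) \<and> (\<forall>c x. f (s c x) = s' c (f x))"
  using assms unfolding Vector_Spaces.linear_def module_hom_def module_hom_axioms_def
  by (auto simp: module_iff_vector_space)

lemma sum_list_apply: "(\<Sum>x\<leftarrow>xs. f x) \<tau> = (\<Sum>x\<leftarrow>xs. f x \<tau>)"
  by (induction xs) auto

lemma sum_list_concat_map: "(\<Sum>x\<leftarrow>xs. \<Sum>y\<leftarrow>f x. g y) = (\<Sum>y\<leftarrow>concat (map f xs). g y)"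
  by (induction xs) auto

lemma sum_list_zero: "(\<And>x. x \<in> set xs \<Longrightarrow> f x = 0) \<Longrightarrow> (\<Sum>x\<leftarrow>xs. f x) = 0"
  by (induction xs) auto

lemma sum_list_sum_swap: "(\<Sum>x\<leftarrow>xs. \<Sum>i\<in>A. f x i) = (\<Sum>i\<in>A. \<Sum>x\<leftarrow>xs. f x i)"
  by (induction xs) (auto simp: sum.distrib)

locale hopf_characters = graded_connected_hopf_algebra scaleH \<Delta> \<epsilon> antipode grade + commutative_locally_convex_algebra B
  for scaleH :: "'k::real_or_complex \<Rightarrow> 'h::ring_1 \<Rightarrow> 'h" and \<Delta> \<epsilon> antipode grade
    and B :: "('k, 'b::{comm_ring, comm_monoid_mult}) tvs"
begin

sublocale LB: locally_convex_space B by (rule lcs)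

sublocale VB: vector_space "smul B"
  by unfold_locales (simp_all add: LB.smul_add_right LB.smul_add_left LB.smul_smul LB.smul_one carrier_UNIV)

sublocale HB: vector_space_pair scaleH "smul B" ..

abbreviation lin :: "('h \<Rightarrow> 'b) \<Rightarrow> bool" where
  "lin \<equiv> Vector_Spaces.linear scaleH (smul B)"

lemmas vs_H = vector_space_axioms
lemmas vs_B = VB.vector_space_axioms

lemma lin_iff: "lin \<phi> \<longleftrightarrow> (\<forall>x y. \<phi> (x + y) = \<phi> x + \<phi> y) \<and> (\<forall>c x. \<phi> (scaleH c x) = smul B c (\<phi> x))"
  by (rule linear_iff_vector_space[OF vs_H vs_B])

lemma mult_smul: "x * smul B c y = smul B c (x * y)"
  using smul_mult[of c y x] by (simp add: mult.commute)

lemma smul_sum_list: "smul B c (\<Sum>x\<leftarrow>xs. f x) = (\<Sum>x\<leftarrow>xs. smul B c (f x))"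
  by (induction xs) (auto simp: VB.scale_right_distrib)

lemma lin_sum_list: "lin \<phi> \<Longrightarrow> \<phi> (\<Sum>x\<leftarrow>xs. f x) = (\<Sum>x\<leftarrow>xs. \<phi> (f x))"
  by (induction xs) (auto simp: HB.linear_0 HB.linear_add)

text \<open>A purely algebraic functional, obtained by extending {b} to a basis. Tensors are tested
  by scalar forms, so identities with values in B are reduced to scalar ones through such
  functionals.\<close>

lemma separating_functional:
  assumes "b \<noteq> 0"
  obtains l where "Vector_Spaces.linear (smul B) (*) l" "l b = (1::'k)"
proof -
  have K: "vector_space ((*) :: 'k \<Rightarrow> 'k \<Rightarrow> 'k)"
    by unfold_locales (simp_all add: algebra_simps)
  interpret p: vector_space_pair "smul B" "(*) :: 'k \<Rightarrow> 'k \<Rightarrow> 'k"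
    by (rule vector_space_pair.intro[OF vs_B K])
  have "VB.independent {b}" using assms by simp
  then obtain l where "Vector_Spaces.linear (smul B) (*) l" "l b = 1"
    using p.linear_independent_extend[of "{b}" "\<lambda>_. 1"] by auto
  then show ?thesis by (rule that)
qed

lemma functional_add: "Vector_Spaces.linear (smul B) ((*) :: 'k \<Rightarrow> _) l \<Longrightarrow> l (x + y) = l x + l y"
  and functional_scale: "Vector_Spaces.linear (smul B) ((*) :: 'k \<Rightarrow> _) l \<Longrightarrow> l (smul B c x) = c * l x"
  and functional_sum_list: "Vector_Spaces.linear (smul B) ((*) :: 'k \<Rightarrow> _) l \<Longrightarrow> l (\<Sum>x\<leftarrow>xs. f x) = (\<Sum>x\<leftarrow>xs. l (f x))"
  and functional_diff: "Vector_Spaces.linear (smul B) ((*) :: 'k \<Rightarrow> _) l \<Longrightarrow> l (x - y) = l x - l y"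
  and functional_sum: "Vector_Spaces.linear (smul B) ((*) :: 'k \<Rightarrow> _) l \<Longrightarrow> l (\<Sum>x\<in>A. f x) = (\<Sum>x\<in>A. l (f x))"
proof -
  assume l: "Vector_Spaces.linear (smul B) ((*) :: 'k \<Rightarrow> _) l"
  have K: "vector_space ((*) :: 'k \<Rightarrow> 'k \<Rightarrow> 'k)"
    by unfold_locales (simp_all add: algebra_simps)
  interpret p: vector_space_pair "smul B" "(*) :: 'k \<Rightarrow> 'k \<Rightarrow> 'k"
    by (rule vector_space_pair.intro[OF vs_B K])
  show "l (x + y) = l x + l y" "l (smul B c x) = c * l x" "l (x - y) = l x - l y" "l (\<Sum>x\<in>A. f x) = (\<Sum>x\<in>A. l (f x))"
    using p.linear_add[OF l] p.linear_scale[OF l] p.linear_diff[OF l] p.linear_sum[OF l] by auto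
  show "l (\<Sum>x\<leftarrow>xs. f x) = (\<Sum>x\<leftarrow>xs. l (f x))"
    by (induction xs) (auto simp: p.linear_0[OF l] p.linear_add[OF l])
qed

subsection \<open>Sweedler sums and convolution\<close>

text \<open>A chosen list of Sweedler summands. The choice need not be additive in x; sums of
  bilinear expressions over it are, by \<open>lift_add\<close> and
  \<open>lift_scale\<close>.\<close>

definition cop :: "'h \<Rightarrow> ('h \<times> 'h) list" where
  "cop x = (SOME xs. \<Delta> x = (\<Sum>(a, b)\<leftarrow>xs. tensor scaleH a b))"

lemma Delta_cop: "\<Delta> x = (\<Sum>(a, b)\<leftarrow>cop x. tensor scaleH a b)"
proof -
  have "\<exists>xs. \<Delta> x = (\<Sum>(a, b)\<leftarrow>xs. tensor scaleH a b)"
    using comult_in[of x] unfolding tensor_sums_def by auto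
  then show ?thesis unfolding cop_def by (rule someI_ex)
qed

lemma bilinear_map_iff:
  assumes "vector_space sX"
  shows "bilinear_map scaleH sX f \<longleftrightarrow>
    (\<forall>x y z. f x (y + z) = f x y + f x z) \<and> (\<forall>x c y. f x (scaleH c y) = sX c (f x y)) \<and>
    (\<forall>x y z. f (x + y) z = f x z + f y z) \<and> (\<forall>x c y. f (scaleH c x) y = sX c (f x y))"
  unfolding bilinear_map_def linear_iff_vector_space[OF vs_H assms] by blast

lemma vs_K: "vector_space ((*) :: 'k \<Rightarrow> 'k \<Rightarrow> 'k)"
  by unfold_locales (simp_all add: algebra_simps)

lemma bilinear_tensor: "bilinear_map scaleH fun_scale (tensor scaleH)"
  unfolding bilinear_map_iff[OF vector_space_fun_scale]
  by (auto simp: tensor_def fun_scale_def fun_eq_iff bilinear_map_iff[OF vs_K])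

lemma trilinear_form_iff: "trilinear_form scaleH f \<longleftrightarrow>
    (\<forall>x x' y z. f (x + x') y z = f x y z + f x' y z) \<and> (\<forall>c x y z. f (scaleH c x) y z = c * f x y z) \<and>
    (\<forall>x y y' z. f x (y + y') z = f x y z + f x y' z) \<and> (\<forall>c x y z. f x (scaleH c y) z = c * f x y z) \<and>
    (\<forall>x y z z'. f x y (z + z') = f x y z + f x y z') \<and> (\<forall>c x y z. f x y (scaleH c z) = c * f x y z)"
  unfolding trilinear_form_def bilinear_map_iff[OF vs_K] linear_iff_vector_space[OF vs_H vs_K] by (safe; simp)

lemma tensor3_linear:
  "tensor3 scaleH (x + x') y z = tensor3 scaleH x y z + tensor3 scaleH x' y z"
  "tensor3 scaleH (scaleH c x) y z = fun_scale c (tensor3 scaleH x y z)"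
  "tensor3 scaleH x (y + y') z = tensor3 scaleH x y z + tensor3 scaleH x y' z"
  "tensor3 scaleH x (scaleH c y) z = fun_scale c (tensor3 scaleH x y z)"
  "tensor3 scaleH x y (z + z') = tensor3 scaleH x y z + tensor3 scaleH x y z'"
  "tensor3 scaleH x y (scaleH c z) = fun_scale c (tensor3 scaleH x y z)"
  by (auto simp: tensor3_def fun_scale_def fun_eq_iff trilinear_form_iff)

lemma lift_cop:
  "bilinear_map scaleH sX f \<Longrightarrow> tensor_lift scaleH f (\<Delta> x) = (\<Sum>(a, b)\<leftarrow>cop x. f a b)"
  by (subst Delta_cop) (rule tensor_lift_sum_list)

lemma lift_list:
  "\<lbrakk>bilinear_map scaleH sX f; \<Delta> x = (\<Sum>(a, b)\<leftarrow>xs. tensor scaleH a b)\<rbrakk> \<Longrightarrow>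
    tensor_lift scaleH f (\<Delta> x) = (\<Sum>(a, b)\<leftarrow>xs. f a b)"
  by (simp add: tensor_lift_sum_list)

lemma lift_add:
  assumes "bilinear_map scaleH sX f"
  shows "tensor_lift scaleH f (\<Delta> (x + y)) = tensor_lift scaleH f (\<Delta> x) + tensor_lift scaleH f (\<Delta> y)"
proof -
  have "\<Delta> (x + y) = (\<Sum>(a, b)\<leftarrow>cop x @ cop y. tensor scaleH a b)"
    unfolding comult_add by (subst (1 2) Delta_cop) simp
  from lift_list[OF assms this] show ?thesis by (simp add: lift_cop[OF assms])
qed

lemma lift_scale:
  assumes sX: "vector_space sX" and f: "bilinear_map scaleH sX f"
  shows "tensor_lift scaleH f (\<Delta> (scaleH c x)) = sX c (tensor_lift scaleH f (\<Delta> x))"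
proof -
  interpret X: vector_space sX by fact
  have "fun_scale c (\<Sum>(a, b)\<leftarrow>xs. tensor scaleH a b) =
      (\<Sum>(a, b)\<leftarrow>map (\<lambda>(a, b). (scaleH c a, b)) xs. tensor scaleH a b)" for xs
  proof
    show "fun_scale c (\<Sum>(a, b)\<leftarrow>xs. tensor scaleH a b) \<tau> =
        (\<Sum>(a, b)\<leftarrow>map (\<lambda>(a, b). (scaleH c a, b)) xs. tensor scaleH a b) \<tau>" for \<tau>
      by (induction xs) (auto simp: fun_scale_def tensor_def bilinear_map_iff[OF vs_K] algebra_simps)
  qed
  then have D: "\<Delta> (scaleH c x) = (\<Sum>(a, b)\<leftarrow>map (\<lambda>(a, b). (scaleH c a, b)) (cop x). tensor scaleH a b)"
    unfolding comult_scale by (subst Delta_cop) (simp add: fun_scale_def)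
  have fs: "f (scaleH c a) b = sX c (f a b)" for a b
    using f unfolding bilinear_map_iff[OF sX] by blast
  have "(\<Sum>(a, b)\<leftarrow>map (\<lambda>(a, b). (scaleH c a, b)) xs. f a b) = sX c (\<Sum>(a, b)\<leftarrow>xs. f a b)" for xs
    by (induction xs) (auto simp: X.scale_right_distrib fs)
  then show ?thesis unfolding lift_cop[OF f, of x] by (rule trans[OF lift_list[OF f D]])
qed

abbreviation conv :: "('h \<Rightarrow> 'b) \<Rightarrow> ('h \<Rightarrow> 'b) \<Rightarrow> 'h \<Rightarrow> 'b" where
  "conv \<equiv> convolution scaleH \<Delta>"

abbreviation cunit :: "'h \<Rightarrow> 'b" where
  "cunit \<equiv> convolution_unit \<epsilon> B"

lemma bilinear_mult: "\<lbrakk>lin \<phi>; lin \<psi>\<rbrakk> \<Longrightarrow> bilinear_map scaleH (smul B) (\<lambda>a b. \<phi> a * \<psi> b)"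
  unfolding bilinear_map_iff[OF vs_B] lin_iff by (auto simp: algebra_simps smul_mult mult_smul)

lemma conv_list:
  "\<lbrakk>lin \<phi>; lin \<psi>; \<Delta> x = (\<Sum>(a, b)\<leftarrow>xs. tensor scaleH a b)\<rbrakk> \<Longrightarrow> conv \<phi> \<psi> x = (\<Sum>(a, b)\<leftarrow>xs. \<phi> a * \<psi> b)"
  unfolding convolution_def by (rule lift_list[OF bilinear_mult])

lemma conv_cop: "\<lbrakk>lin \<phi>; lin \<psi>\<rbrakk> \<Longrightarrow> conv \<phi> \<psi> x = (\<Sum>(a, b)\<leftarrow>cop x. \<phi> a * \<psi> b)"
  by (rule conv_list[OF _ _ Delta_cop])

lemma lin_conv: "\<lbrakk>lin \<phi>; lin \<psi>\<rbrakk> \<Longrightarrow> lin (conv \<phi> \<psi>)"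
  unfolding lin_iff[of "conv \<phi> \<psi>"]
  by (simp add: convolution_def lift_add[OF bilinear_mult] lift_scale[OF vs_B bilinear_mult])

lemma lin_add: "\<lbrakk>lin \<phi>; lin \<psi>\<rbrakk> \<Longrightarrow> lin (\<phi> + \<psi>)"
  and lin_diff: "\<lbrakk>lin \<phi>; lin \<psi>\<rbrakk> \<Longrightarrow> lin (\<phi> - \<psi>)"
  and lin_zero: "lin 0"
  and lin_scale: "lin \<phi> \<Longrightarrow> lin (\<lambda>x. smul B c (\<phi> x))"
  by (auto simp: lin_iff VB.scale_right_distrib VB.scale_right_diff_distrib mult.commute algebra_simps)

lemma epsilon_linear: "\<epsilon> (x + y) = \<epsilon> x + \<epsilon> y" "\<epsilon> (scaleH c x) = c * \<epsilon> x"
  using counit_linear unfolding linear_iff_vector_space[OF vs_H vs_K] by auto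

lemma lin_cunit: "lin cunit"
  by (simp add: lin_iff convolution_unit_def epsilon_linear VB.scale_left_distrib)

lemma conv_add_left: "\<lbrakk>lin \<phi>; lin \<phi>'; lin \<psi>\<rbrakk> \<Longrightarrow> conv (\<phi> + \<phi>') \<psi> = conv \<phi> \<psi> + conv \<phi>' \<psi>"
  and conv_add_right: "\<lbrakk>lin \<psi>; lin \<psi>'; lin \<phi>\<rbrakk> \<Longrightarrow> conv \<phi> (\<psi> + \<psi>') = conv \<phi> \<psi> + conv \<phi> \<psi>'"
  and conv_scale_left: "\<lbrakk>lin \<phi>; lin \<psi>\<rbrakk> \<Longrightarrow> conv (\<lambda>x. smul B c (\<phi> x)) \<psi> = (\<lambda>x. smul B c (conv \<phi> \<psi> x))"
  and conv_scale_right: "\<lbrakk>lin \<phi>; lin \<psi>\<rbrakk> \<Longrightarrow> conv \<phi> (\<lambda>x. smul B c (\<psi> x)) = (\<lambda>x. smul B c (conv \<phi> \<psi> x))"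
  by (auto simp: fun_eq_iff conv_cop lin_add lin_scale case_prod_unfold algebra_simps sum_list_addf smul_sum_list smul_mult mult_smul)

lemma conv_unit_left: assumes \<phi>: "lin \<phi>" shows "conv cunit \<phi> = \<phi>"
proof
  fix x
  have "bilinear_map scaleH scaleH (\<lambda>a b. scaleH (\<epsilon> a) b)"
    unfolding bilinear_map_iff[OF vs_H] by (simp add: epsilon_linear scale_right_distrib scale_left_distrib mult.commute)
  from lift_cop[OF this, of x] have "x = (\<Sum>(a, b)\<leftarrow>cop x. scaleH (\<epsilon> a) b)"
    by (simp add: counit_left)
  then have "\<phi> x = \<phi> (\<Sum>(a, b)\<leftarrow>cop x. scaleH (\<epsilon> a) b)" by simp
  also have "\<dots> = (\<Sum>(a, b)\<leftarrow>cop x. cunit a * \<phi> b)"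
    using \<phi> by (simp add: lin_sum_list case_prod_unfold lin_iff convolution_unit_def smul_mult)
  finally show "conv cunit \<phi> x = \<phi> x" by (simp add: conv_cop lin_cunit \<phi>)
qed

lemma conv_unit_right: assumes \<phi>: "lin \<phi>" shows "conv \<phi> cunit = \<phi>"
proof
  fix x
  have "bilinear_map scaleH scaleH (\<lambda>a b. scaleH (\<epsilon> b) a)"
    unfolding bilinear_map_iff[OF vs_H] by (simp add: epsilon_linear scale_right_distrib scale_left_distrib mult.commute)
  from lift_cop[OF this, of x] have "x = (\<Sum>(a, b)\<leftarrow>cop x. scaleH (\<epsilon> b) a)"
    by (simp add: counit_right)
  then have "\<phi> x = \<phi> (\<Sum>(a, b)\<leftarrow>cop x. scaleH (\<epsilon> b) a)" by simp
  also have "\<dots> = (\<Sum>(a, b)\<leftarrow>cop x. \<phi> a * cunit b)"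
    using \<phi> by (simp add: lin_sum_list case_prod_unfold lin_iff convolution_unit_def mult_smul)
  finally show "conv \<phi> cunit x = \<phi> x" by (simp add: conv_cop lin_cunit \<phi>)
qed

text \<open>Coassociativity is an identity between functions of scalar trilinear forms. Composing
  the map \<open>\<phi> a * \<psi> b * \<omega> c\<close> with a functional yields such a form, so
  no functional can separate the two sides, and they agree.\<close>

lemma conv_assoc:
  assumes \<phi>: "lin \<phi>" and \<psi>: "lin \<psi>" and \<omega>: "lin \<omega>"
  shows "conv (conv \<phi> \<psi>) \<omega> = conv \<phi> (conv \<psi> \<omega>)"
proof
  fix x
  note F = vector_space_fun_scale
  have b1: "bilinear_map scaleH fun_scale (\<lambda>a1 a2. tensor3 scaleH a1 a2 b)" for b
    unfolding bilinear_map_iff[OF F] by (simp add: tensor3_linear)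
  have b2: "bilinear_map scaleH fun_scale (\<lambda>b1 b2. tensor3 scaleH a b1 b2)" for a
    unfolding bilinear_map_iff[OF F] by (simp add: tensor3_linear)
  have add: "(\<Sum>p\<leftarrow>xs. f p + g p) = (\<Sum>p\<leftarrow>xs. f p) + (\<Sum>p\<leftarrow>xs. g p)"
    for xs and f g :: "'h \<times> 'h \<Rightarrow> ('h \<Rightarrow> 'h \<Rightarrow> 'h \<Rightarrow> 'k) \<Rightarrow> 'k"
    by (induction xs) auto
  have scl: "(\<Sum>p\<leftarrow>xs. fun_scale c (f p)) = fun_scale c (\<Sum>p\<leftarrow>xs. f p)"
    for xs c and f :: "'h \<times> 'h \<Rightarrow> ('h \<Rightarrow> 'h \<Rightarrow> 'h \<Rightarrow> 'k) \<Rightarrow> 'k"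
    by (induction xs) (auto simp: fun_scale_def fun_eq_iff algebra_simps)
  have c1: "bilinear_map scaleH fun_scale (\<lambda>a b. tensor_lift scaleH (\<lambda>a1 a2. tensor3 scaleH a1 a2 b) (\<Delta> a))"
    unfolding bilinear_map_iff[OF F] lift_add[OF b1] lift_scale[OF F b1]
    unfolding lift_cop[OF b1] by (simp add: tensor3_linear case_prod_unfold add scl)
  have c2: "bilinear_map scaleH fun_scale (\<lambda>a b. tensor_lift scaleH (\<lambda>b1 b2. tensor3 scaleH a b1 b2) (\<Delta> b))"
    unfolding bilinear_map_iff[OF F] lift_add[OF b2] lift_scale[OF F b2]
    unfolding lift_cop[OF b2] by (simp add: tensor3_linear case_prod_unfold add scl)
  have eq: "(\<Sum>(a, b)\<leftarrow>cop x. \<Sum>(a1, a2)\<leftarrow>cop a. tensor3 scaleH a1 a2 b) =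
      (\<Sum>(a, b)\<leftarrow>cop x. \<Sum>(b1, b2)\<leftarrow>cop b. tensor3 scaleH a b1 b2)"
    using coassoc[of x] unfolding lift_cop[OF c1] lift_cop[OF c2] by (simp only: lift_cop[OF b1] lift_cop[OF b2])
  have l1: "conv (conv \<phi> \<psi>) \<omega> x = (\<Sum>(a, b)\<leftarrow>cop x. \<Sum>(a1, a2)\<leftarrow>cop a. \<phi> a1 * \<psi> a2 * \<omega> b)"
    by (simp add: conv_cop lin_conv \<phi> \<psi> \<omega> case_prod_unfold sum_list_mult_const)
  have r1: "conv \<phi> (conv \<psi> \<omega>) x = (\<Sum>(a, b)\<leftarrow>cop x. \<Sum>(b1, b2)\<leftarrow>cop b. \<phi> a * \<psi> b1 * \<omega> b2)"
    by (simp add: conv_cop lin_conv \<phi> \<psi> \<omega> case_prod_unfold sum_list_const_mult mult.assoc)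
  show "conv (conv \<phi> \<psi>) \<omega> x = conv \<phi> (conv \<psi> \<omega>) x"
  proof (rule ccontr)
    assume "\<not> ?thesis"
    then have "conv (conv \<phi> \<psi>) \<omega> x - conv \<phi> (conv \<psi> \<omega>) x \<noteq> 0" by simp
    then obtain l :: "'b \<Rightarrow> 'k" where l: "Vector_Spaces.linear (smul B) (*) l"
      "l (conv (conv \<phi> \<psi>) \<omega> x - conv \<phi> (conv \<psi> \<omega>) x) = 1"
      by (rule separating_functional)
    define \<tau> where "\<tau> = (\<lambda>a b c. l (\<phi> a * \<psi> b * \<omega> c))"
    have "trilinear_form scaleH \<tau>"
      unfolding trilinear_form_iff \<tau>_def using \<phi> \<psi> \<omega> unfolding lin_iff
      by (simp add: algebra_simps smul_mult mult_smul functional_add[OF l(1)] functional_scale[OF l(1)])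
    then have t3: "tensor3 scaleH a b c \<tau> = l (\<phi> a * \<psi> b * \<omega> c)" for a b c
      by (simp add: tensor3_def \<tau>_def)
    have "l (conv (conv \<phi> \<psi>) \<omega> x) = l (conv \<phi> (conv \<psi> \<omega>) x)"
      using fun_cong[OF eq, of \<tau>]
      by (simp add: l1 r1 sum_list_apply case_prod_unfold t3 functional_sum_list[OF l(1)])
    then show False using l(2) by (simp add: functional_diff[OF l(1)])
  qed
qed

text \<open>Multiplicativity of the coproduct as one explicit list of summands, so that
  \<open>conv_list\<close> evaluates convolutions at products without recourse to the summands
  chosen for the product.\<close>

lemma Delta_mult: "\<Delta> (x * y) = (\<Sum>(a, b)\<leftarrow>concat (map (\<lambda>(a, b). map (\<lambda>(c, d). (a * c, b * d)) (cop y)) (cop x)). tensor scaleH a b)"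
proof -
  note F = vector_space_fun_scale
  note T = bilinear_tensor[unfolded bilinear_map_iff[OF F]]
  have b1: "bilinear_map scaleH fun_scale (\<lambda>c d. tensor scaleH (a * c) (b * d))" for a b
    unfolding bilinear_map_iff[OF F] using T by (simp add: distrib_left scale_mult_right)
  have add: "(\<Sum>p\<leftarrow>xs. f p + g p) = (\<Sum>p\<leftarrow>xs. f p) + (\<Sum>p\<leftarrow>xs. g p)"
    for xs and f g :: "'h \<times> 'h \<Rightarrow> ('h \<Rightarrow> 'h \<Rightarrow> 'k) \<Rightarrow> 'k"
    by (induction xs) auto
  have scl: "(\<Sum>p\<leftarrow>xs. fun_scale c (f p)) = fun_scale c (\<Sum>p\<leftarrow>xs. f p)"
    for xs c and f :: "'h \<times> 'h \<Rightarrow> ('h \<Rightarrow> 'h \<Rightarrow> 'k) \<Rightarrow> 'k"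
    by (induction xs) (auto simp: fun_scale_def fun_eq_iff algebra_simps)
  have c1: "bilinear_map scaleH fun_scale (\<lambda>a b. tensor_lift scaleH (\<lambda>c d. tensor scaleH (a * c) (b * d)) (\<Delta> y))"
    unfolding bilinear_map_iff[OF F] lift_cop[OF b1] using T by (simp add: distrib_right scale_mult_left case_prod_unfold add scl)
  have "\<Delta> (x * y) = (\<Sum>(a, b)\<leftarrow>cop x. \<Sum>(c, d)\<leftarrow>cop y. tensor scaleH (a * c) (b * d))"
    unfolding comult_mult lift_cop[OF c1] by (simp only: lift_cop[OF b1])
  also have "\<dots> = (\<Sum>p\<leftarrow>cop x. \<Sum>q\<leftarrow>map (\<lambda>(c, d). (fst p * c, snd p * d)) (cop y). case q of (a, b) \<Rightarrow> tensor scaleH a b)"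
    by (simp add: case_prod_unfold o_def)
  finally show ?thesis by (simp add: sum_list_concat_map[symmetric] case_prod_unfold o_def)
qed

lemma conv_mult:
  assumes "lin \<phi>" "lin \<psi>"
  shows "conv \<phi> \<psi> (x * y) = (\<Sum>(a, b)\<leftarrow>cop x. \<Sum>(c, d)\<leftarrow>cop y. \<phi> (a * c) * \<psi> (b * d))"
  unfolding conv_list[OF assms Delta_mult]
  by (simp add: sum_list_concat_map[symmetric] case_prod_unfold o_def)

lemma conv_one: "\<lbrakk>lin \<phi>; lin \<psi>\<rbrakk> \<Longrightarrow> conv \<phi> \<psi> 1 = \<phi> 1 * \<psi> 1"
  using conv_list[of \<phi> \<psi> 1 "[(1, 1)]"] by (simp add: comult_one)

text \<open>Commutativity of B exchanges the two middle factors of each summand; this is why the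
  convolution of two characters is again multiplicative.\<close>

lemma conv_product_sum:
  assumes "lin \<phi>" "lin \<psi>" "lin \<phi>'" "lin \<psi>'"
  shows "conv \<phi> \<psi> x * conv \<phi>' \<psi>' y = (\<Sum>(a, b)\<leftarrow>cop x. \<Sum>(c, d)\<leftarrow>cop y. \<phi> a * \<phi>' c * (\<psi> b * \<psi>' d))"
proof -
  have "(\<Sum>p\<leftarrow>xs. f p) * (\<Sum>q\<leftarrow>ys. g q) = (\<Sum>p\<leftarrow>xs. \<Sum>q\<leftarrow>ys. f p * g q)" for xs ys :: "('h \<times> 'h) list" and f g :: "_ \<Rightarrow> 'b"
    by (induction xs) (simp_all add: distrib_right sum_list_const_mult)
  then show ?thesis by (simp add: conv_cop assms case_prod_unfold mult_ac)
qed

subsection \<open>Convolution powers and the grading\<close>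

primrec cpow :: "('h \<Rightarrow> 'b) \<Rightarrow> nat \<Rightarrow> 'h \<Rightarrow> 'b" where
  "cpow \<phi> 0 = cunit"
| "cpow \<phi> (Suc n) = conv \<phi> (cpow \<phi> n)"

lemma lin_cpow: "lin \<phi> \<Longrightarrow> lin (cpow \<phi> n)"
  by (induction n) (auto simp: lin_cunit lin_conv)

lemma cpow_add: "lin \<phi> \<Longrightarrow> conv (cpow \<phi> m) (cpow \<phi> n) = cpow \<phi> (m + n)"
  by (induction m) (auto simp: conv_unit_left lin_cpow conv_assoc)

lemma cpow_one: "lin \<phi> \<Longrightarrow> cpow \<phi> (Suc 0) = \<phi>"
  by (simp add: conv_unit_right)

lemma cpow_scale: "lin \<phi> \<Longrightarrow> cpow (\<lambda>x. smul B c (\<phi> x)) n = (\<lambda>x. smul B (c ^ n) (cpow \<phi> n x))"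
  by (induction n) (auto simp: conv_scale_left conv_scale_right lin_cpow lin_scale)

text \<open>The decreasing filtration of the Hom space dual to the grading; its indices add under
  convolution.\<close>

definition vanishes_below :: "nat \<Rightarrow> ('h \<Rightarrow> 'b) \<Rightarrow> bool" where
  "vanishes_below N \<phi> \<longleftrightarrow> (\<forall>m<N. \<forall>x\<in>grade m. \<phi> x = 0)"

text \<open>Connectedness enters here: degree 0 is a line containing 1, so a linear map with value 0
  at 1 vanishes on all of degree 0 and lies in step one of the filtration.\<close>

lemma grade_zero: assumes "x \<in> grade 0" obtains c where "x = scaleH c 1"
proof -
  obtain b where b: "b \<subseteq> grade 0" "independent b" "grade 0 \<subseteq> span b" "card b = dim (grade 0)"
    using basis_exists[of "grade 0"] by blast
  have "card b = 1" using b(4) grade_connected by simp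
  then obtain v where v: "b = {v}" by (auto simp: card_1_singleton_iff)
  have sp: "\<exists>c. y = scaleH c v" if "y \<in> grade 0" for y
    using b(3) that unfolding v span_singleton by auto
  obtain c where c: "1 = scaleH c v" using sp[OF grade_one] by blast
  obtain d where d: "x = scaleH d v" using sp[OF assms] by blast
  have "c \<noteq> 0" using c by auto
  then have "x = scaleH (d / c) 1" unfolding d c by simp
  then show ?thesis by (rule that)
qed

lemma graded_Delta:
  assumes "x \<in> grade n"
  obtains xs where "\<Delta> x = (\<Sum>(a, b)\<leftarrow>xs. tensor scaleH a b)"
    "\<And>a b. (a, b) \<in> set xs \<Longrightarrow> \<exists>i j. i + j = n \<and> a \<in> grade i \<and> b \<in> grade j"
proof -
  obtain xs where xs: "\<Delta> x = (\<Sum>(a, b)\<leftarrow>xs. tensor scaleH a b)" "set xs \<subseteq> (\<Union>(i, j)\<in>{(i, j). i + j = n}. grade i \<times> grade j)"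
    using grade_comult[OF assms] unfolding tensor_sums_def by blast
  show ?thesis by (rule that[OF xs(1)]) (use xs(2) in blast)
qed

lemma lin_vanish_grade0: "\<lbrakk>lin \<phi>; \<phi> 1 = 0; x \<in> grade 0\<rbrakk> \<Longrightarrow> \<phi> x = 0"
  by (erule grade_zero) (simp add: lin_iff)

lemma vanishes_below_one: "\<lbrakk>lin \<phi>; \<phi> 1 = 0\<rbrakk> \<Longrightarrow> vanishes_below 1 \<phi>"
  by (simp add: vanishes_below_def lin_vanish_grade0)

lemma vanishes_below_conv:
  assumes "lin \<phi>" "lin \<psi>" "vanishes_below M \<phi>" "vanishes_below N \<psi>"
  shows "vanishes_below (M + N) (conv \<phi> \<psi>)"
  unfolding vanishes_below_def
proof (intro allI impI ballI)
  fix m x assume m: "m < M + N" and x: "x \<in> grade m"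
  obtain xs where xs: "\<Delta> x = (\<Sum>(a, b)\<leftarrow>xs. tensor scaleH a b)"
    "\<And>a b. (a, b) \<in> set xs \<Longrightarrow> \<exists>i j. i + j = m \<and> a \<in> grade i \<and> b \<in> grade j"
    by (rule graded_Delta[OF x]) blast
  have "\<phi> a * \<psi> b = 0" if ab: "(a, b) \<in> set xs" for a b
  proof -
    obtain i j where ij: "i + j = m" "a \<in> grade i" "b \<in> grade j" using xs(2)[OF ab] by blast
    then have "i < M \<or> j < N" using m by linarith
    then show ?thesis using assms(3,4) ij unfolding vanishes_below_def by auto
  qed
  then have "(\<Sum>(a, b)\<leftarrow>xs. \<phi> a * \<psi> b) = 0"
    by (intro sum_list_zero) auto
  then show "conv \<phi> \<psi> x = 0" by (simp add: conv_list[OF assms(1,2) xs(1)])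
qed

lemma vanishes_below_cpow: "\<lbrakk>lin \<phi>; \<phi> 1 = 0\<rbrakk> \<Longrightarrow> vanishes_below n (cpow \<phi> n)"
proof (induction n)
  case (Suc n)
  then show ?case using vanishes_below_conv[OF _ lin_cpow vanishes_below_one, of \<phi> \<phi> n n] by simp
qed (simp add: vanishes_below_def)

text \<open>Bounds the degrees occurring in x as far as linear maps to B detect them. In this form
  monotonicity in N is immediate, and homogeneous and arbitrary elements are treated alike.\<close>

definition degree_bound :: "'h \<Rightarrow> nat \<Rightarrow> bool" where
  "degree_bound x N \<longleftrightarrow> (\<forall>\<phi> M. lin \<phi> \<and> vanishes_below M \<phi> \<and> N < M \<longrightarrow> \<phi> x = 0)"

lemma degree_bound_ex: "\<exists>N. degree_bound x N"
proof -
  obtain c where c: "\<And>n. c n \<in> grade n" "finite {n. c n \<noteq> 0}" "x = (\<Sum>n | c n \<noteq> 0. c n)"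
    using grade_direct_sum[of x] by blast
  obtain N where N: "\<And>n. c n \<noteq> 0 \<Longrightarrow> n \<le> N"
    using c(2) finite_nat_set_iff_bounded_le by auto
  have "\<phi> x = 0" if "lin \<phi>" "vanishes_below M \<phi>" "N < M" for \<phi> M
  proof -
    have "\<phi> x = (\<Sum>n | c n \<noteq> 0. \<phi> (c n))"
      by (subst c(3)) (rule HB.linear_sum[OF that(1)])
    also have "\<dots> = 0"
      using that(2,3) N c(1) unfolding vanishes_below_def by (intro sum.neutral) (auto intro: le_less_trans)
    finally show ?thesis .
  qed
  then show ?thesis unfolding degree_bound_def by blast
qed

lemma degree_bound_grade: "x \<in> grade n \<Longrightarrow> degree_bound x n"
  by (auto simp: degree_bound_def vanishes_below_def)

lemma degree_bound_mono: "\<lbrakk>degree_bound x N; N \<le> N'\<rbrakk> \<Longrightarrow> degree_bound x N'"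
  unfolding degree_bound_def by (meson le_less_trans)

text \<open>Some bound, not necessarily the least; nothing relates \<open>deg (x + y)\<close> to
  \<open>deg x\<close> and \<open>deg y\<close>. Sums truncated at \<open>deg\<close> are therefore
  moved to a common bound before they are compared.\<close>

definition deg :: "'h \<Rightarrow> nat" where
  "deg x = (SOME N. degree_bound x N)"

lemma degree_bound_deg: "degree_bound x (deg x)"
  unfolding deg_def by (rule someI_ex) (rule degree_bound_ex)

lemma degree_bound_vanish: "\<lbrakk>degree_bound x N; lin \<phi>; vanishes_below M \<phi>; N < M\<rbrakk> \<Longrightarrow> \<phi> x = 0"
  by (auto simp: degree_bound_def)

lemma cpow_vanish: "\<lbrakk>lin \<phi>; \<phi> 1 = 0; degree_bound x N; N < n\<rbrakk> \<Longrightarrow> cpow \<phi> n x = 0"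
  by (rule degree_bound_vanish[OF _ lin_cpow vanishes_below_cpow])

subsection \<open>Power series in the convolution algebra\<close>

text \<open>Real coefficients let the same formal series act over both scalar fields and on the
  complexification. For linear \<phi> with value 0 at 1 the truncation drops only terms that
  vanish.\<close>

definition ser :: "real fps \<Rightarrow> ('h \<Rightarrow> 'b) \<Rightarrow> 'h \<Rightarrow> 'b" where
  "ser r \<phi> x = (\<Sum>n\<le>deg x. smul B (of_real (fps_nth r n)) (cpow \<phi> n x))"

text \<open>Terms beyond a degree bound vanish, so truncating at either of two bounds gives the same
  as truncating at the larger one.\<close>

lemma graded_sum_eq:
  assumes f: "\<And>n. lin (f n)" "\<And>n. vanishes_below n (f n)" and N: "degree_bound x N"
  shows "(\<Sum>n\<le>deg x. f n x) = (\<Sum>n\<le>N. f n x)"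
proof -
  have "(\<Sum>n\<le>M. f n x) = (\<Sum>n\<le>M'. f n x)" if "degree_bound x M" "M \<le> M'" for M M'
    by (rule sum.mono_neutral_left) (use that degree_bound_vanish[OF that(1) f] in auto)
  from this[OF degree_bound_deg, where M' = "max N (deg x)"] this[OF N, where M' = "max N (deg x)"]
  show ?thesis by simp
qed

lemma lin_graded_sum:
  assumes f: "\<And>n. lin (f n)" "\<And>n. vanishes_below n (f n)"
  shows "lin (\<lambda>x. \<Sum>n\<le>deg x. f n x)"
  unfolding lin_iff
proof (intro conjI allI)
  note l = f(1)[unfolded lin_iff]
  fix x y and c
  let ?N = "max (deg x) (max (deg y) (max (deg (x + y)) (deg (scaleH c x))))"
  have eq: "(\<Sum>n\<le>deg x. f n x) = (\<Sum>n\<le>?N. f n x)" "(\<Sum>n\<le>deg y. f n y) = (\<Sum>n\<le>?N. f n y)"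
    "(\<Sum>n\<le>deg (x + y). f n (x + y)) = (\<Sum>n\<le>?N. f n (x + y))"
    "(\<Sum>n\<le>deg (scaleH c x). f n (scaleH c x)) = (\<Sum>n\<le>?N. f n (scaleH c x))"
    by (rule graded_sum_eq[OF f], rule degree_bound_mono[OF degree_bound_deg], simp)+
  show "(\<Sum>n\<le>deg (x + y). f n (x + y)) = (\<Sum>n\<le>deg x. f n x) + (\<Sum>n\<le>deg y. f n y)"
    unfolding eq using l by (simp add: sum.distrib)
  show "(\<Sum>n\<le>deg (scaleH c x). f n (scaleH c x)) = smul B c (\<Sum>n\<le>deg x. f n x)"
    unfolding eq using l by (simp add: VB.scale_sum_right)
qed

lemma vanishes_below_scale: "vanishes_below n \<phi> \<Longrightarrow> vanishes_below n (\<lambda>x. smul B c (\<phi> x))"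
  by (simp add: vanishes_below_def VB.scale_zero_right)

lemma ser_eq:
  assumes "lin \<phi>" "\<phi> 1 = 0" "degree_bound x N"
  shows "ser r \<phi> x = (\<Sum>n\<le>N. smul B (of_real (fps_nth r n)) (cpow \<phi> n x))"
  unfolding ser_def
  by (rule graded_sum_eq[OF lin_scale[OF lin_cpow] vanishes_below_scale[OF vanishes_below_cpow]]) (use assms in simp_all)

lemma lin_ser: assumes "lin \<phi>" "\<phi> 1 = 0" shows "lin (ser r \<phi>)"
  unfolding ser_def[abs_def]
  by (rule lin_graded_sum[OF lin_scale[OF lin_cpow] vanishes_below_scale[OF vanishes_below_cpow]]) (use assms in simp_all)

text \<open>A finite list of pairs has a common bound; applied to \<open>cop x\<close>, it allows
  all series in a convolution to be truncated at the same N.\<close>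

lemma deg_bound_list: "\<exists>N. M \<le> N \<and> (\<forall>(a, b)\<in>set xs. degree_bound a N \<and> degree_bound b N)"
proof (induction xs)
  case (Cons p xs)
  obtain a b where p: "p = (a, b)" by (cases p)
  from Cons obtain N where "M \<le> N \<and> (\<forall>(a, b)\<in>set xs. degree_bound a N \<and> degree_bound b N)" by blast
  then have N: "M \<le> N" "\<forall>(a, b)\<in>set xs. degree_bound a N \<and> degree_bound b N" by auto
  have "degree_bound a (max N (max (deg a) (deg b)))" "degree_bound b (max N (max (deg a) (deg b)))"
    by (auto intro: degree_bound_mono[OF degree_bound_deg])
  moreover have "\<forall>(c, d)\<in>set xs. degree_bound c (max N (max (deg a) (deg b))) \<and> degree_bound d (max N (max (deg a) (deg b)))"
    using N(2) by (auto intro: degree_bound_mono)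
  ultimately show ?case
    using N(1) by (intro exI[of _ "max N (max (deg a) (deg b))"]) (auto simp: p)
qed auto

lemma ser_mult:
  assumes \<phi>: "lin \<phi>" "\<phi> 1 = 0"
  shows "conv (ser r \<phi>) (ser s \<phi>) = ser (r * s) \<phi>"
proof
  fix x
  obtain N where N: "deg x \<le> N" "\<And>a b. (a, b) \<in> set (cop x) \<Longrightarrow> degree_bound a N \<and> degree_bound b N"
    using deg_bound_list[of "deg x" "cop x"] by blast
  have dx: "degree_bound x N" by (rule degree_bound_mono[OF degree_bound_deg N(1)])
  let ?r = "\<lambda>n. of_real (fps_nth r n) :: 'k" and ?s = "\<lambda>n. of_real (fps_nth s n) :: 'k"
  have "conv (ser r \<phi>) (ser s \<phi>) x = (\<Sum>(a, b)\<leftarrow>cop x. ser r \<phi> a * ser s \<phi> b)"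
    by (simp add: conv_cop lin_ser \<phi>)
  also have "\<dots> = (\<Sum>(a, b)\<leftarrow>cop x. \<Sum>i\<le>N. \<Sum>j\<le>N. smul B (?r i * ?s j) (cpow \<phi> i a * cpow \<phi> j b))"
  proof (rule arg_cong[of _ _ sum_list], rule map_cong[OF refl])
    fix p assume p: "p \<in> set (cop x)"
    obtain a b where ab: "p = (a, b)" by (cases p)
    have "ser r \<phi> a * ser s \<phi> b = (\<Sum>i\<le>N. smul B (?r i) (cpow \<phi> i a)) * (\<Sum>j\<le>N. smul B (?s j) (cpow \<phi> j b))"
      using N(2) p unfolding ab by (simp add: ser_eq[OF \<phi>, of _ N])
    also have "\<dots> = (\<Sum>i\<le>N. \<Sum>j\<le>N. smul B (?r i * ?s j) (cpow \<phi> i a * cpow \<phi> j b))"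
      by (simp add: sum_product smul_mult mult_smul mult.commute)
    finally show "(case p of (a, b) \<Rightarrow> ser r \<phi> a * ser s \<phi> b) =
        (case p of (a, b) \<Rightarrow> \<Sum>i\<le>N. \<Sum>j\<le>N. smul B (?r i * ?s j) (cpow \<phi> i a * cpow \<phi> j b))" by (simp add: ab)
  qed
  also have "\<dots> = (\<Sum>i\<le>N. \<Sum>j\<le>N. smul B (?r i * ?s j) (conv (cpow \<phi> i) (cpow \<phi> j) x))"
    by (simp add: conv_cop lin_cpow \<phi> case_prod_unfold sum_list_sum_swap smul_sum_list)
  also have "\<dots> = (\<Sum>i\<le>N. \<Sum>j\<le>N. smul B (?r i * ?s j) (cpow \<phi> (i + j) x))"
    by (simp add: cpow_add \<phi>)
  also have "\<dots> = (\<Sum>(i, j)\<in>{..N} \<times> {..N}. smul B (?r i * ?s j) (cpow \<phi> (i + j) x))"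
    by (simp add: sum.cartesian_product)
  \<comment> \<open>The square of indices is cut down to the triangle: powers of order i + j > N
    vanish at x.\<close>
  also have "\<dots> = (\<Sum>(i, j)\<in>{(i, j). i + j \<le> N}. smul B (?r i * ?s j) (cpow \<phi> (i + j) x))"
  proof (rule sum.mono_neutral_right)
    have "i + j \<le> N" if "cpow \<phi> (i + j) x \<noteq> 0" for i j
      using that cpow_vanish[OF \<phi> dx, of "i + j"] by (meson not_le)
    then show "\<forall>p\<in>{..N} \<times> {..N} - {(i, j). i + j \<le> N}. (case p of (i, j) \<Rightarrow> smul B (?r i * ?s j) (cpow \<phi> (i + j) x)) = 0"
      by auto
  qed auto
  also have "\<dots> = (\<Sum>n\<le>N. \<Sum>i\<le>n. smul B (?r i * ?s (n - i)) (cpow \<phi> (i + (n - i)) x))"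
    by (rule sum.triangle_reindex_eq)
  also have "\<dots> = (\<Sum>n\<le>N. smul B (of_real (fps_nth (r * s) n)) (cpow \<phi> n x))"
    by (intro sum.cong refl) (simp add: fps_mult_nth VB.scale_sum_left atLeast0AtMost)
  also have "\<dots> = ser (r * s) \<phi> x" by (simp add: ser_eq[OF \<phi> dx])
  finally show "conv (ser r \<phi>) (ser s \<phi>) x = ser (r * s) \<phi> x" .
qed

lemma ser_one: "ser 1 \<phi> = cunit"
proof
  fix x
  have "ser 1 \<phi> x = (\<Sum>n\<in>{0}. smul B (of_real (fps_nth (1::real fps) n)) (cpow \<phi> n x))"
    unfolding ser_def by (rule sum.mono_neutral_right) auto
  then show "ser 1 \<phi> x = cunit x" by simp
qed

lemma ser_X: assumes "lin \<phi>" "\<phi> 1 = 0" shows "ser fps_X \<phi> = \<phi>"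
proof
  fix x
  have "ser fps_X \<phi> x = (\<Sum>n\<le>Suc (deg x). smul B (of_real (fps_nth (fps_X::real fps) n)) (cpow \<phi> n x))"
    by (rule ser_eq[OF assms degree_bound_mono[OF degree_bound_deg]]) simp
  also have "\<dots> = (\<Sum>n\<in>{1}. smul B (of_real (fps_nth (fps_X::real fps) n)) (cpow \<phi> n x))"
    by (rule sum.mono_neutral_right) (auto simp: fps_X_def)
  finally show "ser fps_X \<phi> x = \<phi> x" by (simp add: assms conv_unit_right)
qed

lemma ser_diff: "ser (r - s) \<phi> = ser r \<phi> - ser s \<phi>"
  by (auto simp: ser_def fun_eq_iff VB.scale_left_distrib VB.scale_left_diff_distrib sum.distrib sum_subtractf)

lemma ser_power: "\<lbrakk>lin \<phi>; \<phi> 1 = 0\<rbrakk> \<Longrightarrow> cpow (ser r \<phi>) n = ser (r ^ n) \<phi>"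
  by (induction n) (auto simp: ser_one ser_mult)

lemma ser_at_one: assumes "lin \<phi>" "\<phi> 1 = 0" shows "ser r \<phi> 1 = smul B (of_real (fps_nth r 0)) 1"
  using ser_eq[OF assms degree_bound_grade[OF grade_one]] by (simp add: convolution_unit_def counit_one)

text \<open>Since s has no constant term, \<open>ser s \<phi>\<close> vanishes at 1 and the i-th
  power of s starts in degree i; all sums involved are finite, and the summations over i and n may
  be exchanged.\<close>

lemma ser_compose:
  assumes \<phi>: "lin \<phi>" "\<phi> 1 = 0" and s: "fps_nth s 0 = 0"
  shows "ser r (ser s \<phi>) = ser (fps_compose r s) \<phi>"
proof
  fix x
  have s1: "ser s \<phi> 1 = 0" by (simp add: ser_at_one \<phi> s)
  have "ser r (ser s \<phi>) x = (\<Sum>i\<le>deg x. smul B (of_real (fps_nth r i)) (ser (s ^ i) \<phi> x))"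
    by (simp add: ser_eq[OF lin_ser[OF \<phi>] s1 degree_bound_deg] ser_power \<phi>)
  also have "\<dots> = (\<Sum>i\<le>deg x. \<Sum>n\<le>deg x. smul B (of_real (fps_nth r i * fps_nth (s ^ i) n)) (cpow \<phi> n x))"
    by (simp add: ser_def VB.scale_sum_right)
  also have "\<dots> = (\<Sum>n\<le>deg x. \<Sum>i\<le>deg x. smul B (of_real (fps_nth r i * fps_nth (s ^ i) n)) (cpow \<phi> n x))"
    by (rule sum.swap)
  also have "\<dots> = (\<Sum>n\<le>deg x. smul B (of_real (fps_nth (fps_compose r s) n)) (cpow \<phi> n x))"
  proof (rule sum.cong[OF refl])
    fix n assume n: "n \<in> {..deg x}"
    have "(\<Sum>i\<le>deg x. smul B (of_real (fps_nth r i * fps_nth (s ^ i) n)) (cpow \<phi> n x)) =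
        (\<Sum>i\<le>n. smul B (of_real (fps_nth r i * fps_nth (s ^ i) n)) (cpow \<phi> n x))"
      by (rule sum.mono_neutral_right) (use n s in \<open>auto simp: startsby_zero_power_prefix\<close>)
    then show "(\<Sum>i\<le>deg x. smul B (of_real (fps_nth r i * fps_nth (s ^ i) n)) (cpow \<phi> n x)) =
        smul B (of_real (fps_nth (fps_compose r s) n)) (cpow \<phi> n x)"
      by (simp add: fps_compose_nth atLeast0AtMost VB.scale_sum_left del: of_real_mult)
  qed
  finally show "ser r (ser s \<phi>) x = ser (fps_compose r s) \<phi> x" by (simp add: ser_def)
qed

definition cexp :: "('h \<Rightarrow> 'b) \<Rightarrow> 'h \<Rightarrow> 'b" where
  "cexp \<phi> = ser (fps_exp 1) \<phi>"

text \<open>\<open>fps_ln 1\<close> is the series of log (1 + X), whence the shift by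
  \<open>cunit\<close>.\<close>

definition clog :: "('h \<Rightarrow> 'b) \<Rightarrow> 'h \<Rightarrow> 'b" where
  "clog \<omega> = ser (fps_ln 1) (\<omega> - cunit)"

lemma cunit_one: "cunit 1 = 1"
  by (simp add: convolution_unit_def counit_one)

lemma cexp_eq: "cexp \<phi> = cunit + ser (fps_exp 1 - 1) \<phi>"
  by (simp add: cexp_def ser_diff ser_one)

lemma fps_ln_exp: "fps_compose (fps_ln 1) (fps_exp 1 - 1) = (fps_X :: real fps)"
  and fps_exp_ln: "fps_compose (fps_exp 1 - 1) (fps_ln 1) = (fps_X :: real fps)"
proof -
  have 0: "fps_nth (fps_exp 1 - 1 :: real fps) 0 = 0" "fps_nth (fps_exp 1 - 1 :: real fps) 1 \<noteq> 0"
    by simp_all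
  have "fps_ln 1 = fps_inv (fps_exp 1 - 1 :: real fps)"
    using fps_ln_fps_exp_inv[of "1::real"] by simp
  then show "fps_compose (fps_ln 1) (fps_exp 1 - 1) = (fps_X :: real fps)"
    "fps_compose (fps_exp 1 - 1) (fps_ln 1) = (fps_X :: real fps)"
    using fps_inv[OF 0] fps_inv_right[OF 0] by simp_all
qed

lemma clog_cexp: assumes "lin \<phi>" "\<phi> 1 = 0" shows "clog (cexp \<phi>) = \<phi>"
  by (simp add: clog_def cexp_eq ser_compose assms fps_ln_exp ser_X)

lemma cexp_clog: assumes "lin \<omega>" "\<omega> 1 = 1" shows "cexp (clog \<omega>) = \<omega>"
proof -
  have l: "lin (\<omega> - cunit)" "(\<omega> - cunit) 1 = 0"
    using assms by (simp_all add: lin_diff lin_cunit cunit_one)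
  have "ser (fps_exp 1 - 1) (clog \<omega>) = \<omega> - cunit"
    unfolding clog_def by (subst ser_compose[OF l]) (simp_all only: fps_exp_ln ser_X[OF l], simp add: fps_ln_nth)
  then show ?thesis by (simp add: cexp_eq)
qed

lemma lin_cexp: "\<lbrakk>lin \<phi>; \<phi> 1 = 0\<rbrakk> \<Longrightarrow> lin (cexp \<phi>)"
  and cexp_one: "\<lbrakk>lin \<phi>; \<phi> 1 = 0\<rbrakk> \<Longrightarrow> cexp \<phi> 1 = 1"
  by (simp_all add: cexp_def lin_ser ser_at_one)

lemma lin_clog: "\<lbrakk>lin \<omega>; \<omega> 1 = 1\<rbrakk> \<Longrightarrow> lin (clog \<omega>)"
  and clog_one: "\<lbrakk>lin \<omega>; \<omega> 1 = 1\<rbrakk> \<Longrightarrow> clog \<omega> 1 = 0"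
  by (simp_all add: clog_def lin_ser ser_at_one lin_diff lin_cunit cunit_one fps_ln_nth)

lemma cexp_scale: "\<lbrakk>lin \<phi>; \<phi> 1 = 0\<rbrakk> \<Longrightarrow> cexp (\<lambda>x. smul B (of_real t) (\<phi> x)) = ser (fps_exp t) \<phi>"
  by (simp add: fun_eq_iff cexp_def ser_def cpow_scale flip: of_real_power of_real_mult of_real_divide)

text \<open>Both factors are series in the same \<phi>, so the one-parameter law is the formal
  identity exp (s X) exp (t X) = exp ((s + t) X).\<close>

lemma cexp_add:
  assumes "lin \<phi>" "\<phi> 1 = 0"
  shows "conv (cexp (\<lambda>x. smul B (of_real s) (\<phi> x))) (cexp (\<lambda>x. smul B (of_real t) (\<phi> x))) =
    cexp (\<lambda>x. smul B (of_real (s + t)) (\<phi> x))"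
  unfolding cexp_scale[OF assms] ser_mult[OF assms] by (simp add: fps_exp_add_mult)

end

section \<open>Exponential and logarithm between infinitesimal characters and characters\<close>

section \<open>Characters and infinitesimal characters\<close>

context hopf_characters
begin

abbreviation chars :: "('h \<Rightarrow> 'b) set" where
  "chars \<equiv> characters scaleH B"

abbreviation ichars :: "('h \<Rightarrow> 'b) set" where
  "ichars \<equiv> infinitesimal_characters scaleH \<epsilon> B"

lemma charsD: "\<phi> \<in> chars \<Longrightarrow> lin \<phi>" "\<phi> \<in> chars \<Longrightarrow> \<phi> 1 = 1" "\<phi> \<in> chars \<Longrightarrow> \<phi> (a * b) = \<phi> a * \<phi> b"
  by (auto simp: characters_def)

lemma icharsD: "\<phi> \<in> ichars \<Longrightarrow> lin \<phi>"
  "\<phi> \<in> ichars \<Longrightarrow> \<phi> (a * b) = smul B (\<epsilon> a) (\<phi> b) + smul B (\<epsilon> b) (\<phi> a)"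
  by (auto simp: infinitesimal_characters_def)

lemma ichars_one: assumes "\<phi> \<in> ichars" shows "\<phi> 1 = 0"
  using icharsD(2)[OF assms, of 1 1] by (simp add: counit_one)

lemma conv_chars:
  assumes \<phi>: "\<phi> \<in> chars" and \<psi>: "\<psi> \<in> chars"
  shows "conv \<phi> \<psi> \<in> chars"
proof -
  note l = charsD(1)[OF \<phi>] charsD(1)[OF \<psi>]
  have "conv \<phi> \<psi> (x * y) = conv \<phi> \<psi> x * conv \<phi> \<psi> y" for x y
    unfolding conv_mult[OF l] conv_product_sum[OF l l] using \<phi> \<psi> by (simp add: charsD)
  then show ?thesis
    using l \<phi> \<psi> by (simp add: characters_def lin_conv conv_one)
qed

lemma cunit_chars: "cunit \<in> chars"
  by (simp add: characters_def lin_cunit cunit_one) (simp add: convolution_unit_def counit_mult smul_mult)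

text \<open>Divided powers: with the factorial included, the Leibniz rule has no binomial
  coefficients and the exponential is their plain sum.\<close>

definition dpow :: "('h \<Rightarrow> 'b) \<Rightarrow> nat \<Rightarrow> 'h \<Rightarrow> 'b" where
  "dpow \<phi> n = (\<lambda>x. smul B (of_real (1 / fact n)) (cpow \<phi> n x))"

lemma lin_dpow: "lin \<phi> \<Longrightarrow> lin (dpow \<phi> n)"
  by (simp add: dpow_def lin_scale lin_cpow)

lemma conv_dpow: assumes "lin \<phi>" shows "conv \<phi> (dpow \<phi> n) = (\<lambda>x. smul B (of_real (real (Suc n))) (dpow \<phi> (Suc n) x))"
proof -
  have "real (Suc n) * (1 / fact (Suc n)) = 1 / fact n"
    by (simp add: fact_Suc del: of_nat_Suc)
  then have "(of_real (real (Suc n)) :: 'k) * of_real (1 / fact (Suc n)) = of_real (1 / fact n)"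
    by (metis of_real_mult)
  then show ?thesis
    unfolding dpow_def by (simp add: conv_scale_right assms lin_cpow del: of_real_divide of_nat_Suc)
qed

text \<open>Convolving with the derivation \<phi> produces n + 1 times the next divided power on the
  left, and on the right terms of weights n + 1 - k and k, which add up to n + 1; this factor is
  nonzero in the scalar field and cancels.\<close>

lemma dpow_mult:
  assumes \<phi>: "\<phi> \<in> ichars"
  shows "dpow \<phi> n (x * y) = (\<Sum>k\<le>n. dpow \<phi> k x * dpow \<phi> (n - k) y)"
proof (induction n arbitrary: x y)
  case 0
  show ?case by (simp add: dpow_def convolution_unit_def counit_mult smul_mult)
next
  case (Suc n)
  note l = icharsD(1)[OF \<phi>]
  let ?s = "\<lambda>m::nat. smul B (of_real (real m))"
  have "?s (Suc n) (dpow \<phi> (Suc n) (x * y)) = conv \<phi> (dpow \<phi> n) (x * y)"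
    by (simp only: conv_dpow[OF l])
  also have "\<dots> = (\<Sum>(a, b)\<leftarrow>cop x. \<Sum>(c, d)\<leftarrow>cop y.
      (cunit a * \<phi> c + \<phi> a * cunit c) * (\<Sum>k\<le>n. dpow \<phi> k b * dpow \<phi> (n - k) d))"
    unfolding conv_mult[OF l lin_dpow[OF l]] Suc.IH icharsD(2)[OF \<phi>]
    by (simp add: convolution_unit_def smul_mult mult_smul)
  also have "\<dots> = (\<Sum>k\<le>n. (\<Sum>(a, b)\<leftarrow>cop x. \<Sum>(c, d)\<leftarrow>cop y. cunit a * \<phi> c * (dpow \<phi> k b * dpow \<phi> (n - k) d)) +
      (\<Sum>(a, b)\<leftarrow>cop x. \<Sum>(c, d)\<leftarrow>cop y. \<phi> a * cunit c * (dpow \<phi> k b * dpow \<phi> (n - k) d)))"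
    by (simp add: case_prod_unfold sum_distrib_left distrib_right sum.distrib sum_list_addf sum_list_sum_swap)
  also have "\<dots> = (\<Sum>k\<le>n. conv cunit (dpow \<phi> k) x * conv \<phi> (dpow \<phi> (n - k)) y +
      conv \<phi> (dpow \<phi> k) x * conv cunit (dpow \<phi> (n - k)) y)"
    by (simp add: conv_product_sum l lin_dpow lin_cunit)
  also have "\<dots> = (\<Sum>k\<le>n. ?s (Suc n - k) (dpow \<phi> k x * dpow \<phi> (Suc n - k) y)) +
      (\<Sum>k\<le>n. ?s (Suc k) (dpow \<phi> (Suc k) x * dpow \<phi> (n - k) y))"
    by (simp add: conv_unit_left conv_dpow l lin_dpow sum.distrib smul_mult mult_smul Suc_diff_le del: of_nat_Suc)
  \<comment> \<open>The new term k = n + 1 has weight 0, as has the term k = 0 gained by shifting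
    the other sum.\<close>
  also have "(\<Sum>k\<le>n. ?s (Suc n - k) (dpow \<phi> k x * dpow \<phi> (Suc n - k) y)) =
      (\<Sum>k\<le>Suc n. ?s (Suc n - k) (dpow \<phi> k x * dpow \<phi> (Suc n - k) y))"
    by simp
  also have "(\<Sum>k\<le>n. ?s (Suc k) (dpow \<phi> (Suc k) x * dpow \<phi> (n - k) y)) =
      (\<Sum>k\<le>Suc n. ?s k (dpow \<phi> k x * dpow \<phi> (Suc n - k) y))"
    by (simp add: sum.atMost_Suc_shift del: sum.atMost_Suc of_nat_Suc)
  also have "(\<Sum>k\<le>Suc n. ?s (Suc n - k) (dpow \<phi> k x * dpow \<phi> (Suc n - k) y)) + \<dots> =
      (\<Sum>k\<le>Suc n. ?s (Suc n) (dpow \<phi> k x * dpow \<phi> (Suc n - k) y))"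
    unfolding sum.distrib[symmetric]
    by (intro sum.cong refl) (simp add: VB.scale_left_distrib[symmetric] of_nat_diff del: of_nat_Suc)
  also have "\<dots> = ?s (Suc n) (\<Sum>k\<le>Suc n. dpow \<phi> k x * dpow \<phi> (Suc n - k) y)"
    by (simp only: VB.scale_sum_right)
  finally have eq: "?s (Suc n) (dpow \<phi> (Suc n) (x * y)) = ?s (Suc n) (\<Sum>k\<le>Suc n. dpow \<phi> k x * dpow \<phi> (Suc n - k) y)" .
  have "(of_real (real (Suc n)) :: 'k) \<noteq> 0" by (simp only: of_real_eq_0_iff)
  then show ?case using eq VB.scale_left_imp_eq by blast
qed

lemma cexp_dpow: "\<lbrakk>lin \<phi>; \<phi> 1 = 0; degree_bound x N\<rbrakk> \<Longrightarrow> cexp \<phi> x = (\<Sum>n\<le>N. dpow \<phi> n x)"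
  by (simp add: cexp_def ser_eq dpow_def)

lemma dpow_vanish: "\<lbrakk>lin \<phi>; \<phi> 1 = 0; degree_bound x N; N < n\<rbrakk> \<Longrightarrow> dpow \<phi> n x = 0"
  by (simp add: dpow_def cpow_vanish)

lemma cexp_chars: assumes \<phi>: "\<phi> \<in> ichars" shows "cexp \<phi> \<in> chars"
proof -
  note l = icharsD(1)[OF \<phi>] ichars_one[OF \<phi>]
  have "cexp \<phi> (x * y) = cexp \<phi> x * cexp \<phi> y" for x y
  proof -
    \<comment> \<open>Beyond deg x + deg y one of the two factors vanishes, so the square and the
      triangle of indices give the same sum; the last summand makes N a bound for the product as
      well.\<close>
    define N where "N = deg x + deg y + deg (x * y)"
    have N: "degree_bound (x * y) N" "degree_bound x N" "degree_bound y N"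
      by (auto simp: N_def intro: degree_bound_mono[OF degree_bound_deg])
    have van: "dpow \<phi> i x * dpow \<phi> j y = 0" if "N < i + j" for i j
    proof (cases "deg x < i")
      case True
      then show ?thesis using dpow_vanish[OF l degree_bound_deg] by simp
    next
      case False
      then have "deg y < j" using that by (simp add: N_def)
      then show ?thesis using dpow_vanish[OF l degree_bound_deg] by simp
    qed
    have van': "i + j \<le> N" if "dpow \<phi> i x * dpow \<phi> j y \<noteq> 0" for i j
      using van that by (meson not_le)
    have "cexp \<phi> (x * y) = (\<Sum>n\<le>N. \<Sum>k\<le>n. dpow \<phi> k x * dpow \<phi> (n - k) y)"
      by (simp add: cexp_dpow[OF l N(1)] dpow_mult[OF \<phi>])
    also have "\<dots> = (\<Sum>(i, j)\<in>{(i, j). i + j \<le> N}. dpow \<phi> i x * dpow \<phi> j y)"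
      using sum.triangle_reindex_eq[of "\<lambda>i j. dpow \<phi> i x * dpow \<phi> j y" N] by simp
    also have "\<dots> = (\<Sum>(i, j)\<in>{..N} \<times> {..N}. dpow \<phi> i x * dpow \<phi> j y)"
      by (rule sum.mono_neutral_left) (use van' in auto)
    also have "\<dots> = cexp \<phi> x * cexp \<phi> y"
      by (simp add: cexp_dpow[OF l N(2)] cexp_dpow[OF l N(3)] sum_product sum.cartesian_product)
    finally show ?thesis .
  qed
  then show ?thesis by (simp add: characters_def lin_cexp cexp_one l)
qed

text \<open>A functional turns the coefficients into those of a scalar polynomial that vanishes at
  all natural numbers; these are infinitely many distinct scalars.\<close>

lemma polynomial_coefficients_zero:
  assumes "\<And>n::nat. (\<Sum>k\<le>N. smul B (of_nat n ^ k) (c k)) = 0" "k \<le> N"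
  shows "c k = 0"
proof (rule ccontr)
  assume "c k \<noteq> 0"
  then obtain l :: "'b \<Rightarrow> 'k" where l: "Vector_Spaces.linear (smul B) (*) l" "l (c k) = 1"
    by (rule separating_functional)
  define p where "p = (\<Sum>k\<le>N. monom (l (c k)) k)"
  have "poly p (of_nat n) = l (\<Sum>k\<le>N. smul B (of_nat n ^ k) (c k))" for n
    by (simp add: p_def poly_sum poly_monom functional_sum[OF l(1)] functional_scale[OF l(1)] mult.commute)
  moreover have "l 0 = 0" using functional_diff[OF l(1), of 0 0] by simp
  ultimately have "range (of_nat :: nat \<Rightarrow> 'k) \<subseteq> {x. poly p x = 0}"
    using assms(1) by auto
  moreover have "infinite (range (of_nat :: nat \<Rightarrow> 'k))"
    by (simp add: range_inj_infinite inj_of_nat)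
  ultimately have "p = 0" using poly_roots_finite finite_subset by blast
  moreover have "coeff p k = l (c k)"
    using assms(2) by (simp add: p_def coeff_sum coeff_monom)
  ultimately show False using l(2) by simp
qed

lemma cpow_chars: "\<phi> \<in> chars \<Longrightarrow> cpow \<phi> n \<in> chars"
  by (induction n) (auto simp: cunit_chars conv_chars)

text \<open>The powers \<open>\<omega>\<^sup>n = exp (n log \<omega>)\<close> are characters, and \<open>\<omega>\<^sup>n(x)\<close> is polynomial in \<open>n\<close>; comparing the
  coefficients of \<open>n\<^sup>1\<close> in \<open>\<omega>\<^sup>n(x y) = \<omega>\<^sup>n(x) \<omega>\<^sup>n(y)\<close> shows that \<open>log \<omega>\<close> is a derivation.\<close>

lemma clog_ichars: assumes \<omega>: "\<omega> \<in> chars" shows "clog \<omega> \<in> ichars"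
proof -
  define L where "L = clog \<omega>"
  note \<omega>l = charsD(1)[OF \<omega>] charsD(2)[OF \<omega>]
  have l: "lin L" "L 1 = 0" by (simp_all add: L_def lin_clog clog_one \<omega>l)
  \<comment> \<open>As \<omega> is the exponential of L, its n-th power is the series exp (n X) at
    L.\<close>
  have pow: "cpow \<omega> n x = (\<Sum>k\<le>N. smul B (of_nat n ^ k) (dpow L k x))" if "degree_bound x N" for n x N
  proof -
    have "cpow \<omega> n = ser (fps_exp (real n)) L"
      using cexp_clog[OF \<omega>l] ser_power[OF l, of "fps_exp 1" n]
      by (simp add: L_def[symmetric] cexp_def fps_exp_power_mult)
    then show ?thesis by (simp add: ser_eq[OF l that] dpow_def divide_inverse)
  qed
  have "L (x * y) = smul B (\<epsilon> x) (L y) + smul B (\<epsilon> y) (L x)" for x y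
  proof -
    \<comment> \<open>N is at least 1, so that the coefficient of n^1 is among those
      compared.\<close>
    define N where "N = Suc (deg x + deg y + deg (x * y))"
    have N: "degree_bound (x * y) N" "degree_bound x N" "degree_bound y N"
      by (auto simp: N_def intro: degree_bound_mono[OF degree_bound_deg])
    have van: "dpow L i x * dpow L j y = 0" if "N < i + j" for i j
    proof (cases "deg x < i")
      case True
      then show ?thesis using dpow_vanish[OF l degree_bound_deg] by simp
    next
      case False
      then have "deg y < j" using that by (simp add: N_def)
      then show ?thesis using dpow_vanish[OF l degree_bound_deg] by simp
    qed
    have van': "i + j \<le> N" if "dpow L i x * dpow L j y \<noteq> 0" for i j
      using van that by (meson not_le)
    \<comment> \<open>The coefficient of n^k in the difference of the two sides of multiplicativity;
      for k = 1 its vanishing is the derivation rule.\<close>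
    define c where "c k = dpow L k (x * y) - (\<Sum>i\<le>k. dpow L i x * dpow L (k - i) y)" for k
    have "(\<Sum>k\<le>N. smul B (of_nat n ^ k) (c k)) = 0" for n
    proof -
      have "cpow \<omega> n x * cpow \<omega> n y =
          (\<Sum>(i, j)\<in>{..N} \<times> {..N}. smul B (of_nat n ^ (i + j)) (dpow L i x * dpow L j y))"
        by (simp add: pow[OF N(2)] pow[OF N(3)] sum_product sum.cartesian_product smul_mult mult_smul power_add mult.commute)
      also have "\<dots> = (\<Sum>(i, j)\<in>{(i, j). i + j \<le> N}. smul B (of_nat n ^ (i + j)) (dpow L i x * dpow L j y))"
        by (rule sum.mono_neutral_right) (use van' in auto)
      also have "\<dots> = (\<Sum>k\<le>N. \<Sum>i\<le>k. smul B (of_nat n ^ (i + (k - i))) (dpow L i x * dpow L (k - i) y))"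
        by (rule sum.triangle_reindex_eq)
      also have "\<dots> = (\<Sum>k\<le>N. smul B (of_nat n ^ k) (\<Sum>i\<le>k. dpow L i x * dpow L (k - i) y))"
        by (simp add: VB.scale_sum_right)
      finally have "cpow \<omega> n x * cpow \<omega> n y = (\<Sum>k\<le>N. smul B (of_nat n ^ k) (\<Sum>i\<le>k. dpow L i x * dpow L (k - i) y))" .
      moreover have "cpow \<omega> n (x * y) = cpow \<omega> n x * cpow \<omega> n y"
        by (rule charsD(3)[OF cpow_chars[OF \<omega>]])
      ultimately show ?thesis
        by (simp add: c_def VB.scale_right_diff_distrib sum_subtractf pow[OF N(1)])
    qed
    then have "c 1 = 0"
      by (rule polynomial_coefficients_zero[where N = N]) (simp add: N_def)
    then have "dpow L 1 (x * y) = dpow L 0 x * dpow L 1 y + dpow L 1 x * dpow L 0 y"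
      by (simp add: c_def)
    moreover have "dpow L 1 = L" "dpow L 0 = cunit"
      by (simp_all add: dpow_def conv_unit_right l)
    ultimately show ?thesis by (simp add: convolution_unit_def smul_mult mult_smul)
  qed
  then show ?thesis using l(1) unfolding L_def by (simp add: infinitesimal_characters_def)
qed

lemma ichars_zero: "0 \<in> ichars"
  by (auto simp: infinitesimal_characters_def lin_zero)

lemma ichars_add: "\<lbrakk>\<phi> \<in> ichars; \<psi> \<in> ichars\<rbrakk> \<Longrightarrow> \<phi> + \<psi> \<in> ichars"
  by (auto simp: infinitesimal_characters_def lin_add VB.scale_right_distrib)

lemma ichars_scale: "\<phi> \<in> ichars \<Longrightarrow> (\<lambda>x. smul B c (\<phi> x)) \<in> ichars"
  by (auto simp: infinitesimal_characters_def lin_scale VB.scale_right_distrib mult.commute)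

text \<open>The inverse is written as exp (- log \<omega>), so that inversion becomes negation in
  the logarithm chart.\<close>

lemma conv_inverse:
  assumes "\<omega> \<in> chars"
  shows "cexp (\<lambda>x. smul B (of_real (- 1)) (clog \<omega> x)) \<in> chars"
    and "conv (cexp (\<lambda>x. smul B (of_real (- 1)) (clog \<omega> x))) \<omega> = cunit"
proof -
  note F = clog_ichars[OF assms]
  show "cexp (\<lambda>x. smul B (of_real (- 1)) (clog \<omega> x)) \<in> chars"
    by (rule cexp_chars[OF ichars_scale[OF F]])
  have "conv (cexp (\<lambda>x. smul B (of_real (- 1)) (clog \<omega> x))) (cexp (\<lambda>x. smul B (of_real 1) (clog \<omega> x))) =
      cexp (\<lambda>x. smul B (of_real (- 1 + 1)) (clog \<omega> x))"
    by (rule cexp_add[OF icharsD(1)[OF F] ichars_one[OF F]])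
  moreover have "cexp (\<lambda>x. smul B (of_real (- 1 + 1)) (clog \<omega> x)) = cunit"
    using cexp_scale[OF icharsD(1)[OF F] ichars_one[OF F], of 0] by (simp add: ser_one)
  ultimately show "conv (cexp (\<lambda>x. smul B (of_real (- 1)) (clog \<omega> x))) \<omega> = cunit"
    by (simp add: cexp_clog charsD[OF assms])
qed

abbreviation cgroup :: "('h \<Rightarrow> 'b) monoid" where
  "cgroup \<equiv> character_group scaleH \<Delta> \<epsilon> B"

lemma cgroup_simps [simp]:
  "carrier cgroup = chars" "x \<otimes>\<^bsub>cgroup\<^esub> y = conv x y" "\<one>\<^bsub>cgroup\<^esub> = cunit"
  by (simp_all add: character_group_def)

lemma group_cgroup: "group cgroup"
proof (rule groupI)
  fix x assume "x \<in> carrier cgroup"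
  then show "\<exists>y\<in>carrier cgroup. y \<otimes>\<^bsub>cgroup\<^esub> x = \<one>\<^bsub>cgroup\<^esub>"
    using conv_inverse[of x] by auto
qed (auto simp: conv_chars cunit_chars conv_assoc conv_unit_left charsD(1))

lemma inv_cgroup: "\<omega> \<in> chars \<Longrightarrow> inv\<^bsub>cgroup\<^esub> \<omega> = cexp (\<lambda>x. smul B (of_real (- 1)) (clog \<omega> x))"
  using group.inv_equality[OF group_cgroup, of "cexp (\<lambda>x. smul B (of_real (- 1)) (clog \<omega> x))" \<omega>] conv_inverse[of \<omega>]
  by simp

text \<open>A linear projection of \<open>H\<close> along \<open>K 1 + (ker \<epsilon>)\<^sup>2\<close>; composition with it projects onto the infinitesimal characters.\<close>

lemma indecomposables_projection:
  obtains q where "Vector_Spaces.linear scaleH scaleH q"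
    "\<And>\<phi>. \<lbrakk>lin \<phi>; \<phi> 1 = 0\<rbrakk> \<Longrightarrow> \<phi> \<circ> q \<in> ichars" "\<And>\<phi>. \<phi> \<in> ichars \<Longrightarrow> \<phi> \<circ> q = \<phi>"
proof -
  interpret HH: vector_space_pair scaleH scaleH ..
  \<comment> \<open>A linear map is an infinitesimal character exactly when it vanishes on
    D.\<close>
  define D where "D = insert 1 {a * b | a b. \<epsilon> a = 0 \<and> \<epsilon> b = 0}"
  obtain b0 where b0: "b0 \<subseteq> span D" "independent b0" "span D \<subseteq> span b0"
    using basis_exists[of "span D"] by metis
  define b1 where "b1 = extend_basis b0"
  have b1: "b0 \<subseteq> b1" "independent b1" "span b1 = UNIV"
    using extend_basis_superset[OF b0(2)] independent_extend_basis[OF b0(2)] span_extend_basis[OF b0(2)]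
    by (auto simp: b1_def)
  \<comment> \<open>Kills a basis of the span of D and fixes the remaining vectors of a basis of H,
    so q is a projection along that span.\<close>
  define q where "q = HH.construct b1 (\<lambda>b. if b \<in> b0 then 0 else b)"
  have q: "Vector_Spaces.linear scaleH scaleH q"
    unfolding q_def by (rule HH.linear_construct[OF b1(2)])
  have q_basis: "q b = (if b \<in> b0 then 0 else b)" if "b \<in> b1" for b
    unfolding q_def using HH.construct_basis[OF b1(2) that] .
  have qN: "q x = 0" if "x \<in> span b0" for x
    by (rule HH.linear_eq_0_on_span[OF q _ that]) (use q_basis b1(1) in auto)
  have qD: "q x = 0" if "x \<in> D" for x
    using qN b0(3) span_base[OF that] by blast
  have diff: "x - q x \<in> span D" for x
  proof -
    have "x \<in> span b1" using b1(3) by simp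
    then show ?thesis
    proof (induction rule: span_induct_alt)
      case base
      then show ?case by (simp add: HH.linear_0[OF q] span_zero)
    next
      case (step c b y)
      have "b - q b \<in> span D"
        using q_basis[OF step(1)] b0(1) by (auto simp: span_zero)
      then have "scaleH c (b - q b) + (y - q y) \<in> span D"
        using step(2) by (intro span_add span_scale)
      then show ?case
        by (simp add: HH.linear_add[OF q] HH.linear_scale[OF q] scale_right_diff_distrib algebra_simps)
    qed
  qed
  show ?thesis
  proof (rule that[OF q])
    fix \<phi> assume \<phi>: "lin \<phi>" "\<phi> 1 = 0"
    have lq: "lin (\<phi> \<circ> q)"
      using Vector_Spaces.linear_compose[OF q \<phi>(1)] .
    have "q (x * y) = scaleH (\<epsilon> x) (q y) + scaleH (\<epsilon> y) (q x)" for x y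
    proof -
      have 0: "\<epsilon> (z - scaleH (\<epsilon> z) 1) = 0" for z
        using epsilon_linear(1)[of "z - scaleH (\<epsilon> z) 1" "scaleH (\<epsilon> z) 1"] by (simp add: epsilon_linear counit_one)
      \<comment> \<open>Both factors lie in the kernel of the counit, so q kills their product;
        expanding it gives the derivation rule for q.\<close>
      let ?x = "x - scaleH (\<epsilon> x) 1" and ?y = "y - scaleH (\<epsilon> y) 1"
      have "?x * ?y \<in> D" unfolding D_def using 0 by blast
      then have "q (?x * ?y) = 0" by (rule qD)
      moreover have "?x * ?y = x * y - scaleH (\<epsilon> y) x - scaleH (\<epsilon> x) y + scaleH (\<epsilon> x * \<epsilon> y) 1"
        by (simp add: algebra_simps scale_mult_left scale_mult_right)
      moreover have "q 1 = 0" by (rule qD) (simp add: D_def)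
      ultimately have "q (x * y) - scaleH (\<epsilon> y) (q x) - scaleH (\<epsilon> x) (q y) = 0"
        by (simp add: HH.linear_add[OF q] HH.linear_diff[OF q] HH.linear_scale[OF q])
      then show ?thesis by (simp add: algebra_simps)
    qed
    then show "\<phi> \<circ> q \<in> ichars"
      using lq \<phi>(1) by (simp add: infinitesimal_characters_def lin_iff)
  next
    fix \<phi> assume \<phi>: "\<phi> \<in> ichars"
    have "\<phi> x = 0" if "x \<in> D" for x
      using that icharsD(2)[OF \<phi>] ichars_one[OF \<phi>] by (auto simp: D_def)
    then have "\<phi> x = 0" if "x \<in> span D" for x
      by (rule HB.linear_eq_0_on_span[OF icharsD(1)[OF \<phi>] _ that])
    from this[OF diff] show "\<phi> \<circ> q = \<phi>"
      by (simp add: fun_eq_iff HB.linear_diff[OF icharsD(1)[OF \<phi>]])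
  qed
qed

end

section \<open>Analyticity of convolution series for the topology of pointwise convergence\<close>

section \<open>Analytic functional calculus\<close>

text \<open>Complexification commutes with forming function spaces: a pair of functions is regarded
  as one function with values in the complexification, smoothness is checked there value by value,
  and a continuous linear map takes the result apart again.\<close>

lemma smooth_on_complexification_fun:
  fixes F :: "('k::real_normed_field, 'w::ab_group_add) tvs" and g :: "'v::ab_group_add \<Rightarrow> ('i \<Rightarrow> 'w) \<times> ('i \<Rightarrow> 'w)"
  assumes E: "lcs E" and F: "lcs F"
    and S: "fun_subspace F S" and cl: "closedin (product_topology (\<lambda>_. vtop F) UNIV) S"
    and U: "openin (vtop E) U" and g: "g \<in> U \<rightarrow> S \<times> S"
    and sm: "\<And>i. smooth_on E (complexification F) U (\<lambda>x. (fst (g x) i, snd (g x) i))"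
  shows "smooth_on E (complexification (fun_tvs F S)) U g"
proof -
  interpret F: locally_convex_space F by fact
  let ?F = "complexification F"
  define SC where "SC = {f :: 'i \<Rightarrow> 'w \<times> 'w. (\<lambda>i. fst (f i)) \<in> S \<and> (\<lambda>i. snd (f i)) \<in> S}"
  note FC = lcs_complexification[OF F]
  interpret FS: locally_convex_space "fun_tvs F S" by (rule lcs_fun[OF F S])
  note cFS = vcarrier_fun_tvs[OF S]
  have Sc: "f i \<in> vcarrier F" if "f \<in> S" for f i using S that by (simp add: fun_subspace_def)
  have S_add: "(\<lambda>i. f i + h i) \<in> S" if "f \<in> S" "h \<in> S" for f h
    using S that by (auto simp: fun_subspace_def plus_fun_def)
  have S_smul: "(\<lambda>i. smul F a (f i)) \<in> S" if "f \<in> S" for f a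
    using S that by (auto simp: fun_subspace_def)
  have S_diff: "(\<lambda>i. f i - h i) \<in> S" if "f \<in> S" "h \<in> S" for f h
    using FS.diff_closed[of f h] that by (simp add: cFS fun_diff_def)
  have SC: "fun_subspace ?F SC"
    unfolding fun_subspace_def
  proof (intro conjI ballI allI)
    show "0 \<in> SC" using S by (simp add: SC_def fun_subspace_def zero_fun_def)
    show "f i \<in> vcarrier ?F" if "f \<in> SC" for f i
      using that Sc by (auto simp: SC_def mem_Times_iff)
  qed (auto simp: SC_def S_add S_smul S_diff)
  let ?P = "product_topology (\<lambda>_. vtop F) (UNIV :: 'i set)" and ?PC = "product_topology (\<lambda>_. vtop ?F) (UNIV :: 'i set)"
  have proj: "continuous_map ?PC (prod_topology (vtop F) (vtop F)) (\<lambda>f. f i)" for i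
    using continuous_map_product_projection[of i UNIV "\<lambda>_. vtop ?F"] by simp
  have "continuous_map ?PC ?P (\<lambda>f i. fst (f i))" "continuous_map ?PC ?P (\<lambda>f i. snd (f i))"
    unfolding continuous_map_componentwise_UNIV
    by (intro allI continuous_map_fst_comp[OF proj] continuous_map_snd_comp[OF proj])+
  from this[THEN closedin_continuous_map_preimage, OF cl]
  have "closedin ?PC ({f \<in> topspace ?PC. (\<lambda>i. fst (f i)) \<in> S} \<inter> {f \<in> topspace ?PC. (\<lambda>i. snd (f i)) \<in> S})"
    by (intro closedin_Int)
  also have "{f \<in> topspace ?PC. (\<lambda>i. fst (f i)) \<in> S} \<inter> {f \<in> topspace ?PC. (\<lambda>i. snd (f i)) \<in> S} = SC"
  proof -
    have "f \<in> topspace ?PC" if "(\<lambda>i. fst (f i)) \<in> S" "(\<lambda>i. snd (f i)) \<in> S" for f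
      using Sc[OF that(1)] Sc[OF that(2)] by (simp add: PiE_UNIV_domain mem_Times_iff)
    then show ?thesis unfolding SC_def by blast
  qed
  finally have SCcl: "closedin ?PC SC" .
  define h where "h x i = (fst (g x) i, snd (g x) i)" for x i
  have "smooth_on E (fun_tvs ?F SC) U h"
  proof (rule smooth_on_fun[OF E FC SC SCcl U])
    show "h \<in> U \<rightarrow> SC" using funcset_mem[OF g] by (auto simp: h_def SC_def mem_Times_iff)
  qed (simp add: h_def sm)
  moreover have "continuous_linear (fun_tvs ?F SC) (complexification (fun_tvs F S)) (\<lambda>f. (\<lambda>i. fst (f i), \<lambda>i. snd (f i)))"
    unfolding continuous_linear_def
  proof (intro conjI ballI allI)
    have c: "continuous_map (vtop (fun_tvs ?F SC)) (prod_topology (vtop F) (vtop F)) (\<lambda>f. f i)" for i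
      using continuous_map_fun_tvs_apply[of ?F SC i] by simp
    show "continuous_map (vtop (fun_tvs ?F SC)) (vtop (complexification (fun_tvs F S))) (\<lambda>f. (\<lambda>i. fst (f i), \<lambda>i. snd (f i)))"
      unfolding vtop_complexification
      by (intro continuous_map_pairedI continuous_map_fun_tvs[THEN iffD2] conjI allI
          continuous_map_fst_comp[OF c] continuous_map_snd_comp[OF c])
         (simp_all add: vcarrier_fun_tvs[OF SC] Pi_iff, simp_all add: SC_def)
  qed (auto simp: fun_eq_iff)
  ultimately have "smooth_on E (complexification (fun_tvs F S)) U (\<lambda>x. (\<lambda>i. fst (h x i), \<lambda>i. snd (h x i)))"
    by (intro smooth_on_compose_linear[OF E lcs_fun[OF FC SC]
          lcs_complexification[OF FS.locally_convex_space_axioms]])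
  then show ?thesis by (simp add: h_def)
qed

context hopf_characters
begin

definition Lin :: "('h \<Rightarrow> 'b) set" where "Lin = {\<phi>. lin \<phi>}"

definition E0 :: "('h \<Rightarrow> 'b) set" where "E0 = {\<phi>. lin \<phi> \<and> \<phi> 1 = 0}"

lemma Lin_iff: "\<phi> \<in> Lin \<longleftrightarrow> lin \<phi>" and E0_iff: "\<phi> \<in> E0 \<longleftrightarrow> lin \<phi> \<and> \<phi> 1 = 0"
  by (simp_all add: Lin_def E0_def)

text \<open>The full Hom space, followed by the model of the affine manifold \<open>M'\<close> and
  the model of the character manifold \<open>M\<close>, all with pointwise convergence.\<close>

abbreviation A :: "('k, 'h \<Rightarrow> 'b) tvs" where "A \<equiv> fun_tvs B Lin"
abbreviation E :: "('k, 'h \<Rightarrow> 'b) tvs" where "E \<equiv> fun_tvs B E0"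
abbreviation F :: "('k, 'h \<Rightarrow> 'b) tvs" where "F \<equiv> fun_tvs B ichars"

abbreviation M' :: "('k, 'h \<Rightarrow> 'b, 'h \<Rightarrow> 'b) manifold" where "M' \<equiv> affine_hom_manifold scaleH \<epsilon> B"
abbreviation M :: "('k, 'h \<Rightarrow> 'b, 'h \<Rightarrow> 'b) manifold" where "M \<equiv> character_manifold scaleH \<epsilon> B"

abbreviation PT :: "('h \<Rightarrow> 'b) topology" where "PT \<equiv> product_topology (\<lambda>_. vtop B) UNIV"

lemma topspace_PT: "topspace PT = UNIV"
  by (simp add: PiE_UNIV_domain carrier_UNIV)

lemma hom_tvs_eq: "hom_tvs scaleH B = A"
  by (simp add: hom_tvs_def fun_tvs_def Lin_def)

lemma model_M': "model M' = E"
proof -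
  have "Lin \<inter> {\<phi>. \<phi> 1 = 0} = E0" by (auto simp: Lin_iff E0_iff)
  then show ?thesis
    by (simp add: affine_hom_manifold_def Let_def hom_tvs_eq subspace_tvs_def fun_tvs_def subtopology_subtopology)
qed

lemma ichars_subset: "ichars \<subseteq> E0"
  by (auto simp: E0_iff icharsD(1) ichars_one)

lemma model_M: "model M = F"
proof -
  have "E0 \<inter> ichars = ichars" using ichars_subset by blast
  then show ?thesis
    by (simp add: character_manifold_def submanifold_def model_M' subspace_tvs_def fun_tvs_def subtopology_subtopology)
qed

definition S1 :: "('h \<Rightarrow> 'b) set" where "S1 = {\<phi>. lin \<phi> \<and> \<phi> 1 = 1}"

lemma chars_subset: "chars \<subseteq> S1"
  by (auto simp: S1_def charsD)

lemma mtop_M': "mtop M' = subtopology PT S1"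
proof -
  have "Lin \<inter> {\<phi>. \<phi> 1 = 1} = S1" by (auto simp: Lin_iff S1_def)
  then show ?thesis
    by (simp add: affine_hom_manifold_def Let_def hom_tvs_eq fun_tvs_def subtopology_subtopology)
qed

lemma mtop_M: "mtop M = subtopology PT chars"
proof -
  have "S1 \<inter> chars = chars" using chars_subset by blast
  then show ?thesis
    by (simp add: character_manifold_def submanifold_def mtop_M' subtopology_subtopology)
qed

lemma fun_subspace_Lin: "fun_subspace B Lin"
  and fun_subspace_E0: "fun_subspace B E0"
  and fun_subspace_ichars: "fun_subspace B ichars"
  by (auto simp: fun_subspace_def Lin_iff E0_iff carrier_UNIV lin_zero lin_add lin_scale ichars_zero ichars_add ichars_scale
      simp del: plus_fun_apply) (simp_all)

lemma vcarrier_A [simp]: "vcarrier A = Lin" and vcarrier_E [simp]: "vcarrier E = E0" and vcarrier_F [simp]: "vcarrier F = ichars"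
  by (rule vcarrier_fun_tvs, rule fun_subspace_Lin fun_subspace_E0 fun_subspace_ichars)+

lemma atlas_M': "atlas M' = {(S1, \<lambda>\<phi>. \<phi> - cunit)}"
proof -
  have "{\<phi> \<in> Lin. \<phi> 1 = 1} = S1" by (auto simp: Lin_iff S1_def)
  then show ?thesis by (simp add: affine_hom_manifold_def Let_def hom_tvs_eq)
qed

lemma lcs_A: "lcs A" and lcs_E: "lcs E" and lcs_F: "lcs F"
  by (rule lcs_fun[OF lcs], rule fun_subspace_Lin fun_subspace_E0 fun_subspace_ichars)+

lemma continuous_PT_apply: "continuous_map PT (vtop B) (\<lambda>\<phi>. \<phi> x)"
  by (rule continuous_map_product_projection) simp

lemma closedin_PT_eq:
  assumes "continuous_map PT (vtop B) f" "continuous_map PT (vtop B) g"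
  shows "closedin PT {\<phi>. f \<phi> = g \<phi>}"
  using closedin_continuous_maps_eq[OF LB.hausdorff assms] by (simp add: PiE_UNIV_domain carrier_UNIV)

lemma closedin_Lin: "closedin PT Lin"
proof -
  have "Lin = (\<Inter>x. \<Inter>y. {\<phi>. \<phi> (x + y) = \<phi> x + \<phi> y}) \<inter> (\<Inter>c. \<Inter>x. {\<phi>. \<phi> (scaleH c x) = smul B c (\<phi> x)})"
    by (auto simp: Lin_iff lin_iff)
  also have "closedin PT \<dots>"
    by (intro closedin_Int closedin_INT closedin_PT_eq continuous_PT_apply LB.continuous_map_add' LB.continuous_map_smul_const UNIV_not_empty)
  finally show ?thesis .
qed

lemma continuous_linear_inclusion: "S \<subseteq> T \<Longrightarrow> continuous_linear (fun_tvs B S) (fun_tvs B T) (\<lambda>\<phi>. \<phi>)"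
  unfolding continuous_linear_def continuous_map_fun_tvs
  by (auto simp: continuous_map_fun_tvs_apply) (auto simp: vtop_fun_tvs)

lemma bilinear_B: "continuous_bilinear B B B (*)"
  using continuous_mult
  by (simp add: continuous_bilinear_def case_prod_unfold distrib_left distrib_right smul_mult mult_smul)

lemma continuous_map_mult_B:
  assumes "continuous_map X (vtop B) f" "continuous_map X (vtop B) g"
  shows "continuous_map X (vtop B) (\<lambda>x. f x * g x)"
  using continuous_map_compose[OF continuous_map_pairedI[OF assms] continuous_bilinearD(1)[OF bilinear_B]] by (simp add: o_def)

text \<open>At each x the convolution is a finite sum of products of evaluations, so continuity of
  the product of B gives joint continuity for pointwise convergence.\<close>

lemma bilinear_conv: "continuous_bilinear A A A conv"
proof -
  have ap: "continuous_map (vtop A) (vtop B) (\<lambda>\<phi>. \<phi> x)" for x by (rule continuous_map_fun_tvs_apply)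
  have "continuous_map (prod_topology (vtop A) (vtop A)) (vtop A) (\<lambda>p. conv (fst p) (snd p))"
    unfolding continuous_map_fun_tvs[of _ B Lin]
  proof (intro conjI allI)
    show "(\<lambda>p. conv (fst p) (snd p)) \<in> topspace (prod_topology (vtop A) (vtop A)) \<rightarrow> Lin"
      by (auto simp: Lin_iff lin_conv)
    fix x
    have "continuous_map (prod_topology (vtop A) (vtop A)) (vtop B) (\<lambda>p. \<Sum>q\<leftarrow>cop x. fst p (fst q) * snd p (snd q))"
      by (intro LB.continuous_map_sum_list' continuous_map_mult_B)
         (use continuous_map_compose[OF continuous_map_fst ap] continuous_map_compose[OF continuous_map_snd ap] in \<open>simp_all add: o_def\<close>)
    then show "continuous_map (prod_topology (vtop A) (vtop A)) (vtop B) (\<lambda>p. conv (fst p) (snd p) x)"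
      by (rule continuous_map_eq) (auto simp: conv_cop Lin_iff case_prod_unfold)
  qed
  then show ?thesis
    by (simp add: continuous_bilinear_def Lin_iff conv_add_left conv_add_right conv_scale_left conv_scale_right del: plus_fun_apply)
qed

text \<open>The components of the powers of \<open>\<phi> + i \<psi>\<close> in the complexified convolution algebra.\<close>

primrec cpow_complex :: "('h \<Rightarrow> 'b) \<times> ('h \<Rightarrow> 'b) \<Rightarrow> nat \<Rightarrow> ('h \<Rightarrow> 'b) \<times> ('h \<Rightarrow> 'b)" where
  "cpow_complex z 0 = (cunit, 0)"
| "cpow_complex z (Suc n) =
    (conv (fst z) (fst (cpow_complex z n)) - conv (snd z) (snd (cpow_complex z n)),
     conv (fst z) (snd (cpow_complex z n)) + conv (snd z) (fst (cpow_complex z n)))"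

lemma lin_cpow_complex:
  assumes "lin (fst z)" "lin (snd z)"
  shows "lin (fst (cpow_complex z n)) \<and> lin (snd (cpow_complex z n))"
proof (induction n)
  case (Suc n)
  then show ?case using assms by (simp add: lin_add lin_diff lin_conv del: plus_fun_apply minus_apply)
qed (use lin_cunit lin_zero in \<open>simp_all add: zero_fun_def\<close>)

lemma vanishes_below_add: "\<lbrakk>vanishes_below n \<phi>; vanishes_below n \<psi>\<rbrakk> \<Longrightarrow> vanishes_below n (\<phi> + \<psi>)"
  and vanishes_below_diff: "\<lbrakk>vanishes_below n \<phi>; vanishes_below n \<psi>\<rbrakk> \<Longrightarrow> vanishes_below n (\<phi> - \<psi>)"
  by (auto simp: vanishes_below_def)

lemma vanishes_below_cpow_complex:
  assumes "fst z \<in> E0" "snd z \<in> E0"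
  shows "vanishes_below n (fst (cpow_complex z n)) \<and> vanishes_below n (snd (cpow_complex z n))"
proof (induction n)
  case 0
  then show ?case by (simp add: vanishes_below_def)
next
  case (Suc n)
  have l: "lin (fst z)" "lin (snd z)" "fst z 1 = 0" "snd z 1 = 0" using assms by (auto simp: E0_iff)
  show ?case
    unfolding cpow_complex.simps fst_conv snd_conv
    unfolding plus_1_eq_Suc[symmetric]
    using lin_cpow_complex[OF l(1,2), of n] Suc l
    by (intro conjI vanishes_below_add vanishes_below_diff vanishes_below_conv vanishes_below_one) auto
qed

lemma cpow_complex_real: "lin \<phi> \<Longrightarrow> cpow_complex (\<phi>, 0) n = (cpow \<phi> n, 0)"
proof (induction n)
  case (Suc n)
  have 0: "conv 0 \<psi> = 0" "conv \<psi> 0 = 0" if "lin \<psi>" for \<psi>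
    using that by (auto simp: fun_eq_iff conv_cop lin_zero intro!: sum_list_zero)
  show ?case
    using Suc by (simp add: 0 lin_cpow lin_zero del: zero_fun_apply)
qed simp

lemma smooth_cpow_complex:
  "smooth_on (complexification E) (complexification B) (vcarrier (complexification E))
    (\<lambda>z. (fst (cpow_complex z n) x, snd (cpow_complex z n) x))"
proof (induction n arbitrary: x)
  note EC = lcs_complexification[OF lcs_E] and BC = lcs_complexification[OF lcs]
  case 0
  then show ?case
    by (simp only: cpow_complex.simps fst_conv snd_conv, intro smooth_on_const EC BC openin_topspace) (simp add: carrier_UNIV)
next
  note EC = lcs_complexification[OF lcs_E] and BC = lcs_complexification[OF lcs]
  case (Suc n)
  \<comment> \<open>The product of the complexified algebra, written in real and imaginary
    parts.\<close>
  let ?m = "\<lambda>x y. (fst x * fst y - snd x * snd y, fst x * snd y + snd x * fst y)"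
  have ev: "smooth_on (complexification E) (complexification B) (vcarrier (complexification E)) (\<lambda>z. (fst z a, snd z a))" for a
    using smooth_on_linear[OF EC BC continuous_linear_complexification[OF lcs_E continuous_linear_fun_apply] openin_topspace]
    by simp
  have "smooth_on (complexification E) (complexification B) (vcarrier (complexification E))
      (\<lambda>z. \<Sum>q\<leftarrow>cop x. ?m (fst z (fst q), snd z (fst q)) (fst (cpow_complex z n) (snd q), snd (cpow_complex z n) (snd q)))"
    by (intro smooth_on_sum_list[OF EC BC openin_topspace]
        smooth_on_bilinear_compose[OF EC BC BC BC continuous_bilinear_complexification[OF lcs lcs lcs bilinear_B] ev Suc.IH])
  then show ?case
  proof (rule smooth_on_cong[OF EC BC])
    fix z assume "z \<in> vcarrier (complexification E)"
    then have l: "lin (fst z)" "lin (snd z)" by (auto simp: E0_iff)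
    have pair: "(\<Sum>q\<leftarrow>xs. (f q, g q)) = (\<Sum>q\<leftarrow>xs. f q, \<Sum>q\<leftarrow>xs. g q)" for xs :: "('h \<times> 'h) list" and f g :: "_ \<Rightarrow> 'b"
      by (induction xs) (auto simp: zero_prod_def)
    show "(\<Sum>q\<leftarrow>cop x. ?m (fst z (fst q), snd z (fst q)) (fst (cpow_complex z n) (snd q), snd (cpow_complex z n) (snd q))) =
        (fst (cpow_complex z (Suc n)) x, snd (cpow_complex z (Suc n)) x)"
      using lin_cpow_complex[OF l, of n] l
      by (simp add: pair conv_cop case_prod_unfold sum_list_addf sum_list_subtractf)
  qed
qed

definition ser_complex :: "real fps \<Rightarrow> ('h \<Rightarrow> 'b) \<times> ('h \<Rightarrow> 'b) \<Rightarrow> ('h \<Rightarrow> 'b) \<times> ('h \<Rightarrow> 'b)" where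
  "ser_complex r z = ((\<lambda>x. \<Sum>n\<le>deg x. smul B (of_real (fps_nth r n)) (fst (cpow_complex z n) x)),
    (\<lambda>x. \<Sum>n\<le>deg x. smul B (of_real (fps_nth r n)) (snd (cpow_complex z n) x)))"

lemma smooth_ser_complex:
  "smooth_on (complexification E) (complexification A) (vcarrier (complexification E)) (ser_complex r)"
proof (rule smooth_on_complexification_fun[OF _ lcs fun_subspace_Lin closedin_Lin openin_topspace])
  note EC = lcs_complexification[OF lcs_E] and BC = lcs_complexification[OF lcs]
  show "lcs (complexification E)" by (rule EC)
  show "ser_complex r \<in> vcarrier (complexification E) \<rightarrow> Lin \<times> Lin"
  proof
    fix z assume "z \<in> vcarrier (complexification E)"
    then have z: "fst z \<in> E0" "snd z \<in> E0" by auto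
    then have l: "lin (fst z)" "lin (snd z)" by (auto simp: E0_iff)
    show "ser_complex r z \<in> Lin \<times> Lin"
      using lin_cpow_complex[OF l] vanishes_below_cpow_complex[OF z]
      by (auto simp: ser_complex_def Lin_iff intro!: lin_graded_sum lin_scale vanishes_below_scale)
  qed
  fix x
  have "smooth_on (complexification E) (complexification B) (vcarrier (complexification E))
    (\<lambda>z. \<Sum>n\<le>deg x. smul (complexification B) (of_real (fps_nth r n)) (fst (cpow_complex z n) x, snd (cpow_complex z n) x))"
    by (intro smooth_on_sum[OF EC BC openin_topspace] smooth_on_smul[OF EC BC] smooth_cpow_complex)
  moreover have "(\<Sum>n\<in>I. smul (complexification B) (of_real (r n)) (f n, g n)) =
      (\<Sum>n\<in>I. smul B (of_real (r n)) (f n), \<Sum>n\<in>I. smul B (of_real (r n)) (g n))"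
    for I :: "nat set" and r :: "nat \<Rightarrow> real" and f g
    by (induction I rule: infinite_finite_induct) (auto simp: zero_prod_def)
  ultimately show "smooth_on (complexification E) (complexification B) (vcarrier (complexification E))
    (\<lambda>z. (fst (ser_complex r z) x, snd (ser_complex r z) x))"
    by (simp only: ser_complex_def fst_conv snd_conv)
qed

lemma smooth_cpow: "smooth_on E B E0 (\<lambda>\<phi>. cpow \<phi> n x)"
proof (induction n arbitrary: x)
  have op: "openin (vtop E) E0" using openin_topspace[of "vtop E"] by simp
  case 0
  then show ?case using smooth_on_const[OF lcs_E lcs op] by (simp add: carrier_UNIV)
next
  have op: "openin (vtop E) E0" using openin_topspace[of "vtop E"] by simp
  case (Suc n)
  have "smooth_on E B E0 (\<lambda>\<phi>. \<Sum>q\<leftarrow>cop x. \<phi> (fst q) * cpow \<phi> n (snd q))"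
    by (intro smooth_on_sum_list[OF lcs_E lcs op] smooth_on_bilinear_compose[OF lcs_E lcs lcs lcs bilinear_B] Suc.IH
        smooth_on_linear[OF lcs_E lcs continuous_linear_fun_apply op])
  then show ?case
    by (rule smooth_on_cong[OF lcs_E lcs]) (simp add: E0_iff conv_cop lin_cpow case_prod_unfold)
qed

lemma ser_Lin: "\<phi> \<in> E0 \<Longrightarrow> ser r \<phi> \<in> Lin"
  by (simp add: Lin_iff E0_iff lin_ser)

text \<open>Over the reals, \<open>ser_complex\<close> is an extension to the whole complexification
  and restricts to \<open>ser\<close> at real points because the coefficients are real. Over the
  complex numbers smoothness is checked value by value, each value being a finite sum of convolution
  powers.\<close>

lemma analytic_ser: "analytic_map_on E A E0 (ser r)"
proof (cases "range (of_real :: real \<Rightarrow> 'k) = UNIV")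
  have op: "openin (vtop E) E0" using openin_topspace[of "vtop E"] by simp
  case True
  show ?thesis
  proof (rule analytic_map_onI_real[OF True op _ smooth_ser_complex])
    show "ser r \<in> E0 \<rightarrow> vcarrier A" using ser_Lin by simp
    fix \<phi> assume \<phi>: "\<phi> \<in> E0"
    then show "(\<phi>, 0) \<in> vcarrier (complexification E) \<and> ser_complex r (\<phi>, 0) = (ser r \<phi>, 0)"
      using fun_subspace_E0
      by (auto simp: ser_complex_def cpow_complex_real E0_iff ser_def fun_eq_iff fun_subspace_def)
  qed
next
  have op: "openin (vtop E) E0" using openin_topspace[of "vtop E"] by simp
  case False
  have "smooth_on E B E0 (\<lambda>\<phi>. ser r \<phi> x)" for x
    unfolding ser_def
    by (intro smooth_on_sum[OF lcs_E lcs op] smooth_on_smul[OF lcs_E lcs] smooth_cpow)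
  then have "smooth_on E A E0 (ser r)"
    by (intro smooth_on_fun[OF lcs_E lcs fun_subspace_Lin closedin_Lin op]) (auto simp: ser_Lin)
  then show ?thesis using False by (simp add: analytic_map_on_complex)
qed

text \<open>The projection of the Hom space onto the maps vanishing at 1, along multiples of the
  counit. It corrects the codomain of analytic maps from \<open>A\<close> to \<open>E\<close>, and
  on maps with value 1 at 1 it is subtraction of \<open>cunit\<close>.\<close>

lemma continuous_linear_augmentation: "continuous_linear A E (\<lambda>\<phi> x. \<phi> x - smul B (\<epsilon> x) (\<phi> 1))"
  unfolding continuous_linear_def continuous_map_fun_tvs
proof (intro conjI allI ballI)
  have "lin (\<lambda>x. smul B (\<epsilon> x) b)" for b
    by (simp add: lin_iff epsilon_linear VB.scale_left_distrib)
  then show "(\<lambda>\<phi> x. \<phi> x - smul B (\<epsilon> x) (\<phi> 1)) \<in> vcarrier A \<rightarrow> E0"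
    using lin_diff[of _ "\<lambda>x. smul B (\<epsilon> x) b" for b] by (auto simp: E0_iff Lin_iff counit_one fun_diff_def)
  show "continuous_map (vtop A) (vtop B) (\<lambda>\<phi>. \<phi> x - smul B (\<epsilon> x) (\<phi> 1))" for x
    by (intro LB.continuous_map_diff' LB.continuous_map_smul_const continuous_map_fun_tvs_apply)
qed (auto simp: fun_eq_iff VB.scale_right_distrib VB.scale_right_diff_distrib mult.commute)

lemma analytic_ser_E:
  assumes "fps_nth r 0 = 0"
  shows "analytic_map_on E E E0 (ser r)"
  by (rule analytic_map_on_cong[OF lcs_E lcs_E analytic_map_on_compose_linear[OF lcs_E lcs_A lcs_E analytic_ser[of r] continuous_linear_augmentation]])
     (simp add: E0_iff ser_at_one assms)

text \<open>Precomposition with a fixed map of H is continuous for pointwise convergence, so the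
  algebraic projection of H induces a topological one of \<open>E\<close>.\<close>

lemma continuous_linear_projection:
  obtains p where "continuous_linear E F p" "\<And>\<phi>. \<phi> \<in> ichars \<Longrightarrow> p \<phi> = \<phi>"
proof -
  obtain q where q: "\<And>\<phi>. \<lbrakk>lin \<phi>; \<phi> 1 = 0\<rbrakk> \<Longrightarrow> \<phi> \<circ> q \<in> ichars" "\<And>\<phi>. \<phi> \<in> ichars \<Longrightarrow> \<phi> \<circ> q = \<phi>"
    by (rule indecomposables_projection) blast
  have "continuous_linear E F (\<lambda>\<phi>. \<phi> \<circ> q)"
    unfolding continuous_linear_def continuous_map_fun_tvs
    using q(1) by (auto simp: E0_iff continuous_map_fun_tvs_apply fun_eq_iff)
  then show ?thesis by (rule that) (rule q(2))
qed

end

section \<open>Manifold maps, curves and tangent vectors read in one global chart\<close>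

section \<open>Manifolds with a global chart\<close>

lemma smooth_on_continuous_full:
  "smooth_on E F (vcarrier E) f \<Longrightarrow> continuous_map (vtop E) (vtop F) f"
  using smooth_on_continuous[of E F "vcarrier E" f] by (simp only: subtopology_topspace)

lemma topological_chart_open_image:
  assumes "topological_chart M c" "openin (mtop M) U" "U \<subseteq> fst c"
  shows "openin (vtop (model M)) (snd c ` U)"
proof -
  have "open_map (subtopology (mtop M) (fst c)) (subtopology (vtop (model M)) (snd c ` fst c)) (snd c)"
    using assms(1) homeomorphic_imp_open_map unfolding topological_chart_def by blast
  moreover have "openin (subtopology (mtop M) (fst c)) U"
    using assms(2,3) by (metis inf.absorb_iff1 openin_subtopology)
  ultimately have "openin (subtopology (vtop (model M)) (snd c ` fst c)) (snd c ` U)"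
    unfolding open_map_def by blast
  then show ?thesis
    using assms(1) openin_trans_full unfolding topological_chart_def by blast
qed

lemma topological_chart_inj:
  assumes "topological_chart M c" shows "inj_on (snd c) (fst c)"
proof -
  have "fst c \<subseteq> topspace (mtop M)" using assms openin_subset unfolding topological_chart_def by blast
  moreover have "inj_on (snd c) (topspace (subtopology (mtop M) (fst c)))"
    using assms homeomorphic_imp_injective_map unfolding topological_chart_def by blast
  ultimately show ?thesis by (simp add: Int_absorb1)
qed

lemma inv_into_map_prod:
  assumes "inj_on f A" "inj_on g B" "x \<in> f ` A" "y \<in> g ` B"
  shows "inv_into (A \<times> B) (map_prod f g) (x, y) = (inv_into A f x, inv_into B g y)"
proof (rule inv_into_f_eq)
  show "inj_on (map_prod f g) (A \<times> B)" using assms(1,2) by (rule map_prod_inj_on)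
qed (use assms in \<open>auto simp: inv_into_into f_inv_into_f\<close>)

lemma topological_chart_prod:
  assumes c: "topological_chart M c" and d: "topological_chart N d"
  shows "topological_chart (prod_manifold M N) (fst c \<times> fst d, map_prod (snd c) (snd d))"
proof -
  have im: "map_prod (snd c) (snd d) ` (fst c \<times> fst d) = snd c ` fst c \<times> snd d ` fst d"
    by (rule map_prod_surj_on) auto
  have "homeomorphic_map (prod_topology (subtopology (mtop M) (fst c)) (subtopology (mtop N) (fst d)))
     (prod_topology (subtopology (vtop (model M)) (snd c ` fst c)) (subtopology (vtop (model N)) (snd d ` fst d)))
     (\<lambda>p. (snd c (fst p), snd d (snd p)))"
  proof -
    obtain c' d' where "homeomorphic_maps (subtopology (mtop M) (fst c)) (subtopology (vtop (model M)) (snd c ` fst c)) (snd c) c'"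
      "homeomorphic_maps (subtopology (mtop N) (fst d)) (subtopology (vtop (model N)) (snd d ` fst d)) (snd d) d'"
      using c d unfolding topological_chart_def homeomorphic_map_maps by blast
    then have "homeomorphic_maps (prod_topology (subtopology (mtop M) (fst c)) (subtopology (mtop N) (fst d)))
     (prod_topology (subtopology (vtop (model M)) (snd c ` fst c)) (subtopology (vtop (model N)) (snd d ` fst d)))
     (\<lambda>(x, y). (snd c x, snd d y)) (\<lambda>(x, y). (c' x, d' y))"
      unfolding homeomorphic_maps_prod by simp
    then show ?thesis unfolding homeomorphic_map_maps case_prod_unfold by blast
  qed
  moreover have "map_prod (snd c) (snd d) = (\<lambda>p. (snd c (fst p), snd d (snd p)))"
    by (auto simp: fun_eq_iff)
  ultimately show ?thesis
    using c d im unfolding topological_chart_def prod_manifold_def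
    by (simp add: openin_prod_Times_iff) (simp add: subtopology_Times)
qed

lemma tangent_spaceD:
  assumes "v \<in> tangent_space M p"
  shows "c \<in> charts_at M p \<Longrightarrow> v c \<in> vcarrier (model M)" "c \<notin> charts_at M p \<Longrightarrow> v c = 0"
    "\<lbrakk>c \<in> charts_at M p; d \<in> charts_at M p\<rbrakk> \<Longrightarrow> v d = dir_deriv (model M) (model M) (transition c d) (snd c p) (v c)"
proof -
  note H = assms[unfolded tangent_space_def mem_Collect_eq]
  show "c \<in> charts_at M p \<Longrightarrow> v c \<in> vcarrier (model M)" by (rule H[THEN conjunct1, THEN bspec])
  show "c \<notin> charts_at M p \<Longrightarrow> v c = 0" by (rule H[THEN conjunct2, THEN conjunct1, THEN spec, THEN mp])
  show "\<lbrakk>c \<in> charts_at M p; d \<in> charts_at M p\<rbrakk> \<Longrightarrow> v d = dir_deriv (model M) (model M) (transition c d) (snd c p) (v c)"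
    by (rule H[THEN conjunct2, THEN conjunct2, THEN bspec, THEN bspec])
qed

lemma at_within_Icc_nontrivial: "t \<in> {0..1::real} \<Longrightarrow> at t within {0..1} \<noteq> bot"
proof -
  assume "t \<in> {0..1}"
  moreover have "\<not> (\<exists>a. {0..1::real} = {a})" by (metis atLeastAtMost_singleton_iff zero_neq_one)
  ultimately have "t islimpt {0..1}" by (intro connected_imp_perfect) auto
  then show ?thesis by (simp add: trivial_limit_within)
qed

lemma has_curve_deriv_cong:
  assumes "\<And>s. s \<in> I \<Longrightarrow> \<gamma> s = \<delta> s" "t \<in> I"
  shows "has_curve_deriv E I \<gamma> t v \<longleftrightarrow> has_curve_deriv E I \<delta> t v"
  unfolding has_curve_deriv_def
  by (rule iffI; erule limitin_transform_eventually[rotated]) (use assms in \<open>auto simp: eventually_at_filter\<close>)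

lemma has_curve_deriv_subset:
  assumes "has_curve_deriv E I \<gamma> t v" "J \<subseteq> I"
  shows "has_curve_deriv E J \<gamma> t v"
  using assms unfolding has_curve_deriv_def limitin_def
  by (meson at_le filter_leD)

text \<open>The chart l is defined everywhere, has the inverse \<open>ex\<close>, and every chart of
  the atlas is analytically related to it in both directions. Questions about maps, curves and
  tangent vectors can then be settled in l, whatever the other charts are.\<close>

locale global_chart =
  fixes M :: "('k::real_or_complex, 'e::ab_group_add, 'm) manifold" and l :: "'m \<Rightarrow> 'e" and ex :: "'e \<Rightarrow> 'm"
  assumes lcs: "lcs (model M)"
    and homeo: "homeomorphic_maps (mtop M) (vtop (model M)) l ex"
    and chart0: "(topspace (mtop M), l) \<in> atlas M"
    and charts: "c \<in> atlas M \<Longrightarrow> topological_chart M c"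
    and analytic_out: "c \<in> atlas M \<Longrightarrow> analytic_map_on (model M) (model M) (l ` fst c) (\<lambda>x. snd c (ex x))"
    and analytic_in: "c \<in> atlas M \<Longrightarrow> analytic_map_on (model M) (model M) (snd c ` fst c) (\<lambda>x. l (inv_into (fst c) (snd c) x))"
begin

abbreviation F where "F \<equiv> model M"
abbreviation carr where "carr \<equiv> topspace (mtop M)"

sublocale F: locally_convex_space "model M" by (rule lcs)

lemma l_carrier: "p \<in> carr \<Longrightarrow> l p \<in> vcarrier F"
  and ex_l: "p \<in> carr \<Longrightarrow> ex (l p) = p"
  and l_ex: "x \<in> vcarrier F \<Longrightarrow> l (ex x) = x"
  using homeo by (auto simp: homeomorphic_maps_def continuous_map_def)

lemma l_continuous: "continuous_map (mtop M) (vtop F) l"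
  and ex_continuous: "continuous_map (vtop F) (mtop M) ex"
  using homeo by (auto simp: homeomorphic_maps_def)

lemma chart_subset: "c \<in> atlas M \<Longrightarrow> p \<in> fst c \<Longrightarrow> p \<in> carr"
  using charts openin_subset unfolding topological_chart_def by blast

lemma chart_inv: "\<lbrakk>c \<in> atlas M; p \<in> fst c\<rbrakk> \<Longrightarrow> inv_into (fst c) (snd c) (snd c p) = p"
  by (rule inv_into_f_f[OF topological_chart_inj[OF charts]])

lemma chart_carrier: "\<lbrakk>c \<in> atlas M; p \<in> fst c\<rbrakk> \<Longrightarrow> snd c p \<in> vcarrier F"
  using charts openin_subset unfolding topological_chart_def by blast

lemma chart0_open_image: "openin (mtop M) U \<Longrightarrow> openin (vtop F) (l ` U)"
  using topological_chart_open_image[OF charts[OF chart0]] openin_subset by fastforce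

text \<open>Every chart change factors through l, as a map into l by \<open>analytic_in\<close>
  followed by a map out of l by \<open>analytic_out\<close>.\<close>

lemma transition_analytic:
  assumes c: "c \<in> atlas M" and d: "d \<in> atlas M"
  shows "analytic_map_on F F (snd c ` (fst c \<inter> fst d)) (transition c d)"
proof -
  have op: "openin (mtop M) (fst c \<inter> fst d)"
    using charts[OF c] charts[OF d] unfolding topological_chart_def by (intro openin_Int) auto
  have "analytic_map_on F F (snd c ` (fst c \<inter> fst d)) (\<lambda>x. snd d (ex (l (inv_into (fst c) (snd c) x))))"
  proof (rule analytic_map_on_compose[OF lcs lcs lcs _ analytic_out[OF d]])
    show "analytic_map_on F F (snd c ` (fst c \<inter> fst d)) (\<lambda>x. l (inv_into (fst c) (snd c) x))"
      by (rule analytic_map_on_subset[OF lcs analytic_in[OF c] topological_chart_open_image[OF charts[OF c] op]]) auto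
    show "(\<lambda>x. l (inv_into (fst c) (snd c) x)) ` snd c ` (fst c \<inter> fst d) \<subseteq> l ` fst d"
      using chart_inv[OF c] by auto
  qed
  then show ?thesis
    by (rule analytic_map_on_cong[OF lcs lcs]) (use chart_inv[OF c] chart_subset[OF c] in \<open>auto simp: transition_def ex_l\<close>)
qed

lemma analytic_manifold: "analytic_manifold M"
  unfolding analytic_manifold_def
proof (intro conjI ballI)
  show "Hausdorff_space (mtop M)"
    using homeo F.hausdorff homeomorphic_Hausdorff_space homeomorphic_space_def by blast
  show "(\<Union>c\<in>atlas M. fst c) = carr"
  proof
    show "(\<Union>c\<in>atlas M. fst c) \<subseteq> carr" using chart_subset by auto
    show "carr \<subseteq> (\<Union>c\<in>atlas M. fst c)" using chart0 by force
  qed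
  show "analytic_transition F c d" if "c \<in> atlas M" "d \<in> atlas M" for c d
    unfolding analytic_transition_def by (rule transition_analytic[OF that])
qed (rule lcs charts; assumption)+

text \<open>Stated for an abstract local notion P that is closed under restriction, equality on the
  domain and postcomposition with analytic maps, so that smooth and analytic maps share one proof.
  On the side of the target only the chart l has to be tested.\<close>

lemma manifold_map_into:
  assumes N: "\<And>c. c \<in> atlas N \<Longrightarrow> topological_chart N c"
    and U: "openin (mtop N) U" and f: "continuous_map (subtopology (mtop N) U) (mtop M) f"
    and comp: "\<And>V W g h. \<lbrakk>P (model N) F V h; analytic_map_on F F W g; h ` V \<subseteq> W\<rbrakk> \<Longrightarrow> P (model N) F V (\<lambda>x. g (h x))"
    and sub: "\<And>V V' h. \<lbrakk>P (model N) F V h; openin (vtop (model N)) V'; V' \<subseteq> V\<rbrakk> \<Longrightarrow> P (model N) F V' h"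
    and cong: "\<And>V h h'. \<lbrakk>P (model N) F V h; \<And>x. x \<in> V \<Longrightarrow> h x = h' x\<rbrakk> \<Longrightarrow> P (model N) F V h'"
    and P: "\<And>c. c \<in> atlas N \<Longrightarrow> P (model N) F (snd c ` (U \<inter> fst c)) (\<lambda>x. l (f (inv_into (fst c) (snd c) x)))"
  shows "manifold_map_on P N M U f"
  unfolding manifold_map_on_def
proof (intro conjI ballI U f)
  fix c d assume c: "c \<in> atlas N" and d: "d \<in> atlas M"
  let ?V = "{p \<in> U \<inter> fst c. f p \<in> fst d}"
  have inv: "inv_into (fst c) (snd c) (snd c p) = p" if "p \<in> fst c" for p
    by (rule inv_into_f_f[OF topological_chart_inj[OF N[OF c]] that])
  have fU: "f p \<in> carr" if "p \<in> U" for p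
    using that f openin_subset[OF U] by (auto simp: continuous_map_def)
  have cop: "openin (mtop N) (fst c)" using N[OF c] by (simp add: topological_chart_def)
  have "openin (mtop M) (fst d)" using charts[OF d] by (simp add: topological_chart_def)
  then have "openin (subtopology (mtop N) U) {p \<in> topspace (subtopology (mtop N) U). f p \<in> fst d}"
    by (rule openin_continuous_map_preimage[OF f])
  then have "openin (mtop N) {p \<in> topspace (subtopology (mtop N) U). f p \<in> fst d}"
    by (rule openin_trans_full[OF _ U])
  then have "openin (mtop N) ({p \<in> topspace (subtopology (mtop N) U). f p \<in> fst d} \<inter> fst c)"
    using cop by (rule openin_Int)
  also have "{p \<in> topspace (subtopology (mtop N) U). f p \<in> fst d} \<inter> fst c = ?V"
    using openin_subset[OF U] by auto
  finally have V: "openin (vtop (model N)) (snd c ` ?V)"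
    by (rule topological_chart_open_image[OF N[OF c]]) auto
  have "P (model N) F (snd c ` ?V) (\<lambda>x. snd d (ex (l (f (inv_into (fst c) (snd c) x)))))"
    by (rule comp[OF sub[OF P[OF c] V] analytic_out[OF d]]) (auto simp: inv)
  then show "P (model N) F (snd c ` ?V) (\<lambda>x. snd d (f (inv_into (fst c) (snd c) x)))"
    by (rule cong) (auto simp: inv ex_l fU)
qed

lemma analytic_map_into:
  assumes "lcs (model N)" "\<And>c. c \<in> atlas N \<Longrightarrow> topological_chart N c"
    "openin (mtop N) U" "continuous_map (subtopology (mtop N) U) (mtop M) f"
    "\<And>c. c \<in> atlas N \<Longrightarrow> analytic_map_on (model N) F (snd c ` (U \<inter> fst c)) (\<lambda>x. l (f (inv_into (fst c) (snd c) x)))"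
  shows "manifold_map_on analytic_map_on N M U f"
proof (rule manifold_map_into[where P = analytic_map_on, OF assms(2-4)])
  show "analytic_map_on (model N) F V (\<lambda>x. g (h x))"
    if "analytic_map_on (model N) F V h" "analytic_map_on F F W g" "h ` V \<subseteq> W" for V W g h
    by (rule analytic_map_on_compose[OF assms(1) lcs lcs]; fact)
  show "analytic_map_on (model N) F V' h" if "analytic_map_on (model N) F V h" "openin (vtop (model N)) V'" "V' \<subseteq> V" for V V' h
    by (rule analytic_map_on_subset[OF lcs]; fact)
  show "analytic_map_on (model N) F V h'" if "analytic_map_on (model N) F V h" "\<And>x. x \<in> V \<Longrightarrow> h x = h' x" for V h h'
    by (rule analytic_map_on_cong[OF assms(1) lcs that(1)]) (rule that(2))
qed (assumption, rule assms(5))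

lemma smooth_map_into:
  assumes "lcs (model N)" "\<And>c. c \<in> atlas N \<Longrightarrow> topological_chart N c"
    "openin (mtop N) U" "continuous_map (subtopology (mtop N) U) (mtop M) f"
    "\<And>c. c \<in> atlas N \<Longrightarrow> smooth_on (model N) F (snd c ` (U \<inter> fst c)) (\<lambda>x. l (f (inv_into (fst c) (snd c) x)))"
  shows "manifold_map_on smooth_on N M U f"
proof (rule manifold_map_into[where P = smooth_on, OF assms(2-4)])
  show "smooth_on (model N) F V (\<lambda>x. g (h x))"
    if "smooth_on (model N) F V h" "analytic_map_on F F W g" "h ` V \<subseteq> W" for V W g h
    by (rule smooth_on_compose[OF assms(1) lcs lcs _ analytic_map_on_imp_smooth[OF lcs lcs]]; fact)
  show "smooth_on (model N) F V' h" if "smooth_on (model N) F V h" "openin (vtop (model N)) V'" "V' \<subseteq> V" for V V' h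
    by (rule smooth_on_subset[OF lcs]; fact)
  show "smooth_on (model N) F V h'" if "smooth_on (model N) F V h" "\<And>x. x \<in> V \<Longrightarrow> h x = h' x" for V h h'
    by (rule smooth_on_cong[OF assms(1) lcs that(1)]) (rule that(2))
qed (assumption, rule assms(5))

lemma topological_chart_tvs:
  "c \<in> atlas (tvs_manifold E) \<Longrightarrow> topological_chart (tvs_manifold E) c"
  by (auto simp: tvs_manifold_def topological_chart_def homeomorphic_map_maps homeomorphic_maps_def continuous_map_id'
      intro!: exI[of _ "\<lambda>x. x"])

lemma tvs_manifold_simps [simp]: "model (tvs_manifold E) = E" "mtop (tvs_manifold E) = vtop E"
  "atlas (tvs_manifold E) = {(vcarrier E, \<lambda>x. x)}"
  by (simp_all add: tvs_manifold_def)

lemma analytic_map_from_tvs: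
  assumes E: "lcs E" and f: "analytic_map_on E F (vcarrier E) f"
  shows "manifold_map_on analytic_map_on (tvs_manifold E) M (vcarrier E) (\<lambda>x. ex (f x))"
proof (rule analytic_map_into)
  have fc: "f x \<in> vcarrier F" if "x \<in> vcarrier E" for x using analytic_map_on_funcset[OF f] that by auto
  show "continuous_map (subtopology (mtop (tvs_manifold E)) (vcarrier E)) (mtop M) (\<lambda>x. ex (f x))"
    using continuous_map_compose[OF smooth_on_continuous_full[OF analytic_map_on_imp_smooth[OF E lcs f]] ex_continuous]
    by (simp add: o_def)
  fix c assume "c \<in> atlas (tvs_manifold E)"
  then have c: "c = (vcarrier E, \<lambda>x. x)" by simp
  have "inv_into (vcarrier E) (\<lambda>x. x) x = x" if "x \<in> vcarrier E" for x
    by (rule inv_into_f_eq) (use that in auto)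
  then show "analytic_map_on (model (tvs_manifold E)) F (snd c ` (vcarrier E \<inter> fst c)) (\<lambda>x. l (ex (f (inv_into (fst c) (snd c) x))))"
    unfolding c by simp (rule analytic_map_on_cong[OF E lcs f], simp add: fc l_ex)
qed (auto simp: E intro: topological_chart_tvs)

lemma smooth_map_from_tvs:
  assumes E: "lcs E" and f: "smooth_on E F (vcarrier E) f"
  shows "manifold_map_on smooth_on (tvs_manifold E) M (vcarrier E) (\<lambda>x. ex (f x))"
proof (rule smooth_map_into)
  have fc: "f x \<in> vcarrier F" if "x \<in> vcarrier E" for x using smooth_on_carrier[OF f] that by auto
  show "continuous_map (subtopology (mtop (tvs_manifold E)) (vcarrier E)) (mtop M) (\<lambda>x. ex (f x))"
    using continuous_map_compose[OF smooth_on_continuous_full[OF f] ex_continuous]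
    by (simp add: o_def)
  fix c assume "c \<in> atlas (tvs_manifold E)"
  then have c: "c = (vcarrier E, \<lambda>x. x)" by simp
  have "inv_into (vcarrier E) (\<lambda>x. x) x = x" if "x \<in> vcarrier E" for x
    by (rule inv_into_f_eq) (use that in auto)
  then show "smooth_on (model (tvs_manifold E)) F (snd c ` (vcarrier E \<inter> fst c)) (\<lambda>x. l (ex (f (inv_into (fst c) (snd c) x))))"
    unfolding c by simp (rule smooth_on_cong[OF E lcs f], simp add: fc l_ex)
qed (auto simp: E intro: topological_chart_tvs)

lemma analytic_from_chart:
  assumes G: "lcs G" and c: "c \<in> atlas M" and f: "analytic_map_on F G (vcarrier F) (\<lambda>x. f (ex x))"
  shows "analytic_map_on F G (snd c ` fst c) (\<lambda>x. f (inv_into (fst c) (snd c) x))"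
proof -
  have "analytic_map_on F G (snd c ` fst c) (\<lambda>x. f (ex (l (inv_into (fst c) (snd c) x))))"
    by (rule analytic_map_on_compose[OF lcs lcs G analytic_in[OF c] f])
       (use analytic_map_on_funcset[OF analytic_in[OF c]] in auto)
  then show ?thesis
    by (rule analytic_map_on_cong[OF lcs G]) (use chart_inv[OF c] chart_subset[OF c] in \<open>auto simp: ex_l\<close>)
qed

lemma analytic_map_to_tvs:
  assumes E: "lcs E" and f: "analytic_map_on F E (vcarrier F) (\<lambda>x. f (ex x))"
  shows "manifold_map_on analytic_map_on M (tvs_manifold E) carr f"
  unfolding manifold_map_on_def
proof (intro conjI ballI)
  have fc: "f p \<in> vcarrier E" if "p \<in> carr" for p
    using analytic_map_on_funcset[OF f] l_carrier[OF that] ex_l[OF that] by (auto simp: Pi_iff dest!: bspec[of _ _ "l p"])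
  have "continuous_map (mtop M) (vtop E) (\<lambda>p. f (ex (l p)))"
    using continuous_map_compose[OF l_continuous smooth_on_continuous_full[OF analytic_map_on_imp_smooth[OF lcs E f]]]
    by (simp add: o_def)
  then have "continuous_map (mtop M) (vtop E) f" by (rule continuous_map_eq) (simp add: ex_l)
  then show "continuous_map (subtopology (mtop M) carr) (mtop (tvs_manifold E)) f" by simp
  fix c d assume c: "c \<in> atlas M" and d: "d \<in> atlas (tvs_manifold E)"
  have "{p \<in> carr \<inter> fst c. f p \<in> vcarrier E} = fst c" using chart_subset[OF c] fc by auto
  then show "analytic_map_on (model M) (model (tvs_manifold E)) (snd c ` {p \<in> carr \<inter> fst c. f p \<in> fst d})
      (\<lambda>x. snd d (f (inv_into (fst c) (snd c) x)))"
    using d analytic_from_chart[OF E c f] by simp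
qed simp

lemma analytic_self_map:
  assumes f: "analytic_map_on F F (vcarrier F) (\<lambda>x. l (f (ex x)))" and fM: "f \<in> carr \<rightarrow> carr"
  shows "analytic_manifold_map M M f"
proof (rule analytic_map_into[OF lcs charts openin_topspace])
  have "continuous_map (mtop M) (vtop F) (\<lambda>p. l (f (ex (l p))))"
    using continuous_map_compose[OF l_continuous smooth_on_continuous_full[OF analytic_map_on_imp_smooth[OF lcs lcs f]]]
    by (simp add: o_def)
  from continuous_map_compose[OF this ex_continuous]
  have "continuous_map (mtop M) (mtop M) f"
    by (rule continuous_map_eq) (use funcset_mem[OF fM] in \<open>auto simp: ex_l\<close>)
  then show "continuous_map (subtopology (mtop M) carr) (mtop M) f" by simp
  fix c assume c: "c \<in> atlas M"
  then have "carr \<inter> fst c = fst c" using chart_subset[OF c] by auto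
  then show "analytic_map_on F F (snd c ` (carr \<inter> fst c)) (\<lambda>x. l (f (inv_into (fst c) (snd c) x)))"
    using analytic_from_chart[OF lcs c f] by simp
qed

lemma analytic_product_map:
  assumes f: "analytic_map_on (prod_tvs F F) F (vcarrier (prod_tvs F F)) (\<lambda>x. l (f (ex (fst x), ex (snd x))))"
    and fM: "f \<in> carr \<times> carr \<rightarrow> carr"
  shows "analytic_manifold_map (prod_manifold M M) M f"
proof (rule analytic_map_into)
  note FF = lcs_prod[OF lcs lcs]
  have model: "model (prod_manifold M M) = prod_tvs F F" and mtop: "mtop (prod_manifold M M) = prod_topology (mtop M) (mtop M)"
    by (simp_all add: prod_manifold_def)
  show "lcs (model (prod_manifold M M))" by (simp add: model FF)
  have at: "\<exists>d d'. d \<in> atlas M \<and> d' \<in> atlas M \<and> c = (fst d \<times> fst d', map_prod (snd d) (snd d'))"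
    if "c \<in> atlas (prod_manifold M M)" for c
    using that by (auto simp: prod_manifold_def)
  show "topological_chart (prod_manifold M M) c" if "c \<in> atlas (prod_manifold M M)" for c
    using at[OF that] topological_chart_prod[OF charts charts] by auto
  show "openin (mtop (prod_manifold M M)) (topspace (mtop (prod_manifold M M)))" by simp
  have ll: "continuous_map (prod_topology (mtop M) (mtop M)) (prod_topology (vtop F) (vtop F)) (\<lambda>p. (l (fst p), l (snd p)))"
    using continuous_map_compose[OF continuous_map_fst l_continuous] continuous_map_compose[OF continuous_map_snd l_continuous]
    by (intro continuous_map_pairedI) (simp_all add: o_def)
  have "continuous_map (prod_topology (mtop M) (mtop M)) (vtop F) (\<lambda>p. l (f (ex (l (fst p)), ex (l (snd p)))))"
    using continuous_map_compose[OF ll smooth_on_continuous_full[OF analytic_map_on_imp_smooth[OF FF lcs f], unfolded vtop_prod_tvs]]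
    by (simp add: o_def)
  from continuous_map_compose[OF this ex_continuous]
  have "continuous_map (prod_topology (mtop M) (mtop M)) (mtop M) f"
    by (rule continuous_map_eq) (use funcset_mem[OF fM] in \<open>auto simp: ex_l\<close>)
  then show "continuous_map (subtopology (mtop (prod_manifold M M)) (topspace (mtop (prod_manifold M M)))) (mtop M) f"
    by (simp only: mtop subtopology_topspace)
  fix c assume "c \<in> atlas (prod_manifold M M)"
  then obtain d d' where d: "d \<in> atlas M" "d' \<in> atlas M" and c: "c = (fst d \<times> fst d', map_prod (snd d) (snd d'))"
    using at by blast
  let ?U = "snd d ` fst d \<times> snd d' ` fst d'"
  have dom: "snd c ` (topspace (mtop (prod_manifold M M)) \<inter> fst c) = ?U"
  proof -
    have "topspace (mtop (prod_manifold M M)) \<inter> fst c = fst c"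
      using chart_subset[OF d(1)] chart_subset[OF d(2)] by (auto simp: mtop c)
    then show ?thesis by (simp add: c map_prod_surj_on[OF refl refl])
  qed
  have op: "openin (vtop F) (snd e ` fst e)" if "e \<in> atlas M" for e
    using charts[OF that] by (simp add: topological_chart_def)
  have U: "openin (vtop (prod_tvs F F)) ?U" using op d by (simp add: openin_prod_Times_iff)
  have an2: "analytic_map_on (prod_tvs F F) (prod_tvs F F) ?U
      (\<lambda>x. (l (inv_into (fst d) (snd d) (fst x)), l (inv_into (fst d') (snd d') (snd x))))"
    by (intro analytic_map_on_pair[OF FF lcs lcs]
        analytic_map_on_compose[OF FF lcs lcs analytic_map_on_linear[OF FF lcs continuous_linear_fst U] analytic_in[OF d(1)]]
        analytic_map_on_compose[OF FF lcs lcs analytic_map_on_linear[OF FF lcs continuous_linear_snd U] analytic_in[OF d(2)]]) auto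
  from analytic_map_on_compose[OF FF FF lcs an2 f]
  have "analytic_map_on (prod_tvs F F) F ?U
      (\<lambda>x. l (f (ex (l (inv_into (fst d) (snd d) (fst x))), ex (l (inv_into (fst d') (snd d') (snd x))))))"
    using analytic_map_on_funcset[OF an2] by auto
  then have "analytic_map_on (prod_tvs F F) F ?U (\<lambda>x. l (f (inv_into (fst c) (snd c) x)))"
  proof (rule analytic_map_on_cong[OF FF lcs])
    fix x assume x: "x \<in> ?U"
    then obtain p q where pq: "p \<in> fst d" "q \<in> fst d'" "x = (snd d p, snd d' q)" by auto
    then show "l (f (ex (l (inv_into (fst d) (snd d) (fst x))), ex (l (inv_into (fst d') (snd d') (snd x))))) =
        l (f (inv_into (fst c) (snd c) x))"
      using chart_subset[OF d(1)] chart_subset[OF d(2)]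
      by (simp add: c inv_into_map_prod topological_chart_inj[OF charts] d chart_inv ex_l)
  qed
  then show "analytic_map_on (model (prod_manifold M M)) F (snd c ` (topspace (mtop (prod_manifold M M)) \<inter> fst c))
      (\<lambda>x. l (f (inv_into (fst c) (snd c) x)))"
    unfolding dom model .
qed

subsection \<open>Tangent spaces in a global chart\<close>

abbreviation c0 :: "'m set \<times> ('m \<Rightarrow> 'e)" where "c0 \<equiv> (carr, l)"

text \<open>The tangent vector at p whose representative in the chart l is w; its other
  representatives are forced by the chart changes.\<close>

definition lift :: "'m \<Rightarrow> 'e \<Rightarrow> 'm set \<times> ('m \<Rightarrow> 'e) \<Rightarrow> 'e" where
  "lift p w = (\<lambda>c. if c \<in> charts_at M p then dir_deriv F F (\<lambda>x. snd c (ex x)) (l p) w else 0)"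

lemma charts_atD: "c \<in> charts_at M p \<Longrightarrow> c \<in> atlas M" "c \<in> charts_at M p \<Longrightarrow> p \<in> fst c" "c \<in> charts_at M p \<Longrightarrow> p \<in> carr"
  using chart_subset[of c p] by (auto simp: charts_at_def)

lemma c0_charts_at: "p \<in> carr \<Longrightarrow> c0 \<in> charts_at M p"
  using chart0 by (simp add: charts_at_def)

lemma smooth_out: "c \<in> atlas M \<Longrightarrow> smooth_on F F (l ` fst c) (\<lambda>x. snd c (ex x))"
  and smooth_in: "c \<in> atlas M \<Longrightarrow> smooth_on F F (snd c ` fst c) (\<lambda>x. l (inv_into (fst c) (snd c) x))"
  and smooth_transition: "\<lbrakk>c \<in> atlas M; d \<in> atlas M\<rbrakk> \<Longrightarrow> smooth_on F F (snd c ` (fst c \<inter> fst d)) (transition c d)"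
  by (intro analytic_map_on_imp_smooth[OF lcs lcs] analytic_out analytic_in transition_analytic; assumption)+

lemma lift_c0: assumes "p \<in> carr" "w \<in> vcarrier F" shows "lift p w c0 = w"
proof -
  have "lift p w c0 = dir_deriv F F (\<lambda>x. x) (l p) w"
    unfolding lift_def using c0_charts_at[OF assms(1)]
    by (simp, intro dir_deriv_cong[OF lcs openin_topspace]) (auto simp: assms l_carrier l_ex)
  also have "\<dots> = w" by (rule dir_deriv_linear[OF lcs lcs continuous_linear_id l_carrier[OF assms(1)] assms(2)])
  finally show ?thesis .
qed

text \<open>Undoes the derivative of the chart change. It serves to evaluate
  \<open>tangent_map\<close>, whose definition reads the vector in an unspecified chart.\<close>

lemma dir_deriv_chart_inverse:
  assumes c: "c \<in> charts_at M p" and w: "w \<in> vcarrier F"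
  shows "dir_deriv F F (\<lambda>x. l (inv_into (fst c) (snd c) x)) (snd c p) (lift p w c) = w"
proof -
  note cD = charts_atD[OF c]
  have op: "openin (vtop F) (l ` fst c)" by (rule smooth_on_openin[OF smooth_out[OF cD(1)]])
  have exl: "ex (l p) = p" using cD by (simp add: ex_l)
  have "w = dir_deriv F F (\<lambda>x. x) (l p) w"
    by (rule dir_deriv_linear[OF lcs lcs continuous_linear_id l_carrier[OF cD(3)] w, symmetric])
  also have "\<dots> = dir_deriv F F (\<lambda>x. l (inv_into (fst c) (snd c) (snd c (ex x)))) (l p) w"
    by (rule dir_deriv_cong[OF lcs op _ w])
       (use cD chart_subset[OF cD(1)] chart_inv[OF cD(1)] in \<open>auto simp: ex_l\<close>)
  also have "\<dots> = dir_deriv F F (\<lambda>x. l (inv_into (fst c) (snd c) x)) (snd c (ex (l p))) (dir_deriv F F (\<lambda>x. snd c (ex x)) (l p) w)"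
    by (rule dir_deriv_compose[OF lcs lcs lcs smooth_out[OF cD(1)] smooth_in[OF cD(1)]]) (use cD w exl in auto)
  finally show ?thesis using c by (simp add: lift_def exl)
qed

lemma lift_tangent: assumes p: "p \<in> carr" and w: "w \<in> vcarrier F" shows "lift p w \<in> tangent_space M p"
  unfolding tangent_space_def
proof (intro CollectI conjI ballI allI impI)
  show "lift p w c \<in> vcarrier F" if "c \<in> charts_at M p" for c
    using that charts_atD[OF that] w by (auto simp: lift_def intro!: dir_deriv_carrier[OF smooth_out])
  show "lift p w c = 0" if "c \<notin> charts_at M p" for c using that by (simp add: lift_def)
  fix c d assume c: "c \<in> charts_at M p" and d: "d \<in> charts_at M p"
  note cD = charts_atD[OF c] and dD = charts_atD[OF d]
  have op: "openin (mtop M) (fst c \<inter> fst d)"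
    using charts[OF cD(1)] charts[OF dD(1)] by (auto simp: topological_chart_def)
  have exl: "ex (l p) = p" using p by (rule ex_l)
  have sm: "smooth_on F F (l ` (fst c \<inter> fst d)) (\<lambda>x. snd c (ex x))"
    by (rule smooth_on_subset[OF lcs smooth_out[OF cD(1)] chart0_open_image[OF op]]) auto
  have "dir_deriv F F (\<lambda>x. snd d (ex x)) (l p) w = dir_deriv F F (\<lambda>x. transition c d (snd c (ex x))) (l p) w"
    by (rule dir_deriv_cong[OF lcs chart0_open_image[OF op] _ w])
       (use cD dD chart_subset[OF cD(1)] chart_inv[OF cD(1)] in \<open>auto simp: ex_l transition_def\<close>)
  also have "\<dots> = dir_deriv F F (transition c d) (snd c (ex (l p))) (dir_deriv F F (\<lambda>x. snd c (ex x)) (l p) w)"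
    by (rule dir_deriv_compose[OF lcs lcs lcs sm smooth_transition[OF cD(1) dD(1)]]) (use cD dD w exl in auto)
  finally show "lift p w d = dir_deriv F F (transition c d) (snd c p) (lift p w c)"
    using c d by (simp add: lift_def exl)
qed

lemma tangent_eq_lift: assumes p: "p \<in> carr" and v: "v \<in> tangent_space M p" shows "v = lift p (v c0)"
proof
  fix d
  show "v d = lift p (v c0) d"
  proof (cases "d \<in> charts_at M p")
    case True
    note dD = charts_atD[OF True]
    have vc: "v c0 \<in> vcarrier F" using v c0_charts_at[OF p] by (rule tangent_spaceD(1))
    have inj: "inj_on l carr" by (metis ex_l inj_onI)
    have "v d = dir_deriv F F (transition c0 d) (l p) (v c0)"
      using tangent_spaceD(3)[OF v c0_charts_at[OF p] True] by simp
    also have "\<dots> = dir_deriv F F (\<lambda>x. snd d (ex x)) (l p) (v c0)"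
      by (rule dir_deriv_cong[OF lcs smooth_on_openin[OF smooth_out[OF dD(1)]] _ vc])
         (use dD chart_subset[OF dD(1)] inj in \<open>auto simp: transition_def ex_l\<close>)
    finally show ?thesis using True by (simp add: lift_def)
  next
    case False
    then show ?thesis using tangent_spaceD(2)[OF v False] by (simp add: lift_def)
  qed
qed

lemma tangent_carrier: "\<lbrakk>p \<in> carr; v \<in> tangent_space M p\<rbrakk> \<Longrightarrow> v c0 \<in> vcarrier F"
  by (rule tangent_spaceD(1)[OF _ c0_charts_at])

lemma lift_linear:
  assumes "p \<in> carr"
  shows "\<lbrakk>v \<in> vcarrier F; w \<in> vcarrier F\<rbrakk> \<Longrightarrow> lift p (v + w) = lift p v + lift p w"
    and "w \<in> vcarrier F \<Longrightarrow> lift p (smul F a w) = (\<lambda>c. smul F a (lift p w c))"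
proof -
  have L: "continuous_linear F F (dir_deriv F F (\<lambda>x. snd c (ex x)) (l p))" if "c \<in> charts_at M p" for c
    using charts_atD[OF that] by (intro continuous_linear_dir_deriv[OF lcs lcs smooth_out]) auto
  show "lift p (v + w) = lift p v + lift p w" if "v \<in> vcarrier F" "w \<in> vcarrier F"
    using L that by (auto simp: lift_def fun_eq_iff continuous_linear_def)
  show "lift p (smul F a w) = (\<lambda>c. smul F a (lift p w c))" if "w \<in> vcarrier F"
    using L that by (auto simp: lift_def fun_eq_iff continuous_linear_def F.smul_zero_right)
qed

lemma tangent_tvs_eq: "tangent_tvs M p = fun_tvs F (tangent_space M p)"
  by (simp add: tangent_tvs_def fun_tvs_def)

lemma fun_subspace_tangent: assumes p: "p \<in> carr" shows "fun_subspace F (tangent_space M p)"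
  unfolding fun_subspace_def
proof (intro conjI ballI allI)
  have "lift p 0 = 0"
    using lift_linear(1)[OF p F.zero_closed F.zero_closed] by simp
  then show "0 \<in> tangent_space M p" using lift_tangent[OF p F.zero_closed] by simp
  show "f + g \<in> tangent_space M p" if "f \<in> tangent_space M p" "g \<in> tangent_space M p" for f g
    using tangent_eq_lift[OF p that(1)] tangent_eq_lift[OF p that(2)] tangent_carrier[OF p that(1)] tangent_carrier[OF p that(2)]
      lift_linear(1)[OF p, of "f c0" "g c0"] lift_tangent[OF p, of "f c0 + g c0"] F.add_closed by metis
  show "(\<lambda>i. smul F a (f i)) \<in> tangent_space M p" if "f \<in> tangent_space M p" for f a
    using tangent_eq_lift[OF p that] tangent_carrier[OF p that] lift_linear(2)[OF p, of "f c0" a]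
      lift_tangent[OF p, of "smul F a (f c0)"] F.smul_closed by metis
  show "f c \<in> vcarrier F" if "f \<in> tangent_space M p" for f c
    using tangent_spaceD(1,2)[OF that, of c] F.zero_closed by (cases "c \<in> charts_at M p") simp_all
qed

lemma lcs_tangent: "p \<in> carr \<Longrightarrow> lcs (tangent_tvs M p)"
  unfolding tangent_tvs_eq by (rule lcs_fun[OF lcs fun_subspace_tangent])

lemma vcarrier_tangent: "p \<in> carr \<Longrightarrow> vcarrier (tangent_tvs M p) = tangent_space M p"
  unfolding tangent_tvs_eq by (rule vcarrier_fun_tvs[OF fun_subspace_tangent])

lemma continuous_linear_tangent_c0: "continuous_linear (tangent_tvs M p) F (\<lambda>v. v c0)"
  unfolding tangent_tvs_eq by (rule continuous_linear_fun_apply)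

lemma continuous_linear_lift: assumes p: "p \<in> carr" shows "continuous_linear F (tangent_tvs M p) (lift p)"
  unfolding continuous_linear_def tangent_tvs_eq continuous_map_fun_tvs
proof (intro conjI ballI allI)
  show "lift p \<in> vcarrier F \<rightarrow> tangent_space M p" using lift_tangent[OF p] by auto
  show "continuous_map (vtop F) (vtop F) (\<lambda>w. lift p w c)" for c
  proof (cases "c \<in> charts_at M p")
    case True
    then have "continuous_linear F F (dir_deriv F F (\<lambda>x. snd c (ex x)) (l p))"
      using charts_atD[OF True] by (intro continuous_linear_dir_deriv[OF lcs lcs smooth_out]) auto
    then show ?thesis using True by (simp add: lift_def continuous_linear_def)
  qed (simp add: lift_def F.zero_closed)
qed (simp_all add: lift_linear[OF p] del: plus_fun_apply)

text \<open>A velocity must be correct in every chart around the point; it suffices to compute it in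
  l, and the chain rule transports it through the chart changes.\<close>

lemma has_velocity_lift:
  assumes \<eta>: "has_curve_deriv F I (\<lambda>s. l (\<eta> s)) t w" and I: "\<And>s. s \<in> I \<Longrightarrow> \<eta> s \<in> carr" and t: "t \<in> I" and w: "w \<in> vcarrier F"
  shows "has_velocity M I \<eta> t (lift (\<eta> t) w)"
  unfolding has_velocity_def
proof (intro conjI ballI)
  show "lift (\<eta> t) w \<in> tangent_space M (\<eta> t)" by (rule lift_tangent[OF I[OF t] w])
  fix c assume c: "c \<in> charts_at M (\<eta> t)"
  have "has_curve_deriv F I (\<lambda>s. snd c (ex (l (\<eta> s)))) t (dir_deriv F F (\<lambda>x. snd c (ex x)) (l (\<eta> t)) w)"
    by (rule has_curve_deriv_compose[OF lcs lcs smooth_out[OF charts_atD(1)[OF c]] \<eta> _ t])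
       (use I l_carrier charts_atD[OF c] in auto)
  then show "has_curve_deriv F I (\<lambda>s. snd c (\<eta> s)) t (lift (\<eta> t) w c)"
    by (subst has_curve_deriv_cong[where \<delta> = "\<lambda>s. snd c (ex (l (\<eta> s)))"]) (use I t c in \<open>auto simp: ex_l lift_def\<close>)
qed

text \<open>Frees the tangent map from the chart selected by \<open>SOME\<close>: read from that
  chart, f is the chart change to l, then f in the coordinate l, then the chart change to d, and the
  derivative of the first cancels against the lift.\<close>

lemma tangent_map_lift:
  assumes f: "smooth_on F F (vcarrier F) (\<lambda>x. l (f (ex x)))" and fM: "f \<in> carr \<rightarrow> carr" and p: "p \<in> carr" and w: "w \<in> vcarrier F"
  shows "tangent_map M M f p (lift p w) = lift (f p) (dir_deriv F F (\<lambda>x. l (f (ex x))) (l p) w)"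
proof
  fix d
  show "tangent_map M M f p (lift p w) d = lift (f p) (dir_deriv F F (\<lambda>x. l (f (ex x))) (l p) w) d"
  proof (cases "d \<in> charts_at M (f p)")
    case True
    note dD = charts_atD[OF True]
    define c where "c = (SOME c. c \<in> charts_at M p)"
    have c: "c \<in> charts_at M p" unfolding c_def using c0_charts_at[OF p] by (rule someI)
    note cD = charts_atD[OF c]
    have fl: "f (ex (l p)) = f p" "inv_into (fst c) (snd c) (snd c p) = p"
      using cD by (simp_all add: ex_l chart_inv)
    have fx: "f q \<in> carr" if "q \<in> carr" for q using fM that by auto
    let ?h = "\<lambda>x. l (inv_into (fst c) (snd c) x)" and ?g = "\<lambda>x. l (f (ex x))"
    have h: "smooth_on F F (snd c ` fst c) ?h" by (rule smooth_in[OF cD(1)])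
    have gh: "smooth_on F F (snd c ` fst c) (\<lambda>x. ?g (?h x))"
      by (rule smooth_on_compose[OF lcs lcs lcs h f]) (use smooth_on_carrier[OF h] in auto)
    have hc: "?h (snd c p) \<in> vcarrier F" using cD by (simp add: fl l_carrier)
    have "openin (mtop M) (fst d)" using charts[OF dD(1)] by (simp add: topological_chart_def)
    have od: "openin (vtop F) (l ` fst d)" by (rule smooth_on_openin[OF smooth_out[OF dD(1)]])
    define V where "V = {x \<in> topspace (subtopology (vtop F) (snd c ` fst c)). ?g (?h x) \<in> l ` fst d}"
    have "openin (subtopology (vtop F) (snd c ` fst c)) V"
      unfolding V_def by (rule openin_continuous_map_preimage[OF smooth_on_continuous[OF gh] od])
    then have V: "openin (vtop F) V" by (rule openin_trans_full[OF _ smooth_on_openin[OF h]])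
    have pV: "snd c p \<in> V"
      using cD dD chart_carrier[OF cD(1,2)] by (auto simp: V_def fl ex_l)
    have vc: "lift p w c \<in> vcarrier F"
      using c w cD by (auto simp: lift_def intro!: dir_deriv_carrier[OF smooth_out])
    have "dir_deriv F F (\<lambda>x. snd d (f (inv_into (fst c) (snd c) x))) (snd c p) (lift p w c) =
        dir_deriv F F (\<lambda>x. snd d (ex (?g (?h x)))) (snd c p) (lift p w c)"
    proof (rule dir_deriv_cong[OF lcs V pV vc])
      fix x assume "x \<in> V"
      then have "x \<in> snd c ` fst c" by (simp add: V_def)
      then have "inv_into (fst c) (snd c) x \<in> carr" using chart_inv[OF cD(1)] chart_subset[OF cD(1)] by auto
      then show "snd d (f (inv_into (fst c) (snd c) x)) = snd d (ex (?g (?h x)))"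
        using fx by (simp add: ex_l)
    qed
    also have "\<dots> = dir_deriv F F (\<lambda>x. snd d (ex x)) (?g (?h (snd c p))) (dir_deriv F F (\<lambda>x. ?g (?h x)) (snd c p) (lift p w c))"
      by (rule dir_deriv_compose[OF lcs lcs lcs gh smooth_out[OF dD(1)]]) (use cD dD vc fl in auto)
    also have "dir_deriv F F (\<lambda>x. ?g (?h x)) (snd c p) (lift p w c) =
        dir_deriv F F ?g (?h (snd c p)) (dir_deriv F F ?h (snd c p) (lift p w c))"
      by (rule dir_deriv_compose[OF lcs lcs lcs h f]) (use cD vc hc in auto)
    also have "dir_deriv F F ?h (snd c p) (lift p w c) = w" by (rule dir_deriv_chart_inverse[OF c w])
    finally show ?thesis
      using True by (simp add: tangent_map_def Let_def c_def[symmetric] lift_def[of "f p"] fl)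
  next
    case False
    then show ?thesis by (simp add: tangent_map_def lift_def)
  qed
qed

lemma Cr_manifold_curve_one:
  assumes cont: "continuous_map (top_of_set {0..1}) (vtop F) (\<lambda>t. l (\<eta> t))" and \<eta>: "\<And>t. t \<in> {0..1} \<Longrightarrow> \<eta> t \<in> carr"
    and d: "\<And>t. t \<in> {0..1} \<Longrightarrow> has_curve_deriv F {0..1} (\<lambda>t. l (\<eta> t)) t (w t)"
    and w: "continuous_map (top_of_set {0..1}) (vtop F) w"
  shows "Cr_manifold_curve M 1 {0..1} \<eta>"
  unfolding Cr_manifold_curve_def
proof (intro conjI ballI)
  have "continuous_map (top_of_set {0..1}) (mtop M) (\<lambda>t. ex (l (\<eta> t)))"
    using continuous_map_compose[OF cont ex_continuous] by (simp add: o_def)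
  then show ceta: "continuous_map (top_of_set {0..1}) (mtop M) \<eta>"
    by (rule continuous_map_eq) (auto simp: ex_l \<eta>)
  fix c assume c: "c \<in> atlas M"
  let ?J = "{t \<in> {0..1}. \<eta> t \<in> fst c}" and ?g = "\<lambda>x. snd c (ex x)"
  define D where "D t = dir_deriv F F ?g (l (\<eta> t)) (w t)" for t
  have "openin (mtop M) (fst c)" using charts[OF c] by (simp add: topological_chart_def)
  from openin_continuous_map_preimage[OF ceta this]
  have "openin (top_of_set {0..1}) ?J" by simp
  then obtain T where T: "open T" "?J = {0..1} \<inter> T" unfolding openin_open by blast
  \<comment> \<open>The set of times is relatively open in the unit interval, so none of its points
    is isolated and derivatives relative to it are unique.\<close>
  have nt: "at t within ?J \<noteq> bot" if "t \<in> ?J" for t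
  proof -
    have "at t within ?J = at t within {0..1}"
      by (rule at_within_nhd[OF _ T(1)]) (use that T(2) in auto)
    then show ?thesis using at_within_Icc_nontrivial that by simp
  qed
  have J: "has_curve_deriv F ?J (\<lambda>t. snd c (\<eta> t)) t (D t)" if t: "t \<in> ?J" for t
  proof -
    have "has_curve_deriv F ?J (\<lambda>t. ?g (l (\<eta> t))) t (D t)"
      unfolding D_def
      by (rule has_curve_deriv_compose[OF lcs lcs smooth_out[OF c] has_curve_deriv_subset[OF d]])
         (use t \<eta> l_carrier in auto)
    then show ?thesis
      by (subst has_curve_deriv_cong[where \<delta> = "\<lambda>t. ?g (l (\<eta> t))"]) (use t \<eta> in \<open>auto simp: ex_l\<close>)
  qed
  have sub: "continuous_map (top_of_set ?J) X f" if "continuous_map (top_of_set {0..1}) X f" for X :: "'y topology" and f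
    by (rule continuous_map_from_subtopology_mono[OF that]) auto
  have cd: "continuous_map (top_of_set ?J) (vtop F) (\<lambda>t. iter_deriv F F ?g k (l (\<eta> t)) (\<lambda>_. w t))" for k
    by (rule smooth_on_continuous_map[OF smooth_out[OF c] sub[OF cont] _ sub[OF w]]) auto
  have c0': "continuous_map (top_of_set ?J) (vtop F) (\<lambda>t. snd c (\<eta> t))"
    by (rule continuous_map_eq[OF cd[of 0]]) (auto simp: ex_l \<eta>)
  have c1: "continuous_map (top_of_set ?J) (vtop F) (curve_deriv F ?J 1 (\<lambda>t. snd c (\<eta> t)))"
  proof (rule continuous_map_eq[OF cd[of "Suc 0"]])
    fix t assume "t \<in> topspace (top_of_set ?J)"
    then have t: "t \<in> ?J" by simp
    have "(THE v. has_curve_deriv F ?J (\<lambda>t. snd c (\<eta> t)) t v) = D t"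
      using J[OF t] by (rule the_equality) (rule has_curve_deriv_unique[OF lcs nt[OF t] _ J[OF t]])
    then show "iter_deriv F F ?g (Suc 0) (l (\<eta> t)) (\<lambda>_. w t) = curve_deriv F ?J 1 (\<lambda>t. snd c (\<eta> t)) t"
      by (simp add: D_def)
  qed
  have k0: "k = 0" if "enat (Suc k) \<le> 1" for k using that by (simp add: one_enat_def)
  have k1: "k = 0 \<or> k = 1" if "enat k \<le> 1" for k using that by (auto simp: one_enat_def)
  show "Cr_curve F 1 ?J (\<lambda>t. snd c (\<eta> t))"
    unfolding Cr_curve_def
  proof (intro conjI allI impI ballI)
    fix k t assume "enat (Suc k) \<le> 1" "t \<in> ?J"
    then show "\<exists>v. has_curve_deriv F ?J (curve_deriv F ?J k (\<lambda>t. snd c (\<eta> t))) t v"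
      using k0[of k] J[of t] by (intro exI[of _ "D t"]) simp
  next
    fix k assume "enat k \<le> 1"
    from k1[OF this] show "continuous_map (top_of_set ?J) (vtop F) (curve_deriv F ?J k (\<lambda>t. snd c (\<eta> t)))"
      by (rule disjE) (simp_all only: curve_deriv.simps(1) c0' c1)
  qed
qed

end

section \<open>Integration of continuous curves in sequentially complete spaces\<close>

section \<open>Primitives of curves\<close>

lemma has_curve_deriv_add:
  assumes E: "lcs E" and "has_curve_deriv E I f t v" "has_curve_deriv E I g t w" "t \<in> I"
    and f: "\<And>s. s \<in> I \<Longrightarrow> f s \<in> vcarrier E" and g: "\<And>s. s \<in> I \<Longrightarrow> g s \<in> vcarrier E"
  shows "has_curve_deriv E I (\<lambda>s. f s + g s) t (v + w)"
proof -
  interpret locally_convex_space E by fact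
  show ?thesis
    unfolding has_curve_deriv_def
    by (rule limitin_transform_eventually[OF _ limitin_add[OF assms(2,3)[unfolded has_curve_deriv_def]]])
       (use assms(4) f g in \<open>auto simp: eventually_at_filter smul_add_right[symmetric] diff_closed algebra_simps\<close>)
qed

lemma has_curve_deriv_diff:
  assumes E: "lcs E" and "has_curve_deriv E I f t v" "has_curve_deriv E I g t w" "t \<in> I"
    and f: "\<And>s. s \<in> I \<Longrightarrow> f s \<in> vcarrier E" and g: "\<And>s. s \<in> I \<Longrightarrow> g s \<in> vcarrier E"
  shows "has_curve_deriv E I (\<lambda>s. f s - g s) t (v - w)"
proof -
  interpret locally_convex_space E by fact
  show ?thesis
    unfolding has_curve_deriv_def
  proof (rule limitin_transform_eventually[OF _ limitin_diff[OF assms(2,3)[unfolded has_curve_deriv_def]]])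
    have "smul E c (f s - f t) - smul E c (g s - g t) = smul E c ((f s - g s) - (f t - g t))" if "s \<in> I" for s c
      using smul_diff_right[of "f s - f t" "g s - g t" c] that assms(4) f g by (simp add: diff_closed algebra_simps)
    then show "eventually (\<lambda>s. smul E (of_real (inverse (s - t))) (f s - f t) - smul E (of_real (inverse (s - t))) (g s - g t) =
        smul E (of_real (inverse (s - t))) ((f s - g s) - (f t - g t))) (at t within I)"
      by (auto simp: eventually_at_filter)
  qed
qed

lemma has_curve_deriv_const:
  assumes "lcs E" shows "has_curve_deriv E I (\<lambda>_. c) t 0"
proof -
  interpret locally_convex_space E by fact
  show ?thesis by (simp add: has_curve_deriv_def smul_zero_right zero_closed)
qed

lemma has_curve_deriv_sum:
  assumes E: "lcs E" and "t \<in> I"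
  shows "\<lbrakk>\<And>i. i \<in> A \<Longrightarrow> has_curve_deriv E I (f i) t (v i); \<And>i s. \<lbrakk>i \<in> A; s \<in> I\<rbrakk> \<Longrightarrow> f i s \<in> vcarrier E\<rbrakk> \<Longrightarrow>
    has_curve_deriv E I (\<lambda>s. \<Sum>i\<in>A. f i s) t (\<Sum>i\<in>A. v i)"
proof (induction A rule: infinite_finite_induct)
  case (insert i A)
  then have "has_curve_deriv E I (\<lambda>s. f i s + (\<Sum>i\<in>A. f i s)) t (v i + (\<Sum>i\<in>A. v i))"
    by (intro has_curve_deriv_add[OF E _ _ assms(2)] locally_convex_space.sum_closed[OF E]) auto
  then show ?case using insert by simp
qed (simp_all add: has_curve_deriv_const[OF E])

lemma has_curve_deriv_real_multiple:
  fixes E :: "('k::real_normed_field, 'v::ab_group_add) tvs"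
  assumes E: "lcs E" and x: "x \<in> vcarrier E" and g: "(g has_vector_derivative g') (at t within I)"
  shows "has_curve_deriv E I (\<lambda>s. smul E (of_real (g s)) x) t (smul E (of_real g') x)"
proof -
  interpret locally_convex_space E by fact
  have "((\<lambda>s. (g s - g t) / (s - t)) \<longlongrightarrow> g') (at t within I)"
    using g unfolding has_real_derivative_iff_has_vector_derivative[symmetric] has_field_derivative_iff .
  then have "((\<lambda>s. of_real ((g s - g t) / (s - t)) :: 'k) \<longlongrightarrow> of_real g') (at t within I)"
    by (rule tendsto_of_real)
  then have "limitin (vtop E) (\<lambda>s. smul E (of_real ((g s - g t) / (s - t))) x) (smul E (of_real g') x) (at t within I)"
    by (rule limitin_smul) (simp add: x)
  moreover have "smul E (of_real (inverse (s - t))) (smul E (of_real (g s)) x - smul E (of_real (g t)) x) =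
      smul E (of_real ((g s - g t) / (s - t))) x" for s
    using x by (simp add: smul_diff_left[symmetric] smul_smul divide_inverse mult.commute)
  ultimately show ?thesis by (simp add: has_curve_deriv_def)
qed

context locally_convex_space
begin

lemma eq_zero_if_in_all_nbhds:
  assumes "x \<in> vcarrier E" "\<And>V. \<lbrakk>openin (vtop E) V; 0 \<in> V\<rbrakk> \<Longrightarrow> x \<in> V"
  shows "x = 0"
proof (rule ccontr)
  assume "x \<noteq> 0"
  then obtain U V where "openin (vtop E) U" "openin (vtop E) V" "0 \<in> U" "x \<in> V" "disjnt U V"
    using hausdorff assms(1) zero_closed unfolding Hausdorff_space_def by metis
  then show False using assms(2)[of U] by (auto simp: disjnt_iff)
qed

lemma convex_in_smul:
  assumes "convex_in V" "0 \<in> V" "x \<in> V" "0 \<le> a" "a \<le> 1"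
  shows "smul E (of_real a) x \<in> V"
  using convex_inD[OF assms(1,3,2), of a "1 - a"] assms(4,5) by (simp add: smul_zero_right)

text \<open>Total weight below 1 is allowed because 0 belongs to V. The induction splits off one
  weight and rescales the others by 1 - a j, so the case a j = 1, in which all other weights vanish,
  is separate.\<close>

lemma convex_in_sum:
  assumes V: "convex_in V" "0 \<in> V" "V \<subseteq> vcarrier E" and "finite A"
  shows "\<lbrakk>\<And>i. i \<in> A \<Longrightarrow> x i \<in> V; \<And>i. i \<in> A \<Longrightarrow> 0 \<le> a i; sum a A \<le> 1\<rbrakk> \<Longrightarrow> (\<Sum>i\<in>A. smul E (of_real (a i)) (x i)) \<in> V"
  using \<open>finite A\<close>
proof (induction A arbitrary: a rule: finite_induct)
  case empty
  then show ?case using V(2) by simp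
next
  case (insert j A)
  have xc: "x i \<in> vcarrier E" if "i \<in> insert j A" for i using insert.prems(1)[OF that] V(3) by blast
  have pos: "0 \<le> sum a A" using insert.prems(2) by (intro sum_nonneg) auto
  have s: "a j + sum a A \<le> 1" using insert by simp
  show ?case
  proof (cases "a j = 1")
    case True
    then have "sum a A = 0" using pos s by simp
    then have "a i = 0" if "i \<in> A" for i
      using that insert.prems(2) insert.hyps(1) by (simp add: sum_nonneg_eq_0_iff)
    then have "(\<Sum>i\<in>A. smul E (of_real (a i)) (x i)) = 0"
      using xc by (intro sum.neutral) (auto simp: smul_zero_left)
    then show ?thesis using insert xc[of j] by (simp add: True smul_one)
  next
    case False
    then have lt: "a j < 1" using s pos by linarith
    have "(\<Sum>i\<in>A. smul E (of_real (a i / (1 - a j))) (x i)) \<in> V"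
    proof (rule insert.IH)
      show "(\<Sum>i\<in>A. a i / (1 - a j)) \<le> 1"
        using s lt by (simp add: sum_divide_distrib[symmetric] divide_le_eq)
    qed (use insert.prems lt in auto)
    then have "smul E (of_real (1 - a j)) (\<Sum>i\<in>A. smul E (of_real (a i / (1 - a j))) (x i)) + smul E (of_real (a j)) (x j) \<in> V"
      using insert.prems lt by (intro convex_inD[OF V(1)]) auto
    moreover have "smul E (of_real (1 - a j)) (\<Sum>i\<in>A. smul E (of_real (a i / (1 - a j))) (x i)) = (\<Sum>i\<in>A. smul E (of_real (a i)) (x i))"
    proof -
      have "smul E (of_real (1 - a j)) (smul E (of_real (a i / (1 - a j))) (x i)) = smul E (of_real (a i)) (x i)" if "i \<in> A" for i
      proof -
        have "(of_real (1 - a j) :: 'k) * of_real (a i / (1 - a j)) = of_real ((1 - a j) * (a i / (1 - a j)))"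
          by (simp only: of_real_mult)
        also have "(1 - a j) * (a i / (1 - a j)) = a i" using lt by simp
        finally show ?thesis using xc[of i] that by (simp only: smul_smul insertI2)
      qed
      then show ?thesis
        using xc by (subst smul_sum_right) (auto intro: smul_closed)
    qed
    ultimately show ?thesis using insert.hyps by (simp add: add.commute)
  qed
qed

text \<open>If V + V lies in N, a limit of points of V differs from one of them by an element of V.
  As V is chosen before the functions, uniform estimates pass to the limit.\<close>

lemma limit_in_nbhd:
  assumes "openin (vtop E) N" "0 \<in> N"
  obtains V where "openin (vtop E) V" "0 \<in> V" "V \<subseteq> N"
    "\<And>f a (Fl::'z filter). \<lbrakk>limitin (vtop E) f a Fl; eventually (\<lambda>t. f t \<in> V) Fl; Fl \<noteq> bot\<rbrakk> \<Longrightarrow> a \<in> N"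
proof -
  obtain V where V: "openin (vtop E) V" "0 \<in> V" "V \<subseteq> N" "\<And>x y. \<lbrakk>x \<in> V; y \<in> V\<rbrakk> \<Longrightarrow> x + y \<in> N"
    by (rule half_nbhd[OF assms]) blast
  show ?thesis
  proof (rule that[OF V(1-3)])
    fix f a and Fl :: "'z filter"
    assume f: "limitin (vtop E) f a Fl" and ev: "eventually (\<lambda>t. f t \<in> V) Fl" and Fl: "Fl \<noteq> bot"
    have a: "a \<in> vcarrier E" by (rule limitin_topspace[OF f])
    have "limitin (vtop E) (\<lambda>t. a - f t) (a - a) Fl"
      by (rule limitin_diff[OF _ f]) (simp add: a)
    then have "eventually (\<lambda>t. a - f t \<in> V) Fl"
      using limitin_in_openin[of "vtop E" _ "0" Fl V] V(1,2) by simp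
    with ev have "eventually (\<lambda>t. f t \<in> V \<and> a - f t \<in> V) Fl" by (rule eventually_conj)
    then obtain t where "f t \<in> V" "a - f t \<in> V"
      using eventually_happens'[OF Fl] by blast
    then have "f t + (a - f t) \<in> N" by (rule V(4))
    then show "a \<in> N" by simp
  qed
qed

text \<open>The mean value theorem with p = 0 puts the difference quotient into every neighbourhood
  of 0, and the space is Hausdorff.\<close>

lemma curve_deriv_zero_const:
  assumes \<gamma>: "\<And>t. t \<in> {0..1} \<Longrightarrow> \<gamma> t \<in> vcarrier E" and d: "\<And>t. t \<in> {0..1} \<Longrightarrow> has_curve_deriv E {0..1} \<gamma> t 0"
    and t: "t \<in> {0..1}"
  shows "\<gamma> t = \<gamma> 0"
proof (cases "t = 0")
  case False
  then have t0: "0 < t" using t by simp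
  let ?x = "smul E (of_real (inverse (t - 0))) (\<gamma> t - \<gamma> 0)"
  have "?x = 0"
  proof (rule eq_zero_if_in_all_nbhds)
    show "?x \<in> vcarrier E" using \<gamma> t by (intro smul_closed diff_closed) auto
    fix N assume N: "openin (vtop E) N" "0 \<in> N"
    obtain V where V: "openin (vtop E) V" "0 \<in> V"
      "\<And>\<gamma> \<gamma>' a b p. \<lbrakk>a < b; p \<in> vcarrier E; \<And>t. t \<in> {a..b} \<Longrightarrow> \<gamma> t \<in> vcarrier E;
       \<And>t. t \<in> {a..b} \<Longrightarrow> has_curve_deriv E {a..b} \<gamma> t (\<gamma>' t); \<And>t. t \<in> {a..b} \<Longrightarrow> \<gamma>' t - p \<in> V\<rbrakk> \<Longrightarrow>
       smul E (of_real (inverse (b - a))) (\<gamma> b - \<gamma> a) - p \<in> N"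
      by (rule mean_value[OF N]) auto
    have "?x - 0 \<in> N"
      by (rule V(3)[OF t0 zero_closed, where \<gamma>' = "\<lambda>_. 0"])
         (use V(2) t \<gamma> in \<open>auto intro: has_curve_deriv_subset[OF d]\<close>)
    then show "?x \<in> N" by simp
  qed
  then have "smul E (of_real t) ?x = 0" by (simp add: smul_zero_right)
  moreover have "smul E (of_real t) ?x = \<gamma> t - \<gamma> 0"
    using t0 \<gamma>[of t] \<gamma>[of 0] t by (simp add: smul_smul smul_one diff_closed)
  ultimately show ?thesis by simp
qed simp

text \<open>A partition of unity by normalised hat functions replaces Riemann sums: the approximations are
  differentiable, so that the mean value theorem controls their differences.\<close>

lemma uniform_approximation_antiderivative:
  assumes \<gamma>: "continuous_map (top_of_set {0..1::real}) (vtop E) \<gamma>"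
  obtains \<Gamma> \<delta> :: "nat \<Rightarrow> real \<Rightarrow> 'v" where
    "\<And>n t. t \<in> {0..1} \<Longrightarrow> \<Gamma> n t \<in> vcarrier E" "\<And>n. \<Gamma> n 0 = 0"
    "\<And>n t. t \<in> {0..1} \<Longrightarrow> \<delta> n t \<in> vcarrier E"
    "\<And>n t. t \<in> {0..1} \<Longrightarrow> has_curve_deriv E {0..1} (\<Gamma> n) t (\<delta> n t)"
    "\<And>V. \<lbrakk>openin (vtop E) V; 0 \<in> V\<rbrakk> \<Longrightarrow> \<exists>N. \<forall>n\<ge>N. \<forall>t\<in>{0..1}. \<delta> n t - \<gamma> t \<in> V"
proof -
  have \<gamma>c: "\<gamma> t \<in> vcarrier E" if "t \<in> {0..1}" for t
    using funcset_mem[OF continuous_map_funspace[OF \<gamma>], of t] that by simp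
  define m where "m n = Suc n" for n
  \<comment> \<open>A hat around the node i/m that vanishes at distance 1/m and beyond. At every t
    of the unit interval at least one hat is positive, so the sum S may be divided by.\<close>
  define hat where "hat n i t = max 0 (1 - \<bar>real (m n) * t - real i\<bar>)" for n i and t :: real
  define S where "S n t = (\<Sum>j\<le>m n. hat n j t)" for n t
  define w where "w n i t = hat n i t / S n t" for n i t
  have hat0: "0 \<le> hat n i t" for n i t by (simp add: hat_def)
  have Spos: "0 < S n t" if t: "t \<in> {0..1}" for n t
  proof -
    define j where "j = nat \<lfloor>real (m n) * t\<rfloor>"
    have nn: "0 \<le> real (m n) * t" using t by simp
    have "real (m n) * t \<le> real (m n) * 1" using t by (intro mult_left_mono) auto
    then have "j \<le> m n" unfolding j_def by (simp add: nat_le_iff floor_le_iff)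
    moreover have "0 < hat n j t"
      using nn unfolding hat_def j_def by (simp add: of_nat_nat) linarith
    ultimately show ?thesis
      unfolding S_def using hat0 by (intro sum_pos2[where i = j]) auto
  qed
  have w0: "0 \<le> w n i t" if "t \<in> {0..1}" for n i t
    using Spos[OF that, of n] hat0[of n i t] by (simp add: w_def)
  have w1: "(\<Sum>i\<le>m n. w n i t) = 1" if "t \<in> {0..1}" for n t
    using Spos[OF that, of n] by (simp add: w_def sum_divide_distrib[symmetric]) (simp add: S_def)
  have wnear: "\<bar>t - real i / real (m n)\<bar> < 1 / real (m n)" if "w n i t \<noteq> 0" for n i t
  proof -
    have "hat n i t \<noteq> 0" using that by (auto simp: w_def)
    then have "\<bar>real (m n) * t - real i\<bar> < 1" by (auto simp: hat_def max_def split: if_splits)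
    then have "\<bar>real (m n) * t - real i\<bar> / real (m n) < 1 / real (m n)"
      by (simp add: divide_strict_right_mono m_def)
    moreover have "\<bar>real (m n) * t - real i\<bar> / real (m n) = \<bar>t - real i / real (m n)\<bar>"
      by (simp add: m_def field_simps abs_divide[symmetric] flip: abs_of_pos)
    ultimately show ?thesis by simp
  qed
  have wcont: "continuous_on {0..1} (w n i)" for n i
  proof -
    have hat_cont: "continuous_on {0..1} (hat n i)" for n i
      unfolding hat_def[abs_def] by (intro continuous_intros)
    have "continuous_on {0..1} (\<lambda>t. hat n i t / S n t)"
    proof (rule continuous_on_divide[OF hat_cont])
      show "continuous_on {0..1} (S n)"
        unfolding S_def[abs_def] by (intro continuous_on_sum) (rule hat_cont)
      show "\<forall>t\<in>{0..1}. S n t \<noteq> 0" using Spos by (metis less_irrefl)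
    qed
    then show ?thesis by (simp add: w_def[abs_def])
  qed
  \<comment> \<open>Only the real weights are integrated; vectors appear as constant coefficients,
    so the approximations have antiderivatives in every locally convex space.\<close>
  have "\<exists>g. g 0 = 0 \<and> (\<forall>t\<in>{0..1}. (g has_vector_derivative w n i t) (at t within {0..1}))" for n i
  proof -
    obtain g where g: "\<And>t. t \<in> {0..1} \<Longrightarrow> (g has_vector_derivative w n i t) (at t within {0..1})"
      using antiderivative_continuous[OF wcont] by blast
    have "((\<lambda>t. g t - g 0) has_vector_derivative w n i t - 0) (at t within {0..1})" if "t \<in> {0..1}" for t
      by (rule has_vector_derivative_diff[OF g[OF that] has_vector_derivative_const])
    then show ?thesis by (intro exI[of _ "\<lambda>t. g t - g 0"]) simp
  qed
  then obtain W where W: "\<And>n i. W n i 0 = 0" "\<And>n i t. t \<in> {0..1} \<Longrightarrow> (W n i has_vector_derivative w n i t) (at t within {0..1})"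
    by metis
  have pc: "\<gamma> (real i / real (m n)) \<in> vcarrier E" if "i \<le> m n" for n i
    using that by (intro \<gamma>c) (simp add: m_def)
  define \<Gamma> where "\<Gamma> n t = (\<Sum>i\<le>m n. smul E (of_real (W n i t)) (\<gamma> (real i / real (m n))))" for n t
  define \<delta> where "\<delta> n t = (\<Sum>i\<le>m n. smul E (of_real (w n i t)) (\<gamma> (real i / real (m n))))" for n t
  show ?thesis
  proof (rule that[of \<Gamma> \<delta>])
    show "\<Gamma> n t \<in> vcarrier E" "\<delta> n t \<in> vcarrier E" for n t
      unfolding \<Gamma>_def \<delta>_def by (auto intro!: sum_closed smul_closed pc)
    show "\<Gamma> n 0 = 0" for n
      unfolding \<Gamma>_def using pc by (intro sum.neutral) (auto simp: W smul_zero_left)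
    show "has_curve_deriv E {0..1} (\<Gamma> n) t (\<delta> n t)" if t: "t \<in> {0..1}" for n t
      unfolding \<Gamma>_def[abs_def] \<delta>_def
      by (rule has_curve_deriv_sum[OF locally_convex_space_axioms t])
         (use pc W(2)[OF t] in \<open>auto intro!: has_curve_deriv_real_multiple[OF locally_convex_space_axioms] smul_closed\<close>)
    fix V0 assume "openin (vtop E) V0" "0 \<in> V0"
    then obtain V where V: "openin (vtop E) V" "0 \<in> V" "V \<subseteq> V0" "convex_in V" by (rule convex_nbhd)
    have Vc: "V \<subseteq> vcarrier E" by (rule openin_subset[OF V(1)])
    \<comment> \<open>Open sets on which \<gamma> varies only within V; a Lebesgue number of this
      cover of the compact interval expresses uniform continuity.\<close>
    define \<C> where "\<C> = {T. open T \<and> (\<forall>s\<in>T \<inter> {0..1}. \<forall>t\<in>T \<inter> {0..1}. \<gamma> s - \<gamma> t \<in> V)}"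
    have cover: "t \<in> \<Union>\<C>" if t: "t \<in> {0..1}" for t
    proof -
      let ?W = "{p \<in> topspace (prod_topology (vtop E) (vtop E)). fst p - snd p \<in> V}"
      have "openin (prod_topology (vtop E) (vtop E)) ?W"
        by (rule openin_continuous_map_preimage[OF continuous_map_diff'[OF continuous_map_fst continuous_map_snd] V(1)])
      moreover have "(\<gamma> t, \<gamma> t) \<in> ?W" using \<gamma>c[OF t] V(2) by simp
      ultimately obtain A B where AB: "openin (vtop E) A" "openin (vtop E) B" "\<gamma> t \<in> A" "\<gamma> t \<in> B" "A \<times> B \<subseteq> ?W"
        unfolding openin_prod_topology_alt by meson
      have "openin (top_of_set {0..1}) {s \<in> topspace (top_of_set {0..1}). \<gamma> s \<in> A \<inter> B}"
        using AB by (intro openin_continuous_map_preimage[OF \<gamma>]) auto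
      then obtain T where T: "open T" "{s \<in> {0..1}. \<gamma> s \<in> A \<inter> B} = {0..1} \<inter> T"
        unfolding openin_open by auto
      have "\<gamma> r - \<gamma> s \<in> V" if "r \<in> T \<inter> {0..1}" "s \<in> T \<inter> {0..1}" for r s
      proof -
        have "(\<gamma> r, \<gamma> s) \<in> A \<times> B" using that T(2) by blast
        then have "(\<gamma> r, \<gamma> s) \<in> ?W" using AB(5) by blast
        then show ?thesis by simp
      qed
      then have "T \<in> \<C>" using T(1) by (auto simp: \<C>_def)
      moreover have "t \<in> T" using T(2) t AB(3,4) by blast
      ultimately show ?thesis by blast
    qed
    obtain d where d: "0 < d" "\<And>T. \<lbrakk>T \<subseteq> {0..1}; diameter T < d\<rbrakk> \<Longrightarrow> \<exists>B\<in>\<C>. T \<subseteq> B"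
    proof (rule Lebesgue_number_lemma[of "{0..1::real}" \<C>])
      show "\<C> \<noteq> {}" using cover[of 0] by auto
      show "{0..1} \<subseteq> \<Union>\<C>" using cover by blast
      show "open B" if "B \<in> \<C>" for B using that by (simp add: \<C>_def)
    qed auto
    have close: "\<gamma> s - \<gamma> t \<in> V" if st: "s \<in> {0..1}" "t \<in> {0..1}" "\<bar>s - t\<bar> < d" for s t
    proof -
      have "diameter {s, t} \<le> \<bar>s - t\<bar>" by (rule diameter_le) (auto simp: abs_minus_commute)
      then have "diameter {s, t} < d" using st(3) by linarith
      then obtain B where "B \<in> \<C>" "{s, t} \<subseteq> B" using d(2)[of "{s, t}"] st(1,2) by auto
      then show ?thesis using st by (auto simp: \<C>_def)
    qed
    obtain N where N: "1 / real (Suc N) < d" using d(1) by (metis nat_approx_posE)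
    show "\<exists>N. \<forall>n\<ge>N. \<forall>t\<in>{0..1}. \<delta> n t - \<gamma> t \<in> V0"
    proof (intro exI allI impI ballI)
      fix n t assume n: "N \<le> n" and t: "t \<in> {0..1::real}"
      have "1 / real (m n) \<le> 1 / real (Suc N)" using n by (simp add: m_def frac_le)
      then have nd: "1 / real (m n) < d" using N by linarith
      \<comment> \<open>Nodes far from t carry weight 0, but their differences need not lie in V;
        replacing these by 0 keeps the sum a convex combination of points of V.\<close>
      define x where "x i = (if w n i t = 0 then 0 else \<gamma> (real i / real (m n)) - \<gamma> t)" for i
      have "(\<Sum>i\<le>m n. smul E (of_real (w n i t)) (x i)) \<in> V"
      proof (rule convex_in_sum[OF V(4,2) Vc])
        show "x i \<in> V" if i: "i \<in> {..m n}" for i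
        proof (cases "w n i t = 0")
          case False
          then have "\<bar>real i / real (m n) - t\<bar> < d" using wnear[OF False] nd by linarith
          then show ?thesis
            using False i t by (auto simp: x_def m_def intro!: close)
        qed (simp add: x_def V)
      qed (use w0[OF t] w1[OF t] in auto)
      also have "(\<Sum>i\<le>m n. smul E (of_real (w n i t)) (x i)) =
          (\<Sum>i\<le>m n. smul E (of_real (w n i t)) (\<gamma> (real i / real (m n))) - smul E (of_real (w n i t)) (\<gamma> t))"
        by (intro sum.cong refl) (use pc \<gamma>c[OF t] in \<open>auto simp: x_def smul_diff_right smul_zero_left smul_zero_right\<close>)
      also have "\<dots> = \<delta> n t - (\<Sum>i\<le>m n. smul E (of_real (w n i t)) (\<gamma> t))"
        by (simp add: sum_subtractf \<delta>_def)
      also have "(\<Sum>i\<in>I. smul E (of_real (a i)) (\<gamma> t)) = smul E (of_real (sum a I)) (\<gamma> t)" for I :: "nat set" and a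
        by (induction I rule: infinite_finite_induct) (use \<gamma>c[OF t] in \<open>auto simp: smul_zero_left smul_add_left\<close>)
      finally show "\<delta> n t - \<gamma> t \<in> V0" using V(3) \<gamma>c[OF t] by (auto simp: w1[OF t] smul_one)
    qed
  qed
qed

text \<open>By the mean value theorem the antiderivatives of the approximations form a Cauchy
  sequence at each time, and sequential completeness supplies the limit. The same theorem controls
  their difference quotients near t uniformly in n, and the estimate survives the limit.\<close>

theorem primitive_exists:
  assumes sc: "sequentially_complete E" and \<gamma>: "continuous_map (top_of_set {0..1::real}) (vtop E) \<gamma>"
  obtains \<Gamma> where "\<Gamma> 0 = 0" "\<And>t. t \<in> {0..1} \<Longrightarrow> \<Gamma> t \<in> vcarrier E"
    "\<And>t. t \<in> {0..1} \<Longrightarrow> has_curve_deriv E {0..1} \<Gamma> t (\<gamma> t)"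
proof -
  have \<gamma>c: "\<gamma> t \<in> vcarrier E" if "t \<in> {0..1}" for t
    using funcset_mem[OF continuous_map_funspace[OF \<gamma>], of t] that by simp
  obtain G \<delta> :: "nat \<Rightarrow> real \<Rightarrow> 'v" where
    Gc: "\<And>n t. t \<in> {0..1} \<Longrightarrow> G n t \<in> vcarrier E" and G0: "\<And>n. G n 0 = 0"
    and \<delta>c: "\<And>n t. t \<in> {0..1} \<Longrightarrow> \<delta> n t \<in> vcarrier E"
    and Gd: "\<And>n t. t \<in> {0..1} \<Longrightarrow> has_curve_deriv E {0..1} (G n) t (\<delta> n t)"
    and unif: "\<And>V. \<lbrakk>openin (vtop E) V; 0 \<in> V\<rbrakk> \<Longrightarrow> \<exists>N. \<forall>n\<ge>N. \<forall>t\<in>{0..1}. \<delta> n t - \<gamma> t \<in> V"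
    by (rule uniform_approximation_antiderivative[OF \<gamma>]) (rule that; assumption)
  note L = locally_convex_space_axioms
  have Gd': "has_curve_deriv E {a..b} (G n) s (\<delta> n s)" if "s \<in> {a..b}" "0 \<le> a" "b \<le> 1" for a b n s
    by (rule has_curve_deriv_subset[OF Gd]) (use that in auto)
  have cauchy: "\<exists>N. \<forall>m\<ge>N. \<forall>n\<ge>N. G m t - G n t \<in> U" if t: "t \<in> {0..1}" and U: "openin (vtop E) U" "0 \<in> U" for t U
  proof -
    obtain C where C: "openin (vtop E) C" "0 \<in> C" "C \<subseteq> U" "convex_in C" by (rule convex_nbhd[OF U])
    obtain V where V: "openin (vtop E) V" "0 \<in> V"
      "\<And>\<gamma> \<gamma>' a b p. \<lbrakk>a < b; p \<in> vcarrier E; \<And>t. t \<in> {a..b} \<Longrightarrow> \<gamma> t \<in> vcarrier E;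
       \<And>t. t \<in> {a..b} \<Longrightarrow> has_curve_deriv E {a..b} \<gamma> t (\<gamma>' t); \<And>t. t \<in> {a..b} \<Longrightarrow> \<gamma>' t - p \<in> V\<rbrakk> \<Longrightarrow>
       smul E (of_real (inverse (b - a))) (\<gamma> b - \<gamma> a) - p \<in> C"
      by (rule mean_value[OF C(1,2)]) auto
    let ?W = "{p \<in> topspace (prod_topology (vtop E) (vtop E)). fst p - snd p \<in> V}"
    have "openin (prod_topology (vtop E) (vtop E)) ?W"
      by (rule openin_continuous_map_preimage[OF continuous_map_diff'[OF continuous_map_fst continuous_map_snd] V(1)])
    moreover have "(0, 0) \<in> ?W" using V(2) zero_closed by simp
    ultimately obtain A B where AB: "openin (vtop E) A" "openin (vtop E) B" "0 \<in> A" "0 \<in> B" "A \<times> B \<subseteq> ?W"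
      unfolding openin_prod_topology_alt by meson
    obtain N1 N2 where N: "\<forall>n\<ge>N1. \<forall>t\<in>{0..1}. \<delta> n t - \<gamma> t \<in> A" "\<forall>n\<ge>N2. \<forall>t\<in>{0..1}. \<delta> n t - \<gamma> t \<in> B"
      using unif[OF AB(1,3)] unif[OF AB(2,4)] by blast
    have "G m t - G n t \<in> U" if mn: "m \<ge> max N1 N2" "n \<ge> max N1 N2" for m n
    proof (cases "t = 0")
      case True
      then show ?thesis using U(2) by (simp add: G0)
    next
      case False
      then have t0: "0 < t" "t \<le> 1" using t by auto
      have V': "\<delta> m s - \<delta> n s \<in> V" if "s \<in> {0..1}" for s
      proof -
        have "(\<delta> m s - \<gamma> s, \<delta> n s - \<gamma> s) \<in> A \<times> B" using N mn that by auto
        then have "(\<delta> m s - \<gamma> s, \<delta> n s - \<gamma> s) \<in> ?W" using AB(5) by blast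
        then show ?thesis by simp
      qed
      have "smul E (of_real (inverse (t - 0))) ((G m t - G n t) - (G m 0 - G n 0)) - 0 \<in> C"
        by (rule V(3)[OF t0(1) zero_closed, where \<gamma>' = "\<lambda>s. \<delta> m s - \<delta> n s"])
           (use t0 V' Gc in \<open>auto intro!: diff_closed has_curve_deriv_diff[OF L] Gd'\<close>)
      then have "smul E (of_real (inverse t)) (G m t - G n t) \<in> C" by (simp add: G0)
      \<comment> \<open>The estimate concerns the quotient by t; since t is at most 1 and C is
        convex and contains 0, it carries over to the difference itself.\<close>
      from convex_in_smul[OF C(4,2) this, of t]
      have "smul E (of_real t) (smul E (of_real (inverse t)) (G m t - G n t)) \<in> C" using t0 by simp
      moreover have "smul E (of_real t) (smul E (of_real (inverse t)) (G m t - G n t)) = G m t - G n t"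
        using t0 t Gc by (simp add: smul_smul smul_one diff_closed)
      ultimately show ?thesis using C(3) by auto
    qed
    then show ?thesis by blast
  qed
  have "\<exists>g. limitin (vtop E) (\<lambda>n. G n t) g sequentially" if t: "t \<in> {0..1}" for t
    using sc cauchy[OF t] Gc[OF t] unfolding sequentially_complete_def by (auto simp: image_subset_iff)
  then obtain \<Gamma> where \<Gamma>: "\<And>t. t \<in> {0..1} \<Longrightarrow> limitin (vtop E) (\<lambda>n. G n t) (\<Gamma> t) sequentially"
    by metis
  show ?thesis
  proof (rule that[of \<Gamma>])
    show c: "\<Gamma> t \<in> vcarrier E" if "t \<in> {0..1}" for t by (rule limitin_topspace[OF \<Gamma>[OF that]])
    have "limitin (vtop E) (\<lambda>n. G n 0) 0 sequentially" by (simp add: G0 zero_closed)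
    then show "\<Gamma> 0 = 0" using limitin_unique[OF \<Gamma>[of 0]] by simp
    fix t :: real assume t: "t \<in> {0..1}"
    show "has_curve_deriv E {0..1} \<Gamma> t (\<gamma> t)"
      unfolding has_curve_deriv_def limitin_nbhd_zero
    proof (intro conjI allI impI)
      show "\<gamma> t \<in> vcarrier E" by (rule \<gamma>c[OF t])
      fix U assume U: "openin (vtop E) U \<and> 0 \<in> U"
      \<comment> \<open>The choices run backwards: U' survives the limit over n, V yields quotients
        in U' by the mean value theorem, and V' splits the error into that of the approximation and
        the variation of \<gamma> near t.\<close>
      obtain U' where U': "openin (vtop E) U'" "0 \<in> U'"
        "\<And>f a (Fl::nat filter). \<lbrakk>limitin (vtop E) f a Fl; eventually (\<lambda>t. f t \<in> U') Fl; Fl \<noteq> bot\<rbrakk> \<Longrightarrow> a \<in> U"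
        by (rule limit_in_nbhd[of U]) (use U in auto)
      obtain V where V: "openin (vtop E) V" "0 \<in> V"
        "\<And>\<gamma> \<gamma>' a b p. \<lbrakk>a < b; p \<in> vcarrier E; \<And>t. t \<in> {a..b} \<Longrightarrow> \<gamma> t \<in> vcarrier E;
         \<And>t. t \<in> {a..b} \<Longrightarrow> has_curve_deriv E {a..b} \<gamma> t (\<gamma>' t); \<And>t. t \<in> {a..b} \<Longrightarrow> \<gamma>' t - p \<in> V\<rbrakk> \<Longrightarrow>
         smul E (of_real (inverse (b - a))) (\<gamma> b - \<gamma> a) - p \<in> U'"
        by (rule mean_value[OF U'(1,2)]) auto
      obtain V' where V': "openin (vtop E) V'" "0 \<in> V'" "\<And>x y. \<lbrakk>x \<in> V'; y \<in> V'\<rbrakk> \<Longrightarrow> x + y \<in> V"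
        by (rule half_nbhd[OF V(1,2)]) blast
      obtain N where N: "\<And>n s. \<lbrakk>n \<ge> N; s \<in> {0..1}\<rbrakk> \<Longrightarrow> \<delta> n s - \<gamma> s \<in> V'"
        using unif[OF V'(1,2)] by blast
      have "openin (top_of_set {0..1}) {s \<in> topspace (top_of_set {0..1}). \<gamma> s \<in> {x \<in> vcarrier E. x - \<gamma> t \<in> V'}}"
        by (rule openin_continuous_map_preimage[OF \<gamma> openin_translate[OF V'(1) \<gamma>c[OF t]]])
      then obtain T where T: "open T" "{s \<in> {0..1}. \<gamma> s \<in> {x \<in> vcarrier E. x - \<gamma> t \<in> V'}} = {0..1} \<inter> T"
        unfolding openin_open by auto
      have "t \<in> {0..1} \<inter> T" unfolding T(2)[symmetric] using t V'(2) \<gamma>c[OF t] by simp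
      then have "t \<in> T" by simp
      then obtain e where e: "e > 0" "\<And>s. dist s t < e \<Longrightarrow> s \<in> T"
        using T(1) unfolding open_dist by blast
      have near: "\<gamma> s - \<gamma> t \<in> V'" if "s \<in> {0..1}" "dist s t < e" for s
        using e(2)[OF that(2)] T(2) that(1) by blast
      have \<delta>V: "\<delta> n s - \<gamma> t \<in> V" if "s \<in> {0..1}" "dist s t < e" "n \<ge> N" for n s
        using V'(3)[OF N[OF that(3,1)] near[OF that(1,2)]] by simp
      have mvt: "smul E (of_real (inverse (b - a))) (G n b - G n a) - \<gamma> t \<in> U'"
        if "a < b" "a \<in> {0..1}" "b \<in> {0..1}" "dist a t < e" "dist b t < e" "a \<le> t" "t \<le> b" "n \<ge> N" for a b n
        by (rule V(3)[OF that(1) \<gamma>c[OF t], where \<gamma>' = "\<delta> n"])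
           (use that Gc \<delta>V in \<open>auto intro!: Gd' simp: dist_real_def\<close>)
      have quot: "smul E (of_real (inverse (s - t))) (G n s - G n t) - \<gamma> t \<in> U'"
        if s: "s \<in> {0..1}" "dist s t < e" "s \<noteq> t" "n \<ge> N" for s n
      proof (cases "t < s")
        case True
        then show ?thesis using mvt[of t s n] s t e(1) by simp
      next
        case False
        then have "s < t" using s(3) by simp
        then have "smul E (of_real (inverse (t - s))) (G n t - G n s) - \<gamma> t \<in> U'"
          using mvt[of s t n] s t e(1) by simp
        moreover have "smul E (of_real (inverse (t - s))) (G n t - G n s) = smul E (of_real (inverse (s - t))) (G n s - G n t)"
        proof -
          have "inverse (t - s) = - inverse (s - t)" by (metis inverse_minus_eq minus_diff_eq)
          then have "smul E (of_real (inverse (t - s))) (G n t - G n s) = - smul E (of_real (inverse (s - t))) (G n t - G n s)"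
            using Gc[OF t] Gc[OF s(1)] by (simp only: of_real_minus smul_minus_left diff_closed)
          also have "\<dots> = smul E (of_real (inverse (s - t))) (- (G n t - G n s))"
            using Gc[OF t] Gc[OF s(1)] by (simp only: smul_minus_right diff_closed)
          finally show ?thesis by simp
        qed
        ultimately show ?thesis by simp
      qed
      have "smul E (of_real (inverse (s - t))) (\<Gamma> s - \<Gamma> t) - \<gamma> t \<in> U"
        if s: "s \<in> {0..1}" "dist s t < e" "s \<noteq> t" for s
      proof (rule U'(3))
        show "limitin (vtop E) (\<lambda>n. smul E (of_real (inverse (s - t))) (G n s - G n t) - \<gamma> t)
            (smul E (of_real (inverse (s - t))) (\<Gamma> s - \<Gamma> t) - \<gamma> t) sequentially"
          using \<gamma>c[OF t] by (intro limitin_diff limitin_smul_const \<Gamma> s(1) t) simp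
        show "eventually (\<lambda>n. smul E (of_real (inverse (s - t))) (G n s - G n t) - \<gamma> t \<in> U') sequentially"
          unfolding eventually_sequentially using quot[OF s] by blast
      qed simp
      moreover have "smul E (of_real (inverse (s - t))) (\<Gamma> s - \<Gamma> t) \<in> vcarrier E" if "s \<in> {0..1}" for s
        using c[OF that] c[OF t] by (intro smul_closed diff_closed)
      ultimately show "eventually (\<lambda>s. smul E (of_real (inverse (s - t))) (\<Gamma> s - \<Gamma> t) \<in> vcarrier E \<and>
          smul E (of_real (inverse (s - t))) (\<Gamma> s - \<Gamma> t) - \<gamma> t \<in> U) (at t within {0..1})"
        unfolding eventually_at using e(1) by blast
    qed
  qed
qed

end

section \<open>Uniform convergence on the unit interval and continuous operations on curves\<close>

section \<open>The space of continuous curves\<close>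

lemma Cr_curves_zero:
  "Cr_curves E 0 = {\<gamma>. continuous_map (top_of_set {0..1}) (vtop E) \<gamma> \<and> (\<forall>t. t \<notin> {0..1} \<longrightarrow> \<gamma> t = 0)}"
proof -
  have "\<not> enat (Suc k) \<le> 0" "enat k \<le> 0 \<longleftrightarrow> k = 0" for k by (simp_all add: zero_enat_def)
  then show ?thesis by (auto simp: Cr_curves_def Cr_curve_def)
qed

abbreviation curve_space :: "('k::real_normed_field, 'v::ab_group_add) tvs \<Rightarrow> ('k, real \<Rightarrow> 'v) tvs" where
  "curve_space E \<equiv> Cr_curve_space E 0"

lemma smul_curve_space [simp]: "smul (Cr_curve_space E r) a \<gamma> = (\<lambda>t. smul E a (\<gamma> t))"
  by (simp add: Cr_curve_space_def)

lemma openin_curve_space: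
  "openin (vtop (curve_space E)) W \<longleftrightarrow> W \<subseteq> Cr_curves E 0 \<and>
    (\<forall>\<gamma>\<in>W. \<exists>V. openin (vtop E) V \<and> 0 \<in> V \<and> {\<delta> \<in> Cr_curves E 0. \<forall>t\<in>{0..1}. \<delta> t - \<gamma> t \<in> V} \<subseteq> W)"
proof -
  have "openin (vtop (curve_space E)) W \<longleftrightarrow> Cr_curves_open E 0 W"
    by (simp add: Cr_curve_space_def topology_inverse'[OF istopology_Cr_curves_open])
  moreover have "enat n \<le> 0 \<longleftrightarrow> n = 0" for n by (simp add: zero_enat_def)
  ultimately show ?thesis by (simp add: Cr_curves_open_def)
qed

lemma Cr_curves_zero_memD:
  assumes "\<gamma> \<in> Cr_curves E 0"
  shows "continuous_map (top_of_set {0..1}) (vtop E) \<gamma>" "t \<in> {0..1} \<Longrightarrow> \<gamma> t \<in> vcarrier E" "t \<notin> {0..1} \<Longrightarrow> \<gamma> t = 0"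
proof -
  show c: "continuous_map (top_of_set {0..1}) (vtop E) \<gamma>" using assms by (simp add: Cr_curves_zero)
  show "t \<in> {0..1} \<Longrightarrow> \<gamma> t \<in> vcarrier E" using funcset_mem[OF continuous_map_funspace[OF c], of t] by simp
  show "t \<notin> {0..1} \<Longrightarrow> \<gamma> t = 0" using assms by (simp add: Cr_curves_zero)
qed

lemma Cr_curves_zero_memI:
  "\<lbrakk>continuous_map (top_of_set {0..1}) (vtop E) \<gamma>; \<And>t. t \<notin> {0..1} \<Longrightarrow> \<gamma> t = 0\<rbrakk> \<Longrightarrow> \<gamma> \<in> Cr_curves E 0"
  by (simp add: Cr_curves_zero)

context locally_convex_space
begin

lemma Cr_curves_zero_closed:
  "\<gamma> \<in> Cr_curves E 0 \<Longrightarrow> \<gamma> t \<in> vcarrier E"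
  using Cr_curves_zero_memD(2,3)[of \<gamma> E t] zero_closed by (cases "t \<in> {0..1}") auto

lemma vcarrier_curve_space: "vcarrier (curve_space E) = Cr_curves E 0"
proof
  show "vcarrier (curve_space E) \<subseteq> Cr_curves E 0"
    using openin_topspace[of "vtop (curve_space E)"] unfolding openin_curve_space by blast
  have "openin (vtop (curve_space E)) (Cr_curves E 0)"
    unfolding openin_curve_space using zero_closed by blast
  then show "Cr_curves E 0 \<subseteq> vcarrier (curve_space E)" by (rule openin_subset)
qed

text \<open>The curves whose differences from \<gamma> lie in V need not form an open set. W asks in
  addition for a margin V' uniform in t, which is an open condition; the last clause exposes W
  because its convexity is needed for local convexity of the space of curves.\<close>

lemma nbhd_curve_space:
  assumes \<gamma>: "\<gamma> \<in> Cr_curves E 0" and V: "openin (vtop E) V" "0 \<in> V"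
  obtains W where "openin (vtop (curve_space E)) W" "\<gamma> \<in> W" "\<And>\<delta> t. \<lbrakk>\<delta> \<in> W; t \<in> {0..1}\<rbrakk> \<Longrightarrow> \<delta> t - \<gamma> t \<in> V"
    "W = {\<delta> \<in> Cr_curves E 0. \<exists>V'. openin (vtop E) V' \<and> 0 \<in> V' \<and> (\<forall>t\<in>{0..1}. \<forall>v\<in>V'. \<delta> t - \<gamma> t + v \<in> V)}"
proof -
  define W where "W = {\<delta> \<in> Cr_curves E 0. \<exists>V'. openin (vtop E) V' \<and> 0 \<in> V' \<and> (\<forall>t\<in>{0..1}. \<forall>v\<in>V'. \<delta> t - \<gamma> t + v \<in> V)}"
  have W1: "openin (vtop (curve_space E)) W"
    unfolding openin_curve_space
  proof (intro conjI ballI)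
    show "W \<subseteq> Cr_curves E 0" by (auto simp: W_def)
    fix \<delta> assume "\<delta> \<in> W"
    then obtain V' where V': "openin (vtop E) V'" "0 \<in> V'" "\<And>t v. \<lbrakk>t \<in> {0..1}; v \<in> V'\<rbrakk> \<Longrightarrow> \<delta> t - \<gamma> t + v \<in> V"
      unfolding W_def by blast
    obtain C where C: "openin (vtop E) C" "0 \<in> C" "\<And>x y. \<lbrakk>x \<in> C; y \<in> C\<rbrakk> \<Longrightarrow> x + y \<in> V'"
      by (rule half_nbhd[OF V'(1,2)]) blast
    have "\<eta> \<in> W" if \<eta>: "\<eta> \<in> Cr_curves E 0" "\<forall>t\<in>{0..1}. \<eta> t - \<delta> t \<in> C" for \<eta>
    proof -
      have "\<eta> t - \<gamma> t + v \<in> V" if "t \<in> {0..1}" "v \<in> C" for t v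
        using V'(3)[OF that(1) C(3)[OF bspec[OF \<eta>(2) that(1)] that(2)]] by (simp add: algebra_simps)
      then show ?thesis using \<eta>(1) C(1,2) unfolding W_def by blast
    qed
    then show "\<exists>V. openin (vtop E) V \<and> 0 \<in> V \<and> {\<eta> \<in> Cr_curves E 0. \<forall>t\<in>{0..1}. \<eta> t - \<delta> t \<in> V} \<subseteq> W"
      using C(1,2) by blast
  qed
  have W2: "\<gamma> \<in> W" using \<gamma> V by (auto simp: W_def)
  have W3: "\<delta> t - \<gamma> t \<in> V" if "\<delta> \<in> W" "t \<in> {0..1}" for \<delta> t
    using that unfolding W_def mem_Collect_eq by (elim conjE exE) (drule (1) bspec, drule (1) bspec, simp)
  show ?thesis
  proof (rule that[of W])
    show "\<delta> t - \<gamma> t \<in> V" if "\<delta> \<in> W" "t \<in> {0..1}" for \<delta> t using that by (rule W3[of \<delta> t])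
  qed (rule W1, rule W2, rule W_def)
qed

text \<open>One half of the exponential law: by compactness of the interval and the tube lemma,
  joint continuity in time and parameter makes nearby curves uniformly close.\<close>

lemma continuous_map_into_curve_space:
  assumes H: "\<And>x. x \<in> topspace X \<Longrightarrow> H x \<in> Cr_curves E 0"
    and cont: "continuous_map (prod_topology (top_of_set {0..1}) X) (vtop E) (\<lambda>p. H (snd p) (fst p))"
  shows "continuous_map X (vtop (curve_space E)) H"
  unfolding continuous_map_def
proof (intro conjI allI impI)
  show "H \<in> topspace X \<rightarrow> vcarrier (curve_space E)" using H by (simp add: vcarrier_curve_space)
  fix W assume W: "openin (vtop (curve_space E)) W"
  show "openin X {x \<in> topspace X. H x \<in> W}"
  proof (subst openin_subopen, intro ballI)
    fix x0 assume "x0 \<in> {x \<in> topspace X. H x \<in> W}"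
    then have x0: "x0 \<in> topspace X" "H x0 \<in> W" by auto
    from W x0(2) obtain V where V: "openin (vtop E) V" "0 \<in> V" "{\<delta> \<in> Cr_curves E 0. \<forall>t\<in>{0..1}. \<delta> t - H x0 t \<in> V} \<subseteq> W"
      unfolding openin_curve_space by blast
    have "continuous_map (prod_topology (top_of_set {0..1}) X) (vtop E) (\<lambda>p. H x0 (fst p))"
      using continuous_map_compose[OF continuous_map_fst Cr_curves_zero_memD(1)[OF H[OF x0(1)]]] by (simp add: o_def)
    then have "openin (prod_topology (top_of_set {0..1}) X)
        {p \<in> topspace (prod_topology (top_of_set {0..1}) X). H (snd p) (fst p) - H x0 (fst p) \<in> V}" (is "openin _ ?P")
      by (intro openin_continuous_map_preimage[OF continuous_map_diff'[OF cont] V(1)])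
    moreover have "compactin (top_of_set {0..1::real}) {0..1}" by (simp add: compactin_subtopology)
    moreover have "{0..1} \<times> {x0} \<subseteq> ?P" using x0 V(2) by auto
    ultimately have "\<exists>U0 V0. openin (top_of_set {0..1}) U0 \<and> openin X V0 \<and> {0..1} \<subseteq> U0 \<and> x0 \<in> V0 \<and> U0 \<times> V0 \<subseteq> ?P"
      by (rule tube_lemma_left[OF _ _ x0(1)])
    then obtain U0 V0 where UV: "openin X V0" "{0..1} \<subseteq> U0" "x0 \<in> V0" "U0 \<times> V0 \<subseteq> ?P" by blast
    have "V0 \<subseteq> {x \<in> topspace X. H x \<in> W}"
    proof
      fix x assume x: "x \<in> V0"
      then have xX: "x \<in> topspace X" using openin_subset[OF UV(1)] by blast
      have "H x t - H x0 t \<in> V" if "t \<in> {0..1}" for t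
      proof -
        have "(t, x) \<in> ?P" using UV(2,4) x that by blast
        then show ?thesis by simp
      qed
      then show "x \<in> {x \<in> topspace X. H x \<in> W}" using V(3) H[OF xX] xX by blast
    qed
    then show "\<exists>T. openin X T \<and> x0 \<in> T \<and> T \<subseteq> {x \<in> topspace X. H x \<in> W}" using UV(1,3) by blast
  qed
qed

text \<open>The other half of the exponential law: a value changes by the change of the curve plus
  the oscillation of the fixed curve. Together the two halves reduce operations on curves to
  continuity in time and parameter.\<close>

lemma continuous_map_curve_eval_joint:
  "continuous_map (prod_topology (top_of_set {0..1}) (vtop (curve_space E))) (vtop E) (\<lambda>p. snd p (fst p))"
  unfolding continuous_map_def
proof (intro conjI allI impI)
  let ?T = "prod_topology (top_of_set {0..1}) (vtop (curve_space E))"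
  show "(\<lambda>p. snd p (fst p)) \<in> topspace ?T \<rightarrow> vcarrier E"
    by (auto simp: vcarrier_curve_space intro: Cr_curves_zero_closed)
  fix U assume U: "openin (vtop E) U"
  show "openin ?T {p \<in> topspace ?T. snd p (fst p) \<in> U}"
  proof (subst openin_subopen, intro ballI)
    fix p assume "p \<in> {p \<in> topspace ?T. snd p (fst p) \<in> U}"
    then obtain t0 \<gamma>0 where p: "p = (t0, \<gamma>0)" "t0 \<in> {0..1}" "\<gamma>0 \<in> Cr_curves E 0" "\<gamma>0 t0 \<in> U"
      by (auto simp: vcarrier_curve_space)
    have c0: "\<gamma>0 t0 \<in> vcarrier E" by (rule Cr_curves_zero_closed[OF p(3)])
    define V where "V = {x \<in> vcarrier E. x - (- \<gamma>0 t0) \<in> U}"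
    have V: "openin (vtop E) V" "0 \<in> V"
      unfolding V_def using openin_translate[OF U uminus_closed[OF c0]] p(4) zero_closed by auto
    obtain C where C: "openin (vtop E) C" "0 \<in> C" "\<And>x y. \<lbrakk>x \<in> C; y \<in> C\<rbrakk> \<Longrightarrow> x + y \<in> V"
      by (rule half_nbhd[OF V]) blast
    obtain W where W: "openin (vtop (curve_space E)) W" "\<gamma>0 \<in> W" "\<And>\<delta> t. \<lbrakk>\<delta> \<in> W; t \<in> {0..1}\<rbrakk> \<Longrightarrow> \<delta> t - \<gamma>0 t \<in> C"
      by (rule nbhd_curve_space[OF p(3) C(1,2)]) blast
    define T where "T = {t \<in> topspace (top_of_set {0..1}). \<gamma>0 t \<in> {x \<in> vcarrier E. x - \<gamma>0 t0 \<in> C}}"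
    have T: "openin (top_of_set {0..1}) T"
      unfolding T_def by (rule openin_continuous_map_preimage[OF Cr_curves_zero_memD(1)[OF p(3)] openin_translate[OF C(1) c0]])
    have "t0 \<in> T" using p(2) c0 C(2) by (simp add: T_def)
    have sub: "T \<times> W \<subseteq> {p \<in> topspace ?T. snd p (fst p) \<in> U}"
    proof
      fix q assume "q \<in> T \<times> W"
      then obtain t \<gamma> where q: "q = (t, \<gamma>)" "t \<in> T" "\<gamma> \<in> W" by auto
      have t: "t \<in> {0..1}" "\<gamma>0 t - \<gamma>0 t0 \<in> C" using q(2) by (auto simp: T_def)
      have "\<gamma> \<in> vcarrier (curve_space E)" using q(3) openin_subset[OF W(1)] by blast
      moreover have "(\<gamma> t - \<gamma>0 t) + (\<gamma>0 t - \<gamma>0 t0) \<in> V" by (rule C(3)[OF W(3)[OF q(3) t(1)] t(2)])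
      ultimately show "q \<in> {p \<in> topspace ?T. snd p (fst p) \<in> U}" using q(1) t(1) by (simp add: V_def)
    qed
    show "\<exists>S. openin ?T S \<and> p \<in> S \<and> S \<subseteq> {p \<in> topspace ?T. snd p (fst p) \<in> U}"
      by (rule exI[of _ "T \<times> W"]) (use sub T W(1,2) \<open>t0 \<in> T\<close> p(1) in \<open>simp add: openin_prod_Times_iff\<close>)
  qed
qed

lemma continuous_map_curve_eval:
  assumes "continuous_map Y (top_of_set {0..1}) a" "continuous_map Y (vtop (curve_space E)) g"
  shows "continuous_map Y (vtop E) (\<lambda>y. g y (a y))"
  using continuous_map_compose[OF continuous_map_pairedI[OF assms] continuous_map_curve_eval_joint] by (simp add: o_def)

lemma Cr_curves_zero_add: "\<lbrakk>\<gamma> \<in> Cr_curves E 0; \<delta> \<in> Cr_curves E 0\<rbrakk> \<Longrightarrow> (\<lambda>t. \<gamma> t + \<delta> t) \<in> Cr_curves E 0"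
  by (rule Cr_curves_zero_memI[OF continuous_map_add'[OF Cr_curves_zero_memD(1) Cr_curves_zero_memD(1)]])
     (simp_all add: Cr_curves_zero_memD(3))

lemma Cr_curves_zero_smul: "\<gamma> \<in> Cr_curves E 0 \<Longrightarrow> (\<lambda>t. smul E a (\<gamma> t)) \<in> Cr_curves E 0"
  by (rule Cr_curves_zero_memI[OF continuous_map_smul_const[OF Cr_curves_zero_memD(1)]])
     (simp_all add: Cr_curves_zero_memD(3) smul_zero_right)

lemma lcs_curve_space: "lcs (curve_space E)"
proof
  let ?C = "curve_space E"
  note car = vcarrier_curve_space
  have t_fst: "continuous_map (prod_topology (top_of_set {0..1}) X) (top_of_set {0..1}) fst" for X :: "'x topology"
    by (rule continuous_map_fst)
  have point: "continuous_map (vtop ?C) (vtop E) (\<lambda>\<gamma>. \<gamma> t)" if "t \<in> {0..1}" for t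
    using continuous_map_curve_eval[of "vtop ?C" "\<lambda>_. t" "\<lambda>\<gamma>. \<gamma>"] that by (simp add: continuous_map_id')
  show "Hausdorff_space (vtop ?C)"
    unfolding Hausdorff_space_def
  proof (intro allI impI)
    fix \<gamma> \<delta> assume *: "\<gamma> \<in> vcarrier ?C \<and> \<delta> \<in> vcarrier ?C \<and> \<gamma> \<noteq> \<delta>"
    then obtain t where t: "\<gamma> t \<noteq> \<delta> t" by (auto simp: fun_eq_iff)
    have t01: "t \<in> {0..1}" using * t Cr_curves_zero_memD(3)[of \<gamma> E t] Cr_curves_zero_memD(3)[of \<delta> E t] by (auto simp: car)
    obtain U V where UV: "openin (vtop E) U" "openin (vtop E) V" "\<gamma> t \<in> U" "\<delta> t \<in> V" "disjnt U V"
      using hausdorff t * Cr_curves_zero_closed unfolding Hausdorff_space_def car by metis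
    show "\<exists>U V. openin (vtop ?C) U \<and> openin (vtop ?C) V \<and> \<gamma> \<in> U \<and> \<delta> \<in> V \<and> disjnt U V"
      by (rule exI[of _ "{\<gamma> \<in> vcarrier ?C. \<gamma> t \<in> U}"], rule exI[of _ "{\<gamma> \<in> vcarrier ?C. \<gamma> t \<in> V}"])
         (use * UV openin_continuous_map_preimage[OF point[OF t01]] in \<open>auto simp: disjnt_iff\<close>)
  qed
  have "continuous_map (prod_topology (vtop ?C) (vtop ?C)) (vtop ?C) (\<lambda>p t. fst p t + snd p t)"
  proof (rule continuous_map_into_curve_space)
    show "(\<lambda>t. fst p t + snd p t) \<in> Cr_curves E 0" if "p \<in> topspace (prod_topology (vtop ?C) (vtop ?C))" for p
      using that by (auto simp: car intro: Cr_curves_zero_add)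
    show "continuous_map (prod_topology (top_of_set {0..1}) (prod_topology (vtop ?C) (vtop ?C))) (vtop E)
        (\<lambda>p. fst (snd p) (fst p) + snd (snd p) (fst p))"
      by (intro continuous_map_add' continuous_map_curve_eval t_fst continuous_map_fst_comp[OF continuous_map_snd] continuous_map_snd_comp[OF continuous_map_snd])
  qed
  then show "continuous_map (prod_topology (vtop ?C) (vtop ?C)) (vtop ?C) (\<lambda>(x, y). x + y)"
    by (simp add: case_prod_unfold plus_fun_def)
  have "continuous_map (prod_topology euclidean (vtop ?C)) (vtop ?C) (\<lambda>p t. smul E (fst p) (snd p t))"
  proof (rule continuous_map_into_curve_space)
    show "(\<lambda>t. smul E (fst p) (snd p t)) \<in> Cr_curves E 0" if "p \<in> topspace (prod_topology euclidean (vtop ?C))" for p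
      using that by (auto simp: car intro: Cr_curves_zero_smul)
    show "continuous_map (prod_topology (top_of_set {0..1}) (prod_topology euclidean (vtop ?C))) (vtop E)
        (\<lambda>p. smul E (fst (snd p)) (snd (snd p) (fst p)))"
      by (intro continuous_map_smul' continuous_map_curve_eval t_fst continuous_map_fst_comp[OF continuous_map_snd] continuous_map_snd_comp[OF continuous_map_snd])
  qed
  then show "continuous_map (prod_topology euclidean (vtop ?C)) (vtop ?C) (\<lambda>(a, x). smul ?C a x)"
    by (simp add: case_prod_unfold)
  have zero: "0 \<in> Cr_curves E 0" by (rule Cr_curves_zero_memI) (simp_all add: zero_fun_def zero_closed)
  then show "0 \<in> vcarrier ?C" by (simp add: car)
  show "x + y \<in> vcarrier ?C" if "x \<in> vcarrier ?C" "y \<in> vcarrier ?C" for x y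
    using Cr_curves_zero_add[of x y] that by (simp add: car plus_fun_def)
  show "smul ?C a x \<in> vcarrier ?C" if "x \<in> vcarrier ?C" for a x
    using Cr_curves_zero_smul that by (simp add: car)
  fix U assume U: "openin (vtop ?C) U" "0 \<in> U"
  then obtain V where V: "openin (vtop E) V" "0 \<in> V" "{\<delta> \<in> Cr_curves E 0. \<forall>t\<in>{0..1}. \<delta> t - 0 t \<in> V} \<subseteq> U"
    unfolding openin_curve_space by blast
  obtain D where D: "openin (vtop E) D" "0 \<in> D" "D \<subseteq> V" "convex_in D" by (rule convex_nbhd[OF V(1,2)])
  obtain W where W: "openin (vtop ?C) W" "0 \<in> W" "\<And>\<delta> t. \<lbrakk>\<delta> \<in> W; t \<in> {0..1}\<rbrakk> \<Longrightarrow> \<delta> t - 0 t \<in> D"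
    "W = {\<delta> \<in> Cr_curves E 0. \<exists>V'. openin (vtop E) V' \<and> 0 \<in> V' \<and> (\<forall>t\<in>{0..1}. \<forall>v\<in>V'. \<delta> t - 0 t + v \<in> D)}"
    by (rule nbhd_curve_space[OF zero D(1,2)]) blast
  show "\<exists>C. openin (vtop ?C) C \<and> 0 \<in> C \<and> C \<subseteq> U \<and>
      (\<forall>x\<in>C. \<forall>y\<in>C. \<forall>t\<in>{0..1::real}. smul ?C (of_real (1 - t)) x + smul ?C (of_real t) y \<in> C)"
  \<comment> \<open>Convexity passes from D to W, with the intersection of the two margins as a
    margin for the combination.\<close>
  proof (intro exI[of _ W] conjI ballI W(1,2))
    show "W \<subseteq> U" using W(3) V(3) D(3) openin_subset[OF W(1)] unfolding car by blast
    fix x y and s :: real assume x: "x \<in> W" and y: "y \<in> W" and s: "s \<in> {0..1}"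
    obtain V1 where V1: "openin (vtop E) V1" "0 \<in> V1" "\<And>t v. \<lbrakk>t \<in> {0..1}; v \<in> V1\<rbrakk> \<Longrightarrow> x t + v \<in> D"
      using x unfolding W(4) by auto
    obtain V2 where V2: "openin (vtop E) V2" "0 \<in> V2" "\<And>t v. \<lbrakk>t \<in> {0..1}; v \<in> V2\<rbrakk> \<Longrightarrow> y t + v \<in> D"
      using y unfolding W(4) by auto
    have xy: "x \<in> Cr_curves E 0" "y \<in> Cr_curves E 0" using x y unfolding W(4) by auto
    have "smul E (of_real (1 - s)) (x t) + smul E (of_real s) (y t) + v \<in> D" if t: "t \<in> {0..1}" and v: "v \<in> V1 \<inter> V2" for t v
    proof -
      have vc: "v \<in> vcarrier E" using v openin_subset[OF V1(1)] by blast
      have "smul E (of_real (1 - s)) (x t + v) + smul E (of_real s) (y t + v) \<in> D"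
        using V1(3)[OF t] V2(3)[OF t] v s by (intro convex_inD[OF D(4)]) auto
      moreover have "smul E (of_real (1 - s)) v + smul E (of_real s) v = v"
        using vc by (simp add: smul_add_left[symmetric] smul_one)
      then have "smul E (of_real (1 - s)) (x t + v) + smul E (of_real s) (y t + v) =
          smul E (of_real (1 - s)) (x t) + smul E (of_real s) (y t) + v"
        using vc Cr_curves_zero_closed[OF xy(1), of t] Cr_curves_zero_closed[OF xy(2), of t]
        by (simp only: smul_add_right) (simp only: add.assoc add.left_commute[of _ "smul E (of_real s) (y t)"])
      ultimately show ?thesis by simp
    qed
    then have "\<exists>V'. openin (vtop E) V' \<and> 0 \<in> V' \<and> (\<forall>t\<in>{0..1}. \<forall>v\<in>V'. smul E (of_real (1 - s)) (x t) + smul E (of_real s) (y t) + v \<in> D)"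
      using V1(1,2) V2(1,2) by (intro exI[of _ "V1 \<inter> V2"]) auto
    moreover have "(\<lambda>t. smul E (of_real (1 - s)) (x t) + smul E (of_real s) (y t)) \<in> Cr_curves E 0"
      by (intro Cr_curves_zero_add Cr_curves_zero_smul xy)
    ultimately show "smul ?C (of_real (1 - s)) x + smul ?C (of_real s) y \<in> W"
      unfolding W(4) plus_fun_def smul_curve_space by simp
  qed
qed (auto simp: vcarrier_curve_space fun_eq_iff smul_add_right smul_add_left smul_smul smul_one Cr_curves_zero_closed)

lemma continuous_linear_curve_eval: "t \<in> {0..1} \<Longrightarrow> continuous_linear (curve_space E) E (\<lambda>\<gamma>. \<gamma> t)"
  using continuous_map_curve_eval[of "vtop (curve_space E)" "\<lambda>_. t" "\<lambda>\<gamma>. \<gamma>"]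
  by (simp add: continuous_linear_def continuous_map_id')

lemma curve_deriv_limit:
  assumes c: "\<And>t. t \<in> I \<Longrightarrow> \<Gamma> t \<in> vcarrier E" and d: "has_curve_deriv E I \<Gamma> t v" and t: "t \<in> I"
  shows "limitin (vtop E) \<Gamma> (\<Gamma> t) (at t within I)"
proof -
  have "((\<lambda>s. of_real (s - t) :: 'k) \<longlongrightarrow> of_real (t - t)) (at t within I)" by (intro tendsto_intros)
  then have "((\<lambda>s. of_real (s - t) :: 'k) \<longlongrightarrow> 0) (at t within I)" by simp
  from limitin_add[OF _ limitin_smul[OF this d[unfolded has_curve_deriv_def]], of "\<lambda>_. \<Gamma> t" "\<Gamma> t"]
  have "limitin (vtop E) (\<lambda>s. \<Gamma> t + smul E (of_real (s - t)) (smul E (of_real (inverse (s - t))) (\<Gamma> s - \<Gamma> t))) (\<Gamma> t) (at t within I)"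
    using c[OF t] limitin_topspace[OF d[unfolded has_curve_deriv_def]] by (simp add: smul_zero_left)
  then show ?thesis
  proof (rule limitin_transform_eventually[rotated])
    show "eventually (\<lambda>s. \<Gamma> t + smul E (of_real (s - t)) (smul E (of_real (inverse (s - t))) (\<Gamma> s - \<Gamma> t)) = \<Gamma> s) (at t within I)"
      unfolding eventually_at_filter
    proof (intro always_eventually allI impI)
      fix s assume s: "s \<noteq> t" "s \<in> I"
      have "(of_real (s - t) :: 'k) \<noteq> 0" using s by (simp only: of_real_eq_0_iff)
      then show "\<Gamma> t + smul E (of_real (s - t)) (smul E (of_real (inverse (s - t))) (\<Gamma> s - \<Gamma> t)) = \<Gamma> s"
        unfolding of_real_inverse using c t s by (subst smul_cancel_inverse) (auto intro: diff_closed)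
    qed
  qed
qed

lemma curve_deriv_continuous:
  assumes c: "\<And>t. t \<in> I \<Longrightarrow> \<Gamma> t \<in> vcarrier E" and d: "\<And>t. t \<in> I \<Longrightarrow> has_curve_deriv E I \<Gamma> t (v t)"
  shows "continuous_map (top_of_set I) (vtop E) \<Gamma>"
  unfolding continuous_map_atin
proof
  fix t assume "t \<in> topspace (top_of_set I)"
  then have t: "t \<in> I" by simp
  have "atin (top_of_set I) t = at t within I"
    using t by (auto simp: atin_subtopology_within filter_eq_iff eventually_atin_within eventually_at_topological)
  with curve_deriv_limit[OF c d[OF t] t] show "limitin (vtop E) \<Gamma> (\<Gamma> t) (atin (top_of_set I) t)" by simp
qed

text \<open>Cut off to 0 outside the unit interval, in keeping with the representation of curves by
  extensions by zero; on the interval the choice is immaterial by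
  \<open>primitive_unique\<close>.\<close>

definition primitive :: "(real \<Rightarrow> 'v) \<Rightarrow> real \<Rightarrow> 'v" where
  "primitive \<gamma> t = (if t \<in> {0..1} then (SOME \<Gamma>. \<Gamma> 0 = 0 \<and> (\<forall>t\<in>{0..1}. \<Gamma> t \<in> vcarrier E \<and> has_curve_deriv E {0..1} \<Gamma> t (\<gamma> t))) t else 0)"

lemma primitive_outside: "t \<notin> {0..1} \<Longrightarrow> primitive \<gamma> t = 0"
  by (simp only: primitive_def if_False)

lemma primitive:
  assumes sc: "sequentially_complete E" and \<gamma>: "continuous_map (top_of_set {0..1}) (vtop E) \<gamma>"
  shows "primitive \<gamma> 0 = 0" "t \<in> {0..1} \<Longrightarrow> primitive \<gamma> t \<in> vcarrier E"
    "t \<in> {0..1} \<Longrightarrow> has_curve_deriv E {0..1} (primitive \<gamma>) t (\<gamma> t)" "primitive \<gamma> \<in> Cr_curves E 0"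
proof -
  define \<Gamma> where "\<Gamma> = (SOME \<Gamma>. \<Gamma> 0 = 0 \<and> (\<forall>t\<in>{0..1}. \<Gamma> t \<in> vcarrier E \<and> has_curve_deriv E {0..1} \<Gamma> t (\<gamma> t)))"
  have "\<exists>\<Gamma>. \<Gamma> 0 = 0 \<and> (\<forall>t\<in>{0..1}. \<Gamma> t \<in> vcarrier E \<and> has_curve_deriv E {0..1} \<Gamma> t (\<gamma> t))"
    using primitive_exists[OF sc \<gamma>] by metis
  then have \<Gamma>: "\<Gamma> 0 = 0 \<and> (\<forall>t\<in>{0..1}. \<Gamma> t \<in> vcarrier E \<and> has_curve_deriv E {0..1} \<Gamma> t (\<gamma> t))"
    unfolding \<Gamma>_def by (rule someI_ex)
  have eq: "primitive \<gamma> t = (if t \<in> {0..1} then \<Gamma> t else 0)" for t by (simp only: primitive_def \<Gamma>_def)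
  show "primitive \<gamma> 0 = 0" using \<Gamma> by (simp add: eq)
  show c: "primitive \<gamma> t \<in> vcarrier E" if "t \<in> {0..1}" for t using \<Gamma> that by (simp add: eq)
  show d: "has_curve_deriv E {0..1} (primitive \<gamma>) t (\<gamma> t)" if "t \<in> {0..1}" for t
    by (subst has_curve_deriv_cong[where \<delta> = \<Gamma>]) (use \<Gamma> that in \<open>auto simp: eq\<close>)
  show "primitive \<gamma> \<in> Cr_curves E 0"
    by (rule Cr_curves_zero_memI[OF curve_deriv_continuous[OF c d]]) (auto simp: eq)
qed

lemma primitive_unique:
  assumes sc: "sequentially_complete E" and \<gamma>: "continuous_map (top_of_set {0..1}) (vtop E) \<gamma>"
    and G: "G 0 = 0" "\<And>t. t \<in> {0..1} \<Longrightarrow> G t \<in> vcarrier E" "\<And>t. t \<in> {0..1} \<Longrightarrow> has_curve_deriv E {0..1} G t (\<gamma> t)"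
    and t: "t \<in> {0..1}"
  shows "primitive \<gamma> t = G t"
proof -
  have "primitive \<gamma> t - G t = primitive \<gamma> 0 - G 0"
  proof (rule curve_deriv_zero_const[OF _ _ t])
    fix s :: real assume s: "s \<in> {0..1}"
    show "primitive \<gamma> s - G s \<in> vcarrier E" using primitive(2)[OF sc \<gamma> s] G(2)[OF s] by (rule diff_closed)
    show "has_curve_deriv E {0..1} (\<lambda>t. primitive \<gamma> t - G t) s 0"
      using has_curve_deriv_diff[OF locally_convex_space_axioms primitive(3)[OF sc \<gamma> s] G(3)[OF s] s primitive(2)[OF sc \<gamma>] G(2)] by simp
  qed
  then show ?thesis using primitive(1)[OF sc \<gamma>] G(1) by simp
qed

text \<open>Linearity follows from uniqueness of primitives. Continuity follows from the mean value
  theorem, because the intervals have length at most 1 and a uniformly small curve thus has a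
  uniformly small primitive.\<close>

lemma continuous_linear_primitive:
  assumes sc: "sequentially_complete E"
  shows "continuous_linear (curve_space E) (curve_space E) primitive"
  unfolding continuous_linear_def
proof (intro conjI ballI allI)
  note L = locally_convex_space_axioms
  note P = primitive[OF sc Cr_curves_zero_memD(1)]
  have add: "primitive (\<lambda>t. \<gamma> t + \<delta> t) = (\<lambda>t. primitive \<gamma> t + primitive \<delta> t)" if "\<gamma> \<in> Cr_curves E 0" "\<delta> \<in> Cr_curves E 0" for \<gamma> \<delta>
  proof
    fix t
    show "primitive (\<lambda>t. \<gamma> t + \<delta> t) t = primitive \<gamma> t + primitive \<delta> t"
    proof (cases "t \<in> {0..1}")
      case True
      show ?thesis
        by (rule primitive_unique[OF sc Cr_curves_zero_memD(1)[OF Cr_curves_zero_add[OF that]] _ _ _ True])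
           (use P[OF that(1)] P[OF that(2)] in \<open>auto intro!: add_closed has_curve_deriv_add[OF L]\<close>)
    qed (simp add: primitive_outside del: atLeastAtMost_iff)
  qed
  then show "primitive (\<gamma> + \<delta>) = primitive \<gamma> + primitive \<delta>" if "\<gamma> \<in> vcarrier (curve_space E)" "\<delta> \<in> vcarrier (curve_space E)" for \<gamma> \<delta>
    using that by (simp add: vcarrier_curve_space plus_fun_def)
  have scale: "primitive (\<lambda>t. smul E a (\<gamma> t)) = (\<lambda>t. smul E a (primitive \<gamma> t))" if "\<gamma> \<in> Cr_curves E 0" for a \<gamma>
  proof
    fix t
    show "primitive (\<lambda>t. smul E a (\<gamma> t)) t = smul E a (primitive \<gamma> t)"
    proof (cases "t \<in> {0..1}")
      case True
      have d: "has_curve_deriv E {0..1} (\<lambda>t. smul E a (primitive \<gamma> t)) s (smul E a (\<gamma> s))" if s: "s \<in> {0..1}" for s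
        using has_curve_deriv_compose[OF L L smooth_on_linear[OF L L continuous_linear_smul[OF L] openin_topspace] P(3)[OF \<open>\<gamma> \<in> Cr_curves E 0\<close> s] P(2)[OF \<open>\<gamma> \<in> Cr_curves E 0\<close>] s, of a]
          P(2)[OF \<open>\<gamma> \<in> Cr_curves E 0\<close> s] Cr_curves_zero_closed[OF \<open>\<gamma> \<in> Cr_curves E 0\<close>]
        by (simp add: dir_deriv_linear[OF L L continuous_linear_smul[OF L]])
      show ?thesis
        by (rule primitive_unique[OF sc Cr_curves_zero_memD(1)[OF Cr_curves_zero_smul[OF that]] _ _ _ True])
           (use P[OF that] d in \<open>auto intro!: smul_closed simp: smul_zero_right\<close>)
    qed (simp add: primitive_outside smul_zero_right del: atLeastAtMost_iff)
  qed
  then show "primitive (smul (curve_space E) a \<gamma>) = smul (curve_space E) a (primitive \<gamma>)" if "\<gamma> \<in> vcarrier (curve_space E)" for a \<gamma>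
    using that by (simp add: vcarrier_curve_space)
  show "continuous_map (vtop (curve_space E)) (vtop (curve_space E)) primitive"
    unfolding continuous_map_def
  proof (intro conjI allI impI)
    show "primitive \<in> vcarrier (curve_space E) \<rightarrow> vcarrier (curve_space E)"
      using P(4) by (auto simp: vcarrier_curve_space)
    fix W assume W: "openin (vtop (curve_space E)) W"
    show "openin (vtop (curve_space E)) {\<gamma> \<in> vcarrier (curve_space E). primitive \<gamma> \<in> W}"
      unfolding openin_curve_space
    proof (intro conjI ballI)
      show "{\<gamma> \<in> vcarrier (curve_space E). primitive \<gamma> \<in> W} \<subseteq> Cr_curves E 0" by (auto simp: vcarrier_curve_space)
      fix \<gamma> assume "\<gamma> \<in> {\<gamma> \<in> vcarrier (curve_space E). primitive \<gamma> \<in> W}"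
      then have \<gamma>: "\<gamma> \<in> Cr_curves E 0" "primitive \<gamma> \<in> W" by (auto simp: vcarrier_curve_space)
      obtain U where U: "openin (vtop E) U" "0 \<in> U" "{\<delta> \<in> Cr_curves E 0. \<forall>t\<in>{0..1}. \<delta> t - primitive \<gamma> t \<in> U} \<subseteq> W"
        using W \<gamma>(2) unfolding openin_curve_space by blast
      obtain C where C: "openin (vtop E) C" "0 \<in> C" "C \<subseteq> U" "convex_in C" by (rule convex_nbhd[OF U(1,2)])
      obtain V where V: "openin (vtop E) V" "0 \<in> V"
        "\<And>\<gamma> \<gamma>' a b p. \<lbrakk>a < b; p \<in> vcarrier E; \<And>t. t \<in> {a..b} \<Longrightarrow> \<gamma> t \<in> vcarrier E;
         \<And>t. t \<in> {a..b} \<Longrightarrow> has_curve_deriv E {a..b} \<gamma> t (\<gamma>' t); \<And>t. t \<in> {a..b} \<Longrightarrow> \<gamma>' t - p \<in> V\<rbrakk> \<Longrightarrow>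
         smul E (of_real (inverse (b - a))) (\<gamma> b - \<gamma> a) - p \<in> C"
        by (rule mean_value[OF C(1,2)]) auto
      have "primitive \<delta> \<in> W" if \<delta>: "\<delta> \<in> Cr_curves E 0" "\<forall>t\<in>{0..1}. \<delta> t - \<gamma> t \<in> V" for \<delta>
      proof -
        have "primitive \<delta> t - primitive \<gamma> t \<in> U" if t: "t \<in> {0..1}" for t
        proof (cases "t = 0")
          case True
          then show ?thesis using U(2) P(1)[OF \<gamma>(1)] P(1)[OF \<delta>(1)] by simp
        next
          case False
          then have t0: "0 < t" "t \<le> 1" using t by auto
          have d: "has_curve_deriv E {0..t} (\<lambda>s. primitive \<delta> s - primitive \<gamma> s) s (\<delta> s - \<gamma> s)" if "s \<in> {0..t}" for s
            by (rule has_curve_deriv_subset[OF has_curve_deriv_diff[OF L P(3)[OF \<delta>(1)] P(3)[OF \<gamma>(1)]]])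
               (use that t0 P(2)[OF \<delta>(1)] P(2)[OF \<gamma>(1)] in auto)
          have "smul E (of_real (inverse (t - 0))) ((primitive \<delta> t - primitive \<gamma> t) - (primitive \<delta> 0 - primitive \<gamma> 0)) - 0 \<in> C"
            by (rule V(3)[OF t0(1) zero_closed _ d]) (use t0 \<delta>(2) P(2)[OF \<delta>(1)] P(2)[OF \<gamma>(1)] in \<open>auto intro: diff_closed\<close>)
          then have "smul E (of_real (inverse t)) (primitive \<delta> t - primitive \<gamma> t) \<in> C"
            using P(1)[OF \<gamma>(1)] P(1)[OF \<delta>(1)] by simp
          from convex_in_smul[OF C(4,2) this, of t]
          have "smul E (of_real t) (smul E (of_real (inverse t)) (primitive \<delta> t - primitive \<gamma> t)) \<in> C" using t0 by simp
          moreover have "smul E (of_real t) (smul E (of_real (inverse t)) (primitive \<delta> t - primitive \<gamma> t)) = primitive \<delta> t - primitive \<gamma> t"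
            using t0 P(2)[OF \<delta>(1) t] P(2)[OF \<gamma>(1) t] by (simp add: smul_smul smul_one diff_closed)
          ultimately show ?thesis using C(3) by auto
        qed
        then show ?thesis using U(3) P(4)[OF \<delta>(1)] by blast
      qed
      then show "\<exists>V. openin (vtop E) V \<and> 0 \<in> V \<and>
          {\<delta> \<in> Cr_curves E 0. \<forall>t\<in>{0..1}. \<delta> t - \<gamma> t \<in> V} \<subseteq> {\<gamma> \<in> vcarrier (curve_space E). primitive \<gamma> \<in> W}"
        using V(1,2) by (intro exI[of _ V]) (auto simp: vcarrier_curve_space)
    qed
  qed
qed

end

lemma continuous_linear_postcompose:
  assumes E: "lcs E" and F: "lcs F" and L: "continuous_linear E F L"
  shows "continuous_linear (curve_space E) (curve_space F) (\<lambda>\<gamma> t. L (\<gamma> t))"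
proof -
  interpret E: locally_convex_space E by fact
  interpret F: locally_convex_space F by fact
  have Lc: "continuous_map X (vtop F) (\<lambda>x. L (f x))" if "continuous_map X (vtop E) f" for X :: "'x topology" and f
    using continuous_map_compose[OF that, of "vtop F" L] L by (simp add: continuous_linear_def o_def)
  show ?thesis
    unfolding continuous_linear_def
  proof (intro conjI ballI allI)
    show "continuous_map (vtop (curve_space E)) (vtop (curve_space F)) (\<lambda>\<gamma> t. L (\<gamma> t))"
    proof (rule F.continuous_map_into_curve_space)
      show "(\<lambda>t. L (\<gamma> t)) \<in> Cr_curves F 0" if "\<gamma> \<in> vcarrier (curve_space E)" for \<gamma>
        using that Cr_curves_zero_memD(1,3)[of \<gamma> E] continuous_linear_zero[OF E L]
        by (intro Cr_curves_zero_memI Lc) (auto simp: E.vcarrier_curve_space)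
    qed (intro Lc E.continuous_map_curve_eval continuous_map_fst continuous_map_snd)
  qed (use L in \<open>auto simp: continuous_linear_def E.vcarrier_curve_space E.Cr_curves_zero_closed fun_eq_iff\<close>)
qed

lemma continuous_bilinear_pointwise:
  assumes E: "lcs E" and F: "lcs F" and G: "lcs G"
    and b: "continuous_bilinear E F G b"
  shows "continuous_bilinear (curve_space E) (curve_space F) (curve_space G) (\<lambda>\<gamma> \<delta> t. b (\<gamma> t) (\<delta> t))"
proof -
  interpret E: locally_convex_space E by fact
  interpret F: locally_convex_space F by fact
  interpret G: locally_convex_space G by fact
  note bD = continuous_bilinearD[OF b]
  have b0: "b 0 0 = 0" using bD(3)[OF E.zero_closed E.zero_closed F.zero_closed] by simp
  have bc: "continuous_map X (vtop G) (\<lambda>x. b (f x) (g x))"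
    if "continuous_map X (vtop E) f" "continuous_map X (vtop F) g" for X :: "'x topology" and f g
    using continuous_map_compose[OF continuous_map_pairedI[OF that] bD(1)] by (simp add: o_def)
  show ?thesis
    unfolding continuous_bilinear_def
  proof (intro conjI ballI allI)
    show "continuous_map (prod_topology (vtop (curve_space E)) (vtop (curve_space F))) (vtop (curve_space G)) (\<lambda>p t. b (fst p t) (snd p t))"
    proof (rule G.continuous_map_into_curve_space)
      show "(\<lambda>t. b (fst p t) (snd p t)) \<in> Cr_curves G 0"
        if "p \<in> topspace (prod_topology (vtop (curve_space E)) (vtop (curve_space F)))" for p
        using that Cr_curves_zero_memD(1,3)[of "fst p" E] Cr_curves_zero_memD(1,3)[of "snd p" F] b0
        by (intro Cr_curves_zero_memI bc) (auto simp: E.vcarrier_curve_space F.vcarrier_curve_space)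
    qed (intro bc E.continuous_map_curve_eval F.continuous_map_curve_eval continuous_map_fst
        continuous_map_fst_comp[OF continuous_map_snd] continuous_map_snd_comp[OF continuous_map_snd])
  qed (auto simp: E.vcarrier_curve_space F.vcarrier_curve_space E.Cr_curves_zero_closed F.Cr_curves_zero_closed fun_eq_iff bD)
qed

section \<open>The logarithm chart, the group operations and the exponential map\<close>

section \<open>The character group as a Lie group\<close>

context hopf_characters
begin

lemma S1_iff: "\<phi> \<in> S1 \<longleftrightarrow> lin \<phi> \<and> \<phi> 1 = 1"
  by (simp add: S1_def)

lemma S1_diff: "\<phi> \<in> S1 \<Longrightarrow> \<phi> - cunit \<in> E0"
  and E0_add: "\<phi> \<in> E0 \<Longrightarrow> cunit + \<phi> \<in> S1"
  unfolding S1_iff E0_iff by (simp_all add: lin_diff lin_add lin_cunit cunit_one)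

lemma clog_E0: "\<phi> \<in> S1 \<Longrightarrow> clog \<phi> \<in> E0"
  and cexp_S1: "\<phi> \<in> E0 \<Longrightarrow> cexp \<phi> \<in> S1"
  and cexp_clog_S1: "\<phi> \<in> S1 \<Longrightarrow> cexp (clog \<phi>) = \<phi>"
  and clog_cexp_E0: "\<phi> \<in> E0 \<Longrightarrow> clog (cexp \<phi>) = \<phi>"
  unfolding S1_iff E0_iff by (simp_all add: lin_clog clog_one lin_cexp cexp_one cexp_clog clog_cexp)

lemma cexp_diff_cunit: "cexp \<phi> - cunit = ser (fps_exp 1 - 1) \<phi>"
  unfolding cexp_eq by simp

lemma clog_image: "clog ` S1 = E0"
proof
  show "clog ` S1 \<subseteq> E0" by (rule image_subsetI) (rule clog_E0)
  show "E0 \<subseteq> clog ` S1"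
  proof
    fix \<phi> assume \<phi>: "\<phi> \<in> E0"
    show "\<phi> \<in> clog ` S1" by (rule image_eqI[where x = "cexp \<phi>"]) (simp_all add: clog_cexp_E0[OF \<phi>] cexp_S1[OF \<phi>])
  qed
qed

lemma clog_image_chars: "clog ` chars = ichars"
proof
  show "clog ` chars \<subseteq> ichars" by (rule image_subsetI) (rule clog_ichars)
  show "ichars \<subseteq> clog ` chars"
  proof
    fix \<phi> assume \<phi>: "\<phi> \<in> ichars"
    show "\<phi> \<in> clog ` chars"
      by (rule image_eqI[where x = "cexp \<phi>"]) (simp_all add: clog_cexp_E0[OF subsetD[OF ichars_subset \<phi>]] cexp_chars[OF \<phi>])
  qed
qed

lemma analytic_log: "analytic_map_on E E E0 (ser (fps_ln 1))"
  by (rule analytic_ser_E) simp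

lemma analytic_exp: "analytic_map_on E E E0 (ser (fps_exp 1 - 1))"
  by (rule analytic_ser_E) simp

lemma continuous_analytic_E: "analytic_map_on E E E0 f \<Longrightarrow> continuous_map (vtop E) (vtop E) f"
  by (rule smooth_on_continuous_full) (use analytic_map_on_imp_smooth[OF lcs_E lcs_E] in simp)

lemma continuous_map_into_PT: "continuous_map X PT f \<longleftrightarrow> (\<forall>i. continuous_map X (vtop B) (\<lambda>x. f x i))"
  by (simp add: continuous_map_componentwise_UNIV)

lemma continuous_clog: "continuous_map (subtopology PT S1) (vtop E) clog"
proof -
  have "continuous_map (subtopology PT S1) (vtop B) (\<lambda>\<phi>. \<phi> i)" for i
    by (rule continuous_map_from_subtopology[OF continuous_PT_apply])
  then have "continuous_map (subtopology PT S1) (vtop E) (\<lambda>\<phi>. \<phi> - cunit)"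
    unfolding continuous_map_fun_tvs using S1_diff by (auto simp: carrier_UNIV intro!: LB.continuous_map_diff')
  from continuous_map_compose[OF this continuous_analytic_E[OF analytic_log]] show ?thesis
    by (simp add: o_def clog_def[abs_def])
qed

lemma continuous_cexp: "continuous_map (vtop E) (subtopology PT S1) cexp"
  unfolding continuous_map_in_subtopology
proof
  have "continuous_map (vtop E) (vtop B) (\<lambda>\<phi>. ser (fps_exp 1 - 1) \<phi> i)" for i
    using continuous_map_compose[OF continuous_analytic_E[OF analytic_exp] continuous_map_fun_tvs_apply] by (simp add: o_def)
  then show "continuous_map (vtop E) PT cexp"
    unfolding continuous_map_into_PT cexp_eq plus_fun_apply by (auto simp: carrier_UNIV intro!: LB.continuous_map_add')
  show "cexp \<in> topspace (vtop E) \<rightarrow> S1" using cexp_S1 by simp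
qed

lemma topspace_mtop_M' [simp]: "topspace (mtop M') = S1"
  and topspace_mtop_M: "topspace (mtop M) = chars"
  by (simp_all only: mtop_M' mtop_M topspace_subtopology topspace_PT Int_UNIV_left)

lemma homeo_S1: "homeomorphic_maps (mtop M') (vtop E) clog cexp"
  unfolding homeomorphic_maps_def mtop_M'
  using continuous_clog continuous_cexp cexp_clog_S1 clog_cexp_E0 by (simp add: topspace_PT)

lemma homeo_chars: "homeomorphic_maps (mtop M) (vtop F) (restrict clog chars) cexp"
  unfolding homeomorphic_maps_def
proof (intro conjI ballI)
  have "continuous_map (subtopology PT chars) (vtop E) clog"
    by (rule continuous_map_from_subtopology_mono[OF continuous_clog chars_subset])
  then have "continuous_map (subtopology PT chars) (vtop F) clog"
    unfolding continuous_map_fun_tvs using clog_ichars by (simp add: Pi_iff topspace_PT)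
  then show "continuous_map (mtop M) (vtop F) (restrict clog chars)"
    unfolding mtop_M by (rule continuous_map_eq) (simp add: topspace_PT)
  have "continuous_map (vtop F) (subtopology PT S1) cexp"
    using continuous_map_compose[OF _ continuous_cexp] continuous_linear_inclusion[OF ichars_subset]
    by (fastforce simp: continuous_linear_def o_def)
  then show "continuous_map (vtop F) (mtop M) cexp"
    unfolding mtop_M continuous_map_in_subtopology using cexp_chars by simp
  show "cexp (restrict clog chars x) = x" if "x \<in> topspace (mtop M)" for x
    using that cexp_clog_S1[OF subsetD[OF chars_subset]] by (simp add: topspace_mtop_M)
  show "restrict clog chars (cexp y) = y" if "y \<in> vcarrier F" for y
    using that cexp_chars clog_cexp_E0[OF subsetD[OF ichars_subset]] by simp
qed

text \<open>The affine manifold has one chart, subtraction of \<open>cunit\<close>, so there are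
  just two chart changes to check, and they are the series exp X - 1 and log (1 + X).\<close>

lemma clog_maximal_atlas: "(S1, clog) \<in> maximal_atlas M'"
proof -
  let ?s = "\<lambda>\<phi>. \<phi> - cunit"
  have inj: "inj_on ?s S1" by (rule inj_onI) simp
  have s_image: "?s ` S1 = E0"
  proof
    show "?s ` S1 \<subseteq> E0" by (rule image_subsetI) (rule S1_diff)
    show "E0 \<subseteq> ?s ` S1"
    proof
      fix \<phi> assume "\<phi> \<in> E0"
      from E0_add[OF this] show "\<phi> \<in> ?s ` S1" by (rule image_eqI[rotated]) simp
    qed
  qed
  have inj_clog: "inj_on clog S1" by (rule inj_on_inverseI[where g = cexp]) (rule cexp_clog_S1)
  have inv_clog: "inv_into S1 clog x = cexp x" if "x \<in> E0" for x
    by (rule inv_into_f_eq[OF inj_clog]) (simp_all add: cexp_S1[OF that] clog_cexp_E0[OF that])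
  have inv_s: "inv_into S1 ?s x = cunit + x" if "x \<in> E0" for x
    by (rule inv_into_f_eq[OF inj E0_add[OF that]]) simp
  have "topological_chart M' (S1, clog)"
    unfolding topological_chart_def fst_conv snd_conv model_M' clog_image
    using homeomorphic_maps_map[of "mtop M'" "vtop E" clog cexp] homeo_S1
      openin_topspace[of "mtop M'"] openin_topspace[of "vtop E"]
    by (simp add: subtopology_topspace[of "mtop M'", simplified] subtopology_topspace[of "vtop E", simplified])
  moreover have "analytic_map_on E E E0 (transition (S1, clog) (S1, ?s))"
    by (rule analytic_map_on_cong[OF lcs_E lcs_E analytic_exp]) (simp add: transition_def inv_clog cexp_diff_cunit del: minus_apply)
  moreover have "analytic_map_on E E E0 (transition (S1, ?s) (S1, clog))"
    by (rule analytic_map_on_cong[OF lcs_E lcs_E analytic_log]) (simp add: transition_def inv_s clog_def del: minus_apply plus_fun_apply)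
  ultimately show ?thesis
    by (simp add: maximal_atlas_def atlas_M' model_M' analytic_transition_def clog_image s_image)
qed

lemma atlas_M: "c \<in> atlas M \<longleftrightarrow> (\<exists>U \<kappa>. c = (U \<inter> chars, restrict \<kappa> (U \<inter> chars)) \<and> (U, \<kappa>) \<in> maximal_atlas M' \<and> \<kappa> ` (U \<inter> chars) = \<kappa> ` U \<inter> ichars)"
  by (auto simp: character_manifold_def submanifold_def)

lemma clog_atlas_M: "(chars, restrict clog chars) \<in> atlas M"
  unfolding atlas_M
  by (rule exI[of _ S1], rule exI[of _ clog])
     (use chars_subset ichars_subset clog_maximal_atlas in \<open>simp add: Int_absorb1 Int_absorb2 clog_image clog_image_chars\<close>)

text \<open>Values in a subspace do not by themselves place the complex extension there. Following f
  by the continuous projection does, and it changes nothing where f already takes infinitesimal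
  characters as values.\<close>

lemma analytic_F_restrict:
  assumes f: "analytic_map_on E E V f" and W: "openin (vtop F) W" "W \<subseteq> V" "f ` W \<subseteq> ichars"
  shows "analytic_map_on F F W f"
proof -
  obtain p where p: "continuous_linear E F p" "\<And>\<phi>. \<phi> \<in> ichars \<Longrightarrow> p \<phi> = \<phi>" by (rule continuous_linear_projection) blast
  have "analytic_map_on F E W (\<lambda>\<phi>. \<phi>)"
    by (rule analytic_map_on_linear[OF lcs_F lcs_E continuous_linear_inclusion[OF ichars_subset] W(1)])
  from analytic_map_on_compose[OF lcs_F lcs_E lcs_E this f] W(2) have "analytic_map_on F E W f" by simp
  from analytic_map_on_compose_linear[OF lcs_F lcs_E lcs_F this p(1)] show ?thesis
    by (rule analytic_map_on_cong[OF lcs_F lcs_F]) (use W(3) p(2) in auto)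
qed

lemma topological_chart_submanifold:
  assumes top: "topological_chart M' (U, \<kappa>)" and im: "\<kappa> ` (U \<inter> chars) = \<kappa> ` U \<inter> ichars"
  shows "topological_chart M (U \<inter> chars, restrict \<kappa> (U \<inter> chars))"
proof -
  have U: "openin (subtopology PT S1) U" "openin (vtop E) (\<kappa> ` U)"
    "homeomorphic_map (subtopology (subtopology PT S1) U) (subtopology (vtop E) (\<kappa> ` U)) \<kappa>"
    using top by (simp_all add: topological_chart_def model_M' mtop_M')
  have US: "U \<subseteq> S1" using openin_subset[OF U(1)] by (simp add: topspace_PT)
  have VE: "\<kappa> ` U \<subseteq> E0" using openin_subset[OF U(2)] by simp
  obtain T where T: "openin PT T" "U = T \<inter> S1" using U(1) unfolding openin_subtopology by blast
  obtain T' where T': "openin PT T'" "\<kappa> ` U = T' \<inter> E0" using U(2) unfolding vtop_fun_tvs openin_subtopology by blast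
  have im': "restrict \<kappa> (U \<inter> chars) ` (U \<inter> chars) = \<kappa> ` U \<inter> ichars" using im by simp
  have "openin (subtopology PT chars) (U \<inter> chars)"
    unfolding openin_subtopology using T chars_subset by (intro exI[of _ T]) auto
  moreover have "openin (subtopology PT ichars) (\<kappa> ` U \<inter> ichars)"
    unfolding openin_subtopology T'(2) using T' ichars_subset by (intro exI[of _ T']) auto
  moreover have "homeomorphic_map (subtopology (subtopology PT chars) (U \<inter> chars))
      (subtopology (subtopology PT ichars) (\<kappa> ` U \<inter> ichars)) (restrict \<kappa> (U \<inter> chars))"
  proof -
    have e: "subtopology (subtopology PT chars) (U \<inter> chars) = subtopology (subtopology (subtopology PT S1) U) chars"
      "subtopology (subtopology PT ichars) (\<kappa> ` U \<inter> ichars) = subtopology (subtopology (vtop E) (\<kappa> ` U)) ichars"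
      unfolding vtop_fun_tvs subtopology_subtopology
      using US VE by (intro arg_cong[where f = "subtopology PT"]; blast)+
    have "homeomorphic_map (subtopology (subtopology (subtopology PT S1) U) chars)
        (subtopology (subtopology (vtop E) (\<kappa> ` U)) ichars) \<kappa>"
    proof (rule homeomorphic_map_subtopologies[OF U(3)])
      have "S1 \<inter> U \<inter> chars = U \<inter> chars" "E0 \<inter> \<kappa> ` U \<inter> ichars = \<kappa> ` U \<inter> ichars" using US VE by blast+
      then show "\<kappa> ` (topspace (subtopology (subtopology PT S1) U) \<inter> chars) = topspace (subtopology (vtop E) (\<kappa> ` U)) \<inter> ichars"
        using im by (simp only: topspace_subtopology topspace_PT Int_UNIV_left vcarrier_E)
    qed
    then show ?thesis unfolding e by (rule homeomorphic_map_eq) (simp add: topspace_PT)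
  qed
  ultimately show ?thesis
    unfolding topological_chart_def fst_conv snd_conv im' model_M mtop_M vtop_fun_tvs by blast
qed

text \<open>Compatibility of \<kappa> with the affine chart, spelled out: both chart changes are
  analytic in the coordinate obtained by subtracting \<open>cunit\<close>.\<close>

lemma atlas_M_cases:
  assumes "c \<in> atlas M"
  obtains U \<kappa> where "c = (U \<inter> chars, restrict \<kappa> (U \<inter> chars))" "topological_chart M' (U, \<kappa>)" "\<kappa> ` (U \<inter> chars) = \<kappa> ` U \<inter> ichars"
    "U \<subseteq> S1" "inj_on \<kappa> U"
    "analytic_map_on E E (\<kappa> ` U) (\<lambda>x. inv_into U \<kappa> x - cunit)" "analytic_map_on E E {x \<in> E0. cunit + x \<in> U} (\<lambda>x. \<kappa> (cunit + x))"
proof -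
  let ?s = "\<lambda>\<phi>. \<phi> - cunit"
  from assms obtain U \<kappa> where c: "c = (U \<inter> chars, restrict \<kappa> (U \<inter> chars))" "(U, \<kappa>) \<in> maximal_atlas M'" "\<kappa> ` (U \<inter> chars) = \<kappa> ` U \<inter> ichars"
    unfolding atlas_M by blast
  have top: "topological_chart M' (U, \<kappa>)"
    and an: "analytic_map_on E E (\<kappa> ` (U \<inter> S1)) (transition (U, \<kappa>) (S1, ?s))"
      "analytic_map_on E E (?s ` (S1 \<inter> U)) (transition (S1, ?s) (U, \<kappa>))"
    using c(2) by (simp_all add: maximal_atlas_def atlas_M' model_M' analytic_transition_def)
  have US: "U \<subseteq> S1" using top openin_subset[of "mtop M'" U] by (simp add: topological_chart_def)
  have inj: "inj_on ?s S1" by (rule inj_onI) simp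
  have inv_s: "inv_into S1 ?s x = cunit + x" if "x \<in> E0" for x
    by (rule inv_into_f_eq[OF inj E0_add[OF that]]) simp
  have im: "?s ` (S1 \<inter> U) = {x \<in> E0. cunit + x \<in> U}"
  proof
    show "?s ` (S1 \<inter> U) \<subseteq> {x \<in> E0. cunit + x \<in> U}"
    proof (rule image_subsetI)
      fix \<phi> assume "\<phi> \<in> S1 \<inter> U"
      moreover have "cunit + (\<phi> - cunit) = \<phi>" by (simp del: minus_apply plus_fun_apply)
      ultimately show "\<phi> - cunit \<in> {x \<in> E0. cunit + x \<in> U}" using S1_diff[of \<phi>] by (simp del: minus_apply plus_fun_apply)
    qed
    show "{x \<in> E0. cunit + x \<in> U} \<subseteq> ?s ` (S1 \<inter> U)"
    proof
      fix x assume x: "x \<in> {x \<in> E0. cunit + x \<in> U}"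
      show "x \<in> ?s ` (S1 \<inter> U)" by (rule image_eqI[where x = "cunit + x"]) (use x US in auto)
    qed
  qed
  have "analytic_map_on E E (\<kappa> ` U) (\<lambda>x. inv_into U \<kappa> x - cunit)"
    using an(1) US by (simp add: Int_absorb2 transition_def[abs_def])
  moreover have "analytic_map_on E E {x \<in> E0. cunit + x \<in> U} (\<lambda>x. \<kappa> (cunit + x))"
    by (rule analytic_map_on_cong[OF lcs_E lcs_E an(2)[unfolded im]]) (simp add: transition_def inv_s del: plus_fun_apply)
  ultimately show ?thesis using that[OF c(1) top c(3) US] topological_chart_inj[OF top] by simp
qed

text \<open>For a straightening chart \<kappa>, the chart changes with the logarithm are \<kappa>
  after exp and log after the inverse of \<kappa>. Both factor through the affine chart, where they
  are analytic on the ambient space; since they map infinitesimal characters to infinitesimal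
  characters, they restrict.\<close>

lemma global_chart_M: "global_chart M (restrict clog chars) cexp"
proof (rule global_chart.intro)
  show "lcs (model M)" using lcs_F by (simp add: model_M)
  show "homeomorphic_maps (mtop M) (vtop (model M)) (restrict clog chars) cexp" using homeo_chars by (simp add: model_M)
  show "(topspace (mtop M), restrict clog chars) \<in> atlas M" using clog_atlas_M by (simp add: topspace_mtop_M)
  fix c assume "c \<in> atlas M"
  then obtain U \<kappa> where c: "c = (U \<inter> chars, restrict \<kappa> (U \<inter> chars))" and top: "topological_chart M' (U, \<kappa>)"
    and im: "\<kappa> ` (U \<inter> chars) = \<kappa> ` U \<inter> ichars" and US: "U \<subseteq> S1" and inj: "inj_on \<kappa> U"
    and an: "analytic_map_on E E (\<kappa> ` U) (\<lambda>x. inv_into U \<kappa> x - cunit)" "analytic_map_on E E {x \<in> E0. cunit + x \<in> U} (\<lambda>x. \<kappa> (cunit + x))"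
    by (rule atlas_M_cases)
  show tc: "topological_chart M c" unfolding c by (rule topological_chart_submanifold[OF top im])
  have oV: "openin (vtop F) (\<kappa> ` (U \<inter> chars))" and oU: "openin (mtop M) (U \<inter> chars)"
    using tc by (simp_all add: topological_chart_def c model_M)
  have l_im: "restrict clog chars ` fst c = {x \<in> ichars. cexp x \<in> U}"
  proof
    show "restrict clog chars ` fst c \<subseteq> {x \<in> ichars. cexp x \<in> U}"
      using clog_ichars cexp_clog_S1[OF subsetD[OF chars_subset]] by (auto simp: c)
    show "{x \<in> ichars. cexp x \<in> U} \<subseteq> restrict clog chars ` fst c"
    proof
      fix x assume x: "x \<in> {x \<in> ichars. cexp x \<in> U}"
      show "x \<in> restrict clog chars ` fst c"
        by (rule image_eqI[where x = "cexp x"])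
           (use x cexp_chars[of x] clog_cexp_E0[of x] ichars_subset in \<open>auto simp: c\<close>)
    qed
  qed
  have "openin (vtop F) {x \<in> topspace (vtop F). cexp x \<in> U \<inter> chars}"
    by (rule openin_continuous_map_preimage[OF _ oU]) (use homeo_chars in \<open>simp add: homeomorphic_maps_def\<close>)
  then have oW: "openin (vtop F) {x \<in> ichars. cexp x \<in> U}"
    by (rule back_subst[of "openin (vtop F)"]) (use cexp_chars in auto)
  have oWE: "openin (vtop E) {x \<in> E0. cexp x \<in> U}"
    using openin_continuous_map_preimage[of "vtop E" "mtop M'" cexp U] homeo_S1 top
    by (simp add: homeomorphic_maps_def topological_chart_def)
  show "analytic_map_on (model M) (model M) (restrict clog chars ` fst c) (\<lambda>x. snd c (cexp x))"
    unfolding l_im model_M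
  proof (rule analytic_map_on_cong[OF lcs_F lcs_F])
    show "analytic_map_on F F {x \<in> ichars. cexp x \<in> U} (\<lambda>x. \<kappa> (cexp x))"
    proof (rule analytic_F_restrict[OF _ oW])
      show "analytic_map_on E E {x \<in> E0. cexp x \<in> U} (\<lambda>x. \<kappa> (cexp x))"
      proof (rule analytic_map_on_cong[OF lcs_E lcs_E])
        show "analytic_map_on E E {x \<in> E0. cexp x \<in> U} (\<lambda>x. \<kappa> (cunit + ser (fps_exp 1 - 1) x))"
        proof (rule analytic_map_on_compose[OF lcs_E lcs_E lcs_E analytic_map_on_subset[OF lcs_E analytic_exp oWE] an(2)])
          show "ser (fps_exp 1 - 1) ` {x \<in> E0. cexp x \<in> U} \<subseteq> {x \<in> E0. cunit + x \<in> U}"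
            using S1_diff[OF cexp_S1] by (auto simp: cexp_diff_cunit cexp_eq simp del: minus_apply plus_fun_apply)
        qed blast
      qed (simp only: cexp_eq)
      show "{x \<in> ichars. cexp x \<in> U} \<subseteq> {x \<in> E0. cexp x \<in> U}" using ichars_subset by blast
      show "(\<lambda>x. \<kappa> (cexp x)) ` {x \<in> ichars. cexp x \<in> U} \<subseteq> ichars"
      proof (rule image_subsetI)
        fix x assume "x \<in> {x \<in> ichars. cexp x \<in> U}"
        then have "\<kappa> (cexp x) \<in> \<kappa> ` (U \<inter> chars)" using cexp_chars by blast
        then show "\<kappa> (cexp x) \<in> ichars" unfolding im by blast
      qed
    qed
  qed (use cexp_chars in \<open>auto simp: c\<close>)
  have c_im: "snd c ` fst c = \<kappa> ` (U \<inter> chars)" by (simp add: c)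
  have inv_c: "inv_into (fst c) (snd c) (\<kappa> \<phi>) = \<phi>" "inv_into U \<kappa> (\<kappa> \<phi>) = \<phi>" if "\<phi> \<in> U \<inter> chars" for \<phi>
  proof -
    have "inj_on (restrict \<kappa> (U \<inter> chars)) (U \<inter> chars)" using inj_on_subset[OF inj, of "U \<inter> chars"] by simp
    then show "inv_into (fst c) (snd c) (\<kappa> \<phi>) = \<phi>" unfolding c fst_conv snd_conv by (rule inv_into_f_eq) (use that in simp_all)
    show "inv_into U \<kappa> (\<kappa> \<phi>) = \<phi>" using inj that by simp
  qed
  show "analytic_map_on (model M) (model M) (snd c ` fst c) (\<lambda>x. restrict clog chars (inv_into (fst c) (snd c) x))"
    unfolding c_im model_M
  proof (rule analytic_map_on_cong[OF lcs_F lcs_F])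
    show "analytic_map_on F F (\<kappa> ` (U \<inter> chars)) (\<lambda>x. ser (fps_ln 1) (inv_into U \<kappa> x - cunit))"
    proof (rule analytic_F_restrict[OF _ oV])
      show "analytic_map_on E E (\<kappa> ` U) (\<lambda>x. ser (fps_ln 1) (inv_into U \<kappa> x - cunit))"
        by (rule analytic_map_on_compose[OF lcs_E lcs_E lcs_E an(1) analytic_log])
           (use funcset_mem[OF analytic_map_on_funcset[OF an(1)]] in auto)
      show "\<kappa> ` (U \<inter> chars) \<subseteq> \<kappa> ` U" by blast
      show "(\<lambda>x. ser (fps_ln 1) (inv_into U \<kappa> x - cunit)) ` \<kappa> ` (U \<inter> chars) \<subseteq> ichars"
        unfolding image_image
      proof (rule image_subsetI)
        fix \<phi> assume \<phi>: "\<phi> \<in> U \<inter> chars"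
        then show "ser (fps_ln 1) (inv_into U \<kappa> (\<kappa> \<phi>) - cunit) \<in> ichars"
          using clog_ichars[of \<phi>] by (simp only: inv_c(2)[OF \<phi>] clog_def[symmetric]) simp
      qed
    qed
    fix x assume "x \<in> \<kappa> ` (U \<inter> chars)"
    then obtain \<phi> where \<phi>: "\<phi> \<in> U \<inter> chars" "x = \<kappa> \<phi>" by blast
    then show "ser (fps_ln 1) (inv_into U \<kappa> x - cunit) = restrict clog chars (inv_into (fst c) (snd c) x)"
      by (simp only: \<phi>(2) inv_c[OF \<phi>(1)] clog_def[symmetric]) simp
  qed
qed

end

lemma has_curve_deriv_fun_tvs:
  assumes F: "lcs F" and S: "fun_subspace F S"
    and \<eta>: "\<And>s. s \<in> I \<Longrightarrow> \<eta> s \<in> S" and t: "t \<in> I" and v: "v \<in> S"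
    and d: "\<And>i. has_curve_deriv F I (\<lambda>s. \<eta> s i) t (v i)"
  shows "has_curve_deriv (fun_tvs F S) I \<eta> t v"
proof -
  interpret L: locally_convex_space "fun_tvs F S" by (rule lcs_fun[OF F S])
  have "smul (fun_tvs F S) a (\<eta> s - \<eta> t) \<in> S" if "s \<in> I" for a s
    using L.smul_closed[OF L.diff_closed[of "\<eta> s" "\<eta> t"], of a] \<eta>[OF that] \<eta>[OF t] by (simp only: vcarrier_fun_tvs[OF S])
  then have "\<forall>\<^sub>F s in at t within I. smul (fun_tvs F S) (of_real (inverse (s - t))) (\<eta> s - \<eta> t) \<in> S"
    unfolding eventually_at_filter by (intro always_eventually) blast
  then show ?thesis
    unfolding has_curve_deriv_def limitin_fun_tvs[OF S]
    using v d by (simp add: has_curve_deriv_def)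
qed

context hopf_characters
begin

sublocale GC: global_chart M "restrict clog chars" cexp
  rewrites "model M = F" and "topspace (mtop M) = chars"
  by (rule global_chart_M, rule model_M, rule topspace_mtop_M)

abbreviation "c0 \<equiv> (chars, restrict clog chars)"

text \<open>The characters need not be open in the Hom space, so differentiating the logarithm along
  ambient curves or composing it with convolution calls for an extension to all linear maps:
  normalise by the augmentation, apply the series, project.\<close>

lemma clog_extension:
  obtains T where "analytic_map_on A F Lin T" "\<And>\<phi>. \<phi> \<in> chars \<Longrightarrow> T \<phi> = clog \<phi>"
proof -
  obtain p where p: "continuous_linear E F p" "\<And>\<phi>. \<phi> \<in> ichars \<Longrightarrow> p \<phi> = \<phi>" by (rule continuous_linear_projection) blast
  let ?a = "\<lambda>\<phi> x. \<phi> x - smul B (\<epsilon> x) (\<phi> 1)"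
  have a: "analytic_map_on A E Lin ?a"
    by (rule analytic_map_on_linear[OF lcs_A lcs_E continuous_linear_augmentation]) (use openin_topspace[of "vtop A"] in simp)
  have "analytic_map_on A E Lin (\<lambda>\<phi>. ser (fps_ln 1) (?a \<phi>))"
    by (rule analytic_map_on_compose[OF lcs_A lcs_E lcs_E a analytic_log])
       (use analytic_map_on_funcset[OF a] in auto)
  then have T: "analytic_map_on A F Lin (\<lambda>\<phi>. p (ser (fps_ln 1) (?a \<phi>)))"
    by (rule analytic_map_on_compose_linear[OF lcs_A lcs_E lcs_F _ p(1)])
  moreover have "p (ser (fps_ln 1) (?a \<phi>)) = clog \<phi>" if "\<phi> \<in> chars" for \<phi>
  proof -
    have "?a \<phi> = \<phi> - cunit" using charsD(2)[OF that] by (simp add: fun_eq_iff convolution_unit_def)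
    then show ?thesis using p(2)[OF clog_ichars[OF that]] by (simp only: clog_def)
  qed
  ultimately show ?thesis using that by blast
qed

lemma ichars_Lin: "ichars \<subseteq> Lin" and chars_Lin: "chars \<subseteq> Lin"
  using icharsD(1) charsD(1) by (auto simp: Lin_iff)

lemma openin_ichars: "openin (vtop F) ichars"
  using openin_topspace[of "vtop F"] by simp

lemma analytic_cexp: "analytic_map_on F A ichars cexp"
proof -
  have "analytic_map_on F E ichars (\<lambda>\<phi>. \<phi>)"
    by (rule analytic_map_on_linear[OF lcs_F lcs_E continuous_linear_inclusion[OF ichars_subset] openin_ichars])
  from analytic_map_on_compose[OF lcs_F lcs_E lcs_A this analytic_ser[of "fps_exp 1"]] ichars_subset
  show ?thesis by (simp add: cexp_def[abs_def])
qed

text \<open>In the logarithm chart inversion is negation, and multiplication is the extended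
  logarithm of a convolution of exponentials. It is thus a composite of analytic maps, and the
  Baker-Campbell-Hausdorff series is never written down.\<close>

lemma analytic_lie_group_M: "analytic_lie_group M cgroup"
  unfolding analytic_lie_group_def
proof (intro conjI)
  show "analytic_manifold M" by (rule GC.analytic_manifold)
  show "group cgroup" by (rule group_cgroup)
  show "carrier cgroup = topspace (mtop M)" by (simp add: topspace_mtop_M)
  obtain T where T: "analytic_map_on A F Lin T" "\<And>\<phi>. \<phi> \<in> chars \<Longrightarrow> T \<phi> = clog \<phi>" by (rule clog_extension) blast
  let ?P = "prod_tvs F F" and ?V = "vcarrier (prod_tvs F F)"
  note lP = lcs_prod[OF lcs_F lcs_F]
  have oV: "openin (vtop ?P) ?V" by (rule openin_topspace)
  have "analytic_map_on ?P A ?V (\<lambda>x. cexp (fst x))"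
    by (rule analytic_map_on_compose[OF lP lcs_F lcs_A analytic_map_on_linear[OF lP lcs_F continuous_linear_fst oV] analytic_cexp]) auto
  moreover have "analytic_map_on ?P A ?V (\<lambda>x. cexp (snd x))"
    by (rule analytic_map_on_compose[OF lP lcs_F lcs_A analytic_map_on_linear[OF lP lcs_F continuous_linear_snd oV] analytic_cexp]) auto
  ultimately have pair: "analytic_map_on ?P (prod_tvs A A) ?V (\<lambda>x. (cexp (fst x), cexp (snd x)))"
    by (rule analytic_map_on_pair[OF lP lcs_A lcs_A])
  note lAA = lcs_prod[OF lcs_A lcs_A]
  have "analytic_map_on ?P A ?V (\<lambda>x. conv (cexp (fst x)) (cexp (snd x)))"
    using analytic_map_on_compose[OF lP lAA lcs_A pair analytic_map_on_bilinear[OF lcs_A lcs_A lcs_A bilinear_conv openin_topspace]]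
      analytic_map_on_funcset[OF pair] by (simp add: image_subset_iff_funcset del: vtop_prod_tvs)
  from analytic_map_on_compose[OF lP lcs_A lcs_F this T(1)] analytic_map_on_funcset[OF this]
  have "analytic_map_on ?P F ?V (\<lambda>x. T (conv (cexp (fst x)) (cexp (snd x))))"
    by (simp add: image_subset_iff_funcset del: vtop_prod_tvs)
  then have an: "analytic_map_on ?P F ?V (\<lambda>x. restrict clog chars (conv (cexp (fst x)) (cexp (snd x))))"
    by (rule analytic_map_on_cong[OF lP lcs_F]) (auto simp: T(2) conv_chars cexp_chars)
  show "analytic_manifold_map (prod_manifold M M) M (\<lambda>(x, y). x \<otimes>\<^bsub>cgroup\<^esub> y)"
    by (rule GC.analytic_product_map) (use an conv_chars in \<open>auto simp: case_prod_unfold\<close>)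
  have "analytic_map_on F F ichars (smul F (of_real (- 1)))"
    by (rule analytic_map_on_linear[OF lcs_F lcs_F continuous_linear_smul[OF lcs_F] openin_ichars])
  then have "analytic_map_on F F ichars (\<lambda>x. restrict clog chars (inv\<^bsub>cgroup\<^esub> (cexp x)))"
  proof (rule analytic_map_on_cong[OF lcs_F lcs_F])
    fix x assume x: "x \<in> ichars"
    then have c: "(\<lambda>i. smul B (of_real (- 1)) (x i)) \<in> ichars" by (rule ichars_scale)
    have "clog (cexp x) = x" by (rule clog_cexp_E0[OF subsetD[OF ichars_subset x]])
    then have "inv\<^bsub>cgroup\<^esub> (cexp x) = cexp (\<lambda>i. smul B (of_real (- 1)) (x i))"
      using inv_cgroup[OF cexp_chars[OF x]] by simp
    then show "smul F (of_real (- 1)) x = restrict clog chars (inv\<^bsub>cgroup\<^esub> (cexp x))"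
      using cexp_chars[OF c] clog_cexp_E0[OF subsetD[OF ichars_subset c]] by simp
  qed
  then show "analytic_manifold_map M M (\<lambda>x. inv\<^bsub>cgroup\<^esub> x)"
    unfolding topspace_mtop_M by (rule GC.analytic_self_map[unfolded vcarrier_F]) (use group.inv_closed[OF group_cgroup] in simp_all)
qed

text \<open>The index \<open>c0\<close> is the logarithm chart, so this is the convolution
  exponential of the representative of v in that chart.\<close>

definition char_exp :: "(('h \<Rightarrow> 'b) set \<times> (('h \<Rightarrow> 'b) \<Rightarrow> 'h \<Rightarrow> 'b) \<Rightarrow> 'h \<Rightarrow> 'b) \<Rightarrow> 'h \<Rightarrow> 'b" where
  "char_exp v = cexp (v c0)"

lemma lie_algebra_M: "lie_algebra M cgroup = tangent_tvs M cunit"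
  by (simp add: lie_algebra_def)

lemma lcs_lie_algebra: "lcs (tangent_tvs M cunit)"
  by (rule GC.lcs_tangent[OF cunit_chars])

lemma tangent_c0: "v \<in> vcarrier (tangent_tvs M cunit) \<Longrightarrow> v c0 \<in> ichars"
  using continuous_linear_carrier[OF GC.continuous_linear_tangent_c0] by simp

lemma cexp_zero: "cexp 0 = cunit"
proof -
  have z: "0 \<in> E0" using ichars_zero ichars_subset by blast
  have "ser (fps_exp 1 - 1) 0 = 0"
  proof
    fix x :: 'h
    have l: "lin 0" using z by (simp add: E0_iff)
    have "cpow (0 :: 'h \<Rightarrow> 'b) n x = 0" if "n > 0" for n
      using cpow_scale[OF l, of 0 n] that by (simp add: fun_eq_iff zero_power zero_fun_def)
    then show "ser (fps_exp 1 - 1) 0 x = 0 x"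
      unfolding ser_def by (auto intro!: sum.neutral simp: LB.smul_zero_left carrier_UNIV)
  qed
  then show ?thesis by (simp only: cexp_eq add_0_right)
qed

lemma clog_cunit: "clog cunit = 0"
  using clog_cexp_E0[OF subsetD[OF ichars_subset ichars_zero]] by (simp only: cexp_zero)

lemma has_curve_deriv_line: "\<phi> \<in> ichars \<Longrightarrow> has_curve_deriv F UNIV (\<lambda>s. smul F (of_real s) \<phi>) 0 \<phi>"
  using has_curve_deriv_real_multiple[OF lcs_F, of \<phi> "\<lambda>s. s" 1 0 UNIV] locally_convex_space.smul_one[OF lcs_F, of \<phi>] by simp

text \<open>In the logarithm chart the curve is the straight line through the representative of x,
  so its velocity at 0 lifts to x itself.\<close>

lemma lie_group_exponential_char_exp: "lie_group_exponential M cgroup char_exp"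
  unfolding lie_group_exponential_def lie_algebra_M
proof (intro conjI ballI allI)
  let ?L = "tangent_tvs M cunit"
  have "smooth_on ?L F (vcarrier ?L) (\<lambda>v. v c0)"
    by (rule smooth_on_linear[OF lcs_lie_algebra lcs_F GC.continuous_linear_tangent_c0 openin_topspace])
  from GC.smooth_map_from_tvs[OF lcs_lie_algebra this]
  show "smooth_manifold_map (tvs_manifold ?L) M char_exp" by (simp add: char_exp_def[abs_def])
  fix x assume x: "x \<in> vcarrier ?L"
  then have c: "x c0 \<in> ichars" by (rule tangent_c0)
  have sm: "smul ?L a x c0 = (\<lambda>i. smul B a (x c0 i))" for a
    by (simp add: GC.tangent_tvs_eq)
  show "char_exp (smul ?L (of_real (s + t)) x) = char_exp (smul ?L (of_real s) x) \<otimes>\<^bsub>cgroup\<^esub> char_exp (smul ?L (of_real t) x)" for s t :: real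
    using cexp_add[of "x c0" s t] c ichars_one[OF c] icharsD(1)[OF c] by (simp add: char_exp_def sm)
  have cs: "smul F (of_real s) (x c0) \<in> ichars" for s :: real using ichars_scale[OF c] by simp
  have eta: "char_exp (smul ?L (of_real s) x) = cexp (smul F (of_real s) (x c0))" for s :: real
    by (simp add: char_exp_def sm)
  have "has_curve_deriv F UNIV (\<lambda>s. restrict clog chars (char_exp (smul ?L (of_real s) x))) 0 (x c0)"
    using has_curve_deriv_line[OF c] GC.l_ex[of "smul F (of_real s) (x c0)" for s] cs unfolding eta by simp
  then have "has_velocity M UNIV (\<lambda>s. char_exp (smul ?L (of_real s) x)) 0 (GC.lift (char_exp (smul ?L (of_real 0) x)) (x c0))"
    by (rule GC.has_velocity_lift) (use cs c cexp_chars in \<open>simp_all only: eta UNIV_I vcarrier_F\<close>)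
  moreover have "smul F (of_real 0) (x c0) = 0"
    using locally_convex_space.smul_zero_left[OF lcs_F, of "x c0"] c by simp
  then have "char_exp (smul ?L (of_real 0) x) = cunit" by (simp only: eta cexp_zero)
  moreover have "GC.lift cunit (x c0) = x"
    using GC.tangent_eq_lift[OF cunit_chars] x GC.vcarrier_tangent[OF cunit_chars] by metis
  ultimately show "has_velocity M UNIV (\<lambda>t. char_exp (smul ?L (of_real t) x)) 0 x" by simp
qed

text \<open>Read in the logarithm chart, the exponential is evaluation at \<open>c0\<close> and its
  inverse is the lift at the unit; both are continuous and linear, hence analytic.\<close>

lemma diffeo_char_exp:
  "analytic_diffeo_on (tvs_manifold (lie_algebra M cgroup)) M (vcarrier (lie_algebra M cgroup)) (carrier cgroup) char_exp"
  unfolding analytic_diffeo_on_def lie_algebra_M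
proof (intro conjI)
  let ?L = "tangent_tvs M cunit"
  have lift_L: "GC.lift cunit \<phi> \<in> vcarrier ?L" if "\<phi> \<in> ichars" for \<phi>
    using GC.lift_tangent[OF cunit_chars, of \<phi>] that GC.vcarrier_tangent[OF cunit_chars] by simp
  have lift_exp: "char_exp (GC.lift cunit \<phi>) = cexp \<phi>" if "\<phi> \<in> ichars" for \<phi>
    using GC.lift_c0[OF cunit_chars, of \<phi>] that by (simp add: char_exp_def)
  show bij: "bij_betw char_exp (vcarrier ?L) (carrier cgroup)"
  proof (rule bij_betw_byWitness[where f' = "\<lambda>\<phi>. GC.lift cunit (clog \<phi>)"])
    show "\<forall>v\<in>vcarrier ?L. GC.lift cunit (clog (char_exp v)) = v"
    proof
      fix v assume v: "v \<in> vcarrier ?L"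
      have "GC.lift cunit (v c0) = v"
        using GC.tangent_eq_lift[OF cunit_chars] v GC.vcarrier_tangent[OF cunit_chars] by metis
      then show "GC.lift cunit (clog (char_exp v)) = v"
        using clog_cexp_E0[OF subsetD[OF ichars_subset tangent_c0[OF v]]] by (simp add: char_exp_def)
    qed
    show "\<forall>\<phi>\<in>carrier cgroup. char_exp (GC.lift cunit (clog \<phi>)) = \<phi>"
      using lift_exp[OF clog_ichars] cexp_clog_S1[OF subsetD[OF chars_subset]] by simp
    show "char_exp ` vcarrier ?L \<subseteq> carrier cgroup" using cexp_chars[OF tangent_c0] by (auto simp: char_exp_def)
    show "(\<lambda>\<phi>. GC.lift cunit (clog \<phi>)) ` carrier cgroup \<subseteq> vcarrier ?L" using lift_L[OF clog_ichars] by auto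
  qed
  show "manifold_map_on analytic_map_on (tvs_manifold ?L) M (vcarrier ?L) char_exp"
    using GC.analytic_map_from_tvs[OF lcs_lie_algebra analytic_map_on_linear[OF lcs_lie_algebra lcs_F GC.continuous_linear_tangent_c0 openin_topspace]]
    by (simp add: char_exp_def[abs_def])
  have inj: "inj_on char_exp (vcarrier ?L)" using bij by (rule bij_betw_imp_inj_on)
  have "analytic_map_on F ?L ichars (GC.lift cunit)"
    by (rule analytic_map_on_linear[OF lcs_F lcs_lie_algebra GC.continuous_linear_lift[OF cunit_chars] openin_ichars])
  then have "analytic_map_on F ?L ichars (\<lambda>x. inv_into (vcarrier ?L) char_exp (cexp x))"
    by (rule analytic_map_on_cong[OF lcs_F lcs_lie_algebra])
       (rule sym, rule inv_into_f_eq[OF inj], simp_all add: lift_L lift_exp)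
  then show "manifold_map_on analytic_map_on M (tvs_manifold ?L) (carrier cgroup) (inv_into (vcarrier ?L) char_exp)"
    using GC.analytic_map_to_tvs[OF lcs_lie_algebra, of "inv_into (vcarrier ?L) char_exp"] by simp
qed

lemma exponential_lie_group_M: "exponential_lie_group M cgroup"
  unfolding exponential_lie_group_def
  using analytic_lie_group_M lie_group_exponential_char_exp diffeo_char_exp by blast

lemma BCH_lie_group_M: "BCH_lie_group M cgroup"
proof -
  have "0 \<in> vcarrier (lie_algebra M cgroup)"
    unfolding lie_algebra_M by (rule locally_convex_space.zero_closed[OF lcs_lie_algebra])
  then show ?thesis
    unfolding BCH_lie_group_def
    using analytic_lie_group_M lie_group_exponential_char_exp diffeo_char_exp by blast
qed

end

section \<open>The evolution equation in the Hom space and regularity\<close>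

section \<open>Evolution of curves of infinitesimal characters\<close>

lemma sum_list_swap:
  fixes f :: "'a \<Rightarrow> 'b \<Rightarrow> 'c::comm_monoid_add"
  shows "(\<Sum>x\<leftarrow>xs. \<Sum>y\<leftarrow>ys. f x y) = (\<Sum>y\<leftarrow>ys. \<Sum>x\<leftarrow>xs. f x y)"
  by (induction xs) (simp_all add: sum_list_addf)

context hopf_characters
begin

lemma has_curve_deriv_mult:
  assumes f: "has_curve_deriv B I f t v" and k: "has_curve_deriv B I k t w" and t: "t \<in> I"
  shows "has_curve_deriv B I (\<lambda>s. f s * k s) t (v * k t + f t * w)"
proof -
  have mult: "limitin (vtop B) (\<lambda>s. p s * q s) (a * b) L" if "limitin (vtop B) p a L" "limitin (vtop B) q b L" for p q a b and L :: "real filter"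
    using continuous_map_limit[OF continuous_mult limitin_pairI[OF that]] by (simp add: o_def)
  have lk: "limitin (vtop B) k (k t) (at t within I)"
    by (rule LB.curve_deriv_limit[OF _ k t]) (simp add: carrier_UNIV)
  have "limitin (vtop B) (\<lambda>s. smul B (of_real (inverse (s - t))) (f s - f t) * k s + f t * smul B (of_real (inverse (s - t))) (k s - k t))
      (v * k t + f t * w) (at t within I)"
    using f k unfolding has_curve_deriv_def
    by (intro LB.limitin_add mult lk) (simp_all add: carrier_UNIV)
  moreover have "smul B c (f s - f t) * k s + f t * smul B c (k s - k t) = smul B c (f s * k s - f t * k t)" for c s
    unfolding smul_mult mult_smul VB.scale_right_distrib[symmetric]
    by (rule arg_cong[where f = "smul B c"]) (simp add: left_diff_distrib right_diff_distrib)
  ultimately show ?thesis unfolding has_curve_deriv_def by simp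
qed

text \<open>The Dyson series solves \<open>\<eta>' = \<eta> \<star> g\<close>, \<open>\<eta>(0) = \<epsilon>\<close>; since \<open>g\<close> vanishes in degree \<open>0\<close>, it is
  a finite sum at every element of the Hopf algebra.\<close>

primrec dyson :: "(real \<Rightarrow> 'h \<Rightarrow> 'b) \<Rightarrow> nat \<Rightarrow> 'h \<Rightarrow> real \<Rightarrow> 'b" where
  "dyson g 0 = (\<lambda>h t. if t \<in> {0..1} then cunit h else 0)"
| "dyson g (Suc n) = (\<lambda>h. LB.primitive (\<lambda>t. \<Sum>(a, b)\<leftarrow>cop h. dyson g n a t * g t b))"

definition dyson_sum :: "(real \<Rightarrow> 'h \<Rightarrow> 'b) \<Rightarrow> real \<Rightarrow> 'h \<Rightarrow> 'b" where
  "dyson_sum g t h = (\<Sum>n\<le>deg h. dyson g n h t)"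

end

text \<open>The evolution is built for the representative g of a Lie algebra curve in the logarithm
  chart. Continuity is demanded at each element b separately, in accordance with pointwise
  convergence.\<close>

locale ichar_curve = hopf_characters scaleH \<Delta> \<epsilon> antipode grade B
  for scaleH :: "'k::real_or_complex \<Rightarrow> 'h::ring_1 \<Rightarrow> 'h" and \<Delta> \<epsilon> antipode grade
    and B :: "('k, 'b::{comm_ring, comm_monoid_mult}) tvs" +
  fixes g :: "real \<Rightarrow> 'h \<Rightarrow> 'b"
  assumes sc: "sequentially_complete B"
    and g_curve: "(\<lambda>t. g t b) \<in> Cr_curves B 0"
    and g_ichars: "t \<in> {0..1} \<Longrightarrow> g t \<in> ichars"
begin

abbreviation Y :: "nat \<Rightarrow> 'h \<Rightarrow> real \<Rightarrow> 'b" where "Y \<equiv> dyson g"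
abbreviation \<eta> :: "real \<Rightarrow> 'h \<Rightarrow> 'b" where "\<eta> \<equiv> dyson_sum g"

lemma g_outside: "t \<notin> {0..1} \<Longrightarrow> g t b = 0"
  using Cr_curves_zero_memD(3)[OF g_curve] .

lemma lin_g: "t \<in> {0..1} \<Longrightarrow> lin (g t)" and g_one: "t \<in> {0..1} \<Longrightarrow> g t 1 = 0"
  using g_ichars icharsD(1) ichars_one by blast+

definition dyson_rhs :: "nat \<Rightarrow> 'h \<Rightarrow> real \<Rightarrow> 'b" where
  "dyson_rhs n h t = (\<Sum>(a, b)\<leftarrow>cop h. Y n a t * g t b)"

lemma dyson_Suc: "Y (Suc n) h = LB.primitive (dyson_rhs n h)"
  by (simp add: dyson_rhs_def[abs_def])

lemma dyson_rhs_outside: "t \<notin> {0..1} \<Longrightarrow> dyson_rhs n h t = 0"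
  unfolding dyson_rhs_def by (rule sum_list_zero) (simp add: case_prod_unfold g_outside)

lemma dyson_rhs_curve:
  assumes "\<And>h. Y n h \<in> Cr_curves B 0" shows "dyson_rhs n h \<in> Cr_curves B 0"
proof (rule Cr_curves_zero_memI[OF _ dyson_rhs_outside])
  show "continuous_map (top_of_set {0..1}) (vtop B) (dyson_rhs n h)"
    unfolding dyson_rhs_def[abs_def] case_prod_unfold
    by (intro LB.continuous_map_sum_list' continuous_map_mult_B Cr_curves_zero_memD(1)[OF assms] Cr_curves_zero_memD(1)[OF g_curve])
qed

lemma dyson_rhs_conv:
  assumes "lin (\<lambda>h. Y n h t)" "t \<in> {0..1}" shows "dyson_rhs n h t = conv (\<lambda>h. Y n h t) (g t) h"
  by (simp add: dyson_rhs_def conv_cop[OF assms(1) lin_g[OF assms(2)]])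

text \<open>The claims support each other in one induction: writing the integrand as a convolution
  requires linearity of the current iterate, linearity of the next one follows from that of
  integration, and the filtration index grows because g vanishes in degree 0.\<close>

lemma dyson_properties:
  "Y n h \<in> Cr_curves B 0 \<and> (t \<in> {0..1} \<longrightarrow> lin (\<lambda>h. Y n h t) \<and> vanishes_below n (\<lambda>h. Y n h t))"
proof (induction n arbitrary: h t)
  case 0
  have "Y 0 h \<in> Cr_curves B 0"
  proof (rule Cr_curves_zero_memI)
    show "continuous_map (top_of_set {0..1}) (vtop B) (Y 0 h)"
      by (rule continuous_map_eq[of _ _ "\<lambda>_. cunit h"]) (auto simp: carrier_UNIV)
  qed auto
  moreover have "t \<in> {0..1} \<Longrightarrow> (\<lambda>h. Y 0 h t) = cunit" by (simp add: fun_eq_iff)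
  ultimately show ?case by (simp add: lin_cunit vanishes_below_def del: dyson.simps atLeastAtMost_iff)
next
  case (Suc n)
  have curve: "dyson_rhs n h \<in> Cr_curves B 0" for h using Suc by (intro dyson_rhs_curve) blast
  have l: "lin (\<lambda>h. Y n h t)" if "t \<in> {0..1}" for t using Suc that by blast
  note P = LB.continuous_linear_primitive[OF sc, unfolded continuous_linear_def LB.vcarrier_curve_space smul_curve_space]
  have add: "dyson_rhs n (x + y) = dyson_rhs n x + dyson_rhs n y" for x y
  proof
    fix t show "dyson_rhs n (x + y) t = (dyson_rhs n x + dyson_rhs n y) t"
    proof (cases "t \<in> {0..1}")
      case True
      show ?thesis using lin_conv[OF l[OF True] lin_g[OF True]] by (simp add: dyson_rhs_conv[OF l[OF True] True] lin_iff)
    qed (simp add: dyson_rhs_outside del: atLeastAtMost_iff)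
  qed
  have scale: "dyson_rhs n (scaleH c x) = (\<lambda>t. smul B c (dyson_rhs n x t))" for c x
  proof
    fix t show "dyson_rhs n (scaleH c x) t = smul B c (dyson_rhs n x t)"
    proof (cases "t \<in> {0..1}")
      case True
      show ?thesis using lin_conv[OF l[OF True] lin_g[OF True]] by (simp add: dyson_rhs_conv[OF l[OF True] True] lin_iff)
    qed (simp add: dyson_rhs_outside LB.smul_zero_right del: atLeastAtMost_iff)
  qed
  have "Y (Suc n) (x + y) = Y (Suc n) x + Y (Suc n) y" "Y (Suc n) (scaleH c x) = (\<lambda>t. smul B c (Y (Suc n) x t))" for c x y
    unfolding dyson_Suc add scale using P curve by blast+
  then have "lin (\<lambda>h. Y (Suc n) h t)" for t
    unfolding lin_iff by (simp add: fun_eq_iff del: dyson.simps)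
  moreover have "vanishes_below (Suc n) (\<lambda>h. Y (Suc n) h t)" for t
    unfolding vanishes_below_def
  proof (intro allI impI ballI)
    fix m x assume m: "m < Suc n" and x: "x \<in> grade m"
    have "dyson_rhs n x = 0"
    proof
      fix t show "dyson_rhs n x t = 0 t"
      proof (cases "t \<in> {0..1}")
        case True
        have "vanishes_below (Suc n) (conv (\<lambda>h. Y n h t) (g t))"
          using vanishes_below_conv[OF l[OF True] lin_g[OF True] _ vanishes_below_one[OF lin_g[OF True] g_one[OF True]], of n] Suc True
          by simp
        then show ?thesis using m x by (simp add: dyson_rhs_conv[OF l[OF True] True] vanishes_below_def)
      qed (simp add: dyson_rhs_outside del: atLeastAtMost_iff)
    qed
    then show "Y (Suc n) x t = 0"
      unfolding dyson_Suc using continuous_linear_zero[OF LB.lcs_curve_space LB.continuous_linear_primitive[OF sc]] by simp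
  qed
  moreover have "Y (Suc n) h \<in> Cr_curves B 0"
    unfolding dyson_Suc by (rule LB.primitive(4)[OF sc Cr_curves_zero_memD(1)[OF curve]])
  ultimately show ?case by blast
qed

lemma dyson_curve: "Y n h \<in> Cr_curves B 0"
  and lin_dyson: "t \<in> {0..1} \<Longrightarrow> lin (\<lambda>h. Y n h t)"
  and vanishes_below_dyson: "t \<in> {0..1} \<Longrightarrow> vanishes_below n (\<lambda>h. Y n h t)"
  using dyson_properties by blast+

lemma dyson_sum_eq: "\<lbrakk>degree_bound h N; t \<in> {0..1}\<rbrakk> \<Longrightarrow> \<eta> t h = (\<Sum>n\<le>N. Y n h t)"
  unfolding dyson_sum_def by (rule graded_sum_eq[OF lin_dyson vanishes_below_dyson])

lemma lin_dyson_sum: assumes t: "t \<in> {0..1}" shows "lin (\<eta> t)"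
  unfolding dyson_sum_def[abs_def] by (rule lin_graded_sum[OF lin_dyson[OF t] vanishes_below_dyson[OF t]])

lemma dyson_sum_zero: "\<eta> 0 = cunit"
proof
  fix h
  have "Y (Suc n) h 0 = 0" for n
    unfolding dyson_Suc by (rule LB.primitive(1)[OF sc Cr_curves_zero_memD(1)[OF dyson_rhs_curve[OF dyson_curve]]])
  then have "(\<Sum>n\<le>N. Y n h 0) = cunit h" for N
    by (induction N) (simp_all del: dyson.simps(2))
  then show "\<eta> 0 h = cunit h" by (simp add: dyson_sum_def)
qed

lemma has_curve_deriv_dyson_sum:
  assumes t: "t \<in> {0..1}"
  shows "has_curve_deriv B {0..1} (\<lambda>s. \<eta> s h) t (conv (\<eta> t) (g t) h)"
proof -
  obtain N where N: "deg h \<le> N" "\<forall>(a, b)\<in>set (cop h). degree_bound a N \<and> degree_bound b N"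
    using deg_bound_list by blast
  \<comment> \<open>One term more than N, since differentiating the iterate n + 1 gives back the
    integrand of index n; the iterate 0 is constant on the interval.\<close>
  have h: "degree_bound h (Suc N)" by (rule degree_bound_mono[OF degree_bound_deg]) (use N in simp)
  let ?d = "\<lambda>n. case n of 0 \<Rightarrow> 0 | Suc n \<Rightarrow> dyson_rhs n h t"
  have d: "has_curve_deriv B {0..1} (Y n h) t (?d n)" for n
  proof (cases n)
    case 0
    have "has_curve_deriv B {0..1} (Y 0 h) t 0"
      by (subst has_curve_deriv_cong[where \<delta> = "\<lambda>_. cunit h"]) (use t has_curve_deriv_const[OF lcs] in auto)
    then show ?thesis by (simp add: 0 del: dyson.simps)
  next
    case (Suc m)
    show ?thesis
      unfolding Suc dyson_Suc nat.case by (rule LB.primitive(3)[OF sc Cr_curves_zero_memD(1)[OF dyson_rhs_curve[OF dyson_curve]] t])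
  qed
  have "has_curve_deriv B {0..1} (\<lambda>s. \<Sum>n\<le>Suc N. Y n h s) t (\<Sum>n\<le>Suc N. ?d n)"
    by (rule has_curve_deriv_sum[OF lcs t d]) (simp add: carrier_UNIV)
  then have "has_curve_deriv B {0..1} (\<lambda>s. \<eta> s h) t (\<Sum>n\<le>Suc N. ?d n)"
    by (subst has_curve_deriv_cong[where \<delta> = "\<lambda>s. \<Sum>n\<le>Suc N. Y n h s"]) (use t dyson_sum_eq[OF h] in auto)
  moreover have "(\<Sum>n\<le>Suc N. ?d n) = (\<Sum>n\<le>N. dyson_rhs n h t)"
    by (subst sum.atMost_Suc_shift) simp
  moreover have "(\<Sum>n\<le>N. dyson_rhs n h t) = (\<Sum>(a, b)\<leftarrow>cop h. \<Sum>n\<le>N. Y n a t * g t b)"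
    unfolding dyson_rhs_def case_prod_unfold by (rule sum_list_sum_swap[symmetric])
  moreover have "(\<Sum>(a, b)\<leftarrow>cop h. \<Sum>n\<le>N. Y n a t * g t b) = (\<Sum>(a, b)\<leftarrow>cop h. \<eta> t a * g t b)"
  proof (rule arg_cong[where f = sum_list], rule map_cong[OF refl])
    fix p assume "p \<in> set (cop h)"
    then have "degree_bound (fst p) N" using N(2) by (auto simp: case_prod_unfold)
    then show "(case p of (a, b) \<Rightarrow> \<Sum>n\<le>N. Y n a t * g t b) = (case p of (a, b) \<Rightarrow> \<eta> t a * g t b)"
      by (simp add: case_prod_unfold dyson_sum_eq[OF _ t] sum_distrib_right del: dyson.simps)
  qed
  ultimately show ?thesis by (simp add: conv_cop[OF lin_dyson_sum[OF t] lin_g[OF t]])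
qed

lemma dyson_sum_const:
  assumes "\<And>t. t \<in> {0..1} \<Longrightarrow> has_curve_deriv B {0..1} f t 0" "f 0 = 0" "t \<in> {0..1}"
  shows "f t = 0"
  using LB.curve_deriv_zero_const[OF _ assms(1,3)] assms(2) by (simp add: carrier_UNIV)

text \<open>As \<open>g t\<close> is a derivation relative to the counit, right convolution with it
  obeys a Leibniz rule in the two factors of the argument; the counit in each of the two resulting
  sums collapses one of the coproducts.\<close>

lemma conv_shift:
  assumes t: "t \<in> {0..1}"
  shows "conv (\<eta> t) (g t) (x * y) = conv (\<lambda>a. \<eta> t (a * y)) (g t) x + conv (\<lambda>c. \<eta> t (x * c)) (g t) y"
proof -
  note l\<eta> = lin_dyson_sum[OF t] and lg = lin_g[OF t]
  have lx: "lin (\<lambda>a. \<eta> t (a * z))" "lin (\<lambda>a. \<eta> t (z * a))" for z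
    using l\<eta> by (auto simp: lin_iff distrib_left distrib_right scale_mult_left scale_mult_right)
  have "conv (\<eta> t) (g t) (x * y) = (\<Sum>(a, b)\<leftarrow>cop x. \<Sum>(c, d)\<leftarrow>cop y. \<eta> t (a * c) * g t (b * d))"
    by (rule conv_mult[OF l\<eta> lg])
  also have "\<dots> = (\<Sum>(a, b)\<leftarrow>cop x. \<Sum>(c, d)\<leftarrow>cop y. \<eta> t (a * c) * (cunit b * g t d)) +
      (\<Sum>(a, b)\<leftarrow>cop x. \<Sum>(c, d)\<leftarrow>cop y. \<eta> t (a * c) * (cunit d * g t b))"
  proof -
    have "\<eta> t (a * c) * g t (b * d) = \<eta> t (a * c) * (cunit b * g t d) + \<eta> t (a * c) * (cunit d * g t b)" for a b c d
      using icharsD(2)[OF g_ichars[OF t], of b d] by (simp add: convolution_unit_def smul_mult distrib_left)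
    then show ?thesis by (simp add: case_prod_unfold sum_list_addf)
  qed
  also have "(\<Sum>(a, b)\<leftarrow>cop x. \<Sum>(c, d)\<leftarrow>cop y. \<eta> t (a * c) * (cunit d * g t b)) =
      (\<Sum>(a, b)\<leftarrow>cop x. conv (\<lambda>c. \<eta> t (a * c)) cunit y * g t b)"
    by (simp add: conv_cop[OF lx(2) lin_cunit] case_prod_unfold sum_list_mult_const[symmetric] mult.assoc)
  also have "(\<Sum>(a, b)\<leftarrow>cop x. \<Sum>(c, d)\<leftarrow>cop y. \<eta> t (a * c) * (cunit b * g t d)) =
      (\<Sum>(c, d)\<leftarrow>cop y. \<Sum>(a, b)\<leftarrow>cop x. \<eta> t (a * c) * (cunit b * g t d))"
    unfolding case_prod_unfold by (rule sum_list_swap)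
  also have "\<dots> = (\<Sum>(c, d)\<leftarrow>cop y. conv (\<lambda>a. \<eta> t (a * c)) cunit x * g t d)"
    by (simp add: conv_cop[OF lx(1) lin_cunit] case_prod_unfold sum_list_mult_const[symmetric] mult.assoc)
  finally show ?thesis
    by (simp add: conv_unit_right[OF lx(1)] conv_unit_right[OF lx(2)] conv_cop[OF lx(1) lg] conv_cop[OF lx(2) lg] add.commute)
qed

text \<open>Since g vanishes in degree 0, only values of f in degrees below i enter; this strict
  drop drives the induction on the total degree.\<close>

lemma conv_vanish_graded:
  assumes t: "t \<in> {0..1}" and f: "lin f" "\<And>k a. \<lbrakk>k < i; a \<in> grade k\<rbrakk> \<Longrightarrow> f a = 0" and x: "x \<in> grade i"
  shows "conv f (g t) x = 0"
proof -
  have "vanishes_below i f" using f(2) by (simp add: vanishes_below_def)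
  from vanishes_below_conv[OF f(1) lin_g[OF t] this vanishes_below_one[OF lin_g[OF t] g_one[OF t]]] show ?thesis
    using x lessI[of i] unfolding vanishes_below_def Suc_eq_plus1 by blast
qed

text \<open>The defect \<open>D(x, y) = \<eta>(x y) - \<eta>(x) \<eta>(y)\<close> of multiplicativity satisfies a linear differential
  equation whose right-hand side only involves defects of smaller total degree.\<close>

lemma dyson_sum_mult_graded:
  assumes "x \<in> grade i" "y \<in> grade j" "t \<in> {0..1}"
  shows "\<eta> t (x * y) = \<eta> t x * \<eta> t y"
  using assms
proof (induction "i + j" arbitrary: i j x y t rule: less_induct)
  case less
  define D where "D s a b = \<eta> s (a * b) - \<eta> s a * \<eta> s b" for s a b
  have "has_curve_deriv B {0..1} (\<lambda>s. D s x y) s 0" if s: "s \<in> {0..1}" for s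
  proof -
    note l\<eta> = lin_dyson_sum[OF s] and lg = lin_g[OF s]
    have lx: "lin (\<lambda>a. \<eta> s (a * y))" "lin (\<lambda>c. \<eta> s (x * c))" "lin (\<lambda>a. \<eta> s a * \<eta> s y)" "lin (\<lambda>c. \<eta> s x * \<eta> s c)"
      using l\<eta> by (auto simp: lin_iff distrib_left distrib_right scale_mult_left scale_mult_right smul_mult mult_smul)
    have lD: "lin (\<lambda>a. D s a y)" "lin (D s x)"
      using lin_diff[OF lx(1,3)] lin_diff[OF lx(2,4)] by (simp_all add: D_def[abs_def] fun_diff_def)
    have "has_curve_deriv B {0..1} (\<lambda>s. D s x y) s
        (conv (\<eta> s) (g s) (x * y) - (conv (\<eta> s) (g s) x * \<eta> s y + \<eta> s x * conv (\<eta> s) (g s) y))"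
      unfolding D_def
      by (rule has_curve_deriv_diff[OF lcs has_curve_deriv_dyson_sum[OF s] has_curve_deriv_mult[OF has_curve_deriv_dyson_sum[OF s] has_curve_deriv_dyson_sum[OF s] s] s])
         (simp_all add: carrier_UNIV)
    moreover have "conv (\<eta> s) (g s) (x * y) - (conv (\<eta> s) (g s) x * \<eta> s y + \<eta> s x * conv (\<eta> s) (g s) y) =
        conv (\<lambda>a. D s a y) (g s) x + conv (D s x) (g s) y"
    proof -
      have "conv (\<eta> s) (g s) x * \<eta> s y = conv (\<lambda>a. \<eta> s a * \<eta> s y) (g s) x"
        by (simp add: conv_cop[OF l\<eta> lg] conv_cop[OF lx(3) lg] case_prod_unfold sum_list_mult_const[symmetric]) (simp only: mult_ac)
      moreover have "\<eta> s x * conv (\<eta> s) (g s) y = conv (\<lambda>c. \<eta> s x * \<eta> s c) (g s) y"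
        by (simp add: conv_cop[OF l\<eta> lg] conv_cop[OF lx(4) lg] case_prod_unfold sum_list_const_mult[symmetric]) (simp only: mult_ac)
      moreover have "conv (\<lambda>a. D s a y) (g s) x = conv (\<lambda>a. \<eta> s (a * y)) (g s) x - conv (\<lambda>a. \<eta> s a * \<eta> s y) (g s) x"
        unfolding conv_cop[OF lD(1) lg] conv_cop[OF lx(1) lg] conv_cop[OF lx(3) lg]
        by (simp add: D_def case_prod_unfold left_diff_distrib sum_list_subtractf)
      moreover have "conv (D s x) (g s) y = conv (\<lambda>c. \<eta> s (x * c)) (g s) y - conv (\<lambda>c. \<eta> s x * \<eta> s c) (g s) y"
        unfolding conv_cop[OF lD(2) lg] conv_cop[OF lx(2) lg] conv_cop[OF lx(4) lg]
        by (simp add: D_def case_prod_unfold left_diff_distrib sum_list_subtractf)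
      ultimately show ?thesis by (simp add: conv_shift[OF s])
    qed
    moreover have "conv (\<lambda>a. D s a y) (g s) x = 0"
      by (rule conv_vanish_graded[OF s lD(1) _ less.prems(1)]) (use less.hyps[OF _ _ less.prems(2) s] in \<open>simp add: D_def\<close>)
    moreover have "conv (D s x) (g s) y = 0"
      by (rule conv_vanish_graded[OF s lD(2) _ less.prems(2)]) (use less.hyps[OF _ less.prems(1) _ s] in \<open>simp add: D_def\<close>)
    ultimately show ?thesis by simp
  qed
  moreover have "D 0 x y = 0"
    by (simp add: D_def dyson_sum_zero convolution_unit_def counit_mult smul_mult mult_smul VB.scale_scale)
  ultimately have "D t x y = 0" by (rule dyson_sum_const[OF _ _ less.prems(3)])
  then show ?case by (simp add: D_def)
qed

text \<open>Multiplicativity extends from homogeneous elements by decomposing both factors. The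
  value at 1 is constant because its derivative is \<open>\<eta> t 1 * g t 1\<close>, and the second
  factor is 0.\<close>

lemma dyson_sum_chars:
  assumes t: "t \<in> {0..1}" shows "\<eta> t \<in> chars"
proof -
  note l = lin_dyson_sum[OF t]
  have l0: "\<eta> t 0 = 0" using l HB.linear_0 by blast
  have ladd: "\<eta> t (x + y) = \<eta> t x + \<eta> t y" for x y using l by (simp add: lin_iff)
  have lsum: "\<eta> t (sum f S) = (\<Sum>i\<in>S. \<eta> t (f i))" for f :: "nat \<Rightarrow> 'h" and S
    using HB.linear_sum[OF l, of f S] .
  have "\<eta> t (x * y) = \<eta> t x * \<eta> t y" for x y
  proof -
    obtain c where c: "\<And>n. c n \<in> grade n" "x = (\<Sum>n | c n \<noteq> 0. c n)" using grade_direct_sum[of x] by blast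
    obtain d where d: "\<And>n. d n \<in> grade n" "y = (\<Sum>n | d n \<noteq> 0. d n)" using grade_direct_sum[of y] by blast
    have "\<eta> t (x * y) = (\<Sum>n | c n \<noteq> 0. \<Sum>m | d m \<noteq> 0. \<eta> t (c n * d m))"
      by (subst c(2), subst d(2)) (simp add: sum_product lsum)
    also have "\<dots> = \<eta> t x * \<eta> t y"
      by (subst c(2), subst d(2)) (simp add: dyson_sum_mult_graded[OF c(1) d(1) t] sum_product lsum)
    finally show ?thesis .
  qed
  moreover have "\<eta> t 1 = 1"
  proof -
    have "has_curve_deriv B {0..1} (\<lambda>s. \<eta> s 1 - 1) s 0" if s: "s \<in> {0..1}" for s
      using has_curve_deriv_diff[OF lcs has_curve_deriv_dyson_sum[OF s] has_curve_deriv_const[OF lcs] s, of 1 1]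
      by (simp add: carrier_UNIV conv_one[OF lin_dyson_sum[OF s] lin_g[OF s]] g_one[OF s])
    from dyson_sum_const[OF this _ t] show ?thesis by (simp add: dyson_sum_zero cunit_one)
  qed
  ultimately show ?thesis using l by (simp add: characters_def)
qed

end

lemma continuous_linear_bilinear_right:
  assumes b: "continuous_bilinear E F G b" and x: "x \<in> vcarrier E"
  shows "continuous_linear F G (b x)"
proof -
  have "continuous_map (vtop F) (prod_topology (vtop E) (vtop F)) (\<lambda>y. (x, y))"
    using x by (intro continuous_map_pairedI) (simp_all add: continuous_map_id')
  from continuous_map_compose[OF this continuous_bilinearD(1)[OF b]] show ?thesis
    using x continuous_bilinearD[OF b] by (simp add: continuous_linear_def o_def)
qed

lemma continuous_map_dir_deriv:
  assumes f: "smooth_on E F U f" and u: "continuous_map X (vtop E) u" "u \<in> topspace X \<rightarrow> U" and v: "continuous_map X (vtop E) v"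
  shows "continuous_map X (vtop F) (\<lambda>p. dir_deriv E F f (u p) (v p))"
  unfolding dir_deriv_iter_deriv by (rule smooth_on_continuous_map[OF f u v])

context hopf_characters
begin

text \<open>Computed along the line of multiples of g, on which each value of the exponential is a
  polynomial in s whose linear coefficient is the value of g; smoothness turns this curve derivative
  into the directional one.\<close>

lemma dir_deriv_cexp_zero:
  assumes g: "g \<in> ichars"
  shows "dir_deriv F A cexp 0 g = g"
proof -
  have z: "0 \<in> ichars" by (rule ichars_zero)
  have sg: "smul F (of_real s) g \<in> ichars" for s :: real using ichars_scale[OF g] by simp
  have s0: "smul F (of_real 0) g = 0"
    using locally_convex_space.smul_zero_left[OF lcs_F, of g] g by simp
  have "has_curve_deriv A UNIV (\<lambda>s. cexp (smul F (of_real s) g)) 0 (dir_deriv F A cexp (smul F (of_real 0) g) g)"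
    by (rule has_curve_deriv_compose[OF lcs_F lcs_A analytic_map_on_imp_smooth[OF lcs_F lcs_A analytic_cexp] has_curve_deriv_line[OF g]])
       (simp_all only: sg vcarrier_F UNIV_I)
  then have "has_curve_deriv A UNIV (\<lambda>s. cexp (smul F (of_real s) g)) 0 (dir_deriv F A cexp 0 g)"
    by (simp only: s0)
  moreover have "has_curve_deriv A UNIV (\<lambda>s. cexp (smul F (of_real s) g)) 0 g"
  proof (rule has_curve_deriv_fun_tvs[OF lcs fun_subspace_Lin])
    show "cexp (smul F (of_real s) g) \<in> Lin" for s :: real
      using cexp_chars[OF sg] chars_Lin by blast
    show "g \<in> Lin" using g ichars_Lin by blast
    fix x
    have lg: "lin g" "g 1 = 0" using icharsD(1)[OF g] ichars_one[OF g] .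
    \<comment> \<open>The successor keeps the linear term in the sum even when \<open>deg x\<close>
      is 0.\<close>
    have N: "degree_bound x (Suc (deg x))" by (rule degree_bound_mono[OF degree_bound_deg]) simp
    have eq: "cexp (smul F (of_real s) g) x = (\<Sum>n\<le>Suc (deg x). smul B (of_real (s ^ n / fact n)) (cpow g n x))" for s :: real
      using cexp_scale[OF lg, of s] ser_eq[OF lg N, of "fps_exp s"] by simp
    have "has_curve_deriv B UNIV (\<lambda>s. smul B (of_real (s ^ n / fact n)) (cpow g n x)) 0 (smul B (of_real (if n = 1 then 1 else 0)) (cpow g n x))" for n
    proof (rule has_curve_deriv_real_multiple[OF lcs])
      have "((\<lambda>s::real. s ^ n / fact n) has_real_derivative (real n * 0 ^ (n - 1) / fact n)) (at 0)"
        by (auto intro!: derivative_eq_intros)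
      moreover have "real n * 0 ^ (n - 1) / fact n = (if n = 1 then 1 else 0)" by (cases n) auto
      ultimately show "((\<lambda>s::real. s ^ n / fact n) has_vector_derivative (if n = 1 then 1 else 0)) (at 0 within UNIV)"
        unfolding has_real_derivative_iff_has_vector_derivative by simp
    qed (simp add: carrier_UNIV)
    from has_curve_deriv_sum[OF lcs UNIV_I this, of "{..Suc (deg x)}"]
    have "has_curve_deriv B UNIV (\<lambda>s. cexp (smul F (of_real s) g) x) 0 (\<Sum>n\<le>Suc (deg x). smul B (of_real (if n = 1 then 1 else 0)) (cpow g n x))"
      by (simp only: eq carrier_UNIV UNIV_I simp_thms)
    moreover have "(\<Sum>n\<le>Suc (deg x). smul B (of_real (if n = 1 then 1 else 0)) (cpow g n x)) = (\<Sum>n\<le>Suc (deg x). if n = 1 then g x else 0)"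
      by (rule sum.cong[OF refl]) (use cpow_one[OF lg(1)] in \<open>auto simp: LB.smul_zero_left LB.smul_one carrier_UNIV simp del: cpow.simps\<close>)
    moreover have "\<dots> = g x" by (simp add: sum.delta del: sum.atMost_Suc)
    ultimately show "has_curve_deriv B UNIV (\<lambda>s. cexp (smul F (of_real s) g) x) 0 (g x)" by simp
  qed simp
  ultimately show ?thesis
    by (rule has_curve_deriv_unique[OF lcs_A, rotated]) simp
qed

text \<open>Left translation by \<omega>, read in the logarithm chart, is T after convolution with
  \<omega> after the exponential. The exponential has identity derivative at 0 and the convolution
  is linear, which leaves the derivative of T at \<omega>, the form in which the velocity of the
  evolution is also computed.\<close>

lemma dir_deriv_translation:
  assumes T: "smooth_on A F Lin T" "\<And>\<phi>. \<phi> \<in> chars \<Longrightarrow> T \<phi> = clog \<phi>" and \<omega>: "\<omega> \<in> chars" and g: "g \<in> ichars"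
  shows "smooth_on F F ichars (\<lambda>x. restrict clog chars (conv \<omega> (cexp x)))"
    and "dir_deriv F F (\<lambda>x. restrict clog chars (conv \<omega> (cexp x))) 0 g = dir_deriv A F T \<omega> (conv \<omega> g)"
proof -
  have \<omega>L: "\<omega> \<in> vcarrier A" using \<omega> chars_Lin by auto
  note L = continuous_linear_bilinear_right[OF bilinear_conv \<omega>L]
  have se: "smooth_on F A ichars cexp" by (rule analytic_map_on_imp_smooth[OF lcs_F lcs_A analytic_cexp])
  have sL: "smooth_on A A Lin (conv \<omega>)" by (rule smooth_on_linear[OF lcs_A lcs_A L]) (use openin_topspace[of "vtop A"] in simp)
  have sc: "smooth_on F A ichars (\<lambda>x. conv \<omega> (cexp x))" by (rule smooth_on_compose_linear[OF lcs_F lcs_A lcs_A se L])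
  have LT: "(\<lambda>x. conv \<omega> (cexp x)) ` ichars \<subseteq> Lin" using conv_chars[OF \<omega> cexp_chars] chars_Lin by auto
  have sT: "smooth_on F F ichars (\<lambda>x. T (conv \<omega> (cexp x)))"
    by (rule smooth_on_compose[OF lcs_F lcs_A lcs_F sc T(1)]) (use LT in auto)
  have eq: "T (conv \<omega> (cexp x)) = restrict clog chars (conv \<omega> (cexp x))" if "x \<in> ichars" for x
    using T(2) conv_chars[OF \<omega> cexp_chars[OF that]] by simp
  show "smooth_on F F ichars (\<lambda>x. restrict clog chars (conv \<omega> (cexp x)))"
    by (rule smooth_on_cong[OF lcs_F lcs_F sT eq])
  have c0: "conv \<omega> (cexp 0) = \<omega>" using conv_unit_right[OF charsD(1)[OF \<omega>]] by (simp only: cexp_zero)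
  have "dir_deriv F F (\<lambda>x. restrict clog chars (conv \<omega> (cexp x))) 0 g = dir_deriv F F (\<lambda>x. T (conv \<omega> (cexp x))) 0 g"
    by (rule dir_deriv_cong[OF lcs_F openin_ichars ichars_zero]) (use g eq in simp_all)
  also have "\<dots> = dir_deriv A F T (conv \<omega> (cexp 0)) (dir_deriv F A (\<lambda>x. conv \<omega> (cexp x)) 0 g)"
    by (rule dir_deriv_compose[OF lcs_F lcs_A lcs_F sc T(1) ichars_zero]) (use LT ichars_zero g in auto)
  also have "dir_deriv F A (\<lambda>x. conv \<omega> (cexp x)) 0 g = dir_deriv A A (conv \<omega>) (cexp 0) (dir_deriv F A cexp 0 g)"
    by (rule dir_deriv_compose[OF lcs_F lcs_A lcs_A se sL ichars_zero]) (use cexp_chars[OF ichars_zero] chars_Lin g in auto)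
  also have "\<dots> = conv \<omega> g"
    unfolding dir_deriv_cexp_zero[OF g]
    by (rule dir_deriv_linear[OF lcs_A lcs_A L]) (use cexp_chars[OF ichars_zero] chars_Lin ichars_Lin g in auto)
  finally show "dir_deriv F F (\<lambda>x. restrict clog chars (conv \<omega> (cexp x))) 0 g = dir_deriv A F T \<omega> (conv \<omega> g)"
    by (simp only: c0)
qed

end

context ichar_curve
begin

lemma continuous_dyson_sum: "continuous_map (top_of_set {0..1}) (vtop A) \<eta>"
  unfolding continuous_map_fun_tvs
proof (intro conjI allI)
  show "\<eta> \<in> topspace (top_of_set {0..1}) \<rightarrow> Lin" using dyson_sum_chars chars_Lin by auto
  show "continuous_map (top_of_set {0..1}) (vtop B) (\<lambda>t. \<eta> t h)" for h
    by (rule LB.curve_deriv_continuous[OF _ has_curve_deriv_dyson_sum]) (simp_all add: carrier_UNIV)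
qed

lemma has_curve_deriv_dyson_sum_A:
  assumes t: "t \<in> {0..1}" shows "has_curve_deriv A {0..1} \<eta> t (conv (\<eta> t) (g t))"
  by (rule has_curve_deriv_fun_tvs[OF lcs fun_subspace_Lin _ t _ has_curve_deriv_dyson_sum[OF t]])
     (use lin_conv[OF lin_dyson_sum[OF t] lin_g[OF t]] in \<open>auto simp: Lin_iff lin_dyson_sum\<close>)

lemma continuous_dyson_sum_deriv: "continuous_map (top_of_set {0..1}) (vtop A) (\<lambda>t. conv (\<eta> t) (g t))"
proof -
  have "continuous_map (top_of_set {0..1}) (vtop A) g"
    unfolding continuous_map_fun_tvs using g_ichars ichars_Lin Cr_curves_zero_memD(1)[OF g_curve] by auto
  from continuous_map_compose[OF continuous_map_pairedI[OF continuous_dyson_sum this] continuous_bilinearD(1)[OF bilinear_conv]]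
  show ?thesis by (simp add: o_def)
qed

lemma dyson_sum_velocity:
  assumes T: "smooth_on A F Lin T" "\<And>\<phi>. \<phi> \<in> chars \<Longrightarrow> T \<phi> = clog \<phi>" and t: "t \<in> {0..1}"
  shows "has_curve_deriv F {0..1} (\<lambda>s. restrict clog chars (\<eta> s)) t (dir_deriv A F T (\<eta> t) (conv (\<eta> t) (g t)))"
proof (subst has_curve_deriv_cong[where \<delta> = "\<lambda>s. T (\<eta> s)"])
  show "has_curve_deriv F {0..1} (\<lambda>s. T (\<eta> s)) t (dir_deriv A F T (\<eta> t) (conv (\<eta> t) (g t)))"
    by (rule has_curve_deriv_compose[OF lcs_A lcs_F T(1) has_curve_deriv_dyson_sum_A[OF t]])
       (use dyson_sum_chars chars_Lin t in auto)
qed (use dyson_sum_chars T(2) t in auto)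

lemma Cr_manifold_curve_dyson_sum: "Cr_manifold_curve M 1 {0..1} \<eta>"
proof -
  obtain T where T: "analytic_map_on A F Lin T" "\<And>\<phi>. \<phi> \<in> chars \<Longrightarrow> T \<phi> = clog \<phi>" by (rule clog_extension) blast
  note sT = analytic_map_on_imp_smooth[OF lcs_A lcs_F T(1)]
  have d: "has_curve_deriv F {0..1} (\<lambda>s. restrict clog chars (\<eta> s)) t (dir_deriv A F T (\<eta> t) (conv (\<eta> t) (g t)))" if "t \<in> {0..1}" for t
    by (rule dyson_sum_velocity[OF sT T(2) that])
  show ?thesis
  proof (rule GC.Cr_manifold_curve_one[OF _ _ d])
    show "continuous_map (top_of_set {0..1}) (vtop F) (\<lambda>t. restrict clog chars (\<eta> t))"
      by (rule locally_convex_space.curve_deriv_continuous[OF lcs_F _ d]) (use dyson_sum_chars clog_ichars in auto)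
    show "\<eta> t \<in> chars" if "t \<in> {0..1}" for t by (rule dyson_sum_chars[OF that])
    show "continuous_map (top_of_set {0..1}) (vtop F) (\<lambda>t. dir_deriv A F T (\<eta> t) (conv (\<eta> t) (g t)))"
      by (rule continuous_map_dir_deriv[OF sT continuous_dyson_sum _ continuous_dyson_sum_deriv])
         (use dyson_sum_chars chars_Lin in auto)
  qed
qed

text \<open>Both sides of the equation are lifts of the derivative of T at \<open>\<eta> t\<close>
  in the direction \<open>conv (\<eta> t) (g t)\<close>: the velocity by the chain rule along the
  evolution, the other side by the derivative of the left translation.\<close>

lemma solves_evolution_dyson_sum:
  assumes \<gamma>: "\<And>t. t \<in> {0..1} \<Longrightarrow> \<gamma> t \<in> tangent_space M cunit" "\<And>t. t \<in> {0..1} \<Longrightarrow> \<gamma> t c0 = g t"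
  shows "solves_evolution M cgroup \<gamma> \<eta>"
  unfolding solves_evolution_def
proof (intro conjI ballI)
  show "\<eta> 0 = \<one>\<^bsub>cgroup\<^esub>" by (simp only: dyson_sum_zero cgroup_simps)
  obtain T where T: "analytic_map_on A F Lin T" "\<And>\<phi>. \<phi> \<in> chars \<Longrightarrow> T \<phi> = clog \<phi>" by (rule clog_extension) blast
  note sT = analytic_map_on_imp_smooth[OF lcs_A lcs_F T(1)]
  fix t :: real assume t: "t \<in> {0..1}"
  note \<eta>t = dyson_sum_chars[OF t] and gt = g_ichars[OF t]
  note D = dir_deriv_translation[OF sT T(2) \<eta>t gt]
  let ?w = "dir_deriv A F T (\<eta> t) (conv (\<eta> t) (g t))"
  have w: "?w \<in> ichars"
    using dir_deriv_carrier[OF sT, of "\<eta> t" "conv (\<eta> t) (g t)"] \<eta>t chars_Lin lin_conv[OF lin_dyson_sum[OF t] lin_g[OF t]]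
    by (auto simp: Lin_iff)
  have "\<gamma> t = GC.lift cunit (g t)"
    using GC.tangent_eq_lift[OF cunit_chars \<gamma>(1)[OF t]] \<gamma>(2)[OF t] by simp
  moreover have "tangent_map M M (conv (\<eta> t)) cunit (GC.lift cunit (g t)) =
      GC.lift (conv (\<eta> t) cunit) (dir_deriv F F (\<lambda>x. restrict clog chars (conv (\<eta> t) (cexp x))) (restrict clog chars cunit) (g t))"
    by (rule GC.tangent_map_lift) (use D(1) conv_chars[OF \<eta>t] cunit_chars gt in simp_all)
  moreover have "restrict clog chars cunit = 0" using cunit_chars clog_cunit by simp
  ultimately have "tangent_map M M (conv (\<eta> t)) cunit (\<gamma> t) = GC.lift (\<eta> t) ?w"
    by (simp only: D(2) conv_unit_right[OF lin_dyson_sum[OF t]])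
  moreover have "has_velocity M {0..1} \<eta> t (GC.lift (\<eta> t) ?w)"
    by (rule GC.has_velocity_lift[OF dyson_sum_velocity[OF sT T(2) t]]) (use dyson_sum_chars t w in simp_all)
  ultimately show "has_velocity M {0..1} \<eta> t (tangent_map M M (\<lambda>x. \<eta> t \<otimes>\<^bsub>cgroup\<^esub> x) \<one>\<^bsub>cgroup\<^esub> (\<gamma> t))"
    by simp
qed

end

context hopf_characters
begin

abbreviation L where "L \<equiv> tangent_tvs M cunit"

lemma lie_algebra_curve:
  assumes sc: "sequentially_complete B" and \<gamma>: "\<gamma> \<in> Cr_curves L 0"
  shows "ichar_curve scaleH \<Delta> \<epsilon> antipode grade B (\<lambda>t. \<gamma> t c0)"
proof (intro ichar_curve.intro ichar_curve_axioms.intro hopf_characters_axioms sc)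
  have "continuous_linear L B (\<lambda>v. v c0 b)" for b
    by (rule continuous_linear_compose[OF GC.continuous_linear_tangent_c0 continuous_linear_fun_apply])
  from continuous_linear_carrier[OF continuous_linear_postcompose[OF lcs_lie_algebra lcs this], of \<gamma>] \<gamma>
  show "(\<lambda>t. \<gamma> t c0 b) \<in> Cr_curves B 0" for b
    by (simp add: LB.vcarrier_curve_space locally_convex_space.vcarrier_curve_space[OF lcs_lie_algebra])
  show "\<gamma> t c0 \<in> ichars" if "t \<in> {0..1}" for t
    by (rule tangent_c0[OF Cr_curves_zero_memD(2)[OF \<gamma> that]])
qed

text \<open>The iterates are kept as whole curves instead of values at one time, because on curves
  integration is a continuous linear map and the product is a continuous bilinear one.\<close>

lemma smooth_dyson:
  assumes sc: "sequentially_complete B"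
  shows "smooth_on (curve_space L) (curve_space B) (Cr_curves L 0) (\<lambda>\<gamma>. dyson (\<lambda>t. \<gamma> t c0) n h)"
proof (induction n arbitrary: h)
  note lC = locally_convex_space.lcs_curve_space[OF lcs_lie_algebra]
  note lB = LB.lcs_curve_space
  note car = locally_convex_space.vcarrier_curve_space[OF lcs_lie_algebra]
  have op: "openin (vtop (curve_space L)) (Cr_curves L 0)" using openin_topspace[of "vtop (curve_space L)"] by (simp only: car)
  {
    case 0
    have "(\<lambda>t. if t \<in> {0..1} then cunit h else 0) \<in> Cr_curves B 0"
    proof (rule Cr_curves_zero_memI)
      show "continuous_map (top_of_set {0..1}) (vtop B) (\<lambda>t. if t \<in> {0..1} then cunit h else 0)"
        by (rule continuous_map_eq[of _ _ "\<lambda>_. cunit h"]) (auto simp: carrier_UNIV)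
    qed auto
    then show ?case
      unfolding dyson.simps by (intro smooth_on_const[OF lC lB op]) (simp only: LB.vcarrier_curve_space)
  next
    case (Suc n)
    have g: "smooth_on (curve_space L) (curve_space B) (Cr_curves L 0) (\<lambda>\<gamma> t. \<gamma> t c0 b)" for b
      by (rule smooth_on_linear[OF lC lB continuous_linear_postcompose[OF lcs_lie_algebra lcs] op])
         (rule continuous_linear_compose[OF GC.continuous_linear_tangent_c0 continuous_linear_fun_apply])
    have "smooth_on (curve_space L) (curve_space B) (Cr_curves L 0)
        (\<lambda>\<gamma>. \<Sum>p\<leftarrow>cop h. (\<lambda>t. dyson (\<lambda>t. \<gamma> t c0) n (fst p) t * \<gamma> t c0 (snd p)))"
      by (intro smooth_on_sum_list[OF lC lB op]
          smooth_on_bilinear_compose[OF lC lB lB lB continuous_bilinear_pointwise[OF lcs lcs lcs bilinear_B] Suc g])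
    from smooth_on_compose_linear[OF lC lB lB this LB.continuous_linear_primitive[OF sc]]
    have "smooth_on (curve_space L) (curve_space B) (Cr_curves L 0)
        (\<lambda>\<gamma>. LB.primitive (\<Sum>p\<leftarrow>cop h. (\<lambda>t. dyson (\<lambda>t. \<gamma> t c0) n (fst p) t * \<gamma> t c0 (snd p))))" .
    moreover have "(\<Sum>p\<leftarrow>xs. (\<lambda>t. f p t)) = (\<lambda>t. \<Sum>p\<leftarrow>xs. f p t)" for xs and f :: "'h \<times> 'h \<Rightarrow> real \<Rightarrow> 'b"
      by (simp add: fun_eq_iff sum_list_apply)
    ultimately show ?case unfolding dyson.simps case_prod_unfold by (simp only:)
  }
qed

text \<open>Evaluation at time 1 is continuous and linear on curves, and each value of the sum
  involves finitely many iterates; smoothness into the Hom space is then tested value by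
  value.\<close>

lemma smooth_dyson_sum_end:
  assumes sc: "sequentially_complete B"
  shows "smooth_on (curve_space L) A (Cr_curves L 0) (\<lambda>\<gamma>. dyson_sum (\<lambda>t. \<gamma> t c0) 1)"
proof -
  note lC = locally_convex_space.lcs_curve_space[OF lcs_lie_algebra]
  note lB = LB.lcs_curve_space
  note car = locally_convex_space.vcarrier_curve_space[OF lcs_lie_algebra]
  have op: "openin (vtop (curve_space L)) (Cr_curves L 0)" using openin_topspace[of "vtop (curve_space L)"] by (simp only: car)
  show ?thesis
  proof (rule smooth_on_fun[OF lC lcs fun_subspace_Lin closedin_Lin op])
    show "(\<lambda>\<gamma>. dyson_sum (\<lambda>t. \<gamma> t c0) 1) \<in> Cr_curves L 0 \<rightarrow> Lin"
      using ichar_curve.dyson_sum_chars[OF lie_algebra_curve[OF sc], of _ 1] chars_Lin by auto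
    show "smooth_on (curve_space L) B (Cr_curves L 0) (\<lambda>\<gamma>. dyson_sum (\<lambda>t. \<gamma> t c0) 1 h)" for h
      unfolding dyson_sum_def
    proof (rule smooth_on_sum[OF lC lcs op])
      show "smooth_on (curve_space L) B (Cr_curves L 0) (\<lambda>\<gamma>. dyson (\<lambda>t. \<gamma> t c0) n h 1)" for n
        by (rule smooth_on_compose_linear[OF lC lB lcs smooth_dyson[OF sc] LB.continuous_linear_curve_eval]) simp
    qed
  qed
qed

lemma Cr_regular_zero_M:
  assumes sc: "sequentially_complete B"
  shows "Cr_regular 0 M cgroup"
proof -
  note lC = locally_convex_space.lcs_curve_space[OF lcs_lie_algebra]
  note car = locally_convex_space.vcarrier_curve_space[OF lcs_lie_algebra]
  \<comment> \<open>The default \<open>cunit\<close> makes the value at time 1 a character for every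
    argument, also for functions that are not continuous curves.\<close>
  define Evol where "Evol \<gamma> = (if \<gamma> \<in> Cr_curves L 0 then dyson_sum (\<lambda>t. \<gamma> t c0) else (\<lambda>_. cunit))" for \<gamma>
  have "Cr_manifold_curve M 1 {0..1} (Evol \<gamma>) \<and> solves_evolution M cgroup \<gamma> (Evol \<gamma>)" if \<gamma>: "\<gamma> \<in> Cr_curves L 0" for \<gamma>
  proof -
    interpret ichar_curve scaleH \<Delta> \<epsilon> antipode grade B "\<lambda>t. \<gamma> t c0" by (rule lie_algebra_curve[OF sc \<gamma>])
    have "\<gamma> t \<in> tangent_space M cunit" if "t \<in> {0..1}" for t
      using Cr_curves_zero_memD(2)[OF \<gamma> that] by (simp only: GC.vcarrier_tangent[OF cunit_chars])
    then show ?thesis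
      using Cr_manifold_curve_dyson_sum solves_evolution_dyson_sum[of \<gamma>] \<gamma> by (simp add: Evol_def)
  qed
  moreover have "smooth_manifold_map (tvs_manifold (curve_space L)) M (\<lambda>\<gamma>. Evol \<gamma> 1)"
  proof -
    obtain T where T: "analytic_map_on A F Lin T" "\<And>\<phi>. \<phi> \<in> chars \<Longrightarrow> T \<phi> = clog \<phi>" by (rule clog_extension) blast
    have one: "Evol \<gamma> 1 \<in> chars" for \<gamma>
      using ichar_curve.dyson_sum_chars[OF lie_algebra_curve[OF sc], of \<gamma> 1] cunit_chars by (simp add: Evol_def)
    have "smooth_on (curve_space L) F (Cr_curves L 0) (\<lambda>\<gamma>. T (dyson_sum (\<lambda>t. \<gamma> t c0) 1))"
      by (rule smooth_on_compose[OF lC lcs_A lcs_F smooth_dyson_sum_end[OF sc] analytic_map_on_imp_smooth[OF lcs_A lcs_F T(1)]])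
         (use smooth_on_carrier[OF smooth_dyson_sum_end[OF sc]] in auto)
    then have "smooth_on (curve_space L) F (Cr_curves L 0) (\<lambda>\<gamma>. clog (Evol \<gamma> 1))"
      by (rule smooth_on_cong[OF lC lcs_F]) (simp only: T(2)[OF one, symmetric], simp add: Evol_def)
    then have "manifold_map_on smooth_on (tvs_manifold (curve_space L)) M (vcarrier (curve_space L)) (\<lambda>\<gamma>. cexp (clog (Evol \<gamma> 1)))"
      by (intro GC.smooth_map_from_tvs[OF lC]) (simp only: car)
    then show ?thesis using cexp_clog_S1[OF subsetD[OF chars_subset one]] by simp
  qed
  ultimately show ?thesis
    unfolding Cr_regular_def lie_algebra_M using analytic_lie_group_M by (intro conjI exI[of _ Evol]) auto
qed

end

theorem theoremB:
  fixes scaleH :: "'k::real_or_complex \<Rightarrow> 'h::ring_1 \<Rightarrow> 'h"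
    and \<Delta> :: "'h \<Rightarrow> (('h \<Rightarrow> 'h \<Rightarrow> 'k) \<Rightarrow> 'k)"
    and \<epsilon> :: "'h \<Rightarrow> 'k"
    and antipode :: "'h \<Rightarrow> 'h"
    and grade :: "nat \<Rightarrow> 'h set"
    and B :: "('k, 'b::{comm_ring, comm_monoid_mult}) tvs"
  assumes "graded_connected_hopf_algebra scaleH \<Delta> \<epsilon> antipode grade"
    and "commutative_locally_convex_algebra B"
  shows "(BCH_lie_group (character_manifold scaleH \<epsilon> B) (character_group scaleH \<Delta> \<epsilon> B) \<and>
          exponential_lie_group (character_manifold scaleH \<epsilon> B) (character_group scaleH \<Delta> \<epsilon> B)) \<and>
         (sequentially_complete B \<longrightarrow>
          Cr_regular 0 (character_manifold scaleH \<epsilon> B) (character_group scaleH \<Delta> \<epsilon> B))"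
proof -
  interpret hopf_characters scaleH \<Delta> \<epsilon> antipode grade B
    by (intro hopf_characters.intro assms)
  show ?thesis
    using BCH_lie_group_M exponential_lie_group_M Cr_regular_zero_M by blast
qed

end
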